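(* Let $P$ be a nonzero nonmaximal prime ideal of a regular local ring $R$. (1) There exists a non-archimedean quadratic Shannon extension of $R$ with $R_P$ as its Noetherian hull. (2) If there exists an archimedean quadratic Shannon extension of $R$ contained in $R_P$, then $\dim R/P\ge 2$.
   Context: Local rings need not be Noetherian. An overring of a domain $A$ is a ring between $A$ and its quotient field. For local domains $A\subseteq B$, $B$ birationally dominates $A$ if $B$ is an overring of $A$ and $\mathfrak m_A\subseteq\mathfrak m_B$. An integral domain $A$ is archimedean if $\bigcap_{n>0}a^nA=0$ for each nonunit $a\in A$, and non-archimedean otherwise. Local quadratic transform (LQT): let $(R,\mathfrak m)$ be a Noetherian local domain and $(V,\mathfrak m_V)$ a valuation domain birationally dominating $R$. Then $\mathfrak mV=xV$ for some $x\in\mathfrak m$, and $R_1=R[\mathfrak m/x]_{\mathfrak m_V\cap R[\mathfrak m/x]}$ is the LQT of $R$ along $V$. An LQT of $R$ is an LQT of $R$ along some such $V$. Quadratic Shannon extension: if $R$ is a regular local ring with $\dim R\ge 2$, $R_0=R$, and $\{R_n\}$ is an infinite sequence of regular local rings with $\dim R_n\ge 2$ and $R_{n+1}$ an LQT of $R_n$ for each $n$, then $S=\bigcup_n R_n$ is a quadratic Shannon extension of $R$. The Noetherian hull of a quadratic Shannon extension $S$ of $R$ is the intersection $T$ of all DVR (rank $1$ discrete valuation ring) overrings of $R$ that properly contain $S$ (inside the quotient field of $R$, which is the value of the empty intersection); it is known that $T=S[1/x]$ for any $x\in\mathfrak m_S$ such that $xS$ is $\mathfrak m_S$-primary (such $x$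 exist), and that $T$ is the unique minimal proper Noetherian overring of $S$. *)

theory Defs
  imports "HOL-Algebra.Algebra" "HOL-Library.Extended_Nat"
begin

text \<open>
  All rings under consideration are subrings of one ambient field \<open>K\<close>; a subring is given by its
  underlying set \<open>A\<close>, and the ring itself is \<open>sub K A\<close>.
\<close>

abbreviation sub :: "('a, 'm) ring_scheme \<Rightarrow> 'a set \<Rightarrow> ('a, 'm) ring_scheme"
  where "sub K A \<equiv> K\<lparr>carrier := A\<rparr>"


section \<open>Notions for abstract rings\<close>

text \<open>Local rings are not assumed to be Noetherian.\<close>

definition local_ring :: "('a, 'm) ring_scheme \<Rightarrow> bool"
  where "local_ring A \<longleftrightarrow> cring A \<and> (\<exists>!M. maximalideal M A)"

definition max_ideal :: "('a, 'm) ring_scheme \<Rightarrow> 'a set"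
  where "max_ideal A = (THE M. maximalideal M A)"

text \<open>Supremum of the lengths \<open>n\<close> of chains \<open>p\<^sub>0 \<subset> p\<^sub>1 \<subset> \<dots> \<subset> p\<^sub>n\<close> of prime ideals.\<close>

definition krull_dim :: "('a, 'm) ring_scheme \<Rightarrow> enat"
  where "krull_dim A =
    Sup {enat n | n. \<exists>p :: nat \<Rightarrow> 'a set.
      (\<forall>i\<le>n. primeideal (p i) A) \<and> (\<forall>i<n. p i \<subset> p (Suc i))}"

text \<open>The minimal number of generators of the maximal ideal; only meaningful when that ideal is
  finitely generated, e.g. for Noetherian local rings.\<close>

definition embedding_dim :: "('a, 'm) ring_scheme \<Rightarrow> nat"
  where "embedding_dim A =
    (LEAST n. \<exists>G. G \<subseteq> carrier A \<and> finite G \<and> card G = n \<and> max_ideal A = Idl\<^bsub>A\<^esub> G)"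

definition regular_local_ring :: "('a, 'm) ring_scheme \<Rightarrow> bool"
  where "regular_local_ring A \<longleftrightarrow>
    noetherian_ring A \<and> local_ring A \<and> krull_dim A = enat (embedding_dim A)"

definition valuation_domain :: "('a, 'm) ring_scheme \<Rightarrow> bool"
  where "valuation_domain A \<longleftrightarrow>
    domain A \<and> (\<forall>a \<in> carrier A. \<forall>b \<in> carrier A. a divides\<^bsub>A\<^esub> b \<or> b divides\<^bsub>A\<^esub> a)"

definition dvr :: "('a, 'm) ring_scheme \<Rightarrow> bool"
  where "dvr A \<longleftrightarrow> principal_domain A \<and> local_ring A \<and> \<not> field A"

definition archimedean_domain :: "('a, 'm) ring_scheme \<Rightarrow> bool"
  where "archimedean_domain A \<longleftrightarrow>
    domain A \<and>
    (\<forall>a \<in> carrier A - Units A. (\<Inter>n \<in> {n :: nat. n > 0}. PIdl\<^bsub>A\<^esub> (a [^]\<^bsub>A\<^esub> n)) = {\<zero>\<^bsub>A\<^esub>})"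

definition non_archimedean_domain :: "('a, 'm) ring_scheme \<Rightarrow> bool"
  where "non_archimedean_domain A \<longleftrightarrow> domain A \<and> \<not> archimedean_domain A"


section \<open>Subrings of a field\<close>

text \<open>The localization \<open>A\<^sub>P\<close>, realized inside \<open>K\<close>.\<close>

definition localization :: "('a, 'm) ring_scheme \<Rightarrow> 'a set \<Rightarrow> 'a set \<Rightarrow> 'a set"
  where "localization K A P = {a \<otimes>\<^bsub>K\<^esub> inv\<^bsub>K\<^esub> b | a b. a \<in> A \<and> b \<in> A - P}"

definition quotient_field :: "('a, 'm) ring_scheme \<Rightarrow> 'a set \<Rightarrow> 'a set"
  where "quotient_field K A = localization K A {\<zero>\<^bsub>K\<^esub>}"

definition overring :: "('a, 'm) ring_scheme \<Rightarrow> 'a set \<Rightarrow> 'a set \<Rightarrow> bool"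
  where "overring K A B \<longleftrightarrow>
    subring A K \<and> subring B K \<and> A \<subseteq> B \<and> B \<subseteq> quotient_field K A"

definition birationally_dominates :: "('a, 'm) ring_scheme \<Rightarrow> 'a set \<Rightarrow> 'a set \<Rightarrow> bool"
  where "birationally_dominates K B A \<longleftrightarrow>
    local_ring (sub K A) \<and> local_ring (sub K B) \<and> overring K A B \<and>
    max_ideal (sub K A) \<subseteq> max_ideal (sub K B)"

text \<open>\<open>R\<^sub>1\<close> is the local quadratic transform of \<open>R\<close> along \<open>V\<close>. The choice of \<open>x\<close> does not affect
  the result. The condition that \<open>x\<close> is nonzero only excludes the case that \<open>R\<close> is a field, where
  \<open>\<mm>/x\<close> would be meaningless.\<close>

definition lqt_along ::
    "('a, 'm) ring_scheme \<Rightarrow> 'a set \<Rightarrow> 'a set \<Rightarrow> 'a set \<Rightarrow> bool"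
  where "lqt_along K R V R\<^sub>1 \<longleftrightarrow>
    noetherian_domain (sub K R) \<and> local_ring (sub K R) \<and>
    valuation_domain (sub K V) \<and> birationally_dominates K V R \<and>
    (\<exists>x \<in> max_ideal (sub K R). x \<noteq> \<zero>\<^bsub>K\<^esub> \<and>
      Idl\<^bsub>sub K V\<^esub> (max_ideal (sub K R)) = PIdl\<^bsub>sub K V\<^esub> x \<and>
      (let B = generate_ring K (R \<union> {a \<otimes>\<^bsub>K\<^esub> inv\<^bsub>K\<^esub> x | a. a \<in> max_ideal (sub K R)})
       in R\<^sub>1 = localization K B (max_ideal (sub K V) \<inter> B)))"

definition lqt :: "('a, 'm) ring_scheme \<Rightarrow> 'a set \<Rightarrow> 'a set \<Rightarrow> bool"
  where "lqt K R R\<^sub>1 \<longleftrightarrow> (\<exists>V. lqt_along K R V R\<^sub>1)"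

definition quadratic_shannon_extension :: "('a, 'm) ring_scheme \<Rightarrow> 'a set \<Rightarrow> 'a set \<Rightarrow> bool"
  where "quadratic_shannon_extension K R S \<longleftrightarrow>
    (\<exists>\<R> :: nat \<Rightarrow> 'a set. \<R> 0 = R \<and>
      (\<forall>n. subring (\<R> n) K \<and> regular_local_ring (sub K (\<R> n)) \<and> krull_dim (sub K (\<R> n)) \<ge> 2) \<and>
      (\<forall>n. lqt K (\<R> n) (\<R> (Suc n))) \<and>
      S = (\<Union>n. \<R> n))"

text \<open>The intersection is taken inside the quotient field of \<open>R\<close>, which is therefore the value of
  the empty intersection.\<close>

definition noetherian_hull :: "('a, 'm) ring_scheme \<Rightarrow> 'a set \<Rightarrow> 'a set \<Rightarrow> 'a set"
  where "noetherian_hull K R S =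
    quotient_field K R \<inter> \<Inter>{V. overring K R V \<and> dvr (sub K V) \<and> S \<subset> V}"

end

theory Submission
  imports Defs
begin

text \<open>
  Both parts rest on what a sequence \<open>R = R\<^sub>0, R\<^sub>1, \<dots>\<close> of local quadratic transforms inside \<open>R\<^sub>P\<close> does
  to an element \<open>y\<close> of \<open>R - P\<close>. Let \<open>x\<^sub>n\<close> generate \<open>\<mm>\<^sub>n R\<^sub>n\<^sub>+\<^sub>1\<close>. As long as \<open>y\<close> divided by
  \<open>x\<^sub>0 \<dots> x\<^sub>n\<^sub>-\<^sub>1\<close> is a nonunit of \<open>R\<^sub>n\<close> it can be divided by \<open>x\<^sub>n\<close> as well, and elements of \<open>P R\<^sub>P\<close> can
  always be divided, since a prime ideal lies in the maximal ideal. If the process makes \<open>y\<close> a unit after finitely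
  many steps, then \<open>f/y\<close> lies in the union \<open>S\<close> for every \<open>f\<close> in \<open>P\<close> (\<open>shannon_quotient\<close>). When
  this holds for all \<open>y\<close>, every \<open>f\<close> in \<open>P\<close> is divisible in \<open>S\<close> by all powers of a nonunit, so
  \<open>S\<close> is not archimedean.

  That the process stops follows from an argument of Krull and Akizuki. Let \<open>C \<subseteq> D\<close> be rings between \<open>R\<close> and
  \<open>R\<^sub>P\<close>, with \<open>C\<close> Noetherian and one-dimensional modulo \<open>P R\<^sub>P\<close>. Then the number of factors in \<open>D\<close>
  of an element \<open>y\<close> of \<open>C - P R\<^sub>P\<close> that are nonunits modulo \<open>P R\<^sub>P\<close> is at most the length of
  \<open>C/(P R\<^sub>P \<inter> C + yC)\<close> (\<open>krull_akizuki_bound\<close>).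

  For (2) take \<open>C = R\<close>: if no prime lies strictly between \<open>P\<close> and the maximal ideal, then \<open>R/P\<close>
  is one-dimensional, the process stops, and no Shannon extension inside \<open>R\<^sub>P\<close> is archimedean.

  For (1) the sequence is built along a valuation ring. Dominate \<open>R + P R\<^sub>P\<close> by a valuation ring, let \<open>A\<close> be
  the quadratic transform of \<open>R\<close> along it, and localize \<open>A\<close> at a minimal prime over
  \<open>P R\<^sub>P \<inter> A\<close> and the exceptional parameter. By Krull's principal ideal theorem the result \<open>C\<close> is
  one-dimensional modulo \<open>P R\<^sub>P\<close>, and it dominates \<open>R\<close> (\<open>one_dimensional_overring\<close>). Now dominate
  \<open>C + P R\<^sub>P\<close> by a valuation ring \<open>V\<close> and iterate quadratic transforms along \<open>V\<close>. They stay inside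
  \<open>R\<^sub>P\<close> because \<open>P R\<^sub>P\<close> is contained in the maximal ideal of \<open>V\<close>, the process stops by the bound for
  \<open>C\<close>, and therefore \<open>P R\<^sub>P \<subseteq> S\<close>. A DVR overring \<open>W\<close> containing \<open>S\<close> must contain \<open>R\<^sub>P\<close>:
  if some \<open>y\<close> in \<open>R - P\<close> were a nonunit of \<open>W\<close>, then \<open>P\<close> would lie in all \<open>y\<^sup>n W\<close>.
  Conversely \<open>R\<^sub>P\<close> is an intersection of DVRs since \<open>R\<close> is completely integrally closed
  (\<open>dvr_separates\<close>). So the Noetherian hull of \<open>S\<close> is \<open>R\<^sub>P\<close>.

  What remains is that quadratic transforms of regular local rings are regular
  (\<open>quadratic_transform_regular\<close>). A regular local ring is handled through generators \<open>x\<^sub>1, \<dots>, x\<^sub>d\<close>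
  of its maximal ideal whose initial segments generate a strictly increasing chain of primes; the transform is
  obtained by adjoining the quotients \<open>x\<^sub>i/x\<^sub>1\<close> one at a time, and each step replaces such a sequence by
  another one (\<open>blowup_step\<close>). The equivalence of this description with the equality of Krull dimension and
  embedding dimension is the dimension theory of Noetherian local rings, based on the principal ideal theorem.

  All rings involved are subrings of the field \<open>K\<close>, and all ideals are subsets of \<open>K\<close>. Statements
  about a quotient ring \<open>A/p\<close> are expressed by ideals of \<open>A\<close> that contain \<open>p\<close>.
\<close>

section \<open>Submodules of a field over a subring\<close>

locale ambient = field K for K (structure)
begin

text \<open>
  Submodules, ideals and prime ideals of a subring \<open>A\<close>, as plain subsets of \<open>K\<close>. Ideals of different subrings
  can then be compared and intersected directly, and closure under negation is multiplication by \<open>-1\<close>.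
\<close>

definition smod :: "'a set \<Rightarrow> 'a set \<Rightarrow> bool" where
  "smod A M \<longleftrightarrow> M \<subseteq> carrier K \<and> \<zero> \<in> M \<and> (\<forall>x\<in>M. \<forall>y\<in>M. x \<oplus> y \<in> M) \<and> (\<forall>a\<in>A. \<forall>x\<in>M. a \<otimes> x \<in> M)"

definition idl :: "'a set \<Rightarrow> 'a set \<Rightarrow> bool" where
  "idl A I \<longleftrightarrow> smod A I \<and> I \<subseteq> A"

definition prm :: "'a set \<Rightarrow> 'a set \<Rightarrow> bool" where
  "prm A p \<longleftrightarrow> idl A p \<and> \<one> \<notin> p \<and> (\<forall>a\<in>A. \<forall>b\<in>A. a \<otimes> b \<in> p \<longrightarrow> a \<in> p \<or> b \<in> p)"

definition msum :: "'a set \<Rightarrow> 'a set \<Rightarrow> 'a set" where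
  "msum M N = {x \<oplus> y | x y. x \<in> M \<and> y \<in> N}"

text \<open>The submodule \<open>Ax + I\<close>.\<close>

definition add_gen :: "'a set \<Rightarrow> 'a \<Rightarrow> 'a set \<Rightarrow> 'a set" where
  "add_gen A x I = {a \<otimes> x \<oplus> y | a y. a \<in> A \<and> y \<in> I}"

text \<open>
  \<open>I + (xs)\<close>. The base \<open>I\<close> is what makes it usable for generators of an ideal modulo \<open>I\<close>; the
  finitely generated ideals are those with base \<open>{\<zero>}\<close>.
\<close>

definition add_gens :: "'a set \<Rightarrow> 'a list \<Rightarrow> 'a set \<Rightarrow> 'a set" where
  "add_gens A xs I = foldr (add_gen A) xs I"

definition noeth :: "'a set \<Rightarrow> bool" where
  "noeth A \<longleftrightarrow> (\<forall>I. idl A I \<longrightarrow> (\<exists>xs. set xs \<subseteq> A \<and> I = add_gens A xs {\<zero>}))"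

lemma subringD:
  assumes "subring A K"
  shows "A \<subseteq> carrier K" "\<zero> \<in> A" "\<one> \<in> A" "\<And>a. a \<in> A \<Longrightarrow> a \<in> carrier K" "\<And>a. a \<in> A \<Longrightarrow> \<ominus> a \<in> A"
    "\<And>a b. a \<in> A \<Longrightarrow> b \<in> A \<Longrightarrow> a \<otimes> b \<in> A" "\<And>a b. a \<in> A \<Longrightarrow> b \<in> A \<Longrightarrow> a \<oplus> b \<in> A"
    "\<And>a b. a \<in> A \<Longrightarrow> b \<in> A \<Longrightarrow> a \<ominus> b \<in> A" "\<And>a n. a \<in> A \<Longrightarrow> a [^] (n::nat) \<in> A"
proof -
  note E = subringE[OF assms]
  show "A \<subseteq> carrier K" "\<zero> \<in> A" "\<one> \<in> A" by (rule E)+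
  show 1: "\<And>a. a \<in> A \<Longrightarrow> a \<in> carrier K" using E(1) by blast
  show 2: "\<And>a. a \<in> A \<Longrightarrow> \<ominus> a \<in> A" by (rule E)
  show 3: "\<And>a b. a \<in> A \<Longrightarrow> b \<in> A \<Longrightarrow> a \<otimes> b \<in> A" by (rule E)
  show 4: "\<And>a b. a \<in> A \<Longrightarrow> b \<in> A \<Longrightarrow> a \<oplus> b \<in> A" by (rule E)
  show "\<And>a b. a \<in> A \<Longrightarrow> b \<in> A \<Longrightarrow> a \<ominus> b \<in> A" unfolding a_minus_def using 2 4 by blast
  show "a [^] (n::nat) \<in> A" if "a \<in> A" for a n by (induction n) (use E that 3 in auto)
qed

lemma smodD:
  assumes "smod A M"
  shows "M \<subseteq> carrier K" "\<zero> \<in> M" "\<And>x. x \<in> M \<Longrightarrow> x \<in> carrier K"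
    "\<And>x y. x \<in> M \<Longrightarrow> y \<in> M \<Longrightarrow> x \<oplus> y \<in> M" "\<And>a x. a \<in> A \<Longrightarrow> x \<in> M \<Longrightarrow> a \<otimes> x \<in> M"
  using assms unfolding smod_def by blast+

lemma smod_neg: "subring A K \<Longrightarrow> smod A M \<Longrightarrow> x \<in> M \<Longrightarrow> \<ominus> x \<in> M"
proof -
  assume a: "subring A K" "smod A M" "x \<in> M"
  have "\<ominus> x = (\<ominus> \<one>) \<otimes> x" using smodD(3)[OF a(2,3)] by (simp add: l_minus)
  then show ?thesis using a smodD(5)[OF a(2)] subringD(3,5)[OF a(1)] by auto
qed

lemma smod_minus: "subring A K \<Longrightarrow> smod A M \<Longrightarrow> x \<in> M \<Longrightarrow> y \<in> M \<Longrightarrow> x \<ominus> y \<in> M"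
  unfolding a_minus_def by (meson smodD(4) smod_neg)

lemma smod_addR: "subring A K \<Longrightarrow> smod A M \<Longrightarrow> x \<in> carrier K \<Longrightarrow> y \<in> M \<Longrightarrow> x \<oplus> y \<in> M \<longleftrightarrow> x \<in> M"
proof
  assume a: "subring A K" "smod A M" "x \<in> carrier K" "y \<in> M" and b: "x \<oplus> y \<in> M"
  have "x = (x \<oplus> y) \<ominus> y" using a(3) smodD(3)[OF a(2,4)] by algebra
  then show "x \<in> M" using smod_minus[OF a(1,2) b a(4)] by simp
qed (auto dest: smodD(4))

lemma smod_addL: "subring A K \<Longrightarrow> smod A M \<Longrightarrow> x \<in> carrier K \<Longrightarrow> y \<in> M \<Longrightarrow> y \<oplus> x \<in> M \<longleftrightarrow> x \<in> M"
  using smod_addR a_comm smodD(3) by metis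

lemma smod_self: "subring A K \<Longrightarrow> smod A A" unfolding smod_def by (simp add: subringD(1,2,6,7))
lemma smod_zero: "subring A K \<Longrightarrow> smod A {\<zero>}" unfolding smod_def by (auto dest: subringD(4))
lemma idl_zero: "subring A K \<Longrightarrow> idl A {\<zero>}" unfolding idl_def by (simp add: smod_zero subringD(2))
lemma smod_Int: "smod A M \<Longrightarrow> smod A N \<Longrightarrow> smod A (M \<inter> N)" unfolding smod_def by blast
lemma smod_mono: "smod B M \<Longrightarrow> A \<subseteq> B \<Longrightarrow> smod A M" unfolding smod_def by blast

lemma idlD:
  assumes "idl A I"
  shows "smod A I" "I \<subseteq> A" "\<zero> \<in> I" "\<And>x. x \<in> I \<Longrightarrow> x \<in> A" "\<And>x. x \<in> I \<Longrightarrow> x \<in> carrier K"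
    "\<And>x y. x \<in> I \<Longrightarrow> y \<in> I \<Longrightarrow> x \<oplus> y \<in> I" "\<And>a x. a \<in> A \<Longrightarrow> x \<in> I \<Longrightarrow> a \<otimes> x \<in> I"
proof -
  show s: "smod A I" and i: "I \<subseteq> A" using assms unfolding idl_def by blast+
  note S = smodD[OF s]
  show "\<zero> \<in> I" "\<And>x. x \<in> I \<Longrightarrow> x \<in> A" "\<And>x. x \<in> I \<Longrightarrow> x \<in> carrier K"
    "\<And>x y. x \<in> I \<Longrightarrow> y \<in> I \<Longrightarrow> x \<oplus> y \<in> I" "\<And>a x. a \<in> A \<Longrightarrow> x \<in> I \<Longrightarrow> a \<otimes> x \<in> I"
    using S i by blast+
qed

lemma idl_one: "subring A K \<Longrightarrow> idl A I \<Longrightarrow> \<one> \<in> I \<Longrightarrow> I = A"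
  by (metis idlD(2,7) r_one subringD(4) subsetI subset_antisym)

lemma prmD:
  assumes "prm A p"
  shows "idl A p" "smod A p" "p \<subseteq> A" "\<one> \<notin> p" "\<zero> \<in> p"
    "\<And>a b. a \<in> A \<Longrightarrow> b \<in> A \<Longrightarrow> a \<otimes> b \<in> p \<Longrightarrow> a \<in> p \<or> b \<in> p"
  using assms idlD(1,2,3)[of A p] unfolding prm_def by blast+

lemma prm_pow: "subring A K \<Longrightarrow> prm A p \<Longrightarrow> x \<in> A \<Longrightarrow> x [^] (n::nat) \<in> p \<Longrightarrow> x \<in> p"
proof (induction n)
  case 0 then show ?case using prmD(4) by simp
next
  case (Suc n) then show ?case using prmD(6)[OF Suc(3), of "x [^] n" x] subringD(9)[OF Suc(2)] by auto
qed

lemma smod_msum: assumes "smod A M" "smod A N" "subring A K" shows "smod A (msum M N)"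
  unfolding smod_def
proof (intro conjI ballI)
  note M = smodD[OF assms(1)] and N = smodD[OF assms(2)]
  show "msum M N \<subseteq> carrier K" unfolding msum_def using M N by auto
  show "\<zero> \<in> msum M N" unfolding msum_def using M(2) N(2) by (smt (verit) l_zero mem_Collect_eq zero_closed)
  fix x y assume "x \<in> msum M N" "y \<in> msum M N"
  then obtain a b c d where *: "a \<in> M" "b \<in> N" "c \<in> M" "d \<in> N" "x = a \<oplus> b" "y = c \<oplus> d"
    unfolding msum_def by blast
  have "x \<oplus> y = (a \<oplus> c) \<oplus> (b \<oplus> d)" using * M(3) N(3) by (simp add: a_ac)
  then show "x \<oplus> y \<in> msum M N" unfolding msum_def using * M(4) N(4) by blast
next
  note M = smodD[OF assms(1)] and N = smodD[OF assms(2)]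
  fix r x assume "r \<in> A" "x \<in> msum M N"
  then obtain a b where *: "a \<in> M" "b \<in> N" "x = a \<oplus> b" unfolding msum_def by blast
  have "r \<otimes> x = r \<otimes> a \<oplus> r \<otimes> b" using * M(3) N(3) subringD(4)[OF assms(3) \<open>r \<in> A\<close>] by (simp add: r_distr)
  then show "r \<otimes> x \<in> msum M N" unfolding msum_def using * M(5) N(5) \<open>r \<in> A\<close> by blast
qed

lemma msum_upper: assumes "smod A M" "smod A N" shows "M \<subseteq> msum M N" "N \<subseteq> msum M N"
  unfolding msum_def using smodD(2,3)[OF assms(1)] smodD(2,3)[OF assms(2)] l_zero r_zero by force+

lemma msum_least: "smod A L \<Longrightarrow> M \<subseteq> L \<Longrightarrow> N \<subseteq> L \<Longrightarrow> msum M N \<subseteq> L"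
  unfolding msum_def using smodD(4) by blast

lemma smod_cyc: assumes "subring A K" "x \<in> carrier K" shows "smod A {a \<otimes> x | a. a \<in> A}"
  unfolding smod_def
proof (intro conjI ballI)
  note A = subringD[OF assms(1)]
  show "{a \<otimes> x | a. a \<in> A} \<subseteq> carrier K" using A assms by auto
  show "\<zero> \<in> {a \<otimes> x | a. a \<in> A}" using A(2) l_null[OF assms(2)] by force
  fix u v assume "u \<in> {a \<otimes> x | a. a \<in> A}" "v \<in> {a \<otimes> x | a. a \<in> A}"
  then obtain a b where *: "a \<in> A" "b \<in> A" "u = a \<otimes> x" "v = b \<otimes> x" by blast
  have "u \<oplus> v = (a \<oplus> b) \<otimes> x" using * A(4) assms(2) by (simp add: l_distr)
  then show "u \<oplus> v \<in> {a \<otimes> x | a. a \<in> A}" using * A(7) by blast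
next
  note A = subringD[OF assms(1)]
  fix u v assume "u \<in> A" "v \<in> {a \<otimes> x | a. a \<in> A}"
  then obtain b where *: "b \<in> A" "v = b \<otimes> x" by blast
  have "u \<otimes> v = (u \<otimes> b) \<otimes> x" using * A(4) assms(2) \<open>u \<in> A\<close> by (simp add: m_assoc)
  then show "u \<otimes> v \<in> {a \<otimes> x | a. a \<in> A}" using * A(6) \<open>u \<in> A\<close> by blast
qed

lemma add_gen_msum: "add_gen A x I = msum {a \<otimes> x | a. a \<in> A} I"
  unfolding add_gen_def msum_def by blast

lemma add_gen_smod: "subring A K \<Longrightarrow> x \<in> carrier K \<Longrightarrow> smod A I \<Longrightarrow> smod A (add_gen A x I)"
  unfolding add_gen_msum by (simp add: smod_msum smod_cyc)

lemma add_gen_sup: assumes "subring A K" "x \<in> carrier K" "smod A I" shows "I \<subseteq> add_gen A x I" "x \<in> add_gen A x I"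
proof -
  have "x \<in> {a \<otimes> x | a. a \<in> A}" using subringD(3)[OF assms(1)] l_one[OF assms(2)] by force
  then show "I \<subseteq> add_gen A x I" "x \<in> add_gen A x I"
    unfolding add_gen_msum using msum_upper[OF smod_cyc[OF assms(1,2)] assms(3)] by blast+
qed

lemma add_gen_least: "smod A L \<Longrightarrow> x \<in> L \<Longrightarrow> I \<subseteq> L \<Longrightarrow> add_gen A x I \<subseteq> L"
  unfolding add_gen_def using smodD(4,5) by blast

lemma add_gen_idl: assumes "subring A K" "x \<in> A" "idl A I" shows "idl A (add_gen A x I)"
  using add_gen_smod[OF assms(1) _ idlD(1)[OF assms(3)]] add_gen_least[OF smod_self[OF assms(1)] assms(2) idlD(2)[OF assms(3)]]
    subringD(4)[OF assms(1,2)] unfolding idl_def by blast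

lemma add_gen_iff: "z \<in> add_gen A x I \<longleftrightarrow> (\<exists>a\<in>A. \<exists>y\<in>I. z = a \<otimes> x \<oplus> y)"
  unfolding add_gen_def by blast

lemma add_gens_Nil [simp]: "add_gens A [] I = I" and add_gens_Cons [simp]: "add_gens A (x # xs) I = add_gen A x (add_gens A xs I)"
  and add_gens_append: "add_gens A (xs @ ys) I = add_gens A xs (add_gens A ys I)"
  unfolding add_gens_def by auto

lemma add_gens_smod: "subring A K \<Longrightarrow> set xs \<subseteq> carrier K \<Longrightarrow> smod A I \<Longrightarrow> smod A (add_gens A xs I)"
  by (induction xs) (auto intro: add_gen_smod)

lemma add_gens_idl: "subring A K \<Longrightarrow> set xs \<subseteq> A \<Longrightarrow> idl A I \<Longrightarrow> idl A (add_gens A xs I)"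
  by (induction xs) (auto intro: add_gen_idl)

lemma add_gens_sup: assumes "subring A K" "set xs \<subseteq> carrier K" "smod A I" shows "I \<subseteq> add_gens A xs I" "set xs \<subseteq> add_gens A xs I"
proof -
  have "I \<subseteq> add_gens A xs I \<and> set xs \<subseteq> add_gens A xs I" using assms(2)
  proof (induction xs)
    case (Cons x xs)
    have "smod A (add_gens A xs I)" using add_gens_smod assms Cons by simp
    from add_gen_sup[OF assms(1) _ this, of x] show ?case using Cons by auto
  qed simp
  then show "I \<subseteq> add_gens A xs I" "set xs \<subseteq> add_gens A xs I" by auto
qed

lemma add_gens_least: "smod A L \<Longrightarrow> set xs \<subseteq> L \<Longrightarrow> I \<subseteq> L \<Longrightarrow> add_gens A xs I \<subseteq> L"
  by (induction xs) (simp_all add: add_gen_least)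

lemma add_gens_mono:
  assumes "subring A K" "set ys \<subseteq> carrier K" "smod A J" "set xs \<subseteq> add_gens A ys J" "I \<subseteq> add_gens A ys J"
  shows "add_gens A xs I \<subseteq> add_gens A ys J"
  using add_gens_least[OF add_gens_smod[OF assms(1-3)] assms(4,5)] .

lemma add_gens_perm:
  assumes "subring A K" "set xs \<subseteq> carrier K" "smod A I" "set xs = set ys"
  shows "add_gens A xs I = add_gens A ys I"
  using add_gens_mono add_gens_sup assms by (metis subset_antisym)

lemma noeth_max:
  assumes A: "subring A K" and n: "noeth A" and F: "\<And>J. J \<in> F \<Longrightarrow> idl A J" and ne: "F \<noteq> {}"
  shows "\<exists>M\<in>F. \<forall>J\<in>F. M \<subseteq> J \<longrightarrow> J = M"
proof (rule subset_Zorn_nonempty[OF ne])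
  fix C assume C: "C \<noteq> {}" "subset.chain F C"
  then have CF: "C \<subseteq> F" and tot: "\<And>U W. U \<in> C \<Longrightarrow> W \<in> C \<Longrightarrow> (U \<subseteq> W \<or> W \<subseteq> U)"
    unfolding subset_chain_def by blast+
  have Ci: "\<And>U. U \<in> C \<Longrightarrow> idl A U" using CF F by blast
  have "idl A (\<Union>C)" unfolding idl_def smod_def
  proof (intro conjI ballI)
    show "\<Union>C \<subseteq> carrier K" "\<zero> \<in> \<Union>C" "\<Union>C \<subseteq> A" using Ci C(1) by (auto dest: idlD)
    show "x \<oplus> y \<in> \<Union>C" if xy: "x \<in> \<Union>C" "y \<in> \<Union>C" for x y
    proof -
      obtain U W where "U \<in> C" "W \<in> C" "x \<in> U" "y \<in> W" using xy by blast
      then show ?thesis using tot[of U W] Ci idlD(6) by blast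
    qed
    show "a \<otimes> x \<in> \<Union>C" if "a \<in> A" "x \<in> \<Union>C" for a x using that Ci idlD(7) by blast
  qed
  then obtain xs where xs: "set xs \<subseteq> A" "\<Union>C = add_gens A xs {\<zero>}" using n unfolding noeth_def by blast
  have "set xs \<subseteq> \<Union>C" using add_gens_sup(2)[OF A _ smod_zero[OF A], of xs] xs subringD(1)[OF A] by auto
  then have "\<exists>U\<in>C. set ys \<subseteq> U" if "set ys \<subseteq> set xs" for ys using that
  proof (induction ys)
    case Nil then show ?case using C(1) by auto
  next
    case (Cons y ys)
    then obtain U W where "U \<in> C" "set ys \<subseteq> U" "W \<in> C" "y \<in> W" by auto
    then show ?case using tot[of U W] by (metis insert_subset list.simps(15) subset_iff)
  qed
  then obtain U where U: "U \<in> C" "set xs \<subseteq> U" by blast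
  have "\<Union>C \<subseteq> U" unfolding xs(2) using add_gens_least[OF idlD(1)[OF Ci[OF U(1)]] U(2)] idlD(3)[OF Ci[OF U(1)]] by blast
  then have "\<Union>C = U" using U by blast
  then show "\<Union>C \<in> F" using U CF by blast
qed

lemma noeth_acc:
  assumes A: "subring A K" and n: "noeth A" and f: "\<And>i. idl A (f i)" "\<And>i::nat. f i \<subseteq> f (Suc i)"
  shows "\<exists>n. \<forall>m\<ge>n. f m = f n"
proof -
  have r: "idl A J" if "J \<in> range f" for J using that f(1) by auto
  have ne: "range f \<noteq> {}" by simp
  obtain M where M: "M \<in> range f" "\<forall>J\<in>range f. M \<subseteq> J \<longrightarrow> J = M"
    using noeth_max[OF A n r ne] by blast
  then obtain n where "M = f n" by blast
  moreover have "f n \<subseteq> f m" if "n \<le> m" for m using lift_Suc_mono_le[of f, OF f(2) that] by simp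
  ultimately have "f m = f n" if "n \<le> m" for m using M that by (metis rangeI)
  then show ?thesis by blast
qed

section \<open>Lengths of intervals of submodules\<close>

text \<open>
  Lengths are measured on weakly increasing sequences by counting their strict steps. Intersecting such a sequence with a
  fixed submodule, or adding one, gives again such a sequence, so no re-indexing of strict chains is needed.
\<close>

definition jumps :: "(nat \<Rightarrow> 'a set) \<Rightarrow> nat \<Rightarrow> nat set" where
  "jumps f k = {i. i < k \<and> f i \<noteq> f (Suc i)}"

definition flag :: "'a set \<Rightarrow> 'a set \<Rightarrow> 'a set \<Rightarrow> (nat \<Rightarrow> 'a set) \<Rightarrow> bool" where
  "flag A lo hi f \<longleftrightarrow> (\<forall>i. smod A (f i) \<and> lo \<subseteq> f i \<and> f i \<subseteq> hi \<and> f i \<subseteq> f (Suc i))"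

definition lenle :: "'a set \<Rightarrow> 'a set \<Rightarrow> 'a set \<Rightarrow> nat \<Rightarrow> bool" where
  "lenle A lo hi n \<longleftrightarrow> (\<forall>f k. flag A lo hi f \<longrightarrow> card (jumps f k) \<le> n)"

definition lenge :: "'a set \<Rightarrow> 'a set \<Rightarrow> 'a set \<Rightarrow> nat \<Rightarrow> bool" where
  "lenge A lo hi n \<longleftrightarrow> (\<exists>f k. flag A lo hi f \<and> n \<le> card (jumps f k))"

lemma finite_jumps [simp]: "finite (jumps f k)" unfolding jumps_def by auto

lemma len_le_ge: "lenle A lo hi n \<Longrightarrow> lenge A lo hi m \<Longrightarrow> m \<le> n"
  unfolding lenle_def lenge_def using order_trans by blast

lemma len_exact: assumes "lenle A lo hi N" "smod A lo" "lo \<subseteq> hi" shows "\<exists>n. lenle A lo hi n \<and> lenge A lo hi n"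
proof -
  define n where "n = (LEAST n. lenle A lo hi n)"
  have n: "lenle A lo hi n" unfolding n_def by (rule LeastI, rule assms)
  have "lenge A lo hi n"
  proof (cases n)
    case 0
    have "flag A lo hi (\<lambda>_. lo)" using assms unfolding flag_def by auto
    then show ?thesis unfolding lenge_def 0 by blast
  next
    case (Suc m)
    then have "\<not> lenle A lo hi m" unfolding n_def by (metis lessI not_less_Least)
    then show ?thesis unfolding lenge_def lenle_def Suc by (metis not_less_eq_eq)
  qed
  with n show ?thesis by blast
qed

text \<open>The modular law: a submodule \<open>M \<subseteq> N\<close> is determined by its intersection and its sum with \<open>Y\<close>.\<close>

lemma smod_modular:
  assumes A: "subring A K" and s: "smod A M" "smod A N" and "M \<subseteq> N" "M \<inter> Y = N \<inter> Y" "msum M Y = msum N Y" "smod A Y"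
  shows "M = N"
proof
  show "N \<subseteq> M"
  proof
    fix x assume x: "x \<in> N"
    then have "x \<in> msum M Y" using msum_upper(1)[OF s(2) assms(7)] assms(6) by auto
    then obtain a y where ay: "a \<in> M" "y \<in> Y" "x = a \<oplus> y" unfolding msum_def by blast
    have "y = x \<ominus> a" unfolding ay(3) using smodD(3)[OF s(1) ay(1)] smodD(3)[OF assms(7) ay(2)] by algebra
    then have "y \<in> N" using smod_minus[OF A s(2) x, of a] ay(1) assms(4) by (metis subsetD)
    then have "y \<in> M" using ay assms(5) by blast
    then show "x \<in> M" using ay smodD(4)[OF s(1)] by blast
  qed
qed (rule assms)

text \<open>By the modular law each strict step of a sequence survives in its intersection with \<open>Y\<close> or in its sum with \<open>Y\<close>.\<close>

lemma lenle_add: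
  assumes A: "subring A K" and "lenle A lo Y a" "lenle A Y hi b" "lo \<subseteq> Y" "Y \<subseteq> hi" "smod A Y" "smod A hi"
  shows "lenle A lo hi (a + b)"
  unfolding lenle_def
proof (intro allI impI)
  fix f k assume f: "flag A lo hi f"
  define g where "g i = f i \<inter> Y" for i
  define h where "h i = msum (f i) Y" for i
  have "flag A lo Y g" using f assms(4,6) unfolding flag_def g_def by (auto intro: smod_Int)
  then have g: "card (jumps g k) \<le> a" using assms(2) unfolding lenle_def by blast
  have "flag A Y hi h" unfolding flag_def
  proof (intro allI conjI)
    fix i
    have s: "smod A (f i)" "f i \<subseteq> hi" "f i \<subseteq> f (Suc i)" using f unfolding flag_def by auto
    show "smod A (h i)" unfolding h_def by (intro smod_msum s assms A)
    show "Y \<subseteq> h i" unfolding h_def using msum_upper(2)[OF s(1) assms(6)] .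
    show "h i \<subseteq> hi" unfolding h_def using msum_least[OF assms(7) s(2) assms(5)] .
    show "h i \<subseteq> h (Suc i)" unfolding h_def msum_def using s(3) by blast
  qed
  then have h: "card (jumps h k) \<le> b" using assms(3) unfolding lenle_def by blast
  have "jumps f k \<subseteq> jumps g k \<union> jumps h k"
  proof
    fix i assume i: "i \<in> jumps f k"
    show "i \<in> jumps g k \<union> jumps h k"
    proof (rule ccontr)
      assume "i \<notin> jumps g k \<union> jumps h k"
      then have "f i \<inter> Y = f (Suc i) \<inter> Y" "msum (f i) Y = msum (f (Suc i)) Y" using i unfolding jumps_def g_def h_def by auto
      moreover have "smod A (f i)" "smod A (f (Suc i))" "f i \<subseteq> f (Suc i)" using f unfolding flag_def by auto
      ultimately have "f i = f (Suc i)" using smod_modular[OF A] assms(6) by blast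
      then show False using i unfolding jumps_def by auto
    qed
  qed
  then have "card (jumps f k) \<le> card (jumps g k \<union> jumps h k)" by (simp add: card_mono)
  also have "\<dots> \<le> card (jumps g k) + card (jumps h k)" by (rule card_Un_le)
  finally show "card (jumps f k) \<le> a + b" using g h by linarith
qed

lemma flag_map:
  assumes f: "flag A lo hi f"
    and s: "\<And>M. smod A M \<Longrightarrow> lo \<subseteq> M \<Longrightarrow> M \<subseteq> hi \<Longrightarrow> smod A (\<phi> M) \<and> lo' \<subseteq> \<phi> M \<and> \<phi> M \<subseteq> hi'"
    and m: "\<And>M N. M \<subseteq> N \<Longrightarrow> \<phi> M \<subseteq> \<phi> N"
    and i: "\<And>M N. smod A M \<Longrightarrow> lo \<subseteq> M \<Longrightarrow> smod A N \<Longrightarrow> N \<subseteq> hi \<Longrightarrow> M \<subseteq> N \<Longrightarrow> \<phi> M = \<phi> N \<Longrightarrow> M = N"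
  shows "flag A lo' hi' (\<lambda>i. \<phi> (f i))" "card (jumps f k) = card (jumps (\<lambda>i. \<phi> (f i)) k)"
proof -
  show "flag A lo' hi' (\<lambda>i. \<phi> (f i))" using f s m unfolding flag_def by auto
  have "f n = f (Suc n) \<longleftrightarrow> \<phi> (f n) = \<phi> (f (Suc n))" for n
    using f i[of "f n" "f (Suc n)"] unfolding flag_def by metis
  then have "jumps f k = jumps (\<lambda>i. \<phi> (f i)) k" unfolding jumps_def by simp
  then show "card (jumps f k) = card (jumps (\<lambda>i. \<phi> (f i)) k)" by simp
qed

lemma lenle_map:
  assumes "lenle A lo' hi' n"
    and s: "\<And>M. smod A M \<Longrightarrow> lo \<subseteq> M \<Longrightarrow> M \<subseteq> hi \<Longrightarrow> smod A (\<phi> M) \<and> lo' \<subseteq> \<phi> M \<and> \<phi> M \<subseteq> hi'"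
    and m: "\<And>M N. M \<subseteq> N \<Longrightarrow> \<phi> M \<subseteq> \<phi> N"
    and i: "\<And>M N. smod A M \<Longrightarrow> lo \<subseteq> M \<Longrightarrow> smod A N \<Longrightarrow> N \<subseteq> hi \<Longrightarrow> M \<subseteq> N \<Longrightarrow> \<phi> M = \<phi> N \<Longrightarrow> M = N"
  shows "lenle A lo hi n"
  unfolding lenle_def
proof (intro allI impI)
  fix f k assume f: "flag A lo hi f"
  have F: "flag A lo' hi' (\<lambda>i. \<phi> (f i))"
    by (rule flag_map(1)[where \<phi> = \<phi>, OF f]) ((rule s; assumption), (rule m; assumption), (rule i; assumption))
  have F2: "card (jumps f k) = card (jumps (\<lambda>i. \<phi> (f i)) k)"
    by (rule flag_map(2)[where \<phi> = \<phi> and lo' = lo' and hi' = hi', OF f]) ((rule s; assumption), (rule m; assumption), (rule i; assumption))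
  show "card (jumps f k) \<le> n" using assms(1) F unfolding lenle_def F2 by blast
qed

lemma lenge_map:
  assumes "lenge A lo hi n"
    and s: "\<And>M. smod A M \<Longrightarrow> lo \<subseteq> M \<Longrightarrow> M \<subseteq> hi \<Longrightarrow> smod A (\<phi> M) \<and> lo' \<subseteq> \<phi> M \<and> \<phi> M \<subseteq> hi'"
    and m: "\<And>M N. M \<subseteq> N \<Longrightarrow> \<phi> M \<subseteq> \<phi> N"
    and i: "\<And>M N. smod A M \<Longrightarrow> lo \<subseteq> M \<Longrightarrow> smod A N \<Longrightarrow> N \<subseteq> hi \<Longrightarrow> M \<subseteq> N \<Longrightarrow> \<phi> M = \<phi> N \<Longrightarrow> M = N"
  shows "lenge A lo' hi' n"
proof -
  obtain f k where f: "flag A lo hi f" "n \<le> card (jumps f k)" using assms(1) unfolding lenge_def by blast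
  have F: "flag A lo' hi' (\<lambda>i. \<phi> (f i))"
    by (rule flag_map(1)[where \<phi> = \<phi>, OF f(1)]) ((rule s; assumption), (rule m; assumption), (rule i; assumption))
  have F2: "card (jumps f k) = card (jumps (\<lambda>i. \<phi> (f i)) k)"
    by (rule flag_map(2)[where \<phi> = \<phi> and lo' = lo' and hi' = hi', OF f(1)]) ((rule s; assumption), (rule m; assumption), (rule i; assumption))
  show ?thesis using F f(2) unfolding lenge_def F2 by blast
qed

text \<open>Sequences realizing the two lower bounds can be run one after the other.\<close>

lemma lenge_add:
  assumes "lenge A lo Y a" "lenge A Y hi b" "lo \<subseteq> Y" "Y \<subseteq> hi"
  shows "lenge A lo hi (a + b)"
proof -
  obtain f k where f: "flag A lo Y f" "a \<le> card (jumps f k)" using assms(1) unfolding lenge_def by blast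
  obtain g l where g: "flag A Y hi g" "b \<le> card (jumps g l)" using assms(2) unfolding lenge_def by blast
  define h where "h i = (if i \<le> k then f i else g (i - Suc k))" for i
  have "flag A lo hi h" unfolding flag_def
  proof (intro allI conjI)
    fix i
    have F: "smod A (f i)" "lo \<subseteq> f i" "f i \<subseteq> Y" for i using f(1) unfolding flag_def by auto
    have G: "smod A (g i)" "Y \<subseteq> g i" "g i \<subseteq> hi" for i using g(1) unfolding flag_def by auto
    show "smod A (h i)" using F(1) G(1) unfolding h_def by simp
    show "lo \<subseteq> h i" using F(2)[of i] G(2)[of "i - Suc k"] assms(3) unfolding h_def by auto
    show "h i \<subseteq> hi" using F(3)[of i] G(3)[of "i - Suc k"] assms(4) unfolding h_def by auto
    show "h i \<subseteq> h (Suc i)"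
    proof (cases "i = k")
      case True
      have "f k \<subseteq> Y" "Y \<subseteq> g 0" using f(1) g(1) unfolding flag_def by auto
      then show ?thesis unfolding h_def True by auto
    next
      case False
      show ?thesis
      proof (cases "i < k")
        case True then show ?thesis using f(1) unfolding flag_def h_def by auto
      next
        case F: False
        then have "Suc i - Suc k = Suc (i - Suc k)" using False by auto
        then show ?thesis using g(1) F False unfolding flag_def h_def by auto
      qed
    qed
  qed
  moreover have "jumps f k \<union> (\<lambda>i. i + Suc k) ` jumps g l \<subseteq> jumps h (l + Suc k)"
    unfolding jumps_def h_def by (auto simp: Suc_diff_Suc)
  then have "card (jumps f k \<union> (\<lambda>i. i + Suc k) ` jumps g l) \<le> card (jumps h (l + Suc k))"
    by (intro card_mono) auto
  moreover have "card (jumps f k \<union> (\<lambda>i. i + Suc k) ` jumps g l) = card (jumps f k) + card (jumps g l)"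
  proof (subst card_Un_disjoint)
    show "jumps f k \<inter> (\<lambda>i. i + Suc k) ` jumps g l = {}" unfolding jumps_def by auto
    have "card ((\<lambda>i. i + Suc k) ` jumps g l) = card (jumps g l)" by (rule card_image) (auto intro: inj_onI)
    then show "card (jumps f k) + card ((\<lambda>i. i + Suc k) ` jumps g l) = card (jumps f k) + card (jumps g l)" by simp
  qed auto
  ultimately show ?thesis using f(2) g(2) unfolding lenge_def by (intro exI[of _ h] exI[of _ "l + Suc k"]) linarith
qed

lemma lenle_weaken: "lenle A lo hi n \<Longrightarrow> lo \<subseteq> lo' \<Longrightarrow> hi' \<subseteq> hi \<Longrightarrow> lenle A lo' hi' n"
proof -
  assume a: "lenle A lo hi n" "lo \<subseteq> lo'" "hi' \<subseteq> hi"
  have "flag A lo hi f" if "flag A lo' hi' f" for f using that a(2,3) unfolding flag_def by blast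
  then show ?thesis using a(1) unfolding lenle_def by blast
qed

lemma lenge_one: assumes "smod A M" "smod A N" "M \<subset> N" shows "lenge A M N 1"
proof -
  define f where "f i = (if i = 0 then M else N)" for i :: nat
  have "flag A M N f" using assms unfolding flag_def f_def by auto
  moreover have "jumps f 1 = {0}" using assms unfolding jumps_def f_def by auto
  ultimately show ?thesis unfolding lenge_def by (intro exI[of _ f] exI[of _ 1]) auto
qed

definition colon :: "'a set \<Rightarrow> 'a set \<Rightarrow> 'a \<Rightarrow> 'a set" where
  "colon A J a = {r \<in> A. r \<otimes> a \<in> J}"

lemma colon_idl: assumes "subring A K" "smod A J" "a \<in> carrier K" shows "idl A (colon A J a)"
  unfolding idl_def smod_def colon_def
proof (intro conjI ballI)
  note A = subringD[OF assms(1)]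
  show "{r \<in> A. r \<otimes> a \<in> J} \<subseteq> carrier K" "{r \<in> A. r \<otimes> a \<in> J} \<subseteq> A" "\<zero> \<in> {r \<in> A. r \<otimes> a \<in> J}"
    using A(4) A(2) smodD(2)[OF assms(2)] assms(3) by auto
  show "x \<oplus> y \<in> {r \<in> A. r \<otimes> a \<in> J}" if "x \<in> {r \<in> A. r \<otimes> a \<in> J}" "y \<in> {r \<in> A. r \<otimes> a \<in> J}" for x y
    using that A(4,7) assms(3) smodD(4)[OF assms(2)] by (auto simp: l_distr)
  show "x \<otimes> y \<in> {r \<in> A. r \<otimes> a \<in> J}" if "x \<in> A" "y \<in> {r \<in> A. r \<otimes> a \<in> J}" for x y
    using that A(4,6) assms(3) smodD(5)[OF assms(2)] by (auto simp: m_assoc)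
qed

lemma colon_sup: "idl A J \<Longrightarrow> a \<in> A \<Longrightarrow> subring A K \<Longrightarrow> J \<subseteq> colon A J a"
  unfolding colon_def using idlD m_comm subringD(4) by (smt (verit) mem_Collect_eq subsetI)

lemma colon_pow_mono: assumes "subring A K" "idl A J" "x \<in> A"
  shows "colon A J (x [^] i) \<subseteq> colon A J (x [^] Suc i)"
proof
  fix r assume r: "r \<in> colon A J (x [^] i)"
  then have rr: "r \<in> A" "r \<otimes> x [^] i \<in> J" unfolding colon_def by auto
  have "r \<in> carrier K" "x \<in> carrier K" using subringD(4)[OF assms(1)] rr(1) assms(3) by auto
  then have "r \<otimes> x [^] Suc i = x \<otimes> (r \<otimes> x [^] i)" by (simp add: m_ac)
  then show "r \<in> colon A J (x [^] Suc i)" unfolding colon_def using rr idlD(7)[OF assms(2,3) rr(2)] by simp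
qed

text \<open>The cyclic module \<open>(Aa + J)/J\<close> is isomorphic to \<open>A/(J : a)\<close>.\<close>

lemma lenle_cyclic:
  assumes A: "subring A K" and J: "smod A J" and a: "a \<in> carrier K" and l: "lenle A (colon A J a) A n"
  shows "lenle A J (add_gen A a J) n"
proof (rule lenle_map[OF l, where \<phi> = "\<lambda>M. colon A M a"])
  show "smod A (colon A M a) \<and> colon A J a \<subseteq> colon A M a \<and> colon A M a \<subseteq> A" if "smod A M" "J \<subseteq> M" for M
    using colon_idl[OF A that(1) a] that(2) unfolding idl_def colon_def by auto
  show "colon A M a \<subseteq> colon A N a" if "M \<subseteq> N" for M N using that unfolding colon_def by auto
  show "M = N" if h: "smod A M" "J \<subseteq> M" "smod A N" "N \<subseteq> add_gen A a J" "M \<subseteq> N" "colon A M a = colon A N a" for M N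
  proof
    show "N \<subseteq> M"
    proof
      fix z assume z: "z \<in> N"
      then obtain r y where r: "r \<in> A" "y \<in> J" "z = r \<otimes> a \<oplus> y" using h(4) unfolding add_gen_def by blast
      have "r \<otimes> a = z \<ominus> y" unfolding r(3) using smodD(3)[OF J r(2)] subringD(4)[OF A r(1)] a by algebra
      then have "r \<otimes> a \<in> N" using smod_minus[OF A h(3) z] r(2) h by auto
      then have "r \<in> colon A M a" using h(6) r(1) unfolding colon_def by blast
      then have "r \<otimes> a \<in> M" "y \<in> M" using r(2) h(2) unfolding colon_def by auto
      then show "z \<in> M" unfolding r(3) by (rule smodD(4)[OF h(1)])
    qed
  qed (rule h)
qed

lemma lenle_simple:
  assumes "\<And>M. smod A M \<Longrightarrow> lo \<subseteq> M \<Longrightarrow> M \<subseteq> hi \<Longrightarrow> M = lo \<or> M = hi"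
  shows "lenle A lo hi 1"
  unfolding lenle_def
proof (intro allI impI)
  fix f k assume f: "flag A lo hi f"
  have v: "f i = lo \<or> f i = hi" for i
    using f assms[of "f i"] unfolding flag_def by simp
  have hi: "f i \<subseteq> hi" "lo \<subseteq> f i" for i using f unfolding flag_def by auto
  have mono: "f i \<subseteq> f j" if "i \<le> j" for i j using lift_Suc_mono_le[of f, OF _ that] f unfolding flag_def by auto
  have "i = j" if "i \<in> jumps f k" "j \<in> jumps f k" for i j
  proof -
    have *: "\<not> i < j" if "i \<in> jumps f k" "j \<in> jumps f k" for i j
    proof
      assume "i < j"
      have "f i \<noteq> f (Suc i)" "f j \<noteq> f (Suc j)" using that unfolding jumps_def by auto
      moreover have "f i \<subseteq> f (Suc i)" "f (Suc i) \<subseteq> f j" "f j \<subseteq> f (Suc j)" using mono \<open>i < j\<close> by auto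
      ultimately show False using v[of i] v[of "Suc i"] v[of j] v[of "Suc j"] hi by (metis subset_antisym)
    qed
    show ?thesis using *[OF that] *[OF that(2,1)] by simp
  qed
  then show "card (jumps f k) \<le> 1" using card_le_Suc0_iff_eq[OF finite_jumps[of f k]] by simp
qed

text \<open>
  Noetherian induction: let \<open>J\<close> be maximal among the ideals above \<open>I\<close> with quotient of infinite length. If
  \<open>J\<close> is not prime, say \<open>ab \<in> J\<close>, then \<open>A/(J : a)\<close> and \<open>A/(Aa + J)\<close> have finite length by
  maximality, and they are the pieces of \<open>A/J\<close>.
\<close>

lemma noeth_finite_length:
  assumes A: "subring A K" and n: "noeth A" and I: "idl A I"
    and max: "\<And>q J. prm A q \<Longrightarrow> I \<subseteq> q \<Longrightarrow> idl A J \<Longrightarrow> q \<subseteq> J \<Longrightarrow> J = q \<or> J = A"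
  shows "\<exists>n. lenle A I A n"
proof (rule ccontr)
  define F where "F = {J. idl A J \<and> I \<subseteq> J \<and> \<not> (\<exists>n. lenle A J A n)}"
  assume "\<not> ?thesis"
  then have "I \<in> F" using I unfolding F_def by simp
  then have ne: "F \<noteq> {}" by blast
  have Fi: "idl A J" if "J \<in> F" for J using that unfolding F_def by simp
  obtain J where J: "J \<in> F" "\<And>L. L \<in> F \<Longrightarrow> J \<subseteq> L \<Longrightarrow> L = J"
    using noeth_max[OF A n Fi ne] by metis
  have Ji: "idl A J" "I \<subseteq> J" "\<And>n. \<not> lenle A J A n" using J(1) unfolding F_def by auto
  have big: "\<exists>n. lenle A L A n" if "idl A L" "J \<subset> L" for L using J(2)[of L] that Ji(2) unfolding F_def by blast
  have "J \<noteq> A"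
  proof
    assume "J = A"
    then have "lenle A J A 1" by (intro lenle_simple) auto
    then show False using Ji(3) by blast
  qed
  then have one: "\<one> \<notin> J" using idl_one[OF A Ji(1)] by blast
  show False
  proof (cases "prm A J")
    case True
    have "lenle A J A 1"
      by (rule lenle_simple) (use max[OF True Ji(2)] in \<open>auto simp: idl_def\<close>)
    then show False using Ji(3) by blast
  next
    case False
    then obtain a b where ab: "a \<in> A" "b \<in> A" "a \<otimes> b \<in> J" "a \<notin> J" "b \<notin> J" using Ji(1) one unfolding prm_def by blast
    have aK: "a \<in> carrier K" using subringD(4)[OF A ab(1)] .
    have c: "idl A (colon A J a)" using colon_idl[OF A idlD(1)[OF Ji(1)] aK] .
    have "b \<in> colon A J a" using ab m_comm[OF subringD(4)[OF A ab(1)] subringD(4)[OF A ab(2)]] unfolding colon_def by auto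
    then obtain n1 where n1: "lenle A (colon A J a) A n1" using big[OF c] colon_sup[OF Ji(1) ab(1) A] ab(5) by blast
    have "a \<in> add_gen A a J" "J \<subseteq> add_gen A a J" using add_gen_sup[OF A aK idlD(1)[OF Ji(1)]] by auto
    then obtain n2 where n2: "lenle A (add_gen A a J) A n2" using big[OF add_gen_idl[OF A ab(1) Ji(1)]] ab(4) by blast
    have "lenle A J A (n1 + n2)"
      using lenle_add[OF A lenle_cyclic[OF A idlD(1)[OF Ji(1)] aK n1] n2 \<open>J \<subseteq> add_gen A a J\<close>]
        idlD(1,2)[OF add_gen_idl[OF A ab(1) Ji(1)]] smod_self[OF A] by blast
    then show False using Ji(3) by blast
  qed
qed

section \<open>Local rings\<close>

text \<open>The nonunits; \<open>A\<close> is local exactly when they form an ideal.\<close>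

definition mx :: "'a set \<Rightarrow> 'a set" where
  "mx A = {a \<in> A. \<forall>b\<in>A. a \<otimes> b \<noteq> \<one>}"

definition lcl :: "'a set \<Rightarrow> bool" where
  "lcl A \<longleftrightarrow> subring A K \<and> idl A (mx A)"

lemma lclD: assumes "lcl A" shows "subring A K" "idl A (mx A)" using assms unfolding lcl_def by auto

lemma unit_notin_idl: assumes "idl A I" "a \<in> I" "b \<in> A" "a \<otimes> b = \<one>" "b \<in> carrier K" shows "\<one> \<in> I"
  using idlD(7)[OF assms(1,3,2)] assms(4,5) m_comm[OF idlD(5)[OF assms(1,2)] assms(5)] by simp

lemma prop_idl_mx: assumes "subring A K" "idl A I" "\<one> \<notin> I" shows "I \<subseteq> mx A"
proof
  fix a assume a: "a \<in> I"
  have "a \<otimes> b \<noteq> \<one>" if "b \<in> A" for b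
    using unit_notin_idl[OF assms(2) a that _ subringD(4)[OF assms(1) that]] assms(3) by blast
  then show "a \<in> mx A" unfolding mx_def using idlD(4)[OF assms(2) a] by simp
qed

lemma one_notin_mx: "subring A K \<Longrightarrow> \<one> \<notin> mx A"
  unfolding mx_def using subringD(3)[of A] r_one[OF one_closed] by blast

lemma notin_mx: assumes "a \<in> A" "a \<notin> mx A" obtains b where "b \<in> A" "a \<otimes> b = \<one>"
  using assms unfolding mx_def by blast

lemma unit_cancel: assumes "subring A K" "smod A M" "a \<in> A" "a \<notin> mx A" "z \<in> carrier K" "a \<otimes> z \<in> M" shows "z \<in> M"
proof -
  obtain b where b: "b \<in> A" "a \<otimes> b = \<one>" using notin_mx[OF assms(3,4)] .
  have aK: "a \<in> carrier K" and bK: "b \<in> carrier K" using subringD(4)[OF assms(1)] assms(3) b(1) by auto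
  have "b \<otimes> (a \<otimes> z) = (a \<otimes> b) \<otimes> z" using aK bK assms(5) by algebra
  then have "b \<otimes> (a \<otimes> z) = z" using b(2) assms(5) by simp
  then show ?thesis using smodD(5)[OF assms(2) b(1) assms(6)] by simp
qed

lemma prm_mx: assumes "lcl A" shows "prm A (mx A)"
proof -
  note A = lclD[OF assms]
  have "a \<in> mx A \<or> b \<in> mx A" if ab: "a \<in> A" "b \<in> A" "a \<otimes> b \<in> mx A" for a b
    using unit_cancel[OF A(1) idlD(1)[OF A(2)] ab(1) _ subringD(4)[OF A(1) ab(2)] ab(3)] by blast
  then show ?thesis unfolding prm_def using A(2) one_notin_mx[OF A(1)] by simp
qed

lemma prm_sub_mx: "lcl A \<Longrightarrow> prm A p \<Longrightarrow> p \<subseteq> mx A"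
  using prop_idl_mx[OF lclD(1) prmD(1)] prmD(4) by blast

lemma one_minus_mx: assumes "lcl A" "x \<in> mx A" shows "\<one> \<ominus> x \<in> A" "\<one> \<ominus> x \<notin> mx A"
proof -
  note A = lclD[OF assms(1)]
  have x: "x \<in> A" "x \<in> carrier K" using idlD(4,5)[OF A(2) assms(2)] by auto
  show "\<one> \<ominus> x \<in> A" using subringD(8)[OF A(1) subringD(3)[OF A(1)] x(1)] .
  show "\<one> \<ominus> x \<notin> mx A"
  proof
    assume h: "\<one> \<ominus> x \<in> mx A"
    have "\<one> = (\<one> \<ominus> x) \<oplus> x" using x(2) by algebra
    then have "\<one> \<in> mx A" using idlD(6)[OF A(2) h assms(2)] by simp
    then show False using one_notin_mx[OF A(1)] by simp
  qed
qed

lemma mx_maximal: assumes "lcl A" "idl A J" "mx A \<subseteq> J" shows "J = mx A \<or> J = A"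
  using prop_idl_mx[OF lclD(1)[OF assms(1)] assms(2)] idl_one[OF lclD(1)[OF assms(1)] assms(2)] assms(3) by blast

section \<open>Krull's intersection theorem\<close>

lemma add_gen_congr: assumes "subring A K" "smod A I" "z \<in> carrier K" "x \<in> carrier K"
  shows "z \<in> add_gen A x I \<longleftrightarrow> (\<exists>c\<in>A. z \<ominus> c \<otimes> x \<in> I)"
proof
  assume "z \<in> add_gen A x I"
  then obtain c y where c: "c \<in> A" "y \<in> I" "z = c \<otimes> x \<oplus> y" unfolding add_gen_def by blast
  have "z \<ominus> c \<otimes> x = y" unfolding c(3) using subringD(4)[OF assms(1) c(1)] smodD(3)[OF assms(2) c(2)] assms(4) by algebra
  then show "\<exists>c\<in>A. z \<ominus> c \<otimes> x \<in> I" using c(1,2) by metis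
next
  assume "\<exists>c\<in>A. z \<ominus> c \<otimes> x \<in> I"
  then obtain c where c: "c \<in> A" "z \<ominus> c \<otimes> x \<in> I" by blast
  have "z = c \<otimes> x \<oplus> (z \<ominus> c \<otimes> x)" using subringD(4)[OF assms(1) c(1)] assms(3,4) by algebra
  then show "z \<in> add_gen A x I" unfolding add_gen_def using c by blast
qed

text \<open>
  Write \<open>z \<equiv> c\<^sub>n x\<^sup>n\<close> modulo \<open>I\<close>. Past the point \<open>N\<close> where the ideals \<open>(I : x\<^sup>n)\<close> are constant, equal to
  \<open>L\<close> say, \<open>c\<^sub>n \<equiv> x c\<^sub>n\<^sub>+\<^sub>1\<close> modulo \<open>L\<close>. So the ideals \<open>L + (c\<^sub>n)\<close> increase, and when they become
  stationary \<open>c\<^sub>k\<close> is a multiple of \<open>x c\<^sub>k\<close> modulo \<open>L\<close>, whence \<open>c\<^sub>k \<in> L\<close>.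
\<close>

lemma krull_intersection:
  assumes l: "lcl A" and n: "noeth A" and I: "idl A I" and x: "x \<in> mx A" and z: "z \<in> A"
    and h: "\<And>n::nat. z \<in> add_gen A (x [^] n) I"
  shows "z \<in> I"
proof -
  note A = lclD(1)[OF l]
  note ac = subringD(4)[OF A]
  have xA: "x \<in> A" using x unfolding mx_def by simp
  have pA: "x [^] k \<in> A" for k::nat using subringD(9)[OF A xA] .
  have "\<forall>n::nat. \<exists>c\<in>A. z \<ominus> c \<otimes> x [^] n \<in> I"
  proof
    fix n :: nat
    show "\<exists>c\<in>A. z \<ominus> c \<otimes> x [^] n \<in> I" using iffD1[OF add_gen_congr[OF A idlD(1)[OF I] ac[OF z] ac[OF pA]] h] .
  qed
  then obtain c where c: "\<And>n::nat. c n \<in> A" "\<And>n. z \<ominus> c n \<otimes> x [^] n \<in> I" by metis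
  obtain N :: nat where "\<forall>m\<ge>N. colon A I (x [^] m) = colon A I (x [^] N)"
    using noeth_acc[OF A n, where f = "\<lambda>i. colon A I (x [^] i)", OF colon_idl[OF A idlD(1)[OF I] ac[OF pA]] colon_pow_mono[OF A I xA]] by blast
  then have N: "colon A I (x [^] m) = colon A I (x [^] N)" if "m \<ge> N" for m :: nat using that by blast
  define L where "L = colon A I (x [^] N)"
  have L: "idl A L" unfolding L_def using colon_idl[OF A idlD(1)[OF I] ac[OF pA]] .
  have cL: "c n \<ominus> c (Suc n) \<otimes> x \<in> L" if "N \<le> n" for n
  proof -
    have "(z \<ominus> c (Suc n) \<otimes> x [^] Suc n) \<ominus> (z \<ominus> c n \<otimes> x [^] n) \<in> I"
      using smod_minus[OF A idlD(1)[OF I] c(2) c(2)] .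
    moreover have "(z \<ominus> c (Suc n) \<otimes> x [^] Suc n) \<ominus> (z \<ominus> c n \<otimes> x [^] n) = (c n \<ominus> c (Suc n) \<otimes> x) \<otimes> x [^] n"
      unfolding nat_pow_Suc using ac[OF z] ac[OF c(1)[of n]] ac[OF c(1)[of "Suc n"]] ac[OF xA] ac[OF pA[of n]] by algebra
    ultimately have "c n \<ominus> c (Suc n) \<otimes> x \<in> colon A I (x [^] n)"
      unfolding colon_def using subringD(8)[OF A c(1) subringD(6)[OF A c(1) xA]] by simp
    then show ?thesis unfolding N[OF that] L_def .
  qed
  have cm: "c n \<in> add_gen A (c (Suc n)) L" if "N \<le> n" for n
  proof -
    have "c n \<ominus> x \<otimes> c (Suc n) \<in> L" using cL[OF that] m_comm[OF ac[OF xA] ac[OF c(1)[of "Suc n"]]] by simp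
    then show ?thesis using add_gen_congr[OF A idlD(1)[OF L] ac[OF c(1)[of n]] ac[OF c(1)[of "Suc n"]]] xA by blast
  qed
  have mono2: "add_gen A (c (N + k)) L \<subseteq> add_gen A (c (N + Suc k)) L" for k
    using add_gen_least[OF add_gen_smod[OF A ac[OF c(1)] idlD(1)[OF L]]] cm[of "N + k"] add_gen_sup(1)[OF A ac[OF c(1)] idlD(1)[OF L]] by simp
  obtain M where "\<forall>m\<ge>M. add_gen A (c (N + m)) L = add_gen A (c (N + M)) L"
    using noeth_acc[OF A n, where f = "\<lambda>k. add_gen A (c (N + k)) L", OF add_gen_idl[OF A c(1) L] mono2] by blast
  then have M: "add_gen A (c (N + m)) L = add_gen A (c (N + M)) L" if "m \<ge> M" for m using that by blast
  define k where "k = N + M"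
  have "c (Suc k) \<in> add_gen A (c k) L"
    using add_gen_sup(2)[OF A ac[OF c(1)[of "Suc k"]] idlD(1)[OF L]] M[of "Suc M"] unfolding k_def by simp
  then obtain a where a: "a \<in> A" "c (Suc k) \<ominus> a \<otimes> c k \<in> L"
    using add_gen_congr[OF A idlD(1)[OF L] ac[OF c(1)[of "Suc k"]] ac[OF c(1)[of k]]] by blast
  have kN: "N \<le> k" unfolding k_def by simp
  have "(c k \<ominus> c (Suc k) \<otimes> x) \<oplus> x \<otimes> (c (Suc k) \<ominus> a \<otimes> c k) \<in> L"
    using idlD(6)[OF L cL[OF kN] idlD(7)[OF L xA a(2)]] .
  moreover have "(c k \<ominus> c (Suc k) \<otimes> x) \<oplus> x \<otimes> (c (Suc k) \<ominus> a \<otimes> c k) = (\<one> \<ominus> a \<otimes> x) \<otimes> c k"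
    using ac[OF a(1)] ac[OF xA] ac[OF c(1)[of k]] ac[OF c(1)[of "Suc k"]] by algebra
  ultimately have e: "(\<one> \<ominus> a \<otimes> x) \<otimes> c k \<in> L" by simp
  have "a \<otimes> x \<in> mx A" using idlD(7)[OF lclD(2)[OF l] a(1) x] .
  from unit_cancel[OF A idlD(1)[OF L] one_minus_mx[OF l this] ac[OF c(1)] e] have "c k \<in> L" .
  then have "c k \<otimes> x [^] k \<in> I" using N[OF kN] unfolding L_def colon_def by blast
  from idlD(6)[OF I c(2)[of k] this] have "(z \<ominus> c k \<otimes> x [^] k) \<oplus> c k \<otimes> x [^] k \<in> I" .
  moreover have "(z \<ominus> c k \<otimes> x [^] k) \<oplus> c k \<otimes> x [^] k = z" using ac[OF z] ac[OF c(1)[of k]] ac[OF pA[of k]] by algebra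
  ultimately show ?thesis by simp
qed

section \<open>Localization\<close>

text \<open>
  The localization of a submodule \<open>I\<close> at \<open>p\<close> inside \<open>K\<close>. Asking for a denominator \<open>s\<close> with
  \<open>zs \<in> I\<close> instead of for a fraction keeps field inverses out of the proofs.
\<close>

definition locI :: "'a set \<Rightarrow> 'a set \<Rightarrow> 'a set \<Rightarrow> 'a set" where
  "locI A p I = {z \<in> carrier K. \<exists>s\<in>A. s \<notin> p \<and> z \<otimes> s \<in> I}"

lemma localization_eq: assumes "subring A K" "prm A p" shows "localization K A p = locI A p A"
proof
  note ac = subringD(4)[OF assms(1)]
  show "localization K A p \<subseteq> locI A p A"
  proof
    fix z assume "z \<in> localization K A p"
    then obtain a b where ab: "a \<in> A" "b \<in> A" "b \<notin> p" "z = a \<otimes> inv b" unfolding localization_def by blast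
    have b0: "b \<noteq> \<zero>" using ab(3) prmD(5)[OF assms(2)] by blast
    then have i: "inv b \<in> carrier K" "inv b \<otimes> b = \<one>" using ac[OF ab(2)] field_Units by auto
    have "z \<otimes> b = a" unfolding ab(4) using ac[OF ab(1)] ac[OF ab(2)] i by (simp add: m_assoc)
    then show "z \<in> locI A p A" unfolding locI_def ab(4) using ab ac[OF ab(1)] i(1) by auto
  qed
  show "locI A p A \<subseteq> localization K A p"
  proof
    fix z assume "z \<in> locI A p A"
    then obtain s where s: "z \<in> carrier K" "s \<in> A" "s \<notin> p" "z \<otimes> s \<in> A" unfolding locI_def by blast
    have b0: "s \<noteq> \<zero>" using s(3) prmD(5)[OF assms(2)] by blast
    then have i: "inv s \<in> carrier K" "s \<otimes> inv s = \<one>" using ac[OF s(2)] field_Units by auto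
    have "z = (z \<otimes> s) \<otimes> inv s" using s(1) ac[OF s(2)] i by (simp add: m_assoc)
    then show "z \<in> localization K A p" unfolding localization_def using s by blast
  qed
qed

lemma eq_cancelK: assumes "a \<in> carrier K" "b \<in> carrier K" "c \<in> carrier K" "a \<noteq> \<zero>" "a \<otimes> b = a \<otimes> c" shows "b = c"
  using assms m_lcancel by blast

lemma invK: assumes "a \<in> carrier K" "a \<noteq> \<zero>" shows "inv a \<in> carrier K" "a \<otimes> inv a = \<one>" "inv a \<otimes> a = \<one>" "inv a \<noteq> \<zero>"
proof -
  show i: "inv a \<in> carrier K" "a \<otimes> inv a = \<one>" "inv a \<otimes> a = \<one>" using assms field_Units by auto
  show "inv a \<noteq> \<zero>" using i(2) assms by auto
qed

lemma inv_quotient: assumes a: "a \<in> carrier K" "a \<noteq> \<zero>" and b: "b \<in> carrier K" "b \<noteq> \<zero>"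
  shows "inv (a \<otimes> inv b) = b \<otimes> inv a"
proof (rule comm_inv_char)
  note ia = invK[OF a] and ib = invK[OF b]
  have "a \<otimes> inv b \<otimes> (b \<otimes> inv a) = (a \<otimes> inv a) \<otimes> (b \<otimes> inv b)" using a(1) b(1) ia(1) ib(1) by algebra
  then show "a \<otimes> inv b \<otimes> (b \<otimes> inv a) = \<one>" using ia(2) ib(2) by simp
  show "a \<otimes> inv b \<in> carrier K" "b \<otimes> inv a \<in> carrier K" using a(1) b(1) ia(1) ib(1) by auto
qed

lemma unit_inv: assumes "subring A K" "a \<in> A" "a \<notin> mx A" shows "inv a \<in> A" "a \<otimes> inv a = \<one>" "a \<noteq> \<zero>"
proof -
  obtain b where b: "b \<in> A" "a \<otimes> b = \<one>" using notin_mx[OF assms(2,3)] .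
  have K: "a \<in> carrier K" "b \<in> carrier K" using subringD(4)[OF assms(1)] assms(2) b(1) by auto
  have "inv a = b" using comm_inv_char[OF K b(2)] .
  then show "inv a \<in> A" "a \<otimes> inv a = \<one>" using b by auto
  show "a \<noteq> \<zero>" using b(2) K(2) by auto
qed

lemma prm_zero: assumes "subring A K" shows "prm A {\<zero>}"
  unfolding prm_def
proof (intro conjI ballI impI)
  show "idl A {\<zero>}" using idl_zero[OF assms] .
  show "\<one> \<notin> {\<zero>}" using one_not_zero by blast
  show "a \<in> {\<zero>} \<or> b \<in> {\<zero>}" if "a \<in> A" "b \<in> A" "a \<otimes> b \<in> {\<zero>}" for a b using integral[of a b] that subringD(4)[OF assms] by blast
qed

lemma prm_contract: assumes B: "subring B K" "B \<subseteq> A" and p: "prm A p" shows "prm B (p \<inter> B)"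
  unfolding prm_def
proof (intro conjI ballI impI)
  show "idl B (p \<inter> B)" unfolding idl_def using smod_Int[OF smod_mono[OF prmD(2)[OF p] B(2)] smod_self[OF B(1)]] by blast
  show "\<one> \<notin> p \<inter> B" using prmD(4)[OF p] by blast
  show "a \<in> p \<inter> B \<or> b \<in> p \<inter> B" if "a \<in> B" "b \<in> B" "a \<otimes> b \<in> p \<inter> B" for a b
    using prmD(6)[OF p, of a b] that B(2) by blast
qed

context
  fixes A p assumes A: "subring A K" and p: "prm A p"
begin

lemma loc_den_mult: "s \<in> A \<Longrightarrow> s \<notin> p \<Longrightarrow> t \<in> A \<Longrightarrow> t \<notin> p \<Longrightarrow> s \<otimes> t \<in> A \<and> s \<otimes> t \<notin> p"
  using prmD(6)[OF p] subringD(6)[OF A] by blast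

lemma loc_den_nz: "s \<notin> p \<Longrightarrow> s \<noteq> \<zero>" using prmD(5)[OF p] by blast

lemma locI_smod: assumes I: "smod A I" shows "smod (locI A p A) (locI A p I)"
  unfolding smod_def
proof (intro conjI ballI)
  note ac = subringD(4)[OF A]
  show "locI A p I \<subseteq> carrier K" unfolding locI_def by blast
  show "\<zero> \<in> locI A p I" unfolding locI_def using subringD(3)[OF A] prmD(4)[OF p] smodD(2)[OF I] by force
  show "x \<oplus> y \<in> locI A p I" if xy: "x \<in> locI A p I" "y \<in> locI A p I" for x y
  proof -
    obtain s t where s: "x \<in> carrier K" "s \<in> A" "s \<notin> p" "x \<otimes> s \<in> I" and t: "y \<in> carrier K" "t \<in> A" "t \<notin> p" "y \<otimes> t \<in> I"
      using xy unfolding locI_def by blast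
    have "(x \<oplus> y) \<otimes> (s \<otimes> t) = t \<otimes> (x \<otimes> s) \<oplus> s \<otimes> (y \<otimes> t)" using s(1) t(1) ac[OF s(2)] ac[OF t(2)] by algebra
    then have "(x \<oplus> y) \<otimes> (s \<otimes> t) \<in> I" using smodD(4)[OF I smodD(5)[OF I t(2) s(4)] smodD(5)[OF I s(2) t(4)]] by simp
    then show ?thesis unfolding locI_def using s t loc_den_mult[OF s(2,3) t(2,3)] by auto
  qed
  show "x \<otimes> y \<in> locI A p I" if xy: "x \<in> locI A p A" "y \<in> locI A p I" for x y
  proof -
    obtain s t where s: "x \<in> carrier K" "s \<in> A" "s \<notin> p" "x \<otimes> s \<in> A" and t: "y \<in> carrier K" "t \<in> A" "t \<notin> p" "y \<otimes> t \<in> I"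
      using xy unfolding locI_def by blast
    have "(x \<otimes> y) \<otimes> (s \<otimes> t) = (x \<otimes> s) \<otimes> (y \<otimes> t)" using s(1) t(1) ac[OF s(2)] ac[OF t(2)] by algebra
    then have "(x \<otimes> y) \<otimes> (s \<otimes> t) \<in> I" using smodD(5)[OF I s(4) t(4)] by simp
    then show ?thesis unfolding locI_def using s t loc_den_mult[OF s(2,3) t(2,3)] by auto
  qed
qed

lemma locI_sup: assumes I: "smod A I" shows "I \<subseteq> locI A p I"
proof
  fix x assume x: "x \<in> I"
  have "x \<otimes> \<one> \<in> I" using x smodD(3)[OF I x] by simp
  then show "x \<in> locI A p I" unfolding locI_def using subringD(3)[OF A] prmD(4)[OF p] smodD(3)[OF I x] by blast
qed

lemma locI_mono: "I \<subseteq> J \<Longrightarrow> locI A p I \<subseteq> locI A p J" unfolding locI_def by blast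

lemma loc_subring: "subring (locI A p A) K"
proof -
  note S = smodD[OF locI_smod[OF smod_self[OF A]]]
  have sub: "A \<subseteq> locI A p A" using locI_sup[OF smod_self[OF A]] .
  show ?thesis
  proof (rule subringI)
    show "locI A p A \<subseteq> carrier K" by (rule S)
    show "\<one> \<in> locI A p A" using sub subringD(3)[OF A] by blast
    show "h1 \<otimes> h2 \<in> locI A p A" if "h1 \<in> locI A p A" "h2 \<in> locI A p A" for h1 h2 using S(5)[OF that] .
    show "h1 \<oplus> h2 \<in> locI A p A" if "h1 \<in> locI A p A" "h2 \<in> locI A p A" for h1 h2 using S(4)[OF that] .
    show "\<ominus> h \<in> locI A p A" if h: "h \<in> locI A p A" for h
    proof -
      have "\<ominus> \<one> \<in> locI A p A" using sub subringD(3,5)[OF A] by blast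
      moreover have "\<ominus> h = (\<ominus> \<one>) \<otimes> h" using S(3)[OF h] by (simp add: l_minus)
      ultimately show ?thesis using S(5)[OF _ h] by simp
    qed
  qed
qed

lemma loc_sup: "A \<subseteq> locI A p A" using locI_sup[OF smod_self[OF A]] .

lemma locI_idl: "idl A I \<Longrightarrow> idl (locI A p A) (locI A p I)"
  unfolding idl_def using locI_smod locI_mono by blast

lemma loc_inv: assumes "s \<in> A" "s \<notin> p" shows "inv s \<in> locI A p A"
proof -
  have s: "s \<in> carrier K" "s \<noteq> \<zero>" using subringD(4)[OF A assms(1)] loc_den_nz[OF assms(2)] by auto
  have "inv s \<otimes> s \<in> A" using invK[OF s] subringD(3)[OF A] by simp
  then show ?thesis unfolding locI_def using assms invK[OF s] by blast
qed

lemma loc_den_cancel: assumes "smod (locI A p A) M" "s \<in> A" "s \<notin> p" "z \<in> carrier K" "z \<otimes> s \<in> M" shows "z \<in> M"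
proof -
  have s: "s \<in> carrier K" "s \<noteq> \<zero>" using subringD(4)[OF A assms(2)] loc_den_nz[OF assms(3)] by auto
  have "inv s \<otimes> (z \<otimes> s) = z \<otimes> (s \<otimes> inv s)" using s(1) invK(1)[OF s] assms(4) by algebra
  then have "inv s \<otimes> (z \<otimes> s) = z" using invK[OF s] assms(4) by simp
  then show ?thesis using smodD(5)[OF assms(1) loc_inv[OF assms(2,3)] assms(5)] by simp
qed

lemma locI_least: assumes "smod (locI A p A) M" "I \<subseteq> M" shows "locI A p I \<subseteq> M"
proof
  fix z assume "z \<in> locI A p I"
  then obtain s where "z \<in> carrier K" "s \<in> A" "s \<notin> p" "z \<otimes> s \<in> I" unfolding locI_def by blast
  then show "z \<in> M" using loc_den_cancel[OF assms(1), of s z] assms(2) by blast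
qed

lemma locI_contract: assumes q: "prm A q" "q \<subseteq> p" shows "locI A p q \<inter> A = q"
proof
  show "q \<subseteq> locI A p q \<inter> A" using locI_sup[OF prmD(2)[OF q(1)]] prmD(3)[OF q(1)] by blast
  show "locI A p q \<inter> A \<subseteq> q"
  proof
    fix z assume "z \<in> locI A p q \<inter> A"
    then obtain s where "s \<in> A" "s \<notin> p" "z \<otimes> s \<in> q" "z \<in> A" unfolding locI_def by blast
    then show "z \<in> q" using prmD(6)[OF q(1), of z s] q(2) by blast
  qed
qed

lemma loc_expand: assumes "idl (locI A p A) Q" shows "idl A (Q \<inter> A)" "Q = locI A p (Q \<inter> A)"
proof -
  have Q: "smod A Q" using smod_mono[OF idlD(1)[OF assms] loc_sup] .
  show i: "idl A (Q \<inter> A)" unfolding idl_def using smod_Int[OF Q smod_self[OF A]] by blast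
  show "Q = locI A p (Q \<inter> A)"
  proof
    show "locI A p (Q \<inter> A) \<subseteq> Q" using locI_least[OF idlD(1)[OF assms]] by blast
    show "Q \<subseteq> locI A p (Q \<inter> A)"
    proof
      fix z assume z: "z \<in> Q"
      then have "z \<in> locI A p A" using idlD(2)[OF assms] by blast
      then obtain s where s: "z \<in> carrier K" "s \<in> A" "s \<notin> p" "z \<otimes> s \<in> A" unfolding locI_def by blast
      have "z \<otimes> s = s \<otimes> z" using m_comm[OF s(1) subringD(4)[OF A s(2)]] .
      then have "z \<otimes> s \<in> Q" using smodD(5)[OF Q s(2) z] by simp
      then show "z \<in> locI A p (Q \<inter> A)" unfolding locI_def using s by blast
    qed
  qed
qed

lemma loc_prm: assumes q: "prm A q" "q \<subseteq> p" shows "prm (locI A p A) (locI A p q)"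
  unfolding prm_def
proof (intro conjI ballI impI)
  show "idl (locI A p A) (locI A p q)" using locI_idl[OF prmD(1)[OF q(1)]] .
  show "\<one> \<notin> locI A p q" using locI_contract[OF q] prmD(4)[OF q(1)] subringD(3)[OF A] by blast
  fix a b assume ab: "a \<in> locI A p A" "b \<in> locI A p A" "a \<otimes> b \<in> locI A p q"
  obtain s t r where s: "a \<in> carrier K" "s \<in> A" "s \<notin> p" "a \<otimes> s \<in> A" and t: "b \<in> carrier K" "t \<in> A" "t \<notin> p" "b \<otimes> t \<in> A"
    and r: "r \<in> A" "r \<notin> p" "(a \<otimes> b) \<otimes> r \<in> q" using ab unfolding locI_def by blast
  note c = subringD(4)[OF A s(2)] subringD(4)[OF A t(2)] subringD(4)[OF A r(1)]
  have "((a \<otimes> s) \<otimes> (b \<otimes> t)) \<otimes> r = (s \<otimes> t) \<otimes> ((a \<otimes> b) \<otimes> r)" using s(1) t(1) c by algebra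
  also have "\<dots> \<in> q" using smodD(5)[OF prmD(2)[OF q(1)] _ r(3)] subringD(6)[OF A s(2) t(2)] by blast
  finally have "(a \<otimes> s) \<otimes> (b \<otimes> t) \<in> q \<or> r \<in> q"
    by (rule prmD(6)[OF q(1) subringD(6)[OF A s(4) t(4)] r(1)])
  then have "a \<otimes> s \<in> q \<or> b \<otimes> t \<in> q" using prmD(6)[OF q(1) s(4) t(4)] r(2) q(2) by blast
  then show "a \<in> locI A p q \<or> b \<in> locI A p q" unfolding locI_def using s t by blast
qed

lemma loc_prm_contract: assumes Q: "prm (locI A p A) Q" shows "prm A (Q \<inter> A)" "Q \<inter> A \<subseteq> p"
proof -
  show "prm A (Q \<inter> A)" by (rule prm_contract[OF A loc_sup Q])
  show "Q \<inter> A \<subseteq> p"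
  proof
    fix z assume z: "z \<in> Q \<inter> A"
    show "z \<in> p"
    proof (rule ccontr)
      assume zp: "z \<notin> p"
      have zK: "z \<in> carrier K" using z subringD(4)[OF A] by blast
      have "\<one> \<otimes> z \<in> Q" using z zK by simp
      then have "\<one> \<in> Q" using loc_den_cancel[OF prmD(2)[OF Q], of z \<one>] z zp by blast
      then show False using prmD(4)[OF Q] by blast
    qed
  qed
qed

lemma mx_loc: "mx (locI A p A) = locI A p p"
proof
  show "locI A p p \<subseteq> mx (locI A p A)"
    using prop_idl_mx[OF loc_subring locI_idl[OF prmD(1)[OF p]]] prmD(4)[OF loc_prm[OF p]] by blast
  show "mx (locI A p A) \<subseteq> locI A p p"
  proof
    fix z assume z: "z \<in> mx (locI A p A)"
    then have "z \<in> locI A p A" unfolding mx_def by blast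
    then obtain s where s: "z \<in> carrier K" "s \<in> A" "s \<notin> p" "z \<otimes> s \<in> A" unfolding locI_def by blast
    have "z \<otimes> s \<in> p"
    proof (rule ccontr)
      assume n: "z \<otimes> s \<notin> p"
      have zs: "z \<otimes> s \<in> carrier K" "z \<otimes> s \<noteq> \<zero>" using subringD(4)[OF A s(4)] loc_den_nz[OF n] by auto
      have "s \<otimes> inv (z \<otimes> s) \<in> locI A p A" using subringD(6)[OF loc_subring _ loc_inv[OF s(4) n]] loc_sup s(2) by blast
      moreover have "z \<otimes> (s \<otimes> inv (z \<otimes> s)) = (z \<otimes> s) \<otimes> inv (z \<otimes> s)" using s(1) subringD(4)[OF A s(2)] invK(1)[OF zs] by (simp add: m_assoc)
      ultimately show False using z invK(2)[OF zs] unfolding mx_def by auto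
    qed
    then show "z \<in> locI A p p" unfolding locI_def using s by blast
  qed
qed

lemma loc_lcl: "lcl (locI A p A)"
  unfolding lcl_def mx_loc using loc_subring locI_idl[OF prmD(1)[OF p]] by blast

lemma locI_add_gens: assumes xs: "set xs \<subseteq> carrier K" and I: "smod A I"
  shows "locI A p (add_gens A xs I) = add_gens (locI A p A) xs (locI A p I)"
proof
  have S: "smod (locI A p A) (add_gens (locI A p A) xs (locI A p I))"
    using add_gens_smod[OF loc_subring xs locI_smod[OF I]] .
  note sup = add_gens_sup[OF loc_subring xs locI_smod[OF I]]
  have "add_gens A xs I \<subseteq> add_gens (locI A p A) xs (locI A p I)"
    by (rule add_gens_least[OF smod_mono[OF S loc_sup] sup(2)]) (use sup(1) locI_sup[OF I] in blast)
  then show "locI A p (add_gens A xs I) \<subseteq> add_gens (locI A p A) xs (locI A p I)" using locI_least[OF S] by blast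
  have T: "smod A (add_gens A xs I)" using add_gens_smod[OF A xs I] .
  show "add_gens (locI A p A) xs (locI A p I) \<subseteq> locI A p (add_gens A xs I)"
  proof (rule add_gens_least[OF locI_smod[OF T]])
    show "set xs \<subseteq> locI A p (add_gens A xs I)" using add_gens_sup(2)[OF A xs I] locI_sup[OF T] by blast
    show "locI A p I \<subseteq> locI A p (add_gens A xs I)" using locI_mono[OF add_gens_sup(1)[OF A xs I]] .
  qed
qed

lemma locI_zero: "locI A p {\<zero>} = {\<zero>}"
proof
  show "{\<zero>} \<subseteq> locI A p {\<zero>}" using locI_sup[OF smod_zero[OF A]] .
  show "locI A p {\<zero>} \<subseteq> {\<zero>}"
  proof
    fix z assume "z \<in> locI A p {\<zero>}"
    then obtain s where s: "z \<in> carrier K" "s \<in> A" "s \<notin> p" "z \<otimes> s = \<zero>" unfolding locI_def by blast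
    then show "z \<in> {\<zero>}" using integral[OF s(4) s(1) subringD(4)[OF A s(2)]] loc_den_nz[OF s(3)] by blast
  qed
qed

lemma noeth_loc: assumes n: "noeth A" shows "noeth (locI A p A)"
  unfolding noeth_def
proof (intro allI impI)
  fix I assume I: "idl (locI A p A) I"
  obtain xs where xs: "set xs \<subseteq> A" "I \<inter> A = add_gens A xs {\<zero>}"
    using n loc_expand(1)[OF I] unfolding noeth_def by blast
  have "I = add_gens (locI A p A) xs {\<zero>}"
    using loc_expand(2)[OF I] locI_add_gens[OF _ smod_zero[OF A], of xs] locI_zero xs subringD(1)[OF A] by auto
  then show "\<exists>xs. set xs \<subseteq> locI A p A \<and> I = add_gens (locI A p A) xs {\<zero>}" using xs(1) loc_sup by blast
qed

end

section \<open>Krull's principal ideal theorem\<close>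

definition smul :: "'a \<Rightarrow> 'a set \<Rightarrow> 'a set" where
  "smul u M = {u \<otimes> z | z. z \<in> M}"

lemma smul_smod: assumes "subring A K" "smod A M" "u \<in> carrier K" shows "smod A (smul u M)"
  unfolding smod_def smul_def
proof (intro conjI ballI)
  note M = smodD[OF assms(2)]
  show "{u \<otimes> z | z. z \<in> M} \<subseteq> carrier K" using M(3) assms(3) by auto
  show "\<zero> \<in> {u \<otimes> z | z. z \<in> M}" using M(2) r_null[OF assms(3)] by force
  fix x y assume "x \<in> {u \<otimes> z | z. z \<in> M}" "y \<in> {u \<otimes> z | z. z \<in> M}"
  then obtain a b where *: "a \<in> M" "b \<in> M" "x = u \<otimes> a" "y = u \<otimes> b" by blast
  have "x \<oplus> y = u \<otimes> (a \<oplus> b)" unfolding * using r_distr M(3)[OF *(1)] M(3)[OF *(2)] assms(3) by simp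
  then show "x \<oplus> y \<in> {u \<otimes> z | z. z \<in> M}" using M(4)[OF *(1,2)] by blast
next
  note M = smodD[OF assms(2)]
  fix r x assume r: "r \<in> A" "x \<in> {u \<otimes> z | z. z \<in> M}"
  then obtain a where *: "a \<in> M" "x = u \<otimes> a" by blast
  have "r \<otimes> x = u \<otimes> (r \<otimes> a)" unfolding * using m_lcomm subringD(4)[OF assms(1) r(1)] M(3)[OF *(1)] assms(3) by simp
  then show "r \<otimes> x \<in> {u \<otimes> z | z. z \<in> M}" using M(5)[OF r(1) *(1)] by blast
qed

text \<open>
  Krull's principal ideal theorem modulo a prime \<open>p\<^sub>0\<close>, by Kaplansky's length argument. Suppose only the maximal
  ideal contains both \<open>p\<^sub>0\<close> and \<open>x\<close>, choose \<open>y \<in> p\<^sub>1 - p\<^sub>0\<close> and a power \<open>u\<close> of \<open>x\<close> for which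
  \<open>tu\<^sup>2 \<in> (y)\<close> implies \<open>tu \<in> (y)\<close>. All ideals being taken modulo \<open>p\<^sub>0\<close>, there are isomorphisms
  \<open>(u, y)/(u) \<cong> (u\<^sup>2, uy)/(u\<^sup>2)\<close> and \<open>(u\<^sup>2, y)/(u\<^sup>2, uy) \<cong> C/(u) \<cong> (u)/(u\<^sup>2)\<close>, so that
  \<open>(u\<^sup>2, y)/(u\<^sup>2)\<close> and \<open>(u, y)/(u\<^sup>2)\<close> have the same finite length. Hence \<open>u \<in> (u\<^sup>2, y)\<close>, so
  \<open>u \<in> p\<^sub>1\<close> and \<open>x \<in> p\<^sub>1\<close>, although \<open>p\<^sub>1\<close> is not the maximal ideal.
\<close>

lemma pit_local:
  assumes l: "lcl C" and n: "noeth C" and p0: "prm C p0" and p1: "prm C p1" and c: "p0 \<subset> p1" "p1 \<noteq> mx C" and x: "x \<in> mx C"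
  shows "\<exists>q. prm C q \<and> p0 \<subseteq> q \<and> x \<in> q \<and> q \<noteq> mx C"
proof (rule ccontr)
  assume "\<not> ?thesis"
  then have no: "q = mx C" if "prm C q" "p0 \<subseteq> q" "x \<in> q" for q using that by blast
  note C = lclD(1)[OF l]
  note ac = subringD(4)[OF C]
  note s0 = prmD(2)[OF p0]
  have xC: "x \<in> C" using x unfolding mx_def by simp
  have xp1: "x \<notin> p1" using no[OF p1] c by blast
  obtain y where y: "y \<in> p1" "y \<notin> p0" using c by blast
  have yC: "y \<in> C" using y prmD(3)[OF p1] by blast
  note yK = ac[OF yC]
  have pC: "x [^] k \<in> C" for k :: nat using subringD(9)[OF C xC] .
  define Y0 where "Y0 = add_gen C y p0"
  have Y0: "idl C Y0" unfolding Y0_def using add_gen_idl[OF C yC prmD(1)[OF p0]] .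
  obtain N :: nat where "\<forall>m\<ge>N. colon C Y0 (x [^] m) = colon C Y0 (x [^] N)"
    using noeth_acc[OF C n, where f = "\<lambda>i. colon C Y0 (x [^] i)", OF colon_idl[OF C idlD(1)[OF Y0] ac[OF pC]] colon_pow_mono[OF C Y0 xC]] by blast
  then have N: "colon C Y0 (x [^] m) = colon C Y0 (x [^] N)" if "m \<ge> N" for m :: nat using that by blast
  \<comment> \<open>\<open>Suc N\<close> rather than \<open>N\<close>, so that \<open>u\<close> is a nonunit\<close>
  define u where "u = x [^] Suc N"
  have uC: "u \<in> C" unfolding u_def using pC .
  note uK = ac[OF uC]
  define v where "v = u \<otimes> u"
  have vC: "v \<in> C" unfolding v_def using subringD(6)[OF C uC uC] .
  note vK = ac[OF vC]
  have vx: "v = x [^] (Suc N + Suc N)" unfolding v_def u_def by (rule nat_pow_mult[OF ac[OF xC]])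
  have col: "colon C Y0 v = colon C Y0 u" unfolding vx unfolding u_def using N[of "Suc N + Suc N"] N[of "Suc N"] by simp
  have up1: "u \<notin> p1" unfolding u_def using prm_pow[OF C p1 xC] xp1 by blast
  have up0: "u \<notin> p0" using up1 c by blast
  have um: "u \<in> mx C" unfolding u_def using idlD(7)[OF lclD(2)[OF l] pC[of N] x] by simp
  define V where "V = add_gen C v p0"
  define U where "U = add_gen C u p0"
  define UY where "UY = add_gen C y U"
  define VUY where "VUY = add_gen C (u \<otimes> y) V"
  define VY where "VY = add_gen C y V"
  have uyC: "u \<otimes> y \<in> C" using subringD(6)[OF C uC yC] .
  note uyK = ac[OF uyC]
  have sV: "smod C V" unfolding V_def by (rule add_gen_smod[OF C vK s0])
  have sU: "smod C U" unfolding U_def by (rule add_gen_smod[OF C uK s0])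
  have sUY: "smod C UY" unfolding UY_def by (rule add_gen_smod[OF C yK sU])
  have sVUY: "smod C VUY" unfolding VUY_def by (rule add_gen_smod[OF C uyK sV])
  have sVY: "smod C VY" unfolding VY_def by (rule add_gen_smod[OF C yK sV])
  have p0V: "p0 \<subseteq> V" and vV: "v \<in> V" unfolding V_def using add_gen_sup[OF C vK s0] by auto
  have p0U: "p0 \<subseteq> U" and uU: "u \<in> U" unfolding U_def using add_gen_sup[OF C uK s0] by auto
  have UUY: "U \<subseteq> UY" and yUY: "y \<in> UY" unfolding UY_def using add_gen_sup[OF C yK sU] by auto
  have VVUY: "V \<subseteq> VUY" and uyVUY: "u \<otimes> y \<in> VUY" unfolding VUY_def using add_gen_sup[OF C uyK sV] by auto
  have VVY: "V \<subseteq> VY" and yVY: "y \<in> VY" unfolding VY_def using add_gen_sup[OF C yK sV] by auto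
  have VU: "V \<subseteq> U" unfolding V_def using add_gen_least[OF sU _ p0U] smodD(5)[OF sU uC uU] unfolding v_def by blast
  have VUYVY: "VUY \<subseteq> VY" unfolding VUY_def using add_gen_least[OF sVY smodD(5)[OF sVY uC yVY] VVY] .
  have VYUY: "VY \<subseteq> UY" unfolding VY_def using add_gen_least[OF sUY yUY] VU UUY by blast
  have p0C: "p0 \<subseteq> C" using prmD(3)[OF p0] .
  have VC: "V \<subseteq> C" unfolding V_def using add_gen_least[OF smod_self[OF C] vC p0C] .
  have UC: "U \<subseteq> C" unfolding U_def using add_gen_least[OF smod_self[OF C] uC p0C] .
  have UYC: "UY \<subseteq> C" unfolding UY_def using add_gen_least[OF smod_self[OF C] yC UC] .
  obtain M where M: "lenle C V C M"
  proof -
    have "J = q \<or> J = C" if q: "prm C q" "V \<subseteq> q" "idl C J" "q \<subseteq> J" for q J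
    proof -
      have "x \<in> q" using prm_pow[OF C q(1) xC] vV q(2) unfolding vx by blast
      then have "q = mx C" using no[OF q(1)] p0V q(2) by blast
      then show ?thesis using mx_maximal[OF l q(3)] q(4) by blast
    qed
    moreover have "idl C V" using sV VC unfolding idl_def by blast
    ultimately show ?thesis using noeth_finite_length[OF C n, of V] that by blast
  qed
  obtain a where a: "lenle C U C a" "lenge C U C a" using len_exact[OF lenle_weaken[OF M VU subset_refl] sU UC] by blast
  obtain b where b: "lenle C U UY b" "lenge C U UY b" using len_exact[OF lenle_weaken[OF M VU UYC] sU UUY] by blast
  have le: "lenle C V UY (a + b)"
  proof (rule lenle_add[OF C _ b(1) VU UUY sU sUY])
    have "U \<subseteq> colon C V u"
    proof
      fix r assume r: "r \<in> U"
      then obtain d w where d: "d \<in> C" "w \<in> p0" "r = d \<otimes> u \<oplus> w" unfolding U_def add_gen_def by blast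
      have wK: "w \<in> carrier K" using smodD(3)[OF s0 d(2)] .
      have "r \<otimes> u = d \<otimes> v \<oplus> u \<otimes> w" unfolding d(3) v_def using ac[OF d(1)] wK uK by algebra
      moreover have "d \<otimes> v \<in> V" "u \<otimes> w \<in> V" using smodD(5)[OF sV d(1) vV] smodD(5)[OF s0 uC d(2)] p0V by auto
      ultimately show "r \<in> colon C V u" unfolding colon_def using smodD(4)[OF sV] r UC by auto
    qed
    then have "lenle C V (add_gen C u V) a" using lenle_cyclic[OF C sV uK] lenle_weaken[OF a(1)] by blast
    moreover have "U \<subseteq> add_gen C u V" unfolding U_def
      using add_gen_least[OF add_gen_smod[OF C uK sV]] add_gen_sup[OF C uK sV] p0V by blast
    ultimately show "lenle C V U a" using lenle_weaken by blast
  qed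
  have ge1: "lenge C V VUY b"
  proof (rule lenge_map[OF b(2), where \<phi> = "\<lambda>M. msum (smul u M) V"])
    show "smod C (msum (smul u M) V) \<and> V \<subseteq> msum (smul u M) V \<and> msum (smul u M) V \<subseteq> VUY"
      if m: "smod C M" "U \<subseteq> M" "M \<subseteq> UY" for M
    proof (intro conjI)
      have s: "smod C (smul u M)" using smul_smod[OF C m(1) uK] .
      show "smod C (msum (smul u M) V)" using smod_msum[OF s sV C] .
      show "V \<subseteq> msum (smul u M) V" using msum_upper(2)[OF s sV] .
      have "smul u M \<subseteq> VUY"
      proof
        fix t assume "t \<in> smul u M"
        then obtain z where z: "z \<in> UY" "t = u \<otimes> z" using m(3) unfolding smul_def by blast
        then obtain d e w where d: "d \<in> C" "e \<in> C" "w \<in> p0" "z = d \<otimes> y \<oplus> (e \<otimes> u \<oplus> w)" unfolding UY_def U_def add_gen_def by blast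
        have wK: "w \<in> carrier K" using smodD(3)[OF s0 d(3)] .
        have "t = d \<otimes> (u \<otimes> y) \<oplus> (e \<otimes> v \<oplus> u \<otimes> w)" unfolding z(2) d(4) v_def using ac[OF d(1)] ac[OF d(2)] wK uK yK by algebra
        moreover have "u \<otimes> w \<in> p0" using smodD(5)[OF s0 uC d(3)] .
        ultimately show "t \<in> VUY" unfolding VUY_def V_def add_gen_def using d(1,2) by blast
      qed
      then show "msum (smul u M) V \<subseteq> VUY" using msum_least[OF sVUY _ VVUY] by blast
    qed
    show "msum (smul u M) V \<subseteq> msum (smul u M') V" if "M \<subseteq> M'" for M M' using that unfolding msum_def smul_def by blast
    show "M = M'" if m: "smod C M" "U \<subseteq> M" "smod C M'" "M' \<subseteq> UY" "M \<subseteq> M'" "msum (smul u M) V = msum (smul u M') V" for M M'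
    proof
      show "M' \<subseteq> M"
      proof
        fix z assume z: "z \<in> M'"
        have zC: "z \<in> C" using z m(4) UYC by blast
        have "u \<otimes> z \<in> smul u M'" using z unfolding smul_def by blast
        then have "u \<otimes> z \<in> msum (smul u M) V" unfolding m(6) using msum_upper(1)[OF smul_smod[OF C m(3) uK] sV] by blast
        then obtain k e w where k: "k \<in> M" "e \<in> C" "w \<in> p0" "u \<otimes> z = u \<otimes> k \<oplus> (e \<otimes> v \<oplus> w)"
          unfolding msum_def smul_def V_def add_gen_def by blast
        have kC: "k \<in> C" using k(1) m(4,5) UYC by blast
        have euM: "e \<otimes> u \<in> M" using smodD(5)[OF m(1) k(2)] m(2) uU by blast
        have wK: "w \<in> carrier K" using smodD(3)[OF s0 k(3)] .
        have "u \<otimes> (z \<ominus> (k \<oplus> e \<otimes> u)) = u \<otimes> z \<ominus> (u \<otimes> k \<oplus> e \<otimes> v)" unfolding v_def using ac[OF zC] ac[OF kC] ac[OF k(2)] uK by algebra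
        also have "\<dots> = w" unfolding k(4) using ac[OF kC] ac[OF k(2)] uK vK wK by algebra
        finally have e1: "u \<otimes> (z \<ominus> (k \<oplus> e \<otimes> u)) \<in> p0" using k(3) by simp
        have "z \<ominus> (k \<oplus> e \<otimes> u) \<in> C" using subringD(8)[OF C zC subringD(7)[OF C kC subringD(6)[OF C k(2) uC]]] .
        then have "z \<ominus> (k \<oplus> e \<otimes> u) \<in> p0" using prmD(6)[OF p0 uC _ e1] up0 by blast
        then have "z \<ominus> (k \<oplus> e \<otimes> u) \<in> M" using p0U m(2) by blast
        then have "(z \<ominus> (k \<oplus> e \<otimes> u)) \<oplus> (k \<oplus> e \<otimes> u) \<in> M" using smodD(4)[OF m(1) _ smodD(4)[OF m(1) k(1) euM]] by blast
        moreover have "(z \<ominus> (k \<oplus> e \<otimes> u)) \<oplus> (k \<oplus> e \<otimes> u) = z" using ac[OF zC] ac[OF kC] ac[OF k(2)] uK by algebra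
        ultimately show "z \<in> M" by simp
      qed
    qed (rule m)
  qed
  have ge2: "lenge C VUY VY a"
  proof (rule lenge_map[OF a(2), where \<phi> = "\<lambda>M. msum (smul y M) VUY"])
    show "smod C (msum (smul y M) VUY) \<and> VUY \<subseteq> msum (smul y M) VUY \<and> msum (smul y M) VUY \<subseteq> VY"
      if m: "smod C M" "U \<subseteq> M" "M \<subseteq> C" for M
    proof (intro conjI)
      have s: "smod C (smul y M)" using smul_smod[OF C m(1) yK] .
      show "smod C (msum (smul y M) VUY)" using smod_msum[OF s sVUY C] .
      show "VUY \<subseteq> msum (smul y M) VUY" using msum_upper(2)[OF s sVUY] .
      have "smul y M \<subseteq> VY"
      proof
        fix t assume "t \<in> smul y M"
        then obtain z where z: "z \<in> C" "t = y \<otimes> z" using m(3) unfolding smul_def by blast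
        then have "t = z \<otimes> y" using m_comm[OF yK ac[OF z(1)]] by simp
        then show "t \<in> VY" using smodD(5)[OF sVY z(1) yVY] by simp
      qed
      then show "msum (smul y M) VUY \<subseteq> VY" using msum_least[OF sVY _ VUYVY] by blast
    qed
    show "msum (smul y M) VUY \<subseteq> msum (smul y M') VUY" if "M \<subseteq> M'" for M M' using that unfolding msum_def smul_def by blast
    show "M = M'" if m: "smod C M" "U \<subseteq> M" "smod C M'" "M' \<subseteq> C" "M \<subseteq> M'" "msum (smul y M) VUY = msum (smul y M') VUY" for M M'
    proof
      show "M' \<subseteq> M"
      proof
        fix t assume t: "t \<in> M'"
        have tC: "t \<in> C" using t m(4) by blast
        have "y \<otimes> t \<in> smul y M'" using t unfolding smul_def by blast
        then have "y \<otimes> t \<in> msum (smul y M) VUY" unfolding m(6) using msum_upper(1)[OF smul_smod[OF C m(3) yK] sVUY] by blast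
        then obtain k f e w where k: "k \<in> M" "f \<in> C" "e \<in> C" "w \<in> p0" "y \<otimes> t = y \<otimes> k \<oplus> (f \<otimes> (u \<otimes> y) \<oplus> (e \<otimes> v \<oplus> w))"
          unfolding msum_def smul_def VUY_def V_def add_gen_def by blast
        have kC: "k \<in> C" using k(1) m(4,5) by blast
        have wK: "w \<in> carrier K" using smodD(3)[OF s0 k(4)] .
        note cs = ac[OF tC] ac[OF kC] ac[OF k(2)] ac[OF k(3)] wK uK yK vK
        let ?g = "t \<ominus> (k \<oplus> f \<otimes> u)"
        have gC: "?g \<in> C" using subringD(8)[OF C tC subringD(7)[OF C kC subringD(6)[OF C k(2) uC]]] .
        have "e \<otimes> v = (y \<otimes> k \<oplus> (f \<otimes> (u \<otimes> y) \<oplus> (e \<otimes> v \<oplus> w))) \<ominus> y \<otimes> k \<ominus> f \<otimes> (u \<otimes> y) \<ominus> w"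
          using cs by algebra
        also have "\<dots> = y \<otimes> t \<ominus> y \<otimes> k \<ominus> f \<otimes> (u \<otimes> y) \<ominus> w" unfolding k(5) ..
        also have "\<dots> = ?g \<otimes> y \<oplus> \<ominus> w" using cs by algebra
        finally have ev: "e \<otimes> v = ?g \<otimes> y \<oplus> \<ominus> w" .
        have nw: "\<ominus> w \<in> p0" using smod_neg[OF C s0 k(4)] .
        have "e \<otimes> v \<in> Y0" unfolding Y0_def add_gen_def ev using gC nw by blast
        then have "e \<in> colon C Y0 u" using col k(3) unfolding colon_def by blast
        then have "e \<otimes> u \<in> Y0" unfolding colon_def by blast
        then obtain d w' where d: "d \<in> C" "w' \<in> p0" "e \<otimes> u = d \<otimes> y \<oplus> w'" unfolding Y0_def add_gen_def by blast
        have w'K: "w' \<in> carrier K" using smodD(3)[OF s0 d(2)] .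
        have "(?g \<ominus> d \<otimes> u) \<otimes> y = (?g \<otimes> y \<oplus> \<ominus> w) \<oplus> w \<ominus> u \<otimes> (d \<otimes> y \<oplus> w') \<oplus> u \<otimes> w'" using cs ac[OF d(1)] w'K by algebra
        also have "\<dots> = e \<otimes> v \<oplus> w \<ominus> u \<otimes> (e \<otimes> u) \<oplus> u \<otimes> w'" unfolding ev d(3) ..
        also have "\<dots> = w \<oplus> u \<otimes> w'" unfolding v_def using cs w'K by algebra
        finally have "(?g \<ominus> d \<otimes> u) \<otimes> y = w \<oplus> u \<otimes> w'" .
        then have "(?g \<ominus> d \<otimes> u) \<otimes> y \<in> p0" using smodD(4)[OF s0 k(4) smodD(5)[OF s0 uC d(2)]] by simp
        moreover have "?g \<ominus> d \<otimes> u \<in> C" using subringD(8)[OF C gC subringD(6)[OF C d(1) uC]] .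
        ultimately have "?g \<ominus> d \<otimes> u \<in> p0" using prmD(6)[OF p0 _ yC] y(2) by blast
        then have 1: "?g \<ominus> d \<otimes> u \<in> M" using p0U m(2) by blast
        have uM: "u \<in> M" using uU m(2) by blast
        have "(?g \<ominus> d \<otimes> u) \<oplus> (k \<oplus> f \<otimes> u \<oplus> d \<otimes> u) \<in> M"
          using smodD(4)[OF m(1) 1 smodD(4)[OF m(1) smodD(4)[OF m(1) k(1) smodD(5)[OF m(1) k(2) uM]] smodD(5)[OF m(1) d(1) uM]]] .
        moreover have "(?g \<ominus> d \<otimes> u) \<oplus> (k \<oplus> f \<otimes> u \<oplus> d \<otimes> u) = t" using cs ac[OF d(1)] by algebra
        ultimately show "t \<in> M" by simp
      qed
    qed (rule m)
  qed
  have ge: "lenge C V VY (b + a)" using lenge_add[OF ge1 ge2 VVUY VUYVY] .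
  show False
  proof (cases "VY = UY")
    case False
    have "lenge C V UY (b + a + 1)" using lenge_add[OF ge lenge_one[OF sVY sUY] VVY VYUY] False VYUY by blast
    then show False using len_le_ge[OF le] by fastforce
  next
    case True
    then have "u \<in> VY" using uU UUY by blast
    then obtain d e w where d: "d \<in> C" "e \<in> C" "w \<in> p0" "u = d \<otimes> y \<oplus> (e \<otimes> v \<oplus> w)" unfolding VY_def V_def add_gen_def by blast
    have wK: "w \<in> carrier K" using smodD(3)[OF s0 d(3)] .
    note cs = ac[OF d(1)] ac[OF d(2)] wK yK uK vK
    have "u \<otimes> (\<one> \<ominus> e \<otimes> u) = u \<ominus> e \<otimes> v" unfolding v_def using cs by algebra
    also have "\<dots> = (d \<otimes> y \<oplus> (e \<otimes> v \<oplus> w)) \<ominus> e \<otimes> v" using d(4) by simp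
    also have "\<dots> = d \<otimes> y \<oplus> w" using cs by algebra
    finally have "u \<otimes> (\<one> \<ominus> e \<otimes> u) = d \<otimes> y \<oplus> w" .
    moreover have "d \<otimes> y \<oplus> w \<in> p1" using smodD(4)[OF prmD(2)[OF p1] smodD(5)[OF prmD(2)[OF p1] d(1) y(1)]] d(3) c by blast
    ultimately have e1: "u \<otimes> (\<one> \<ominus> e \<otimes> u) \<in> p1" by simp
    have "e \<otimes> u \<in> mx C" using idlD(7)[OF lclD(2)[OF l] d(2) um] .
    note o = one_minus_mx[OF l this]
    have "\<one> \<ominus> e \<otimes> u \<in> p1" using prmD(6)[OF p1 uC o(1) e1] up1 by blast
    then show False using o(2) prm_sub_mx[OF l p1] by blast
  qed
qed

lemma pit:
  assumes A: "subring A K" and n: "noeth A" and p0: "prm A p0" and p1: "prm A p1" and p2: "prm A p2"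
    and c: "p0 \<subset> p1" "p1 \<subset> p2" and x: "x \<in> p2"
  shows "\<exists>q. prm A q \<and> p0 \<subseteq> q \<and> x \<in> q \<and> q \<subset> p2"
proof -
  let ?C = "locI A p2 A"
  have l: "lcl ?C" using loc_lcl[OF A p2] .
  have nC: "noeth ?C" using noeth_loc[OF A p2 n] .
  have q0: "prm ?C (locI A p2 p0)" using loc_prm[OF A p2 p0] c by blast
  have q1: "prm ?C (locI A p2 p1)" using loc_prm[OF A p2 p1] c by blast
  have ct: "locI A p2 p0 \<inter> A = p0" "locI A p2 p1 \<inter> A = p1" "locI A p2 p2 \<inter> A = p2"
    using locI_contract[OF A p2 p0] locI_contract[OF A p2 p1] locI_contract[OF A p2 p2] c by auto
  have m: "mx ?C = locI A p2 p2" using mx_loc[OF A p2] .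
  have 1: "locI A p2 p0 \<subset> locI A p2 p1" using locI_mono[OF A p2, of p0 p1] ct c by blast
  have 2: "locI A p2 p1 \<noteq> mx ?C" using m ct c by auto
  have 3: "x \<in> mx ?C" unfolding m using x ct by blast
  obtain q where q: "prm ?C q" "locI A p2 p0 \<subseteq> q" "x \<in> q" "q \<noteq> mx ?C" using pit_local[OF l nC q0 q1 1 2 3] by blast
  have r: "prm A (q \<inter> A)" "q \<inter> A \<subseteq> p2" using loc_prm_contract[OF A p2 q(1)] .
  have "q \<inter> A \<noteq> p2" using loc_expand(2)[OF A p2 prmD(1)[OF q(1)]] q(4) m by auto
  moreover have "x \<in> A" using x prmD(3)[OF p2] by blast
  ultimately show ?thesis using r q ct by blast
qed

section \<open>Chains of primes and regular local rings\<close>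

definition pchain :: "'a set \<Rightarrow> (nat \<Rightarrow> 'a set) \<Rightarrow> nat \<Rightarrow> bool" where
  "pchain A p d \<longleftrightarrow> (\<forall>i\<le>d. prm A (p i)) \<and> (\<forall>i<d. p i \<subset> p (Suc i))"

lemma pchain_snoc: assumes "pchain A p d" "prm A q" "p d \<subset> q" shows "pchain A (p(Suc d := q)) (Suc d)"
  using assms unfolding pchain_def by (auto simp: le_Suc_eq less_Suc_eq)

lemma pchain_butlast: "pchain A p (Suc d) \<Longrightarrow> pchain A p d" unfolding pchain_def by auto

lemma pchain_tl: "pchain A p (Suc d) \<Longrightarrow> pchain A (\<lambda>i. p (Suc i)) d" unfolding pchain_def by auto

lemma pchain_cons: "pchain A p d \<Longrightarrow> prm A q \<Longrightarrow> q \<subset> p 0 \<Longrightarrow> pchain A (\<lambda>i. case i of 0 \<Rightarrow> q | Suc j \<Rightarrow> p j) (Suc d)"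
  unfolding pchain_def by (auto split: nat.split simp: less_Suc_eq_0_disj)

lemma pchain_prm: "pchain A p d \<Longrightarrow> i \<le> d \<Longrightarrow> prm A (p i)" unfolding pchain_def by auto

text \<open>
  Working down from the top of the chain, the principal ideal theorem replaces each prime by one that contains \<open>x\<close>
  and lies between the same neighbours, until only the bottom prime is left.
\<close>

lemma pchain_through:
  assumes A: "subring A K" and n: "noeth A"
  shows "pchain A p (Suc d) \<Longrightarrow> x \<in> p (Suc d) \<Longrightarrow> \<exists>q. pchain A q (Suc d) \<and> q 0 = p 0 \<and> q (Suc d) = p (Suc d) \<and> x \<in> q 1"
proof (induction d arbitrary: p)
  case 0 then show ?case by (intro exI[of _ p]) simp
next
  case (Suc d)
  have pr: "prm A (p d)" "prm A (p (Suc d))" "prm A (p (Suc (Suc d)))" using Suc.prems(1) unfolding pchain_def by auto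
  have in1: "p d \<subset> p (Suc d)" "p (Suc d) \<subset> p (Suc (Suc d))" using Suc.prems(1) unfolding pchain_def by auto
  obtain r where r: "prm A r" "p d \<subset> r" "r \<subset> p (Suc (Suc d))" "x \<in> r"
  proof (cases "x \<in> p (Suc d)")
    case True then show ?thesis using that[OF pr(2) in1] by blast
  next
    case False
    obtain q where q: "prm A q" "p d \<subseteq> q" "x \<in> q" "q \<subset> p (Suc (Suc d))"
      using pit[OF A n pr in1 Suc.prems(2)] by blast
    moreover have "p d \<noteq> q" using False q(3) in1 by blast
    ultimately show ?thesis using that[of q] by blast
  qed
  have c: "pchain A (p(Suc d := r)) (Suc d)" using pchain_snoc[OF pchain_butlast[OF pchain_butlast[OF Suc.prems(1)]] r(1,2)] .
  obtain q where q: "pchain A q (Suc d)" "q 0 = p 0" "q (Suc d) = r" "x \<in> q 1"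
    using Suc.IH[OF c] r(4) by auto
  have c': "pchain A (q(Suc (Suc d) := p (Suc (Suc d)))) (Suc (Suc d))" using pchain_snoc[OF q(1) pr(3)] q(3) r(3) by blast
  show ?case by (rule exI[of _ "q(Suc (Suc d) := p (Suc (Suc d)))"], intro conjI, rule c') (use q in simp_all)
qed

lemma add_gens_shift: assumes "subring A K" "x \<in> carrier K" "set xs \<subseteq> carrier K" "smod A I"
  shows "add_gens A (x # xs) I = add_gens A xs (add_gen A x I)"
proof -
  have "add_gens A (x # xs) I = add_gens A (xs @ [x]) I" using add_gens_perm[OF assms(1) _ assms(4), of "x # xs" "xs @ [x]"] assms by auto
  then show ?thesis by (simp add: add_gens_append)
qed

text \<open>  Consequently a chain of length \<open>d + 1\<close> above \<open>I\<close> yields one of length \<open>d\<close> above \<open>I + (x)\<close>.\<close>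

lemma pchain_raise:
  assumes l: "lcl A" and n: "noeth A" and p: "pchain A p (Suc d)" and I: "smod A I" "I \<subseteq> p 0" and x: "x \<in> mx A"
  shows "\<exists>q. pchain A q (Suc d) \<and> q 0 = p 0 \<and> add_gen A x I \<subseteq> q 1"
proof -
  note A = lclD(1)[OF l]
  have pd: "prm A (p (Suc d))" "prm A (p d)" "p d \<subset> p (Suc d)" using p unfolding pchain_def by auto
  have "p d \<subset> mx A" using pd prm_sub_mx[OF l pd(1)] by blast
  then have c: "pchain A (p(Suc d := mx A)) (Suc d)" using pchain_snoc[OF pchain_butlast[OF p] prm_mx[OF l]] by blast
  obtain q where q: "pchain A q (Suc d)" "q 0 = p 0" "x \<in> q 1" using pchain_through[OF A n c, of x] x by auto
  have "q 0 \<subset> q 1" "prm A (q 1)" using q(1) unfolding pchain_def by auto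
  then have "add_gen A x I \<subseteq> q 1" using add_gen_least[OF prmD(2) q(3)] I(2) q(2) by blast
  then show ?thesis using q by blast
qed

text \<open>The height theorem: each generator of the maximal ideal modulo \<open>I\<close> costs at most one step of a chain.\<close>

lemma dim_bound:
  assumes l: "lcl A" and n: "noeth A"
  shows "set xs \<subseteq> A \<Longrightarrow> smod A I \<Longrightarrow> mx A = add_gens A xs I \<Longrightarrow> pchain A p d \<Longrightarrow> I \<subseteq> p 0 \<Longrightarrow> d \<le> length xs"
proof (induction xs arbitrary: I p d)
  case Nil
  show ?case
  proof (cases d)
    case (Suc e)
    have "prm A (p 1)" "p 0 \<subset> p 1" using Nil(4) unfolding pchain_def Suc by auto
    then show ?thesis using prm_sub_mx[OF l] Nil(3,5) by auto
  qed simp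
next
  case (Cons x xs)
  note A = lclD(1)[OF l]
  have xK: "x \<in> carrier K" "set xs \<subseteq> carrier K" using Cons.prems(1) subringD(4)[OF A] by auto
  have m: "mx A = add_gens A xs (add_gen A x I)" using Cons.prems(3) add_gens_shift[OF A xK Cons.prems(2)] by simp
  have xm: "x \<in> mx A" using add_gens_sup(2)[OF A _ Cons.prems(2), of "x # xs"] xK Cons.prems(3) by simp
  show ?case
  proof (cases d)
    case (Suc e)
    obtain q where q: "pchain A q (Suc e)" "add_gen A x I \<subseteq> q 1"
      using pchain_raise[OF l n Cons.prems(4)[unfolded Suc] Cons.prems(2) Cons.prems(5) xm] by blast
    have "e \<le> length xs"
      by (rule Cons.IH[OF _ add_gen_smod[OF A xK(1) Cons.prems(2)] m pchain_tl[OF q(1)]]) (use Cons.prems(1) q(2) in auto)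
    then show ?thesis using Suc by simp
  qed simp
qed

text \<open>
  A regular local ring is a domain. With \<open>J = I + (x)\<close> prime by induction, raise the chain so that its second prime
  contains \<open>J\<close>; the height theorem leaves no room, so this prime is \<open>J\<close> and the bottom prime \<open>q\<^sub>0\<close> is
  contained in \<open>J\<close> without containing \<open>x\<close>. Then \<open>q\<^sub>0 \<subseteq> I + x q\<^sub>0\<close>, and \<open>q\<^sub>0 = I\<close> by Krull's
  intersection theorem.
\<close>

lemma regular_prime:
  assumes l: "lcl A" and n: "noeth A"
  shows "set xs \<subseteq> A \<Longrightarrow> idl A I \<Longrightarrow> mx A = add_gens A xs I \<Longrightarrow> pchain A p (length xs) \<Longrightarrow> I \<subseteq> p 0 \<Longrightarrow> prm A I"
proof (induction xs arbitrary: I p)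
  case Nil then show ?case using prm_mx[OF l] by simp
next
  case (Cons x xs)
  note A = lclD(1)[OF l]
  note ac = subringD(4)[OF A]
  note sI = idlD(1)[OF Cons.prems(2)]
  have xA: "x \<in> A" "set xs \<subseteq> A" using Cons.prems(1) by auto
  have xK: "x \<in> carrier K" "set xs \<subseteq> carrier K" using Cons.prems(1) ac by auto
  define J where "J = add_gen A x I"
  have J: "idl A J" unfolding J_def using add_gen_idl[OF A xA(1) Cons.prems(2)] .
  have m: "mx A = add_gens A xs J" unfolding J_def using Cons.prems(3) add_gens_shift[OF A xK sI] by simp
  have xm: "x \<in> mx A" using add_gens_sup(2)[OF A _ sI, of "x # xs"] xK Cons.prems(3) by simp
  obtain q where q: "pchain A q (Suc (length xs))" "q 0 = p 0" "J \<subseteq> q 1"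
    using pchain_raise[OF l n Cons.prems(4)[simplified] sI Cons.prems(5) xm] unfolding J_def by auto
  have tl: "pchain A (\<lambda>i. q (Suc i)) (length xs)" using pchain_tl[OF q(1)] .
  have pJ: "prm A J" using Cons.IH[OF xA(2) J m tl] q(3) by simp
  have "J = q 1"
  proof (rule ccontr)
    assume "J \<noteq> q 1"
    then have "pchain A (\<lambda>i. case i of 0 \<Rightarrow> J | Suc j \<Rightarrow> q (Suc j)) (Suc (length xs))" using pchain_cons[OF tl pJ] q(3) by simp
    then have "Suc (length xs) \<le> length xs" using dim_bound[OF l n xA(2) idlD(1)[OF J] m] by fastforce
    then show False by simp
  qed
  then have q0: "prm A (q 0)" "q 0 \<subset> J" using q(1) unfolding pchain_def by auto
  have I0: "I \<subseteq> q 0" using q(2) Cons.prems(5) by simp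
  have x0: "x \<notin> q 0" using add_gen_least[OF prmD(2)[OF q0(1)] _ I0, of x] q0(2) unfolding J_def by blast
  have step: "\<exists>a\<in>q 0. z \<ominus> a \<otimes> x \<in> I" if z: "z \<in> q 0" for z
  proof -
    obtain a i where a: "a \<in> A" "i \<in> I" "z = a \<otimes> x \<oplus> i" using z q0(2) unfolding J_def add_gen_def by blast
    have iK: "i \<in> carrier K" using idlD(5)[OF Cons.prems(2) a(2)] .
    have "a \<otimes> x = z \<ominus> i" unfolding a(3) using ac[OF a(1)] xK(1) iK by algebra
    then have "a \<otimes> x \<in> q 0" using smod_minus[OF A prmD(2)[OF q0(1)] z] a(2) I0 by auto
    then have "a \<in> q 0" using prmD(6)[OF q0(1) a(1) xA(1)] x0 by blast
    moreover have "z \<ominus> a \<otimes> x = i" unfolding a(3) using ac[OF a(1)] xK(1) iK by algebra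
    ultimately show ?thesis using a(2) by auto
  qed
  have pw: "\<exists>a\<in>q 0. z \<ominus> a \<otimes> x [^] k \<in> I" if z: "z \<in> q 0" for z and k :: nat
  proof (induction k)
    case 0
    have "z \<in> carrier K" using smodD(3)[OF prmD(2)[OF q0(1)] z] .
    then have "z \<ominus> z \<otimes> x [^] (0::nat) = \<zero>" by (simp add: a_minus_def r_neg)
    then show ?case using z idlD(3)[OF Cons.prems(2)] by metis
  next
    case (Suc k)
    then obtain a where a: "a \<in> q 0" "z \<ominus> a \<otimes> x [^] k \<in> I" by blast
    obtain b where b: "b \<in> q 0" "a \<ominus> b \<otimes> x \<in> I" using step[OF a(1)] by blast
    have K: "z \<in> carrier K" "a \<in> carrier K" "b \<in> carrier K" using smodD(3)[OF prmD(2)[OF q0(1)]] z a(1) b(1) by auto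
    have xk: "x [^] k \<in> A" using subringD(9)[OF A xA(1)] .
    have "z \<ominus> b \<otimes> x [^] Suc k = (z \<ominus> a \<otimes> x [^] k) \<oplus> x [^] k \<otimes> (a \<ominus> b \<otimes> x)"
      unfolding nat_pow_Suc using K xK(1) ac[OF xk] by algebra
    moreover have "\<dots> \<in> I" using idlD(6)[OF Cons.prems(2) a(2) idlD(7)[OF Cons.prems(2) xk b(2)]] .
    ultimately show ?case using b(1) by metis
  qed
  have "q 0 \<subseteq> I"
  proof
    fix z assume z: "z \<in> q 0"
    have zA: "z \<in> A" using z prmD(3)[OF q0(1)] by blast
    have "z \<in> add_gen A (x [^] k) I" for k :: nat
    proof -
      obtain a where "a \<in> q 0" "z \<ominus> a \<otimes> x [^] k \<in> I" using pw[OF z] by blast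
      then show ?thesis using add_gen_congr[OF A sI ac[OF zA] ac[OF subringD(9)[OF A xA(1)]], of k] prmD(3)[OF q0(1)] by blast
    qed
    then show "z \<in> I" using krull_intersection[OF l n Cons.prems(2) xm zA] by blast
  qed
  then show ?case using q0(1) I0 by auto
qed

text \<open>
  Regularity in the form that survives blowing up: the initial segments of \<open>xs\<close> generate a strictly increasing chain
  of primes ending with the maximal ideal. \<open>reg_intro\<close> and \<open>reg_chain\<close> relate it to chains of primes.
\<close>

definition reg :: "'a set \<Rightarrow> 'a list \<Rightarrow> bool" where
  "reg A xs \<longleftrightarrow> lcl A \<and> noeth A \<and> set xs \<subseteq> A \<and> mx A = add_gens A xs {\<zero>} \<and>
     (\<forall>ys z zs. xs = ys @ z # zs \<longrightarrow> prm A (add_gens A ys {\<zero>}) \<and> z \<notin> add_gens A ys {\<zero>})"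

lemma regular_raise:
  assumes l: "lcl A" and n: "noeth A"
  shows "set (ys @ zs) \<subseteq> A \<Longrightarrow> idl A I \<Longrightarrow> mx A = add_gens A (ys @ zs) I \<Longrightarrow> pchain A p (length (ys @ zs)) \<Longrightarrow> I \<subseteq> p 0 \<Longrightarrow>
    \<exists>q. pchain A q (length zs) \<and> add_gens A ys I \<subseteq> q 0"
proof (induction ys arbitrary: I p)
  case Nil then show ?case by auto
next
  case (Cons y ys)
  note A = lclD(1)[OF l]
  have yA: "y \<in> A" "set (ys @ zs) \<subseteq> A" using Cons.prems(1) by auto
  have yK: "y \<in> carrier K" "set (ys @ zs) \<subseteq> carrier K" "set ys \<subseteq> carrier K" using Cons.prems(1) subringD(4)[OF A] by auto
  note sI = idlD(1)[OF Cons.prems(2)]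
  have ym: "y \<in> mx A" using add_gens_sup(2)[OF A _ sI, of "(y # ys) @ zs"] yK Cons.prems(3) by simp
  obtain q where q: "pchain A q (Suc (length (ys @ zs)))" "add_gen A y I \<subseteq> q 1"
    using pchain_raise[OF l n Cons.prems(4)[unfolded append_Cons list.size(4) add_Suc_right add_0_right] sI Cons.prems(5) ym] by auto
  have m: "mx A = add_gens A (ys @ zs) (add_gen A y I)" using Cons.prems(3) add_gens_shift[OF A yK(1,2) sI] by simp
  have "\<exists>q. pchain A q (length zs) \<and> add_gens A ys (add_gen A y I) \<subseteq> q 0"
    using Cons.IH[OF yA(2) add_gen_idl[OF A yA(1) Cons.prems(2)] m pchain_tl[OF q(1)]] q(2) by simp
  then show ?case using add_gens_shift[OF A yK(1,3) sI] by simp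
qed

lemma reg_intro:
  assumes l: "lcl A" and n: "noeth A" and xs: "set xs \<subseteq> A" and m: "mx A = add_gens A xs {\<zero>}" and p: "pchain A p d" and d: "length xs \<le> d"
  shows "reg A xs"
proof -
  note A = lclD(1)[OF l]
  have p': "pchain A p (length xs)" using p d unfolding pchain_def by auto
  have z: "{\<zero>} \<subseteq> p 0" using p prmD(5) unfolding pchain_def by auto
  have "prm A (add_gens A ys {\<zero>}) \<and> z \<notin> add_gens A ys {\<zero>}" if e: "xs = ys @ z # zs" for ys z zs
  proof -
    have sub: "set ys \<subseteq> A" "z \<in> A" "set zs \<subseteq> A" using xs e by auto
    have subK: "set ys \<subseteq> carrier K" "z \<in> carrier K" "set zs \<subseteq> carrier K" using sub subringD(4)[OF A] by auto
    obtain q where q: "pchain A q (length (z # zs))" "add_gens A ys {\<zero>} \<subseteq> q 0"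
      using regular_raise[OF l n, of ys "z # zs" "{\<zero>}" p] xs m p' z idl_zero[OF A] unfolding e by blast
    have I: "idl A (add_gens A ys {\<zero>})" using add_gens_idl[OF A sub(1) idl_zero[OF A]] .
    have m2: "mx A = add_gens A (z # zs) (add_gens A ys {\<zero>})"
      unfolding m e using add_gens_perm[OF A _ smod_zero[OF A], of "ys @ z # zs" "(z # zs) @ ys"] subK
      by (simp only: add_gens_append) auto
    have "prm A (add_gens A ys {\<zero>})" using regular_prime[OF l n _ I m2 q] sub by simp
    moreover have "z \<notin> add_gens A ys {\<zero>}"
    proof
      assume zz: "z \<in> add_gens A ys {\<zero>}"
      have "add_gen A z (add_gens A ys {\<zero>}) = add_gens A ys {\<zero>}"
        using add_gen_least[OF idlD(1)[OF I] zz] add_gen_sup(1)[OF A subK(2) idlD(1)[OF I]] by blast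
      then have "mx A = add_gens A zs (add_gens A ys {\<zero>})" using m2 add_gens_shift[OF A subK(2,3) idlD(1)[OF I]] by simp
      then have "length (z # zs) \<le> length zs" using dim_bound[OF l n sub(3) idlD(1)[OF I] _ q] by blast
      then show False by simp
    qed
    ultimately show ?thesis by blast
  qed
  then show ?thesis unfolding reg_def using assms by blast
qed

lemma pchain_mono: "pchain A p d \<Longrightarrow> i \<le> j \<Longrightarrow> j \<le> d \<Longrightarrow> p i \<subseteq> p j"
proof (induction j)
  case (Suc j)
  show ?case
  proof (cases "i = Suc j")
    case False
    then have "p i \<subseteq> p j" using Suc by auto
    moreover have "p j \<subset> p (Suc j)" using Suc.prems unfolding pchain_def by auto
    ultimately show ?thesis by blast
  qed simp
qed simp

lemma reg_chain: assumes "reg A xs" shows "\<exists>p. pchain A p (length xs)"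
proof -
  have l: "lcl A" and m: "mx A = add_gens A xs {\<zero>}" and xs: "set xs \<subseteq> A"
    and r: "\<And>ys z zs. xs = ys @ z # zs \<Longrightarrow> prm A (add_gens A ys {\<zero>}) \<and> z \<notin> add_gens A ys {\<zero>}"
    using assms unfolding reg_def by auto
  note A = lclD(1)[OF l]
  define p where "p i = add_gens A (take i xs) {\<zero>}" for i
  have sp: "xs = take i xs @ xs ! i # drop (Suc i) xs" if "i < length xs" for i using id_take_nth_drop[OF that] .
  have "prm A (p i)" if "i \<le> length xs" for i
  proof (cases "i = length xs")
    case True then show ?thesis unfolding p_def using prm_mx[OF l] m by simp
  next
    case False then show ?thesis unfolding p_def using r[OF sp] that by simp
  qed
  moreover have "p i \<subset> p (Suc i)" if i: "i < length xs" for i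
  proof -
    have tk: "take (Suc i) xs = take i xs @ [xs ! i]" using i by (simp add: take_Suc_conv_app_nth)
    have sK: "set (take (Suc i) xs) \<subseteq> carrier K" using xs subringD(4)[OF A] by (meson set_take_subset subset_iff)
    have "set (take (Suc i) xs) \<subseteq> p (Suc i)" unfolding p_def using add_gens_sup(2)[OF A sK smod_zero[OF A]] .
    then have "set (take i xs) \<subseteq> p (Suc i)" "xs ! i \<in> p (Suc i)" unfolding tk by auto
    moreover have "smod A (p (Suc i))" unfolding p_def using add_gens_smod[OF A sK smod_zero[OF A]] .
    moreover have "xs ! i \<notin> p i" unfolding p_def using r[OF sp[OF i]] by blast
    ultimately show ?thesis unfolding p_def[of i] using add_gens_least[of A "p (Suc i)" "take i xs" "{\<zero>}"] smodD(2) unfolding p_def by blast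
  qed
  ultimately show ?thesis unfolding pchain_def by blast
qed

section \<open>Adjoining one element and Hilbert's basis theorem\<close>

text \<open>
  Polynomials appear only through their values at \<open>t\<close>: \<open>pols I t n\<close> consists of the values of polynomials
  of degree less than \<open>n\<close> with coefficients in \<open>I\<close>, and \<open>adjoin A t\<close> is the ring \<open>A[t]\<close>. The
  coefficients are in general not determined by the value.
\<close>

primrec poly_val :: "'a \<Rightarrow> (nat \<Rightarrow> 'a) \<Rightarrow> nat \<Rightarrow> 'a" where
  "poly_val t c 0 = \<zero>"
| "poly_val t c (Suc n) = poly_val t c n \<oplus> c n \<otimes> t [^] n"

definition pols :: "'a set \<Rightarrow> 'a \<Rightarrow> nat \<Rightarrow> 'a set" where
  "pols I t n = {poly_val t c n | c. \<forall>i. c i \<in> I}"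

definition adjoin :: "'a set \<Rightarrow> 'a \<Rightarrow> 'a set" where
  "adjoin I t = (\<Union>n. pols I t n)"

lemma poly_val_closed: "t \<in> carrier K \<Longrightarrow> (\<And>i. c i \<in> carrier K) \<Longrightarrow> poly_val t c n \<in> carrier K"
  by (induction n) auto

lemma poly_val_cong: "(\<And>i. i < n \<Longrightarrow> c i = d i) \<Longrightarrow> poly_val t c n = poly_val t d n"
  by (induction n) auto

lemma poly_val_add: assumes "t \<in> carrier K" "\<And>i. c i \<in> carrier K" "\<And>i. d i \<in> carrier K"
  shows "poly_val t (\<lambda>i. c i \<oplus> d i) n = poly_val t c n \<oplus> poly_val t d n"
proof (induction n)
  case (Suc n)
  note k = assms(2)[of n] assms(3)[of n] poly_val_closed[where c = c and n = n, OF assms(1,2)] poly_val_closed[where c = d and n = n, OF assms(1,3)] nat_pow_closed[OF assms(1), where n = n]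
  show ?case unfolding poly_val.simps Suc using k by algebra
qed simp

lemma poly_val_smult: assumes "t \<in> carrier K" "\<And>i. c i \<in> carrier K" "a \<in> carrier K"
  shows "poly_val t (\<lambda>i. a \<otimes> c i) n = a \<otimes> poly_val t c n"
proof (induction n)
  case 0 then show ?case using assms by simp
next
  case (Suc n)
  note k = assms(2)[of n] assms(3) poly_val_closed[where c = c and n = n, OF assms(1,2)] nat_pow_closed[OF assms(1), where n = n]
  show ?case unfolding poly_val.simps Suc using k by algebra
qed

lemma poly_val_shift: assumes "t \<in> carrier K" "\<And>i. c i \<in> carrier K"
  shows "poly_val t (\<lambda>i. case i of 0 \<Rightarrow> \<zero> | Suc j \<Rightarrow> c j) (Suc n) = t \<otimes> poly_val t c n"
proof (induction n)
  case 0 then show ?case using assms by simp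
next
  case (Suc n)
  note k = assms(2)[of n] assms(1) poly_val_closed[where c = c and n = n, OF assms(1,2)] nat_pow_closed[OF assms(1), where n = n]
  show ?case unfolding poly_val.simps(2)[of t _ "Suc n"] Suc using k by (simp add: r_distr m_ac)
qed

lemma poly_val_pad: assumes "t \<in> carrier K" "\<And>i. c i \<in> carrier K" "n \<le> m"
  shows "poly_val t (\<lambda>i. if i < n then c i else \<zero>) m = poly_val t c n"
  using assms(3)
proof (induction m)
  case 0 then show ?case by simp
next
  case (Suc m)
  show ?case
  proof (cases "n = Suc m")
    case True
    show ?thesis unfolding True by (rule poly_val_cong) simp
  next
    case False
    then have "n \<le> m" using Suc by simp
    then show ?thesis using Suc.IH poly_val_closed[OF assms(1,2)] assms(1) by simp
  qed
qed

context
  fixes A t assumes A: "subring A K" and t: "t \<in> carrier K"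
begin

lemma tpow_carrier: "t [^] (n::nat) \<in> carrier K" using t by simp

lemma pols_carrier: assumes I: "smod A I" and z: "z \<in> pols I t n" shows "z \<in> carrier K"
proof -
  obtain c where c: "\<And>i. c i \<in> I" "z = poly_val t c n" using z unfolding pols_def by blast
  show ?thesis unfolding c(2) by (rule poly_val_closed[OF t smodD(3)[OF I c(1)]])
qed

lemma pols_smod: assumes I: "smod A I" shows "smod A (pols I t n)"
  unfolding smod_def
proof (intro conjI ballI)
  show "pols I t n \<subseteq> carrier K" using pols_carrier[OF I] by blast
  have "poly_val t (\<lambda>_. \<zero>) n = \<zero>" using poly_val_pad[OF t, of "\<lambda>_. \<zero>" 0 n] by simp
  then show "\<zero> \<in> pols I t n" unfolding pols_def using smodD(2)[OF I] by force
next
  fix x y assume "x \<in> pols I t n" "y \<in> pols I t n"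
  then obtain c d where c: "\<And>i. c i \<in> I" "x = poly_val t c n" "\<And>i. d i \<in> I" "y = poly_val t d n" unfolding pols_def by blast
  have "x \<oplus> y = poly_val t (\<lambda>i. c i \<oplus> d i) n" unfolding c using poly_val_add[OF t smodD(3)[OF I c(1)] smodD(3)[OF I c(3)]] by simp
  moreover have "c i \<oplus> d i \<in> I" for i using smodD(4)[OF I c(1) c(3)] .
  ultimately show "x \<oplus> y \<in> pols I t n" unfolding pols_def by blast
next
  fix a x assume a: "a \<in> A" and "x \<in> pols I t n"
  then obtain c where c: "\<And>i. c i \<in> I" "x = poly_val t c n" unfolding pols_def by blast
  have "a \<otimes> x = poly_val t (\<lambda>i. a \<otimes> c i) n" unfolding c using poly_val_smult[OF t smodD(3)[OF I c(1)] subringD(4)[OF A a]] by simp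
  moreover have "a \<otimes> c i \<in> I" for i using smodD(5)[OF I a c(1)] .
  ultimately show "a \<otimes> x \<in> pols I t n" unfolding pols_def by blast
qed

lemma pols_0: assumes "smod A I" shows "pols I t 0 = {\<zero>}" unfolding pols_def using smodD(2)[OF assms] by auto

lemma pols_Suc: "z \<in> pols I t (Suc n) \<longleftrightarrow> (\<exists>g\<in>pols I t n. \<exists>a\<in>I. z = g \<oplus> a \<otimes> t [^] n)"
proof
  assume "z \<in> pols I t (Suc n)"
  then obtain c where "\<forall>i. c i \<in> I" "z = poly_val t c (Suc n)" unfolding pols_def by blast
  then show "\<exists>g\<in>pols I t n. \<exists>a\<in>I. z = g \<oplus> a \<otimes> t [^] n" unfolding pols_def by auto
next
  assume "\<exists>g\<in>pols I t n. \<exists>a\<in>I. z = g \<oplus> a \<otimes> t [^] n"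
  then obtain c a where c: "\<And>i. c i \<in> I" "a \<in> I" "z = poly_val t c n \<oplus> a \<otimes> t [^] n" unfolding pols_def by blast
  have "poly_val t c n = poly_val t (c(n := a)) n" by (rule poly_val_cong) auto
  then have "z = poly_val t (c(n := a)) (Suc n)" using c(3) by simp
  moreover have "\<forall>i. (c(n := a)) i \<in> I" using c(1,2) by simp
  ultimately show "z \<in> pols I t (Suc n)" unfolding pols_def by blast
qed

lemma pols_mono: assumes I: "smod A I" and "n \<le> m" shows "pols I t n \<subseteq> pols I t m"
proof
  fix z assume "z \<in> pols I t n"
  then obtain c where c: "\<And>i. c i \<in> I" "z = poly_val t c n" unfolding pols_def by blast
  have "z = poly_val t (\<lambda>i. if i < n then c i else \<zero>) m" unfolding c using poly_val_pad[OF t smodD(3)[OF I c(1)] assms(2)] by simp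
  moreover have "\<forall>i. (if i < n then c i else \<zero>) \<in> I" using c(1) smodD(2)[OF I] by simp
  ultimately show "z \<in> pols I t m" unfolding pols_def by blast
qed

lemma pols_shift1: assumes I: "smod A I" and "z \<in> pols I t n" shows "t \<otimes> z \<in> pols I t (Suc n)"
proof -
  obtain c where c: "\<And>i. c i \<in> I" "z = poly_val t c n" using assms(2) unfolding pols_def by blast
  have "t \<otimes> z = poly_val t (\<lambda>i. case i of 0 \<Rightarrow> \<zero> | Suc j \<Rightarrow> c j) (Suc n)" unfolding c using poly_val_shift[OF t smodD(3)[OF I c(1)]] by simp
  moreover have "\<forall>i. (case i of 0 \<Rightarrow> \<zero> | Suc j \<Rightarrow> c j) \<in> I" using c(1) smodD(2)[OF I] by (simp split: nat.split)
  ultimately show ?thesis unfolding pols_def by blast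
qed

lemma pols_shift: assumes I: "smod A I" and z: "z \<in> pols I t n" shows "t [^] k \<otimes> z \<in> pols I t (n + k)"
proof (induction k)
  case 0 then show ?case using z pols_carrier[OF I z] by simp
next
  case (Suc k)
  have "t [^] Suc k \<otimes> z = t \<otimes> (t [^] k \<otimes> z)" unfolding nat_pow_Suc using t tpow_carrier[of k] pols_carrier[OF I z] by algebra
  then show ?case using pols_shift1[OF I Suc] by simp
qed

lemma pols_monom: assumes I: "smod A I" "a \<in> I" shows "a \<otimes> t [^] n \<in> pols I t (Suc n)"
proof -
  have "a \<otimes> t [^] n = \<zero> \<oplus> a \<otimes> t [^] n" using smodD(3)[OF I] tpow_carrier[of n] by simp
  then show ?thesis unfolding pols_Suc using smodD(2)[OF pols_smod[OF I(1)]] I(2) by blast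
qed

lemma pols_const: "smod A I \<Longrightarrow> a \<in> I \<Longrightarrow> a \<in> pols I t 1"
  using pols_monom[of I a 0] smodD(3)[of A I a] by simp

lemma pols_mult: assumes I: "smod A I" shows "x \<in> pols A t n \<Longrightarrow> y \<in> pols I t m \<Longrightarrow> x \<otimes> y \<in> pols I t (n + m)"
proof (induction n arbitrary: x)
  case 0
  then have "x \<otimes> y = \<zero>" using pols_0[OF smod_self[OF A]] pols_carrier[OF I] by auto
  then show ?case using smodD(2)[OF pols_smod[OF I]] by simp
next
  case (Suc n)
  obtain g a where g: "g \<in> pols A t n" "a \<in> A" "x = g \<oplus> a \<otimes> t [^] n" using Suc.prems(1) unfolding pols_Suc by blast
  have K: "g \<in> carrier K" "a \<in> carrier K" "y \<in> carrier K"
    using pols_carrier[OF smod_self[OF A] g(1)] subringD(4)[OF A g(2)] pols_carrier[OF I Suc.prems(2)] by auto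
  have e: "x \<otimes> y = g \<otimes> y \<oplus> a \<otimes> (t [^] n \<otimes> y)" unfolding g(3) using K tpow_carrier[of n] by algebra
  have 1: "g \<otimes> y \<in> pols I t (Suc n + m)" using Suc.IH[OF g(1) Suc.prems(2)] pols_mono[OF I, of "n + m" "Suc n + m"] by auto
  have "t [^] n \<otimes> y \<in> pols I t (Suc n + m)" using pols_shift[OF I Suc.prems(2), of n] pols_mono[OF I, of "m + n" "Suc n + m"] by auto
  then have "a \<otimes> (t [^] n \<otimes> y) \<in> pols I t (Suc n + m)" using smodD(5)[OF pols_smod[OF I] g(2)] by blast
  then show ?case unfolding e using smodD(4)[OF pols_smod[OF I] 1] by blast
qed

lemma adjoin_iff: "z \<in> adjoin I t \<longleftrightarrow> (\<exists>n. z \<in> pols I t n)" unfolding adjoin_def by blast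

lemma adjoin_smod: assumes I: "smod A I" shows "smod (adjoin A t) (adjoin I t)"
  unfolding smod_def
proof (intro conjI ballI)
  show "adjoin I t \<subseteq> carrier K" unfolding adjoin_def using pols_carrier[OF I] by blast
  show "\<zero> \<in> adjoin I t" unfolding adjoin_iff using smodD(2)[OF pols_smod[OF I]] by blast
  show "x \<oplus> y \<in> adjoin I t" if xy: "x \<in> adjoin I t" "y \<in> adjoin I t" for x y
  proof -
    obtain n m where "x \<in> pols I t n" "y \<in> pols I t m" using xy unfolding adjoin_iff by blast
    then have "x \<in> pols I t (max n m)" "y \<in> pols I t (max n m)" using pols_mono[OF I, of n "max n m"] pols_mono[OF I, of m "max n m"] by auto
    then show ?thesis unfolding adjoin_iff using smodD(4)[OF pols_smod[OF I]] by blast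
  qed
  show "x \<otimes> y \<in> adjoin I t" if "x \<in> (adjoin A t)" "y \<in> adjoin I t" for x y using that pols_mult[OF I] unfolding adjoin_iff by blast
qed

lemma adjoin_sup: "smod A I \<Longrightarrow> I \<subseteq> adjoin I t" unfolding adjoin_def using pols_const by blast

lemma adjoin_mono: "I \<subseteq> J \<Longrightarrow> adjoin I t \<subseteq> adjoin J t" unfolding adjoin_def pols_def by blast

lemma adjoin_base: "A \<subseteq> (adjoin A t)" using adjoin_sup[OF smod_self[OF A]] .

lemma adjoin_elem: "t \<in> (adjoin A t)"
proof -
  have "t = \<one> \<otimes> t [^] (1::nat)" using t by simp
  then have "t \<in> pols A t (Suc 1)" using pols_monom[OF smod_self[OF A] subringD(3)[OF A], of 1] by simp
  then show ?thesis unfolding adjoin_iff by blast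
qed

lemma adjoin_subring: "subring (adjoin A t) K"
proof -
  note S = smodD[OF adjoin_smod[OF smod_self[OF A]]]
  show ?thesis
  proof (rule subringI)
    show "(adjoin A t) \<subseteq> carrier K" by (rule S)
    show "\<one> \<in> (adjoin A t)" using adjoin_base subringD(3)[OF A] by blast
    show "h1 \<otimes> h2 \<in> (adjoin A t)" if "h1 \<in> (adjoin A t)" "h2 \<in> (adjoin A t)" for h1 h2 using S(5)[OF that] .
    show "h1 \<oplus> h2 \<in> (adjoin A t)" if "h1 \<in> (adjoin A t)" "h2 \<in> (adjoin A t)" for h1 h2 using S(4)[OF that] .
    show "\<ominus> h \<in> (adjoin A t)" if h: "h \<in> (adjoin A t)" for h
    proof -
      have "\<ominus> \<one> \<in> (adjoin A t)" using adjoin_base subringD(3,5)[OF A] by blast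
      moreover have "\<ominus> h = (\<ominus> \<one>) \<otimes> h" using S(3)[OF h] by (simp add: l_minus)
      ultimately show ?thesis using S(5)[OF _ h] by simp
    qed
  qed
qed

lemma adjoin_idl: "idl A I \<Longrightarrow> idl (adjoin A t) (adjoin I t)" unfolding idl_def using adjoin_smod adjoin_mono by blast

lemma tpow_mem: "subring D K \<Longrightarrow> t \<in> D \<Longrightarrow> t [^] (n::nat) \<in> D" by (rule subringD(9))

lemma adjoin_least: assumes M: "smod D M" and D: "subring D K" "t \<in> D" and I: "I \<subseteq> M" shows "adjoin I t \<subseteq> M"
proof -
  have "poly_val t c n \<in> M" if c: "\<And>i. c i \<in> I" for c n
  proof (induction n)
    case 0 then show ?case using smodD(2)[OF M] by simp
  next
    case (Suc n)
    have cM: "c n \<in> M" using c I by blast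
    have "c n \<otimes> t [^] n = t [^] n \<otimes> c n" using m_comm[OF smodD(3)[OF M cM] tpow_carrier] .
    also have "\<dots> \<in> M" using smodD(5)[OF M tpow_mem[OF D] cM] .
    finally show ?case using smodD(4)[OF M Suc] by simp
  qed
  then show ?thesis unfolding adjoin_def pols_def by blast
qed

lemma adjoin_minimal: "subring D K \<Longrightarrow> A \<subseteq> D \<Longrightarrow> t \<in> D \<Longrightarrow> (adjoin A t) \<subseteq> D"
  using adjoin_least[OF smod_self] by blast

text \<open>The possible coefficients of \<open>t\<^sup>n\<close> in members of \<open>J\<close> written with degree at most \<open>n\<close>.\<close>

definition lead :: "'a set \<Rightarrow> nat \<Rightarrow> 'a set" where
  "lead J n = {a \<in> A. \<exists>g\<in>pols A t n. g \<oplus> a \<otimes> t [^] n \<in> J}"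

lemma lead_idl: assumes J: "idl (adjoin A t) J" shows "idl A (lead J n)"
  unfolding idl_def smod_def
proof (intro conjI ballI)
  note ac = subringD(4)[OF A]
  note P = smodD[OF pols_smod[OF smod_self[OF A], of n]]
  show "lead J n \<subseteq> A" "lead J n \<subseteq> carrier K" unfolding lead_def using subringD(1)[OF A] by auto
  have "\<zero> \<oplus> \<zero> \<otimes> t [^] n \<in> J" using idlD(3)[OF J] tpow_carrier by simp
  then show "\<zero> \<in> lead J n" unfolding lead_def using P(2) subringD(2)[OF A] by blast
  show "a \<oplus> b \<in> lead J n" if ab: "a \<in> lead J n" "b \<in> lead J n" for a b
  proof -
    obtain g h where g: "a \<in> A" "g \<in> pols A t n" "g \<oplus> a \<otimes> t [^] n \<in> J" and h: "b \<in> A" "h \<in> pols A t n" "h \<oplus> b \<otimes> t [^] n \<in> J"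
      using ab unfolding lead_def by blast
    have "(g \<oplus> h) \<oplus> (a \<oplus> b) \<otimes> t [^] n = (g \<oplus> a \<otimes> t [^] n) \<oplus> (h \<oplus> b \<otimes> t [^] n)"
      using ac[OF g(1)] ac[OF h(1)] P(3)[OF g(2)] P(3)[OF h(2)] tpow_carrier[of n] by algebra
    then have "(g \<oplus> h) \<oplus> (a \<oplus> b) \<otimes> t [^] n \<in> J" using idlD(6)[OF J g(3) h(3)] by simp
    then show ?thesis unfolding lead_def using P(4)[OF g(2) h(2)] subringD(7)[OF A g(1) h(1)] by blast
  qed
  show "r \<otimes> a \<in> lead J n" if r: "r \<in> A" "a \<in> lead J n" for r a
  proof -
    obtain g where g: "a \<in> A" "g \<in> pols A t n" "g \<oplus> a \<otimes> t [^] n \<in> J" using r unfolding lead_def by blast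
    have "r \<otimes> g \<oplus> (r \<otimes> a) \<otimes> t [^] n = r \<otimes> (g \<oplus> a \<otimes> t [^] n)"
      using ac[OF g(1)] ac[OF r(1)] P(3)[OF g(2)] tpow_carrier[of n] by algebra
    moreover have "r \<in> (adjoin A t)" using adjoin_base r(1) by blast
    ultimately have "r \<otimes> g \<oplus> (r \<otimes> a) \<otimes> t [^] n \<in> J" using idlD(7)[OF J _ g(3)] by simp
    then show ?thesis unfolding lead_def using P(5)[OF r(1) g(2)] subringD(6)[OF A r(1) g(1)] by blast
  qed
qed

lemma lead_Suc: assumes J: "idl (adjoin A t) J" shows "lead J n \<subseteq> lead J (Suc n)"
proof
  fix a assume "a \<in> lead J n"
  then obtain g where g: "a \<in> A" "g \<in> pols A t n" "g \<oplus> a \<otimes> t [^] n \<in> J" unfolding lead_def by blast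
  have "t \<otimes> g \<oplus> a \<otimes> t [^] Suc n = t \<otimes> (g \<oplus> a \<otimes> t [^] n)"
    unfolding nat_pow_Suc using subringD(4)[OF A g(1)] pols_carrier[OF smod_self[OF A] g(2)] tpow_carrier[of n] t by algebra
  then have "t \<otimes> g \<oplus> a \<otimes> t [^] Suc n \<in> J" using idlD(7)[OF J adjoin_elem g(3)] by simp
  then show "a \<in> lead J (Suc n)" unfolding lead_def using pols_shift1[OF smod_self[OF A] g(2)] g(1) by blast
qed

lemma lead_mono: assumes "J \<subseteq> G" shows "lead J n \<subseteq> lead G n" using assms unfolding lead_def by blast

text \<open>Subtracting a member of \<open>G\<close> with the same leading coefficient lowers the degree.\<close>

lemma lead_sub: assumes J: "idl (adjoin A t) J" and G: "idl (adjoin A t) G" and GJ: "G \<subseteq> J" and le: "\<And>n. lead J n \<subseteq> lead G n" shows "J \<subseteq> G"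
proof -
  have "z \<in> G" if "z \<in> J" "z \<in> pols A t n" for z n using that
  proof (induction n arbitrary: z)
    case 0 then show ?case using pols_0[OF smod_self[OF A]] idlD(3)[OF G] by auto
  next
    case (Suc n)
    note P = pols_smod[OF smod_self[OF A], of n]
    obtain g a where g: "g \<in> pols A t n" "a \<in> A" "z = g \<oplus> a \<otimes> t [^] n" using Suc.prems(2) unfolding pols_Suc by blast
    have "a \<in> lead J n" unfolding lead_def using g Suc.prems(1) by blast
    then obtain h where h: "h \<in> pols A t n" "h \<oplus> a \<otimes> t [^] n \<in> G" using le unfolding lead_def by blast
    have K: "g \<in> carrier K" "h \<in> carrier K" "a \<in> carrier K" using smodD(3)[OF P] g(1) h(1) subringD(4)[OF A g(2)] by auto
    have e: "z \<ominus> (h \<oplus> a \<otimes> t [^] n) = g \<ominus> h" unfolding g(3) using K tpow_carrier[of n] by algebra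
    have "z \<ominus> (h \<oplus> a \<otimes> t [^] n) \<in> J" using smod_minus[OF adjoin_subring idlD(1)[OF J] Suc.prems(1)] h(2) GJ by blast
    then have "g \<ominus> h \<in> G" using Suc.IH smod_minus[OF A P g(1) h(1)] unfolding e by blast
    then have "(g \<ominus> h) \<oplus> (h \<oplus> a \<otimes> t [^] n) \<in> G" using idlD(6)[OF G _ h(2)] by blast
    moreover have "(g \<ominus> h) \<oplus> (h \<oplus> a \<otimes> t [^] n) = z" unfolding g(3) using K tpow_carrier[of n] by algebra
    ultimately show ?case by simp
  qed
  then show ?thesis using idlD(2)[OF J] unfolding adjoin_def by blast
qed

lemma lead_gens: assumes J: "idl (adjoin A t) J"
  shows "set as \<subseteq> lead J n \<Longrightarrow> \<exists>es. set es \<subseteq> J \<and> set as \<subseteq> lead (add_gens (adjoin A t) es {\<zero>}) n"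
proof (induction as)
  case Nil then show ?case by (intro exI[of _ "[]"]) auto
next
  case (Cons a as)
  then obtain es where es: "set es \<subseteq> J" "set as \<subseteq> lead (add_gens (adjoin A t) es {\<zero>}) n" by auto
  obtain g where g: "a \<in> A" "g \<in> pols A t n" "g \<oplus> a \<otimes> t [^] n \<in> J" using Cons.prems unfolding lead_def by auto
  let ?e = "g \<oplus> a \<otimes> t [^] n"
  have K: "set (?e # es) \<subseteq> carrier K" using es(1) g(3) idlD(5)[OF J] by auto
  note s = add_gens_sup[OF adjoin_subring K smod_zero[OF adjoin_subring]]
  have s0: "smod (adjoin A t) (add_gens (adjoin A t) es {\<zero>})" using add_gens_smod[OF adjoin_subring _ smod_zero[OF adjoin_subring]] K by simp
  have eK: "?e \<in> carrier K" using K by simp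
  have "?e \<in> add_gens (adjoin A t) (?e # es) {\<zero>}" "add_gens (adjoin A t) es {\<zero>} \<subseteq> add_gens (adjoin A t) (?e # es) {\<zero>}"
    using s(2) add_gen_sup(1)[OF adjoin_subring eK s0] by auto
  then have "a \<in> lead (add_gens (adjoin A t) (?e # es) {\<zero>}) n" "set as \<subseteq> lead (add_gens (adjoin A t) (?e # es) {\<zero>}) n"
    using es(2) lead_mono[of "add_gens (adjoin A t) es {\<zero>}" "add_gens (adjoin A t) (?e # es) {\<zero>}" n] g unfolding lead_def by blast+
  then have "set (a # as) \<subseteq> lead (add_gens (adjoin A t) (?e # es) {\<zero>}) n" by simp
  then show ?case using es(1) g(3) by (intro exI[of _ "?e # es"]) simp
qed

text \<open>
  The ideals \<open>lead J n\<close> increase with \<open>n\<close> and become stationary, so finitely many members of \<open>J\<close> realize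
  generators of all of them; by \<open>lead_sub\<close> these members generate \<open>J\<close>.
\<close>

theorem hilbert_basis: assumes n: "noeth A" shows "noeth (adjoin A t)"
  unfolding noeth_def
proof (intro allI impI)
  fix J assume J: "idl (adjoin A t) J"
  have adm: "add_gens (adjoin A t) es {\<zero>} \<subseteq> add_gens (adjoin A t) fs {\<zero>}" if "set es \<subseteq> set fs" "set fs \<subseteq> J" for es fs
  proof -
    have K: "set fs \<subseteq> carrier K" using that(2) idlD(5)[OF J] by blast
    show ?thesis using add_gens_mono[OF adjoin_subring K smod_zero[OF adjoin_subring]] add_gens_sup[OF adjoin_subring K smod_zero[OF adjoin_subring]] that(1) by blast
  qed
  have adi: "idl (adjoin A t) (add_gens (adjoin A t) es {\<zero>})" if "set es \<subseteq> J" for es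
    using add_gens_idl[OF adjoin_subring _ idl_zero[OF adjoin_subring]] that idlD(2)[OF J] by blast
  have one: "\<exists>es. set es \<subseteq> J \<and> lead J k \<subseteq> lead (add_gens (adjoin A t) es {\<zero>}) k" for k
  proof -
    obtain as where as: "set as \<subseteq> A" "lead J k = add_gens A as {\<zero>}" using n lead_idl[OF J] unfolding noeth_def by blast
    have "set as \<subseteq> lead J k" unfolding as(2) using add_gens_sup(2)[OF A _ smod_zero[OF A]] as(1) subringD(1)[OF A] by blast
    then obtain es where es: "set es \<subseteq> J" "set as \<subseteq> lead (add_gens (adjoin A t) es {\<zero>}) k" using lead_gens[OF J] by blast
    have i: "idl A (lead (add_gens (adjoin A t) es {\<zero>}) k)" using lead_idl[OF adi[OF es(1)]] .
    have "lead J k \<subseteq> lead (add_gens (adjoin A t) es {\<zero>}) k" unfolding as(2) using add_gens_least[OF idlD(1)[OF i] es(2)] idlD(3)[OF i] by blast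
    then show ?thesis using es(1) by blast
  qed
  have many: "\<exists>es. set es \<subseteq> J \<and> (\<forall>k\<le>N. lead J k \<subseteq> lead (add_gens (adjoin A t) es {\<zero>}) k)" for N
  proof (induction N)
    case 0 then show ?case using one[of 0] by auto
  next
    case (Suc N)
    then obtain es where es: "set es \<subseteq> J" "\<forall>k\<le>N. lead J k \<subseteq> lead (add_gens (adjoin A t) es {\<zero>}) k" by blast
    obtain fs where fs: "set fs \<subseteq> J" "lead J (Suc N) \<subseteq> lead (add_gens (adjoin A t) fs {\<zero>}) (Suc N)" using one by blast
    have "lead J k \<subseteq> lead (add_gens (adjoin A t) (es @ fs) {\<zero>}) k" if k: "k \<le> Suc N" for k
    proof (cases "k = Suc N")
      case True then show ?thesis using fs lead_mono[OF adm[of fs "es @ fs"]] es(1) by auto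
    next
      case False
      then have "lead J k \<subseteq> lead (add_gens (adjoin A t) es {\<zero>}) k" using es(2) k by simp
      then show ?thesis using lead_mono[OF adm[of es "es @ fs"], of k] es(1) fs(1) by auto
    qed
    then show ?case using es(1) fs(1) by (intro exI[of _ "es @ fs"]) simp
  qed
  obtain N where N: "\<forall>m\<ge>N. lead J m = lead J N"
    using noeth_acc[OF A n, where f = "lead J", OF lead_idl[OF J] lead_Suc[OF J]] by blast
  obtain es where es: "set es \<subseteq> J" "\<forall>k\<le>N. lead J k \<subseteq> lead (add_gens (adjoin A t) es {\<zero>}) k" using many by blast
  let ?G = "add_gens (adjoin A t) es {\<zero>}"
  have G: "idl (adjoin A t) ?G" using adi[OF es(1)] .
  have GJ: "?G \<subseteq> J" using add_gens_least[OF idlD(1)[OF J] es(1)] idlD(3)[OF J] by blast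
  have "lead J k \<subseteq> lead ?G k" for k
  proof (cases "k \<le> N")
    case False
    then have "N \<le> k" by simp
    then have "lead ?G N \<subseteq> lead ?G k" using lift_Suc_mono_le[of "lead ?G", OF lead_Suc[OF G]] by blast
    then show ?thesis using es(2) N \<open>N \<le> k\<close> by blast
  qed (use es in blast)
  then have "J = ?G" using lead_sub[OF J G GJ] GJ by blast
  then show "\<exists>xs. set xs \<subseteq> (adjoin A t) \<and> J = add_gens (adjoin A t) xs {\<zero>}" using es(1) idlD(2)[OF J] by blast
qed

end

section \<open>Centres of a local overring\<close>

text \<open>The localization of \<open>B\<close> at the centre of \<open>V\<close>.\<close>

definition LocV :: "'a set \<Rightarrow> 'a set \<Rightarrow> 'a set" where
  "LocV V B = locI B (mx V \<inter> B) B"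

lemma centre_prm: "lcl V \<Longrightarrow> subring B K \<Longrightarrow> B \<subseteq> V \<Longrightarrow> prm B (mx V \<inter> B)"
  using prm_contract prm_mx by blast

lemma LocV_iff: "z \<in> LocV V B \<longleftrightarrow> z \<in> carrier K \<and> (\<exists>s\<in>B. s \<notin> mx V \<and> z \<otimes> s \<in> B)"
  unfolding LocV_def locI_def by blast

lemma LocV_facts: assumes V: "lcl V" and B: "subring B K" "B \<subseteq> V"
  shows "lcl (LocV V B)" "subring (LocV V B) K" "B \<subseteq> LocV V B" "LocV V B \<subseteq> V" "mx (LocV V B) \<subseteq> mx V"
    "mx (LocV V B) = locI B (mx V \<inter> B) (mx V \<inter> B)"
proof -
  note p = centre_prm[OF assms]
  show 1: "lcl (LocV V B)" unfolding LocV_def using loc_lcl[OF B(1) p] .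
  show "subring (LocV V B) K" using lclD(1)[OF 1] .
  show "B \<subseteq> LocV V B" unfolding LocV_def using loc_sup[OF B(1) p] .
  show m: "mx (LocV V B) = locI B (mx V \<inter> B) (mx V \<inter> B)" unfolding LocV_def using mx_loc[OF B(1) p] .
  have u: "z \<in> M" if M: "smod V M" and s: "z \<in> carrier K" "s \<in> B" "s \<notin> mx V" "z \<otimes> s \<in> M" for z s M
  proof -
    have "s \<otimes> z \<in> M" using s(4) m_comm[OF s(1) subringD(4)[OF B(1) s(2)]] by simp
    then show ?thesis using unit_cancel[OF lclD(1)[OF V] M _ s(3) s(1)] s(2) B(2) by blast
  qed
  show "LocV V B \<subseteq> V"
  proof
    fix z assume "z \<in> LocV V B"
    then obtain s where s: "z \<in> carrier K" "s \<in> B" "s \<notin> mx V" "z \<otimes> s \<in> V" using B(2) unfolding LocV_iff by blast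
    show "z \<in> V" by (rule u[OF smod_self[OF lclD(1)[OF V]] s])
  qed
  show "mx (LocV V B) \<subseteq> mx V"
  proof
    fix z assume "z \<in> mx (LocV V B)"
    then have "z \<in> locI B (mx V \<inter> B) (mx V \<inter> B)" using m by simp
    then obtain s where s: "z \<in> carrier K" "s \<in> B" "s \<notin> mx V" "z \<otimes> s \<in> mx V" unfolding locI_def by blast
    show "z \<in> mx V" by (rule u[OF idlD(1)[OF lclD(2)[OF V]] s])
  qed
qed

lemma LocV_mono: "B \<subseteq> C \<Longrightarrow> LocV V B \<subseteq> LocV V C" unfolding LocV_iff subset_iff by blast

text \<open>
  Together with monotonicity this makes \<open>LocV V\<close> a closure operator, so that adjoining several elements and localizing
  once is the same as localizing after each of them.
\<close>

lemma LocV_idem: assumes V: "lcl V" and B: "subring B K" "B \<subseteq> V" shows "LocV V (LocV V B) = LocV V B"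
proof
  note F = LocV_facts[OF assms]
  show "LocV V B \<subseteq> LocV V (LocV V B)" using LocV_facts(3)[OF V F(2,4)] .
  show "LocV V (LocV V B) \<subseteq> LocV V B"
  proof
    fix z assume "z \<in> LocV V (LocV V B)"
    from iffD1[OF LocV_iff this]
    obtain s where s: "z \<in> carrier K" "s \<in> LocV V B" "s \<notin> mx V" "z \<otimes> s \<in> LocV V B" by blast
    obtain u where u: "s \<in> carrier K" "u \<in> B" "u \<notin> mx V" "s \<otimes> u \<in> B" using s(2) unfolding LocV_iff by blast
    obtain w where w: "w \<in> B" "w \<notin> mx V" "(z \<otimes> s) \<otimes> w \<in> B" using s(4) unfolding LocV_iff by blast
    note c = subringD(4)[OF B(1) u(2)] subringD(4)[OF B(1) w(1)]
    have e: "z \<otimes> ((s \<otimes> u) \<otimes> w) = u \<otimes> ((z \<otimes> s) \<otimes> w)" using s(1) u(1) c by algebra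
    have "z \<otimes> ((s \<otimes> u) \<otimes> w) \<in> B" unfolding e using subringD(6)[OF B(1) u(2) w(3)] .
    moreover have "(s \<otimes> u) \<otimes> w \<in> B" using subringD(6)[OF B(1) u(4) w(1)] .
    moreover have "s \<otimes> u \<notin> mx V" using prmD(6)[OF prm_mx[OF V], of s u] s(2,3) u(2,3) B(2) F(4) by blast
    then have "(s \<otimes> u) \<otimes> w \<notin> mx V" using prmD(6)[OF prm_mx[OF V], of "s \<otimes> u" w] u(4) w(1,2) B(2) by blast
    ultimately show "z \<in> LocV V B" unfolding LocV_iff using s(1) by blast
  qed
qed

lemma dominated: assumes V: "lcl V" and A: "lcl A" "A \<subseteq> V" "mx A \<subseteq> mx V"
  shows "mx V \<inter> A = mx A" "LocV V A = A"
proof -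
  have u: "a \<in> mx A" if a: "a \<in> A" "a \<in> mx V" for a
  proof (rule ccontr)
    assume n: "a \<notin> mx A"
    obtain b where "b \<in> A" "a \<otimes> b = \<one>" using notin_mx[OF a(1) n] .
    then show False using a(2) A(2) unfolding mx_def by blast
  qed
  show 1: "mx V \<inter> A = mx A" using u A(3) unfolding mx_def by blast
  show "LocV V A = A"
  proof
    show "A \<subseteq> LocV V A" using LocV_facts(3)[OF V lclD(1)[OF A(1)] A(2)] .
    show "LocV V A \<subseteq> A"
    proof
      fix z assume "z \<in> LocV V A"
      then obtain s where s: "z \<in> carrier K" "s \<in> A" "s \<notin> mx V" "z \<otimes> s \<in> A" unfolding LocV_iff by blast
      have "s \<otimes> z \<in> A" using s(4) m_comm[OF s(1) subringD(4)[OF lclD(1)[OF A(1)] s(2)]] by simp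
      then show "z \<in> A" using unit_cancel[OF lclD(1)[OF A(1)] smod_self[OF lclD(1)[OF A(1)]] s(2) _ s(1)] s(3) A(3) by blast
    qed
  qed
qed

section \<open>Blowing up a regular local ring\<close>

context
  fixes A t x y assumes A: "subring A K" and t: "t \<in> carrier K" and x: "x \<in> A" "x \<noteq> \<zero>" and y: "y \<in> A" and tx: "t \<otimes> x = y"
    and px: "prm A (add_gens A [x] {\<zero>})" and yx: "y \<notin> add_gens A [x] {\<zero>}"
begin

lemma xy_carrier: "x \<in> carrier K" "y \<in> carrier K" using subringD(4)[OF A] x y by auto

lemma xA_iff: "z \<in> add_gens A [x] {\<zero>} \<longleftrightarrow> (\<exists>a\<in>A. z = x \<otimes> a)"
proof -
  have "a \<otimes> x \<oplus> \<zero> = x \<otimes> a" if "a \<in> A" for a using xy_carrier(1) subringD(4)[OF A that] m_comm by simp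
  then show ?thesis unfolding add_gens_Cons add_gens_Nil add_gen_iff by auto
qed

lemma xpow: "x [^] n \<otimes> t [^] n = y [^] (n::nat)"
proof -
  have "(t \<otimes> x) [^] n = t [^] n \<otimes> x [^] n" using nat_pow_distrib[OF t xy_carrier(1)] .
  then show ?thesis unfolding tx using m_comm[OF nat_pow_closed[OF t] nat_pow_closed[OF xy_carrier(1)]] by simp
qed

text \<open>A polynomial in \<open>t = y/x\<close> of degree less than \<open>n\<close> is divisible by \<open>x\<close> after multiplication by \<open>x\<^sup>n\<close>.\<close>

lemma clear_den: assumes c: "\<And>i. c i \<in> A" shows "\<exists>r\<in>A. x [^] n \<otimes> poly_val t c n = x \<otimes> r"
proof (induction n)
  case 0
  have "x [^] (0::nat) \<otimes> poly_val t c 0 = x \<otimes> \<zero>" using xy_carrier by simp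
  then show ?case using subringD(2)[OF A] by blast
next
  case (Suc n)
  then obtain r where r: "r \<in> A" "x [^] n \<otimes> poly_val t c n = x \<otimes> r" by blast
  have yn: "y [^] n \<in> A" using subringD(9)[OF A y] .
  have k: "x [^] n \<in> carrier K" "t [^] n \<in> carrier K" "poly_val t c n \<in> carrier K" "c n \<in> carrier K" "r \<in> carrier K" "y [^] n \<in> carrier K"
    using xy_carrier t subringD(4)[OF A c] subringD(4)[OF A r(1)] poly_val_closed[where c = c and n = n, OF t subringD(4)[OF A c]] by auto
  have "x [^] Suc n \<otimes> poly_val t c (Suc n) = x \<otimes> (x [^] n \<otimes> poly_val t c n) \<oplus> (x \<otimes> c n) \<otimes> (x [^] n \<otimes> t [^] n)"
    unfolding poly_val.simps nat_pow_Suc using k xy_carrier by algebra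
  also have "\<dots> = x \<otimes> (x \<otimes> r \<oplus> c n \<otimes> y [^] n)" unfolding r(2) xpow using k xy_carrier by algebra
  finally have "x [^] Suc n \<otimes> poly_val t c (Suc n) = x \<otimes> (x \<otimes> r \<oplus> c n \<otimes> y [^] n)" .
  moreover have "x \<otimes> r \<oplus> c n \<otimes> y [^] n \<in> A" using subringD(7)[OF A subringD(6)[OF A x(1) r(1)] subringD(6)[OF A c yn]] .
  ultimately show ?case by blast
qed

text \<open>
  Modulo \<open>(x, y)\<close> the element \<open>t = y/x\<close> satisfies no relation. Clearing denominators in a relation of degree
  \<open>n\<close> gives \<open>c\<^sub>n y\<^sup>n \<in> (x)\<close>, hence \<open>c\<^sub>n = bx\<close> because \<open>(x)\<close> is prime and does not contain \<open>y\<close>;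
  then \<open>c\<^sub>n t\<^sup>n = by t\<^sup>n\<^sup>-\<^sup>1\<close> moves into the next lower coefficient.
\<close>

lemma zero_relation_coeffs: "(\<And>i. c i \<in> A) \<Longrightarrow> poly_val t c n = \<zero> \<Longrightarrow> i < n \<Longrightarrow> c i \<in> add_gens A [x, y] {\<zero>}"
proof (induction n arbitrary: c i)
  case (Suc n)
  note c = Suc.prems(1)
  have s: "smod A (add_gens A [x, y] {\<zero>})" using add_gens_smod[OF A _ smod_zero[OF A], of "[x, y]"] xy_carrier by simp
  have sp: "x \<in> add_gens A [x, y] {\<zero>}" "y \<in> add_gens A [x, y] {\<zero>}" using add_gens_sup(2)[OF A _ smod_zero[OF A], of "[x, y]"] xy_carrier by auto
  have k: "poly_val t c n \<in> carrier K" "c n \<in> carrier K" "x [^] n \<in> carrier K" "t [^] n \<in> carrier K" "y [^] n \<in> carrier K"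
    using xy_carrier t subringD(4)[OF A c] poly_val_closed[where c = c and n = n, OF t subringD(4)[OF A c]] by auto
  have z: "poly_val t c n \<oplus> c n \<otimes> t [^] n = \<zero>" using Suc.prems(2) by simp
  obtain r where r: "r \<in> A" "x [^] n \<otimes> poly_val t c n = x \<otimes> r" using clear_den[where c = c and n = n, OF c] by blast
  have rK: "r \<in> carrier K" using subringD(4)[OF A r(1)] .
  have "c n \<otimes> y [^] n = x [^] n \<otimes> (poly_val t c n \<oplus> c n \<otimes> t [^] n) \<ominus> x [^] n \<otimes> poly_val t c n"
    unfolding xpow[symmetric] using k by algebra
  also have "\<dots> = x \<otimes> (\<ominus> r)" unfolding z r(2) using k xy_carrier rK by algebra
  finally have "c n \<otimes> y [^] n \<in> add_gens A [x] {\<zero>}" unfolding xA_iff using subringD(5)[OF A r(1)] by blast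
  then have "c n \<in> add_gens A [x] {\<zero>}" using prmD(6)[OF px c subringD(9)[OF A y]] prm_pow[OF A px y] yx by blast
  then obtain b where b: "b \<in> A" "c n = x \<otimes> b" unfolding xA_iff by blast
  have bK: "b \<in> carrier K" using subringD(4)[OF A b(1)] .
  have cn: "c n \<in> add_gens A [x, y] {\<zero>}" unfolding b(2) using smodD(5)[OF s b(1) sp(1)] m_comm[OF xy_carrier(1) bK] by simp
  show ?case
  proof (cases n)
    case 0 then show ?thesis using cn Suc.prems(3) by simp
  next
    case (Suc m)
    \<comment> \<open>\<open>c\<^sub>n t\<^sup>n = b y t\<^sup>m\<close>\<close>
    define d where "d = c(m := c m \<oplus> b \<otimes> y)"
    have dA: "d i \<in> A" for i unfolding d_def using c subringD(7)[OF A c subringD(6)[OF A b(1) y]] by simp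
    have k2: "t [^] m \<in> carrier K" "c m \<in> carrier K" "poly_val t c m \<in> carrier K" using t subringD(4)[OF A c] poly_val_closed[where c = c and n = m, OF t subringD(4)[OF A c]] by auto
    have "poly_val t d m = poly_val t c m" by (rule poly_val_cong) (simp add: d_def)
    then have "poly_val t d n = poly_val t c m \<oplus> (c m \<oplus> b \<otimes> (t \<otimes> x)) \<otimes> t [^] m" unfolding Suc tx by (simp add: d_def)
    also have "\<dots> = (poly_val t c m \<oplus> c m \<otimes> t [^] m) \<oplus> (x \<otimes> b) \<otimes> (t [^] m \<otimes> t)" using k2 bK xy_carrier t by algebra
    also have "\<dots> = \<zero>" using z unfolding b(2)[symmetric] Suc by simp
    finally have "poly_val t d n = \<zero>" .
    then have ih: "d i \<in> add_gens A [x, y] {\<zero>}" if "i < n" for i using Suc.IH[of d i, OF dA _ that] by blast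
    have "c i \<in> add_gens A [x, y] {\<zero>}" if "i < n" for i
    proof (cases "i = m")
      case False then show ?thesis using ih[OF that] unfolding d_def by simp
    next
      case True
      have "c m \<oplus> b \<otimes> y \<in> add_gens A [x, y] {\<zero>}" using ih[of m] Suc unfolding d_def by simp
      then show ?thesis unfolding True using smod_addR[OF A s k2(2) smodD(5)[OF s b(1) sp(2)]] by blast
    qed
    then show ?thesis using cn Suc.prems(3) less_Suc_eq by blast
  qed
qed simp

context
  fixes p assumes p: "idl A p" and xp: "x \<in> p" and yp: "y \<in> p"
begin

text \<open>
  For an ideal \<open>p\<close> containing \<open>x\<close> and \<open>y\<close> the previous lemma says that \<open>A[t]/pA[t]\<close> is the
  polynomial ring over \<open>A/p\<close>; this is the form in which it is used.
\<close>

lemma leading_coeff_mem: assumes "a \<in> A" "g \<in> pols A t n" "g \<oplus> a \<otimes> t [^] n \<in> adjoin p t" shows "a \<in> p"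
proof -
  obtain c where c: "\<And>i. c i \<in> A" "g = poly_val t c n" using assms(2) unfolding pols_def by blast
  obtain d m where d: "\<And>i. d i \<in> p" "g \<oplus> a \<otimes> t [^] n = poly_val t d m" using assms(3) unfolding adjoin_def pols_def by blast
  have dA: "d i \<in> A" for i using d(1) idlD(2)[OF p] by blast
  define c' where "c' = c(n := a)"
  have c'A: "c' i \<in> A" for i unfolding c'_def using c(1) assms(1) by simp
  define N where "N = max m (Suc n)"
  define e where "e i = (if i < Suc n then c' i else \<zero>)" for i
  define f where "f i = \<ominus> \<one> \<otimes> (if i < m then d i else \<zero>)" for i
  have eA: "e i \<in> A" for i unfolding e_def using c'A subringD(2)[OF A] by simp
  have oA: "\<ominus> \<one> \<in> A" using subringD(3,5)[OF A] by blast
  have d'p: "(if i < m then d i else \<zero>) \<in> p" for i using d(1) idlD(3)[OF p] by simp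
  have d'K: "(if i < m then d i else \<zero>) \<in> carrier K" for i using d'p idlD(5)[OF p] by blast
  have fp: "f i \<in> p" for i unfolding f_def using idlD(7)[OF p oA d'p] .
  have fA: "f i \<in> A" for i using fp idlD(2)[OF p] by blast
  have "poly_val t c' n = poly_val t c n" by (rule poly_val_cong) (simp add: c'_def)
  then have "poly_val t c' (Suc n) = g \<oplus> a \<otimes> t [^] n" unfolding c(2) by (simp add: c'_def)
  then have 1: "poly_val t e N = g \<oplus> a \<otimes> t [^] n" unfolding e_def using poly_val_pad[where c = c' and n = "Suc n" and m = N, OF t subringD(4)[OF A c'A]] unfolding N_def by simp
  have "poly_val t (\<lambda>i. if i < m then d i else \<zero>) N = poly_val t d m" using poly_val_pad[where c = d and n = m and m = N, OF t subringD(4)[OF A dA]] unfolding N_def by simp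
  then have 2: "poly_val t f N = \<ominus> \<one> \<otimes> (g \<oplus> a \<otimes> t [^] n)" unfolding f_def using poly_val_smult[where c = "\<lambda>i. if i < m then d i else \<zero>" and a = "\<ominus> \<one>" and n = N, OF t d'K] d(2) by simp
  have gK: "g \<oplus> a \<otimes> t [^] n \<in> carrier K" unfolding d(2) by (rule poly_val_closed[OF t subringD(4)[OF A dA]])
  have "poly_val t (\<lambda>i. e i \<oplus> f i) N = \<zero>" unfolding poly_val_add[where c = e and d = f and n = N, OF t subringD(4)[OF A eA] subringD(4)[OF A fA]] 1 2 using gK by algebra
  then have "e n \<oplus> f n \<in> add_gens A [x, y] {\<zero>}" using zero_relation_coeffs[of "\<lambda>i. e i \<oplus> f i" N n] subringD(7)[OF A eA fA] unfolding N_def by simp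
  moreover have "add_gens A [x, y] {\<zero>} \<subseteq> p" using add_gens_least[OF idlD(1)[OF p], of "[x, y]" "{\<zero>}"] xp yp idlD(3)[OF p] by simp
  ultimately have "e n \<oplus> f n \<in> p" by blast
  then have "e n \<in> p" using smod_addR[OF A idlD(1)[OF p] subringD(4)[OF A eA] fp] by blast
  then show ?thesis unfolding e_def c'_def by simp
qed

lemma adjoin_contract: "adjoin p t \<inter> A = p"
proof
  show "p \<subseteq> adjoin p t \<inter> A" using adjoin_sup[OF A t idlD(1)[OF p]] idlD(2)[OF p] by blast
  show "adjoin p t \<inter> A \<subseteq> p"
  proof
    fix a assume a: "a \<in> adjoin p t \<inter> A"
    then have "\<zero> \<oplus> a \<otimes> t [^] (0::nat) \<in> adjoin p t" using subringD(4)[OF A, of a] by simp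
    then show "a \<in> p" using leading_coeff_mem[of a \<zero> 0] a pols_0[OF A t smod_self[OF A]] by simp
  qed
qed

lemma strip_leading: assumes "z \<in> pols A t n" "z \<notin> adjoin p t"
  shows "\<exists>k<n. \<exists>a\<in>A. a \<notin> p \<and> (\<exists>g\<in>pols A t k. \<exists>r\<in>adjoin p t. z = (g \<oplus> a \<otimes> t [^] k) \<oplus> r)"
  using assms
proof (induction n arbitrary: z)
  case 0
  have "\<zero> \<in> adjoin p t" using idlD(3)[OF adjoin_idl[OF A t p]] .
  then show ?case using 0 pols_0[OF A t smod_self[OF A]] by simp
next
  case (Suc n)
  note P = adjoin_idl[OF A t p]
  obtain g a where g: "g \<in> pols A t n" "a \<in> A" "z = g \<oplus> a \<otimes> t [^] n" using Suc.prems(1) unfolding pols_Suc[OF A t] by blast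
  have K: "g \<in> carrier K" "a \<otimes> t [^] n \<in> carrier K" "z \<in> carrier K"
    using pols_carrier[OF A t smod_self[OF A]] g(1) Suc.prems(1) subringD(4)[OF A g(2)] t by auto
  show ?case
  proof (cases "a \<in> p")
    case False
    have "z = (g \<oplus> a \<otimes> t [^] n) \<oplus> \<zero>" using g(3) K by simp
    then show ?thesis using False g(1,2) idlD(3)[OF P] by blast
  next
    case True
    have at: "a \<otimes> t [^] n \<in> adjoin p t" unfolding adjoin_iff[OF A t] using pols_monom[OF A t idlD(1)[OF p] True] by blast
    have "g \<notin> adjoin p t" using Suc.prems(2) idlD(6)[OF P _ at] unfolding g(3) by blast
    then obtain k b h r where h: "k < n" "b \<in> A" "b \<notin> p" "h \<in> pols A t k" "r \<in> adjoin p t" "g = (h \<oplus> b \<otimes> t [^] k) \<oplus> r" using Suc.IH[OF g(1)] by blast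
    have "h \<in> carrier K" "b \<in> carrier K" "r \<in> carrier K" using pols_carrier[OF A t smod_self[OF A] h(4)] subringD(4)[OF A h(2)] idlD(5)[OF P h(5)] by auto
    then have "z = (h \<oplus> b \<otimes> t [^] k) \<oplus> (r \<oplus> a \<otimes> t [^] n)" unfolding g(3) h(6) using K(2) t by (simp add: a_assoc)
    moreover have "r \<oplus> a \<otimes> t [^] n \<in> adjoin p t" using idlD(6)[OF P h(5) at] .
    ultimately show ?thesis using h(1-4) less_SucI by blast
  qed
qed

text \<open>As for polynomial rings: the product of two leading coefficients outside \<open>p\<close> is outside \<open>p\<close>.\<close>

lemma adjoin_prm: assumes pp: "prm A p" shows "prm (adjoin A t) (adjoin p t)"
  unfolding prm_def
proof (intro conjI ballI impI)
  note P = adjoin_idl[OF A t p]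
  note B = adjoin_subring[OF A t]
  show "idl (adjoin A t) (adjoin p t)" using P .
  show "\<one> \<notin> adjoin p t" using adjoin_contract subringD(3)[OF A] prmD(4)[OF pp] by blast
  fix z w assume zw: "z \<in> adjoin A t" "w \<in> adjoin A t" "z \<otimes> w \<in> adjoin p t"
  show "z \<in> adjoin p t \<or> w \<in> adjoin p t"
  proof (rule ccontr)
    assume n: "\<not> ?thesis"
    obtain k a g r where g: "a \<in> A" "a \<notin> p" "g \<in> pols A t k" "r \<in> adjoin p t" "z = (g \<oplus> a \<otimes> t [^] k) \<oplus> r"
      using strip_leading[of z] zw(1) n unfolding adjoin_iff[OF A t, of z A] by blast
    obtain l b h s where h: "b \<in> A" "b \<notin> p" "h \<in> pols A t l" "s \<in> adjoin p t" "w = (h \<oplus> b \<otimes> t [^] l) \<oplus> s"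
      using strip_leading[of w] zw(2) n unfolding adjoin_iff[OF A t, of w A] by blast
    have K: "g \<in> carrier K" "a \<in> carrier K" "h \<in> carrier K" "b \<in> carrier K" "r \<in> carrier K" "s \<in> carrier K" "w \<in> carrier K" "z \<in> carrier K"
      using pols_carrier[OF A t smod_self[OF A]] g h subringD(4)[OF A] idlD(5)[OF P] zw(1,2) subringD(4)[OF B] by auto
    have tk: "t [^] k \<in> carrier K" "t [^] l \<in> carrier K" using t by auto
    let ?u = "g \<oplus> a \<otimes> t [^] k" and ?v = "h \<oplus> b \<otimes> t [^] l"
    have "?u \<in> adjoin A t" using g(1,3) pols_Suc[OF A t] unfolding adjoin_iff[OF A t] by blast
    have "u \<otimes> v = ((u \<oplus> r) \<otimes> (v \<oplus> s) \<oplus> (\<ominus> r) \<otimes> (v \<oplus> s)) \<oplus> (\<ominus> u) \<otimes> s"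
      if "u \<in> carrier K" "v \<in> carrier K" for u v using that K(5,6) by algebra
    from this[of ?u ?v] have e: "?u \<otimes> ?v = (z \<otimes> w \<oplus> (\<ominus> r) \<otimes> w) \<oplus> (\<ominus> ?u) \<otimes> s"
      unfolding g(5)[symmetric] h(5)[symmetric] using K(1-4) tk by simp
    have "(\<ominus> r) \<otimes> w = (\<ominus> w) \<otimes> r" "(\<ominus> ?u) \<in> adjoin A t" using K subringD(5)[OF B \<open>?u \<in> adjoin A t\<close>] by (algebra, simp)
    then have "(\<ominus> r) \<otimes> w \<in> adjoin p t" "(\<ominus> ?u) \<otimes> s \<in> adjoin p t" using idlD(7)[OF P] subringD(5)[OF B zw(2)] g(4) h(4) by auto
    then have uv: "?u \<otimes> ?v \<in> adjoin p t" unfolding e using idlD(6)[OF P] zw(3) by blast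
    have tkl: "t [^] (k + l) = t [^] k \<otimes> t [^] l" using nat_pow_mult[OF t, of k l] by simp
    have e2: "?u \<otimes> ?v = (g \<otimes> h \<oplus> (b \<otimes> (t [^] l \<otimes> g) \<oplus> a \<otimes> (t [^] k \<otimes> h))) \<oplus> (a \<otimes> b) \<otimes> t [^] (k + l)"
      unfolding tkl using K tk by algebra
    note S = pols_smod[OF A t smod_self[OF A], of "k + l"]
    have "g \<otimes> h \<in> pols A t (k + l)" using pols_mult[OF A t smod_self[OF A] g(3) h(3)] .
    moreover have "b \<otimes> (t [^] l \<otimes> g) \<in> pols A t (k + l)" using smodD(5)[OF S h(1) pols_shift[OF A t smod_self[OF A] g(3), of l]] .
    moreover have "t [^] k \<otimes> h \<in> pols A t (k + l)" using pols_shift[OF A t smod_self[OF A] h(3), of k] by (simp add: add.commute)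
    then have "a \<otimes> (t [^] k \<otimes> h) \<in> pols A t (k + l)" using smodD(5)[OF S g(1)] by blast
    ultimately have "g \<otimes> h \<oplus> (b \<otimes> (t [^] l \<otimes> g) \<oplus> a \<otimes> (t [^] k \<otimes> h)) \<in> pols A t (k + l)" using smodD(4)[OF S] by blast
    then have "a \<otimes> b \<in> p" using leading_coeff_mem[OF subringD(6)[OF A g(1) h(1)]] uv unfolding e2 by blast
    then show False using prmD(6)[OF pp g(1) h(1)] g(2) h(2) by blast
  qed
qed

end

text \<open>The generator \<open>y = tx\<close> becomes redundant in \<open>A[t]\<close>.\<close>

lemma adjoin_add_gens: assumes ys: "set ys \<subseteq> A" shows "adjoin (add_gens A (x # y # ys) {\<zero>}) t = add_gens (adjoin A t) (x # ys) {\<zero>}"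
proof
  note B = adjoin_subring[OF A t]
  let ?p = "add_gens A (x # y # ys) {\<zero>}"
  have K: "set (x # y # ys) \<subseteq> carrier K" "set (x # ys) \<subseteq> carrier K" using ys xy_carrier subringD(4)[OF A] by auto
  have S: "smod (adjoin A t) (add_gens (adjoin A t) (x # ys) {\<zero>})" using add_gens_smod[OF B K(2) smod_zero[OF B]] .
  note sup = add_gens_sup[OF B K(2) smod_zero[OF B]]
  have "t \<otimes> x \<in> add_gens (adjoin A t) (x # ys) {\<zero>}" using smodD(5)[OF S adjoin_elem[OF A t]] sup(2) by auto
  then have "?p \<subseteq> add_gens (adjoin A t) (x # ys) {\<zero>}"
    by (intro add_gens_least[OF smod_mono[OF S adjoin_base[OF A t]]]) (use sup tx in auto)
  then show "adjoin ?p t \<subseteq> add_gens (adjoin A t) (x # ys) {\<zero>}" using adjoin_least[OF A t S B adjoin_elem[OF A t]] by blast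
  have sp: "smod A ?p" using add_gens_smod[OF A K(1) smod_zero[OF A]] .
  show "add_gens (adjoin A t) (x # ys) {\<zero>} \<subseteq> adjoin ?p t"
    by (rule add_gens_least[OF adjoin_smod[OF A t sp]])
      (use add_gens_sup[OF A K(1) smod_zero[OF A]] adjoin_sup[OF A t sp] in auto)
qed

end

text \<open>
  One step of the blow-up. Let \<open>t = y/x\<close>. The primes \<open>(x, y, z\<^sub>1, \<dots>, z\<^sub>i)\<close> of \<open>A\<close> extend to the primes
  \<open>(x, z\<^sub>1, \<dots>, z\<^sub>i)\<close> of \<open>A[t]\<close>, and these lie in the centre \<open>q\<close> of \<open>V\<close>. Modulo the extension of the
  maximal ideal, \<open>A[t]\<close> is a polynomial ring in one variable over the residue field, so \<open>q\<close> is either that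
  extension or needs exactly one more generator, a monic polynomial in \<open>t\<close> of least degree.
\<close>

lemma blowup_step:
  assumes V: "lcl V" and r: "reg A (x # y # zs)" and AV: "A \<subseteq> V" "mx A \<subseteq> mx V" and t: "t \<in> V" and tx: "t \<otimes> x = y"
  shows "\<exists>ws. reg (LocV V (adjoin A t)) (x # zs @ ws)"
proof -
  have lA: "lcl A" and nA: "noeth A" and xs: "x \<in> A" "y \<in> A" "set zs \<subseteq> A" and m: "mx A = add_gens A (x # y # zs) {\<zero>}"
    and pr: "\<And>us z vs. x # y # zs = us @ z # vs \<Longrightarrow> prm A (add_gens A us {\<zero>}) \<and> z \<notin> add_gens A us {\<zero>}"
    using r unfolding reg_def by auto
  note A = lclD(1)[OF lA]
  note ac = subringD(4)[OF A]
  have tK: "t \<in> carrier K" using subringD(4)[OF lclD(1)[OF V] t] .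
  have x0: "x \<noteq> \<zero>" "prm A {\<zero>}" using pr[of "[]" x "y # zs"] by auto
  have px: "prm A (add_gens A [x] {\<zero>})" "y \<notin> add_gens A [x] {\<zero>}" using pr[of "[x]" y zs] by auto
  define B where "B = adjoin A t"
  have B: "subring B K" unfolding B_def using adjoin_subring[OF A tK] .
  have AB: "A \<subseteq> B" unfolding B_def using adjoin_base[OF A tK] .
  have BV: "B \<subseteq> V" unfolding B_def using adjoin_minimal[OF A tK lclD(1)[OF V] AV(1) t] .
  define q where "q = mx V \<inter> B"
  have q: "prm B q" unfolding q_def using centre_prm[OF V B BV] .
  define A' where "A' = LocV V B"
  have A'q: "A' = locI B q B" unfolding A'_def LocV_def q_def ..
  note F = LocV_facts[OF V B BV, folded A'_def]
  have nA': "noeth A'" unfolding A'q using noeth_loc[OF B q] hilbert_basis[OF A tK nA] unfolding B_def by blast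
  note ctx = A tK xs(1) x0(1) xs(2) tx px
  let ?p = "\<lambda>ys. add_gens A (x # y # ys) {\<zero>}"
  have pi: "idl A (?p ys)" "x \<in> ?p ys" "y \<in> ?p ys" if "set ys \<subseteq> A" for ys
  proof -
    show "idl A (?p ys)" using add_gens_idl[where xs = "x # y # ys", OF A _ idl_zero[OF A]] xs that by simp
    show "x \<in> ?p ys" "y \<in> ?p ys" using add_gens_sup(2)[OF A _ smod_zero[OF A], of "x # y # ys"] xs that ac by auto
  qed
  have eq: "adjoin (?p ys) t = add_gens B (x # ys) {\<zero>}" if "set ys \<subseteq> A" for ys unfolding B_def using adjoin_add_gens[OF ctx that] .
  have eq': "locI B q (adjoin (?p ys) t) = add_gens A' (x # ys) {\<zero>}" if "set ys \<subseteq> A" for ys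
    unfolding eq[OF that] A'q using locI_add_gens[OF B q _ smod_zero[OF B], of "x # ys"] locI_zero[OF B q] that xs ac by auto
  have pm: "?p ys \<subseteq> mx A" if "set ys \<subseteq> set zs" for ys
    unfolding m using add_gens_mono[OF A _ smod_zero[OF A], of "x # y # zs" "x # y # ys" "{\<zero>}"] add_gens_sup[OF A _ smod_zero[OF A], of "x # y # zs"] xs ac that by auto
  have Pq: "adjoin (?p ys) t \<subseteq> q" if "set ys \<subseteq> set zs" for ys
  proof -
    have "?p ys \<subseteq> q" using pm[OF that] AV(2) AB unfolding q_def mx_def[of A] by blast
    then show ?thesis using adjoin_least[OF A tK prmD(2)[OF q] B] adjoin_elem[OF A tK] unfolding B_def by blast
  qed
  have prm': "prm A' (add_gens A' (x # ys) {\<zero>})" "add_gens A' (x # ys) {\<zero>} \<inter> B = adjoin (?p ys) t"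
    if "prm A (?p ys)" "set ys \<subseteq> set zs" for ys
  proof -
    have ysA: "set ys \<subseteq> A" using that xs(3) by blast
    have P: "prm B (adjoin (?p ys) t)" unfolding B_def using adjoin_prm[OF ctx pi[OF ysA] that(1)] .
    show "prm A' (add_gens A' (x # ys) {\<zero>})" using loc_prm[OF B q P Pq[OF that(2)]] by (simp only: eq'[OF ysA] A'q[symmetric])
    show "add_gens A' (x # ys) {\<zero>} \<inter> B = adjoin (?p ys) t" unfolding eq'[OF ysA, symmetric] using locI_contract[OF B q P Pq[OF that(2)]] .
  qed
  have z0: "prm A' (add_gens A' [] {\<zero>})"
  proof -
    have "prm A' (locI B q {\<zero>})" unfolding A'q using loc_prm[OF B q prm_zero[OF B]] prmD(5)[OF q] by blast
    then show ?thesis using locI_zero[OF B q] by simp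
  qed
  have split: "prm A' (add_gens A' us {\<zero>}) \<and> z \<notin> add_gens A' us {\<zero>}" if e: "x # zs = us @ z # vs" for us z vs
  proof (cases us)
    case Nil then show ?thesis using z0 e x0 by simp
  next
    case (Cons u ys)
    then have e': "x # y # zs = (x # y # ys) @ z # vs" "u = x" "set ys \<subseteq> set zs" "z \<in> set zs" using e by auto
    note P = pr[OF e'(1)]
    have "z \<in> A" "set ys \<subseteq> A" using e'(3,4) xs(3) by auto
    then have "z \<notin> adjoin (?p ys) t" using adjoin_contract[OF ctx pi[OF \<open>set ys \<subseteq> A\<close>]] P by blast
    moreover have "z \<in> B" using \<open>z \<in> A\<close> AB by blast
    ultimately have "z \<notin> add_gens A' (x # ys) {\<zero>}" using prm'(2)[OF conjunct1[OF P] e'(3)] by blast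
    then show ?thesis using prm'(1)[OF conjunct1[OF P] e'(3)] Cons e'(2) by simp
  qed
  have mA': "mx A' = locI B q q" unfolding F(6) q_def ..
  have PM: "adjoin (mx A) t = add_gens B (x # zs) {\<zero>}" using eq[OF xs(3)] m by simp
  have PM': "locI B q (adjoin (mx A) t) = add_gens A' (x # zs) {\<zero>}" using eq'[OF xs(3)] m by simp
  have xsA': "set (x # zs) \<subseteq> A'" using xs AB F(3) by auto
  show ?thesis
  proof (cases "q = adjoin (mx A) t")
    case True
    then have "mx A' = add_gens A' (x # zs) {\<zero>}" using mA' PM' by simp
    then have "reg A' (x # zs @ [])" unfolding reg_def append_Nil2 using F(1) nA' xsA' split by blast
    then show ?thesis unfolding A'_def B_def by blast
  next
    case False
    note mi = lclD(2)[OF lA]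
    have xm: "x \<in> mx A" "y \<in> mx A" using pi[OF xs(3)] m by auto
    note cm = ctx mi xm
    have Pm: "adjoin (mx A) t \<subseteq> q" using Pq[OF subset_refl] m by simp
    \<comment> \<open>degrees of monic polynomials whose value at \<open>t\<close> lies in the centre\<close>
    define mon where "mon k \<longleftrightarrow> (\<exists>g\<in>pols A t k. g \<oplus> t [^] k \<in> q)" for k
    have monic: "\<exists>k<n. mon k" if z: "z \<in> pols A t n" "z \<in> q" "z \<notin> adjoin (mx A) t" for z n
    proof -
      obtain k a g s where g: "k < n" "a \<in> A" "a \<notin> mx A" "g \<in> pols A t k" "s \<in> adjoin (mx A) t" "z = (g \<oplus> a \<otimes> t [^] k) \<oplus> s"
        using strip_leading[OF cm z(1,3)] by blast
      obtain b where b: "b \<in> A" "a \<otimes> b = \<one>" using notin_mx[OF g(2,3)] .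
      have K: "g \<in> carrier K" "a \<in> carrier K" "b \<in> carrier K" "t [^] k \<in> carrier K" "s \<in> carrier K"
        using pols_carrier[OF A tK smod_self[OF A] g(4)] ac[OF g(2)] ac[OF b(1)] tK g(5) Pm smodD(3)[OF prmD(2)[OF q]] by auto
      have sq: "s \<in> q" using g(5) Pm by blast
      have "(g \<oplus> a \<otimes> t [^] k) \<oplus> s \<in> q" using z(2) g(6) by simp
      then have 1: "g \<oplus> a \<otimes> t [^] k \<in> q" using smod_addR[OF B prmD(2)[OF q] _ sq] K by simp
      have bB: "b \<in> B" using b(1) AB by blast
      have "b \<otimes> (g \<oplus> a \<otimes> t [^] k) = b \<otimes> g \<oplus> (a \<otimes> b) \<otimes> t [^] k" using K by algebra
      also have "\<dots> = b \<otimes> g \<oplus> t [^] k" using b(2) K by simp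
      finally have "b \<otimes> g \<oplus> t [^] k \<in> q" using smodD(5)[OF prmD(2)[OF q] bB 1] by simp
      moreover have "b \<otimes> g \<in> pols A t k" using smodD(5)[OF pols_smod[OF A tK smod_self[OF A]] b(1) g(4)] .
      ultimately show ?thesis unfolding mon_def using g(1) by blast
    qed
    obtain z where z: "z \<in> q" "z \<notin> adjoin (mx A) t" using False Pm by blast
    then have "z \<in> B" using prmD(3)[OF q] by blast
    then have "\<exists>k. mon k" using monic[OF _ z] unfolding B_def adjoin_iff[OF A tK] by blast
    define k where "k = (LEAST k. mon k)"
    have mk: "mon k" unfolding k_def using LeastI_ex[OF \<open>\<exists>k. mon k\<close>] .
    have kmin: "\<not> mon j" if "j < k" for j using not_less_Least that unfolding k_def by blast
    obtain g where g: "g \<in> pols A t k" "g \<oplus> t [^] k \<in> q" using mk unfolding mon_def by blast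
    define f where "f = g \<oplus> t [^] k"
    have gK: "g \<in> carrier K" using pols_carrier[OF A tK smod_self[OF A] g(1)] .
    have tk: "t [^] n \<in> carrier K" for n :: nat using tK by simp
    have fK: "f \<in> carrier K" unfolding f_def using gK tk by simp
    have fq: "f \<in> q" unfolding f_def using g(2) .
    have fB: "f \<in> B" using fq prmD(3)[OF q] by blast
    have fn: "f \<notin> adjoin (mx A) t"
    proof
      assume "f \<in> adjoin (mx A) t"
      then have "g \<oplus> \<one> \<otimes> t [^] k \<in> adjoin (mx A) t" unfolding f_def using tk by simp
      then have "\<one> \<in> mx A" using leading_coeff_mem[OF cm subringD(3)[OF A] g(1)] by blast
      then show False using one_notin_mx[OF A] by blast
    qed
    have PMi: "idl B (adjoin (mx A) t)" unfolding B_def using adjoin_idl[OF A tK mi] .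
    have qsub: "z \<in> add_gen B f (adjoin (mx A) t)" if "z \<in> pols A t n" "z \<in> q" for z n using that
    proof (induction n arbitrary: z)
      case 0
      then have "z = \<zero>" using pols_0[OF A tK smod_self[OF A]] by simp
      then show ?case using smodD(2)[OF add_gen_smod[OF B fK idlD(1)[OF PMi]]] by simp
    next
      case (Suc n)
      show ?case
      proof (cases "n < k")
        case True
        have "z \<in> adjoin (mx A) t"
        proof (rule ccontr)
          assume "z \<notin> adjoin (mx A) t"
          then obtain j where "j < Suc n" "mon j" using monic[OF Suc.prems] by blast
          then show False using kmin[of j] True by simp
        qed
        then show ?thesis using add_gen_sup(1)[OF B fK idlD(1)[OF PMi]] by blast
      next
        case False
        then obtain l where l: "n = k + l" using le_Suc_ex by (metis not_less)
        obtain h a where h: "h \<in> pols A t n" "a \<in> A" "z = h \<oplus> a \<otimes> t [^] n" using Suc.prems(1) unfolding pols_Suc[OF A tK] by blast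
        have hK: "h \<in> carrier K" "a \<in> carrier K" using pols_carrier[OF A tK smod_self[OF A] h(1)] ac[OF h(2)] by auto
        have tn: "t [^] n = t [^] l \<otimes> t [^] k" unfolding l using nat_pow_mult[OF tK, of l k] by (simp add: add.commute)
        let ?w = "h \<ominus> a \<otimes> (t [^] l \<otimes> g)"
        have e: "z = (a \<otimes> t [^] l) \<otimes> f \<oplus> ?w" unfolding h(3) tn f_def using hK gK tk[of l] tk[of k] by algebra
        have "t [^] l \<otimes> g \<in> pols A t n" unfolding l using pols_shift[OF A tK smod_self[OF A] g(1)] .
        then have w: "?w \<in> pols A t n" using smod_minus[OF A pols_smod[OF A tK smod_self[OF A]] h(1)] smodD(5)[OF pols_smod[OF A tK smod_self[OF A]] h(2)] by blast
        have tB: "t [^] l \<in> B" using subringD(9)[OF B] adjoin_elem[OF A tK] unfolding B_def by blast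
        have atB: "a \<otimes> t [^] l \<in> B" using subringD(6)[OF B _ tB] h(2) AB by blast
        have wK: "?w \<in> carrier K" using pols_carrier[OF A tK smod_self[OF A] w] .
        have "(a \<otimes> t [^] l) \<otimes> f \<in> q" using smodD(5)[OF prmD(2)[OF q] atB fq] .
        then have "?w \<in> q" using smod_addL[OF B prmD(2)[OF q] wK, of "(a \<otimes> t [^] l) \<otimes> f"] Suc.prems(2) unfolding e by blast
        then have "?w \<in> add_gen B f (adjoin (mx A) t)" using Suc.IH[OF w] by blast
        moreover have "(a \<otimes> t [^] l) \<otimes> f \<in> add_gen B f (adjoin (mx A) t)"
          using smodD(5)[OF add_gen_smod[OF B fK idlD(1)[OF PMi]] atB add_gen_sup(2)[OF B fK idlD(1)[OF PMi]]] .
        ultimately show ?thesis unfolding e using smodD(4)[OF add_gen_smod[OF B fK idlD(1)[OF PMi]]] by blast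
      qed
    qed
    have "q = add_gen B f (adjoin (mx A) t)"
    proof
      show "q \<subseteq> add_gen B f (adjoin (mx A) t)"
      proof
        fix z assume z: "z \<in> q"
        then obtain n where "z \<in> pols A t n" using prmD(3)[OF q] unfolding B_def adjoin_def by blast
        then show "z \<in> add_gen B f (adjoin (mx A) t)" using qsub z by blast
      qed
      show "add_gen B f (adjoin (mx A) t) \<subseteq> q" using add_gen_least[OF prmD(2)[OF q] fq Pm] .
    qed
    then have qa: "q = add_gens B (f # x # zs) {\<zero>}" unfolding PM by simp
    have fA': "f \<in> A'" using fB F(3) by blast
    have "mx A' = add_gens A' (f # x # zs) {\<zero>}" unfolding mA' qa using locI_add_gens[OF B q _ smod_zero[OF B], of "f # x # zs"] locI_zero[OF B q] fK xs ac
      unfolding A'q qa by auto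
    also have "\<dots> = add_gens A' (x # zs @ [f]) {\<zero>}"
      by (rule add_gens_perm[OF F(2) _ smod_zero[OF F(2)]]) (use fK xs ac in auto)
    finally have mA'f: "mx A' = add_gens A' (x # zs @ [f]) {\<zero>}" .
    have "prm A' (add_gens A' us {\<zero>}) \<and> z \<notin> add_gens A' us {\<zero>}" if e: "x # zs @ [f] = us @ z # vs" for us z vs
    proof (cases vs rule: rev_cases)
      case Nil
      then have e': "us = x # zs" "z = f" using e by (metis append_Cons append1_eq_conv)+
      have "prm A (?p zs)" using prm_mx[OF lA] m by simp
      note P = prm'[OF this subset_refl]
      show ?thesis unfolding e' using P fn fB m by auto
    next
      case (snoc vs' w)
      then have "x # zs = us @ z # vs'" using e by (metis append_Cons append_assoc append1_eq_conv)
      then show ?thesis using split by blast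
    qed
    then have "reg A' (x # zs @ [f])" unfolding reg_def using F(1) nA' xsA' fA' mA'f by auto
    then show ?thesis unfolding A'_def B_def by blast
  qed
qed

lemma gen_facts: assumes "H \<subseteq> carrier K"
  shows "subring (generate_ring K H) K" "H \<subseteq> generate_ring K H" "\<And>D. subring D K \<Longrightarrow> H \<subseteq> D \<Longrightarrow> generate_ring K H \<subseteq> D"
  using generate_ring_is_subring[OF assms] generate_ringE(2,3)[OF assms refl] by auto

lemma reg_hd: assumes "reg A (x # xs)" shows "x \<noteq> \<zero>"
proof -
  have "\<And>ys z zs. x # xs = ys @ z # zs \<Longrightarrow> z \<notin> add_gens A ys {\<zero>}" using assms unfolding reg_def by blast
  from this[of "[]" x xs] show ?thesis by simp
qed

text \<open>
  Processing the parameters one after the other. The monic polynomials produced on the way are appended at the end of the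
  list, so that the parameters still to be treated keep their position behind \<open>x\<close>.
\<close>

lemma blowup_iter:
  assumes V: "lcl V"
  shows "reg A (x # todo @ fin) \<Longrightarrow> A \<subseteq> V \<Longrightarrow> mx A \<subseteq> mx V \<Longrightarrow> (\<And>y. y \<in> set todo \<Longrightarrow> y \<otimes> inv x \<in> V) \<Longrightarrow>
    \<exists>ws. reg (LocV V (generate_ring K (A \<union> {y \<otimes> inv x | y. y \<in> set todo}))) (x # ws)"
proof (induction todo arbitrary: A fin)
  case Nil
  have lA: "lcl A" using Nil(1) unfolding reg_def by blast
  have "generate_ring K A = A" using gen_facts(2,3)[OF subringD(1)[OF lclD(1)[OF lA]]] lclD(1)[OF lA] by blast
  then have "LocV V (generate_ring K (A \<union> {y \<otimes> inv x | y. y \<in> set []})) = A" using dominated(2)[OF V lA Nil(2,3)] by simp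
  then show ?case using Nil(1) by auto
next
  case (Cons y todo)
  note r = Cons.prems(1)
  have lA: "lcl A" and xy: "x \<in> A" "y \<in> A" "set todo \<subseteq> A"
    using r unfolding reg_def by auto
  have x0: "x \<noteq> \<zero>" using reg_hd r by simp
  note A = lclD(1)[OF lA]
  note VS = lclD(1)[OF V]
  have xK: "x \<in> carrier K" "y \<in> carrier K" using subringD(4)[OF A] xy by auto
  define t where "t = y \<otimes> inv x"
  have tV: "t \<in> V" unfolding t_def using Cons.prems(4) by simp
  have tK: "t \<in> carrier K" using subringD(4)[OF VS tV] .
  have tx: "t \<otimes> x = y" unfolding t_def using xK invK[OF xK(1) x0] by (simp add: m_assoc)
  define B where "B = adjoin A t"
  have B: "subring B K" "A \<subseteq> B" "t \<in> B" "B \<subseteq> V" unfolding B_def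
    using adjoin_subring[OF A tK] adjoin_base[OF A tK] adjoin_elem[OF A tK] adjoin_minimal[OF A tK VS Cons.prems(2) tV] by auto
  note F = LocV_facts[OF V B(1,4)]
  obtain ws where "reg (LocV V B) (x # (todo @ fin) @ ws)"
    using blowup_step[OF V _ Cons.prems(2,3) tV tx, of "todo @ fin"] r unfolding B_def by auto
  then have r1: "reg (LocV V B) (x # todo @ fin @ ws)" by simp
  define T where "T = {y \<otimes> inv x | y. y \<in> set todo}"
  have TV: "T \<subseteq> V" unfolding T_def using Cons.prems(4) by auto
  have e: "{z \<otimes> inv x | z. z \<in> set (y # todo)} = insert t T" unfolding T_def t_def by auto
  obtain ws' where ws': "reg (LocV V (generate_ring K (LocV V B \<union> T))) (x # ws')"
    using Cons.IH[OF r1 F(4,5)] Cons.prems(4) unfolding T_def by auto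
  define D where "D = generate_ring K (A \<union> insert t T)"
  define E where "E = generate_ring K (LocV V B \<union> T)"
  have "A \<union> insert t T \<subseteq> V" "LocV V B \<union> T \<subseteq> V" using Cons.prems(2) tV TV F(4) by auto
  then have s: "A \<union> insert t T \<subseteq> carrier K" "LocV V B \<union> T \<subseteq> carrier K" using subringD(1)[OF VS] by auto
  note gD = gen_facts[OF s(1), folded D_def] and gE = gen_facts[OF s(2), folded E_def]
  have DV: "D \<subseteq> V" using gD(3)[OF VS] \<open>A \<union> insert t T \<subseteq> V\<close> by blast
  note FD = LocV_facts[OF V gD(1) DV]
  have "B \<subseteq> D" unfolding B_def using adjoin_minimal[OF A tK gD(1)] gD(2) by blast
  then have "LocV V B \<union> T \<subseteq> LocV V D" using LocV_mono[of B D V] gD(2) FD(3) by blast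
  then have "E \<subseteq> LocV V D" using gE(3)[OF FD(2)] by blast
  then have 1: "LocV V E \<subseteq> LocV V D" using LocV_mono[of E "LocV V D" V] LocV_idem[OF V gD(1) DV] by simp
  have "A \<union> insert t T \<subseteq> E" using gE(2) F(3) B(2,3) by blast
  then have "D \<subseteq> E" using gD(3)[OF gE(1)] by blast
  then have "LocV V D = LocV V E" using 1 LocV_mono[of D E V] by blast
  then show ?case using ws' unfolding e D_def E_def by metis
qed

text \<open>
  The local quadratic transform along \<open>V\<close> is regular. Dimension theory allows the generators of the maximal ideal to be
  reordered such that \<open>x\<close> comes first, and \<open>A[\<mm>/x]\<close> is generated by the quotients of the generators.
\<close>

lemma quadratic_transform_regular:
  assumes V: "lcl V" and r: "reg A xs" and AV: "A \<subseteq> V" "mx A \<subseteq> mx V" and x: "x \<in> set xs" and d: "\<And>y. y \<in> set xs \<Longrightarrow> y \<otimes> inv x \<in> V"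
    and B: "B = generate_ring K (A \<union> {a \<otimes> inv x | a. a \<in> mx A})"
  shows "\<exists>ws. reg (localization K B (mx V \<inter> B)) (x # ws)" "localization K B (mx V \<inter> B) = LocV V B" "subring B K" "B \<subseteq> V"
    "\<And>a. a \<in> mx A \<Longrightarrow> a \<otimes> inv x \<in> V" "x \<noteq> \<zero>"
proof -
  have lA: "lcl A" and nA: "noeth A" and xsA: "set xs \<subseteq> A" and m: "mx A = add_gens A xs {\<zero>}" using r unfolding reg_def by auto
  note A = lclD(1)[OF lA]
  note VS = lclD(1)[OF V]
  obtain us vs where uv: "xs = us @ x # vs" using split_list[OF x] by blast
  define rest where "rest = us @ vs"
  have st: "set (x # rest) = set xs" "length (x # rest) = length xs" unfolding rest_def uv by auto
  obtain p where p: "pchain A p (length xs)" using reg_chain[OF r] by blast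
  have xsK: "set xs \<subseteq> carrier K" using xsA subringD(1)[OF A] by blast
  have m2: "mx A = add_gens A (x # rest) {\<zero>}" using m add_gens_perm[OF A xsK smod_zero[OF A] st(1)[symmetric]] by simp
  have "set (x # rest) \<subseteq> A" "length (x # rest) \<le> length xs" using st xsA by auto
  then have r2: "reg A (x # rest @ [])" using reg_intro[OF lA nA _ m2 p] by simp
  then show x0: "x \<noteq> \<zero>" using reg_hd by simp
  have xK: "x \<in> carrier K" using x xsK by blast
  note i = invK[OF xK x0]
  have key: "a \<otimes> inv x \<in> D" if D: "subring D K" "A \<subseteq> D" "\<And>y. y \<in> set rest \<Longrightarrow> y \<otimes> inv x \<in> D" and a: "a \<in> mx A" for D a
  proof -
    have "smod A {a \<in> carrier K. a \<otimes> inv x \<in> D}" unfolding smod_def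
    proof (intro conjI ballI)
      show "{a \<in> carrier K. a \<otimes> inv x \<in> D} \<subseteq> carrier K" by blast
      show "\<zero> \<in> {a \<in> carrier K. a \<otimes> inv x \<in> D}" using i subringD(2)[OF D(1)] by simp
      show "u \<oplus> v \<in> {a \<in> carrier K. a \<otimes> inv x \<in> D}" if "u \<in> {a \<in> carrier K. a \<otimes> inv x \<in> D}" "v \<in> {a \<in> carrier K. a \<otimes> inv x \<in> D}" for u v
        using that subringD(7)[OF D(1)] i(1) by (simp add: l_distr)
      show "u \<otimes> v \<in> {a \<in> carrier K. a \<otimes> inv x \<in> D}" if "u \<in> A" "v \<in> {a \<in> carrier K. a \<otimes> inv x \<in> D}" for u v
        using that subringD(6)[OF D(1)] D(2) subringD(4)[OF A that(1)] i(1) by (auto simp: m_assoc)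
    qed
    moreover have "set (x # rest) \<subseteq> carrier K" using st(1) xsK by simp
    then have "set (x # rest) \<subseteq> {a \<in> carrier K. a \<otimes> inv x \<in> D}" using D(3) i(2) subringD(3)[OF D(1)] by auto
    moreover have "{\<zero>} \<subseteq> {a \<in> carrier K. a \<otimes> inv x \<in> D}" using i subringD(2)[OF D(1)] by simp
    ultimately have "mx A \<subseteq> {a \<in> carrier K. a \<otimes> inv x \<in> D}" unfolding m2 by (rule add_gens_least)
    then show ?thesis using a by blast
  qed
  show aV: "a \<otimes> inv x \<in> V" if "a \<in> mx A" for a using key[OF VS AV(1) _ that] d st(1) by auto
  have mK: "a \<otimes> inv x \<in> carrier K" if "a \<in> mx A" for a using aV[OF that] subringD(4)[OF VS] by blast
  have sub: "A \<union> {a \<otimes> inv x | a. a \<in> mx A} \<subseteq> V" using AV(1) aV by auto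
  then have subK: "A \<union> {a \<otimes> inv x | a. a \<in> mx A} \<subseteq> carrier K" using subringD(1)[OF VS] by blast
  note g = gen_facts[OF subK, folded B]
  show BS: "subring B K" using g(1) .
  show BV: "B \<subseteq> V" using g(3)[OF VS sub] .
  show eq: "localization K B (mx V \<inter> B) = LocV V B" unfolding LocV_def using localization_eq[OF BS centre_prm[OF V BS BV]] .
  define D where "D = generate_ring K (A \<union> {y \<otimes> inv x | y. y \<in> set rest})"
  have "set (x # rest) \<subseteq> carrier K" using st(1) xsK by simp
  from add_gens_sup(2)[OF A this smod_zero[OF A]] have rm: "set rest \<subseteq> mx A" unfolding m2 by simp
  have s2: "A \<union> {y \<otimes> inv x | y. y \<in> set rest} \<subseteq> A \<union> {a \<otimes> inv x | a. a \<in> mx A}" using rm by blast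
  note gD = gen_facts[OF order_trans[OF s2 subK], folded D_def]
  have "D \<subseteq> B" using gD(3)[OF g(1)] s2 g(2) by blast
  moreover have "B \<subseteq> D"
  proof (rule g(3)[OF gD(1)])
    have "a \<otimes> inv x \<in> D" if "a \<in> mx A" for a using key[OF gD(1) _ _ that] gD(2) by blast
    then show "A \<union> {a \<otimes> inv x | a. a \<in> mx A} \<subseteq> D" using gD(2) by blast
  qed
  ultimately have "D = B" by blast
  then show "\<exists>ws. reg (localization K B (mx V \<inter> B)) (x # ws)"
    unfolding eq using blowup_iter[OF V r2 AV] d st(1) unfolding D_def by auto
qed

section \<open>Regular local rings are completely integrally closed\<close>

lemma add_gen_gen_cong: assumes A: "subring A K" and p: "idl A p" and uv: "u \<in> A" "v \<in> A" "u \<ominus> v \<in> p" shows "add_gen A u p = add_gen A v p"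
proof -
  have *: "add_gen A u p \<subseteq> add_gen A v p" if "u \<in> A" "v \<in> A" "u \<ominus> v \<in> p" for u v
  proof (rule add_gen_least)
    have K: "u \<in> carrier K" "v \<in> carrier K" using that subringD(4)[OF A] by auto
    show s: "smod A (add_gen A v p)" using add_gen_smod[OF A K(2) idlD(1)[OF p]] .
    note u = add_gen_sup[OF A K(2) idlD(1)[OF p]]
    then show "p \<subseteq> add_gen A v p" by blast
    have "v \<oplus> (u \<ominus> v) = u" using K by algebra
    then show "u \<in> add_gen A v p" using smodD(4)[OF s u(2), of "u \<ominus> v"] u(1) that(3) by auto
  qed
  have "v \<ominus> u = \<ominus> (u \<ominus> v)" using subringD(4)[OF A uv(1)] subringD(4)[OF A uv(2)] by algebra
  then have "v \<ominus> u \<in> p" using smod_neg[OF A idlD(1)[OF p] uv(3)] by simp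
  then show ?thesis using *[OF uv] *[OF uv(2,1)] by blast
qed

lemma pow_cong: assumes A: "subring A K" and p: "idl A p" and uv: "u \<in> A" "v \<in> A" "u \<ominus> v \<in> p" shows "u [^] n \<ominus> v [^] (n::nat) \<in> p"
proof (induction n)
  case 0 then show ?case using idlD(3)[OF p] by (simp add: a_minus_def r_neg)
next
  case (Suc n)
  have un: "u [^] n \<in> A" using subringD(9)[OF A uv(1)] .
  have K: "u \<in> carrier K" "v \<in> carrier K" "u [^] n \<in> carrier K" "v [^] n \<in> carrier K" using uv subringD(4)[OF A] by auto
  have "u [^] Suc n \<ominus> v [^] Suc n = u [^] n \<otimes> (u \<ominus> v) \<oplus> v \<otimes> (u [^] n \<ominus> v [^] n)" unfolding nat_pow_Suc using K by algebra
  then show ?case using idlD(6)[OF p idlD(7)[OF p un uv(3)] idlD(7)[OF p uv(2) Suc]] by simp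
qed

text \<open>
  \<open>A/p\<close> is completely integrally closed in its quotient field, for a fraction \<open>a/b\<close> and a common denominator
  \<open>e\<close> of its powers.
\<close>

definition cic_mod :: "'a set \<Rightarrow> 'a set \<Rightarrow> bool" where
  "cic_mod A p \<longleftrightarrow> (\<forall>a\<in>A. \<forall>b\<in>A. \<forall>e\<in>A. b \<notin> p \<longrightarrow> e \<notin> p \<longrightarrow> (\<forall>n::nat. e \<otimes> a [^] n \<in> add_gen A (b [^] n) p) \<longrightarrow> a \<in> add_gen A b p)"

context
  fixes A p x J
  assumes l: "lcl A" and nA: "noeth A" and p: "prm A p" and x: "x \<in> mx A" "x \<notin> p" and J: "J = add_gen A x p" "prm A J"
begin

lemma cic_setting: "subring A K" "x \<in> A" "x \<in> carrier K" "idl A p" "p \<subseteq> J" "x \<in> J" "smod A p"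
proof -
  show A: "subring A K" using lclD(1)[OF l] .
  show xA: "x \<in> A" using x(1) unfolding mx_def by blast
  show xK: "x \<in> carrier K" using subringD(4)[OF A xA] .
  show "idl A p" "smod A p" using prmD(1,2)[OF p] by auto
  show "p \<subseteq> J" "x \<in> J" unfolding J(1) using add_gen_sup[OF A xK prmD(2)[OF p]] by auto
qed

lemma cic_setting_idl: "v \<in> A \<Longrightarrow> idl A (add_gen A v p)" using add_gen_idl[OF cic_setting(1) _ cic_setting(4)] .

lemma x_cancel_p: "s \<in> A \<Longrightarrow> x \<otimes> s \<in> p \<Longrightarrow> s \<in> p" using prmD(6)[OF p cic_setting(2)] x(2) by blast

text \<open>
  The next lemmas express that \<open>x\<close> is a prime element of \<open>A/p\<close>, with quotient the domain \<open>A/J\<close>: elements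
  outside \<open>J\<close> and powers of \<open>x\<close> can be cancelled against each other.
\<close>

lemma cancel_x1: assumes s: "s \<in> A" and v: "v \<in> A" "v \<notin> J" and h: "x \<otimes> s \<in> add_gen A v p" shows "s \<in> add_gen A v p"
proof -
  note A = cic_setting(1)
  note ac = subringD(4)[OF A]
  obtain c i where c: "c \<in> A" "i \<in> p" "x \<otimes> s = c \<otimes> v \<oplus> i" using h unfolding add_gen_def by blast
  have K: "x \<in> carrier K" "s \<in> carrier K" "v \<in> carrier K" "c \<in> carrier K" "i \<in> carrier K"
    using cic_setting(3) ac s v c(1) smodD(3)[OF cic_setting(7) c(2)] by auto
  have "s \<otimes> x \<in> J" using smodD(5)[OF prmD(2)[OF J(2)] s cic_setting(6)] .
  then have "c \<otimes> v \<oplus> i \<in> J" using c(3) m_comm[OF K(1,2)] by simp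
  then have "c \<otimes> v \<in> J" using smod_addR[OF A prmD(2)[OF J(2)]] c(2) cic_setting(5) K by blast
  then have "c \<in> J" using prmD(6)[OF J(2) c(1) v(1)] v(2) by blast
  then obtain d i' where d: "d \<in> A" "i' \<in> p" "c = d \<otimes> x \<oplus> i'" unfolding J(1) add_gen_def by blast
  have K2: "d \<in> carrier K" "i' \<in> carrier K" using ac[OF d(1)] smodD(3)[OF cic_setting(7) d(2)] by auto
  have "x \<otimes> (s \<ominus> d \<otimes> v) = x \<otimes> s \<ominus> x \<otimes> (d \<otimes> v)" using K K2 by algebra
  also have "\<dots> = v \<otimes> i' \<oplus> i" unfolding c(3) d(3) using K K2 by algebra
  finally have "x \<otimes> (s \<ominus> d \<otimes> v) \<in> p" using smodD(4)[OF cic_setting(7) smodD(5)[OF cic_setting(7) v(1) d(2)] c(2)] by simp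
  then have "s \<ominus> d \<otimes> v \<in> p" using x_cancel_p subringD(8)[OF A s subringD(6)[OF A d(1) v(1)]] by blast
  then show ?thesis using add_gen_congr[OF A cic_setting(7) K(2,3)] d(1) by blast
qed

lemma cancel_xk: assumes s: "s \<in> A" and v: "v \<in> A" "v \<notin> J" shows "x [^] (k::nat) \<otimes> s \<in> add_gen A v p \<Longrightarrow> s \<in> add_gen A v p"
proof (induction k)
  case 0 then show ?case using subringD(4)[OF cic_setting(1) s] by simp
next
  case (Suc k)
  have xk: "x [^] k \<in> A" using subringD(9)[OF cic_setting(1,2)] .
  have "x [^] Suc k \<otimes> s = x \<otimes> (x [^] k \<otimes> s)" unfolding nat_pow_Suc using cic_setting(3) subringD(4)[OF cic_setting(1) s] subringD(4)[OF cic_setting(1) xk] by algebra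
  then have "x [^] k \<otimes> s \<in> add_gen A v p" using cancel_x1[OF subringD(6)[OF cic_setting(1) xk s] v] Suc.prems by simp
  then show ?case using Suc.IH by blast
qed

lemma pow_notin_J: "v \<in> A \<Longrightarrow> v \<notin> J \<Longrightarrow> v [^] (n::nat) \<notin> J" using prm_pow[OF cic_setting(1) J(2)] by blast

lemma cancel_v: assumes v: "v \<in> A" "v \<notin> J" shows "e \<in> A \<Longrightarrow> e \<otimes> v \<in> add_gen A (x [^] (n::nat)) p \<Longrightarrow> e \<in> add_gen A (x [^] n) p"
proof (induction n arbitrary: e)
  case 0
  have "e = e \<otimes> x [^] (0::nat) \<oplus> \<zero>" using subringD(4)[OF cic_setting(1) 0(1)] by simp
  then show ?case unfolding add_gen_def using 0(1) smodD(2)[OF cic_setting(7)] by blast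
next
  case (Suc n)
  note A = cic_setting(1)
  note ac = subringD(4)[OF A]
  have xn: "x [^] n \<in> A" using subringD(9)[OF A cic_setting(2)] .
  obtain c i where c: "c \<in> A" "i \<in> p" "e \<otimes> v = c \<otimes> x [^] Suc n \<oplus> i" using Suc.prems(2) unfolding add_gen_def by blast
  have "c \<otimes> x [^] Suc n = (c \<otimes> x [^] n) \<otimes> x" unfolding nat_pow_Suc using ac[OF c(1)] ac[OF xn] cic_setting(3) by algebra
  then have "c \<otimes> x [^] Suc n \<in> J" using smodD(5)[OF prmD(2)[OF J(2)] subringD(6)[OF A c(1) xn] cic_setting(6)] by simp
  then have "e \<otimes> v \<in> J" unfolding c(3) using smodD(4)[OF prmD(2)[OF J(2)]] c(2) cic_setting(5) by blast
  then have "e \<in> J" using prmD(6)[OF J(2) Suc.prems(1) v(1)] v(2) by blast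
  then obtain e1 j where e1: "e1 \<in> A" "j \<in> p" "e = e1 \<otimes> x \<oplus> j" unfolding J(1) add_gen_def by blast
  have K: "x \<in> carrier K" "v \<in> carrier K" "c \<in> carrier K" "i \<in> carrier K" "e1 \<in> carrier K" "j \<in> carrier K" "x [^] n \<in> carrier K"
    using cic_setting(3) ac v c(1) e1(1) xn smodD(3)[OF cic_setting(7)] c(2) e1(2) by auto
  have "x \<otimes> (e1 \<otimes> v \<ominus> c \<otimes> x [^] n) = ((e1 \<otimes> x \<oplus> j) \<otimes> v) \<ominus> v \<otimes> j \<ominus> c \<otimes> (x [^] n \<otimes> x)" using K by algebra
  also have "\<dots> = (c \<otimes> (x [^] n \<otimes> x) \<oplus> i) \<ominus> v \<otimes> j \<ominus> c \<otimes> (x [^] n \<otimes> x)" using c(3) e1(3) by simp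
  also have "\<dots> = i \<ominus> v \<otimes> j" using K by algebra
  finally have "x \<otimes> (e1 \<otimes> v \<ominus> c \<otimes> x [^] n) \<in> p" using smod_minus[OF A cic_setting(7) c(2) smodD(5)[OF cic_setting(7) v(1) e1(2)]] by simp
  then have "e1 \<otimes> v \<ominus> c \<otimes> x [^] n \<in> p" using x_cancel_p subringD(8)[OF A subringD(6)[OF A e1(1) v(1)] subringD(6)[OF A c(1) xn]] by blast
  then have "e1 \<otimes> v \<in> add_gen A (x [^] n) p" using add_gen_congr[OF A cic_setting(7) _ K(7)] c(1) K by blast
  then have "e1 \<in> add_gen A (x [^] n) p" using Suc.IH[OF e1(1)] by blast
  then obtain d i' where d: "d \<in> A" "i' \<in> p" "e1 = d \<otimes> x [^] n \<oplus> i'" unfolding add_gen_def by blast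
  have K2: "d \<in> carrier K" "i' \<in> carrier K" using ac[OF d(1)] smodD(3)[OF cic_setting(7) d(2)] by auto
  have "e = d \<otimes> x [^] Suc n \<oplus> (x \<otimes> i' \<oplus> j)" unfolding e1(3) d(3) nat_pow_Suc using K K2 by algebra
  moreover have "x \<otimes> i' \<oplus> j \<in> p" using smodD(4)[OF cic_setting(7) smodD(5)[OF cic_setting(7) cic_setting(2) d(2)] e1(2)] .
  ultimately show ?case unfolding add_gen_def using d(1) by blast
qed

text \<open>By Krull's intersection theorem an element outside \<open>p\<close> is divisible by only finitely many powers of \<open>x\<close> modulo \<open>p\<close>.\<close>

lemma x_factor: assumes a: "a \<in> A" "a \<notin> p" shows "\<exists>(k::nat) a'. a' \<in> A \<and> a' \<notin> J \<and> a \<ominus> x [^] k \<otimes> a' \<in> p"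
proof -
  note A = cic_setting(1)
  note ac = subringD(4)[OF A]
  have "\<exists>n::nat. a \<notin> add_gen A (x [^] n) p" using krull_intersection[OF l nA cic_setting(4) x(1) a(1)] a(2) by blast
  define n where "n = (LEAST n::nat. a \<notin> add_gen A (x [^] n) p)"
  have n: "a \<notin> add_gen A (x [^] n) p" unfolding n_def using LeastI_ex[OF \<open>\<exists>n::nat. a \<notin> add_gen A (x [^] n) p\<close>] .
  have "a = a \<otimes> x [^] (0::nat) \<oplus> \<zero>" using ac[OF a(1)] by simp
  then have "a \<in> add_gen A (x [^] (0::nat)) p" unfolding add_gen_def using a(1) smodD(2)[OF cic_setting(7)] by blast
  then obtain k where k: "n = Suc k" using n by (cases n) auto
  have xk: "x [^] k \<in> A" using subringD(9)[OF A cic_setting(2)] .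
  have "a \<in> add_gen A (x [^] k) p" using not_less_Least[of k] k unfolding n_def by (metis lessI)
  then obtain c i where c: "c \<in> A" "i \<in> p" "a = c \<otimes> x [^] k \<oplus> i" unfolding add_gen_def by blast
  have K: "c \<in> carrier K" "i \<in> carrier K" "x [^] k \<in> carrier K" "x \<in> carrier K" using ac c(1) xk smodD(3)[OF cic_setting(7) c(2)] cic_setting(3) by auto
  have "c \<notin> J"
  proof
    assume "c \<in> J"
    then obtain d j where d: "d \<in> A" "j \<in> p" "c = d \<otimes> x \<oplus> j" unfolding J(1) add_gen_def by blast
    have "a = d \<otimes> x [^] n \<oplus> (x [^] k \<otimes> j \<oplus> i)" unfolding c(3) d(3) k nat_pow_Suc using K ac[OF d(1)] smodD(3)[OF cic_setting(7) d(2)] by algebra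
    moreover have "x [^] k \<otimes> j \<oplus> i \<in> p" using smodD(4)[OF cic_setting(7) smodD(5)[OF cic_setting(7) xk d(2)] c(2)] .
    ultimately show False using n d(1) unfolding add_gen_def by blast
  qed
  moreover have "a \<ominus> x [^] k \<otimes> c = i" unfolding c(3) using K by algebra
  ultimately show ?thesis using c(1,2) by metis
qed

text \<open>
  If all \<open>e (a/b)\<^sup>n\<close> are integral, then so are all \<open>e (a/b - r)\<^sup>n\<close>; the additional exponent \<open>m\<close> makes the
  binomial expansion an induction.
\<close>

lemma power_condition_shift:
  assumes a: "a \<in> A" and b: "b \<in> A" and e: "e \<in> A" and r: "r \<in> A" and H: "\<And>n::nat. e \<otimes> a [^] n \<in> add_gen A (b [^] n) p"
  shows "e \<otimes> (a [^] m \<otimes> (a \<ominus> r \<otimes> b) [^] n) \<in> add_gen A (b [^] (m + n :: nat)) p"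
proof (induction n arbitrary: m)
  case 0
  show ?case using H[of m] subringD(4)[OF cic_setting(1) a] by simp
next
  case (Suc n)
  note A = cic_setting(1)
  note ac = subringD(4)[OF A]
  let ?w = "a \<ominus> r \<otimes> b"
  have w: "?w \<in> A" using subringD(8)[OF A a subringD(6)[OF A r b]] .
  note pw = subringD(9)[OF A a, of m] subringD(9)[OF A w, of n] subringD(9)[OF A b, of "m + Suc n"] subringD(9)[OF A b, of "m + n"]
  note I = cic_setting_idl[OF pw(3)]
  have K: "a \<in> carrier K" "b \<in> carrier K" "e \<in> carrier K" "r \<in> carrier K" "a [^] m \<in> carrier K" "?w [^] n \<in> carrier K" "b [^] (m + n) \<in> carrier K"
    using ac a b e r pw by auto
  have 1: "e \<otimes> (a [^] Suc m \<otimes> ?w [^] n) \<in> add_gen A (b [^] (m + Suc n)) p" using Suc.IH[of "Suc m"] by simp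
  obtain c i where c: "c \<in> A" "i \<in> p" "e \<otimes> (a [^] m \<otimes> ?w [^] n) = c \<otimes> b [^] (m + n) \<oplus> i" using Suc.IH[of m] unfolding add_gen_def by blast
  have "b \<otimes> (e \<otimes> (a [^] m \<otimes> ?w [^] n)) = c \<otimes> b [^] (m + Suc n) \<oplus> b \<otimes> i"
    unfolding c(3) add_Suc_right nat_pow_Suc using K ac[OF c(1)] smodD(3)[OF cic_setting(7) c(2)] by algebra
  then have "b \<otimes> (e \<otimes> (a [^] m \<otimes> ?w [^] n)) \<in> add_gen A (b [^] (m + Suc n)) p" unfolding add_gen_def using c(1) smodD(5)[OF cic_setting(7) b c(2)] by blast
  then have 2: "r \<otimes> (b \<otimes> (e \<otimes> (a [^] m \<otimes> ?w [^] n))) \<in> add_gen A (b [^] (m + Suc n)) p" using idlD(7)[OF I r] by blast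
  have "u \<otimes> (am \<otimes> (wn \<otimes> (a \<ominus> r \<otimes> b))) = u \<otimes> ((am \<otimes> a) \<otimes> wn) \<ominus> r \<otimes> (b \<otimes> (u \<otimes> (am \<otimes> wn)))"
    if "u \<in> carrier K" "am \<in> carrier K" "wn \<in> carrier K" for u am wn using that K(1,2,4) by algebra
  from this[OF K(3,5,6)]
  have "e \<otimes> (a [^] m \<otimes> ?w [^] Suc n) = e \<otimes> (a [^] Suc m \<otimes> ?w [^] n) \<ominus> r \<otimes> (b \<otimes> (e \<otimes> (a [^] m \<otimes> ?w [^] n)))"
    unfolding nat_pow_Suc .
  then show ?case using smod_minus[OF A idlD(1)[OF I] 1 2] by simp
qed

text \<open>
  Since \<open>A/J\<close> is completely integrally closed, \<open>a/b \<equiv> r\<close> modulo \<open>x\<close>, and \<open>(a/b - r)/x\<close> satisfies the same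
  condition as \<open>a/b\<close>. Iterating shows that \<open>a\<close> is a multiple of \<open>b\<close> modulo every power of \<open>x\<close>.
\<close>

lemma cic_base:
  assumes cJ: "cic_mod A J" and b: "b \<in> A" "b \<notin> J" and e: "e \<in> A" "e \<notin> J"
  shows "a \<in> A \<Longrightarrow> (\<And>n::nat. e \<otimes> a [^] n \<in> add_gen A (b [^] n) p) \<Longrightarrow> \<exists>r\<in>A. \<exists>a1\<in>A. a \<ominus> (r \<otimes> b \<oplus> a1 \<otimes> x [^] (k::nat)) \<in> p"
proof (induction k arbitrary: a)
  case 0
  have "a \<ominus> (\<zero> \<otimes> b \<oplus> a \<otimes> x [^] (0::nat)) = \<zero>" using subringD(4)[OF cic_setting(1)] 0(1) b(1) by (simp add: a_minus_def r_neg)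
  then show ?case using 0(1) subringD(2)[OF cic_setting(1)] smodD(2)[OF cic_setting(7)] by metis
next
  case (Suc k)
  note A = cic_setting(1)
  note ac = subringD(4)[OF A]
  have pJ: "add_gen A v p \<subseteq> add_gen A v J" for v unfolding add_gen_def using cic_setting(5) by blast
  have "a \<in> add_gen A b J" using cJ Suc.prems b e pJ unfolding cic_mod_def by blast
  then obtain r j where r: "r \<in> A" "j \<in> J" "a = r \<otimes> b \<oplus> j" unfolding add_gen_def by blast
  obtain a1 i where a1: "a1 \<in> A" "i \<in> p" "j = a1 \<otimes> x \<oplus> i" using r(2) unfolding J(1) add_gen_def by blast
  have K: "a \<in> carrier K" "r \<in> carrier K" "b \<in> carrier K" "a1 \<in> carrier K" "x \<in> carrier K" "i \<in> carrier K" "e \<in> carrier K"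
    using ac Suc.prems(1) r(1) b a1(1) e cic_setting(3) smodD(3)[OF cic_setting(7) a1(2)] by auto
  have wA: "a \<ominus> r \<otimes> b \<in> A" using subringD(8)[OF A Suc.prems(1) subringD(6)[OF A r(1) b(1)]] .
  have axA: "a1 \<otimes> x \<in> A" using subringD(6)[OF A a1(1) cic_setting(2)] .
  have "(a \<ominus> r \<otimes> b) \<ominus> a1 \<otimes> x = i" unfolding r(3) a1(3) using K by algebra
  then have cg: "(a \<ominus> r \<otimes> b) \<ominus> a1 \<otimes> x \<in> p" using a1(2) by simp
  have H1: "e \<otimes> a1 [^] n \<in> add_gen A (b [^] n) p" for n :: nat
  proof -
    have bn: "b [^] n \<in> A" "b [^] n \<notin> J" using subringD(9)[OF A b(1)] pow_notin_J[OF b] by auto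
    note I = cic_setting_idl[OF bn(1)]
    have "a [^] (0::nat) \<otimes> (a \<ominus> r \<otimes> b) [^] n = (a \<ominus> r \<otimes> b) [^] n" using ac[OF wA] by simp
    then have 1: "e \<otimes> (a \<ominus> r \<otimes> b) [^] n \<in> add_gen A (b [^] n) p" using power_condition_shift[OF Suc.prems(1) b(1) e(1) r(1) Suc.prems(2), of 0 n] by simp
    have 2: "(a \<ominus> r \<otimes> b) [^] n \<ominus> (a1 \<otimes> x) [^] n \<in> p" using pow_cong[OF A cic_setting(4) wA axA cg] .
    have K2: "(a \<ominus> r \<otimes> b) [^] n \<in> carrier K" "(a1 \<otimes> x) [^] n \<in> carrier K" using ac[OF wA] ac[OF axA] by auto
    have "u \<ominus> e \<otimes> (w \<ominus> v) = e \<otimes> v" if "u = e \<otimes> w" "w \<in> carrier K" "v \<in> carrier K" for u v w unfolding that(1) using that(2,3) K(7) by algebra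
    from this[OF refl K2] have "e \<otimes> (a1 \<otimes> x) [^] n = e \<otimes> (a \<ominus> r \<otimes> b) [^] n \<ominus> e \<otimes> ((a \<ominus> r \<otimes> b) [^] n \<ominus> (a1 \<otimes> x) [^] n)" by simp
    moreover have "e \<otimes> ((a \<ominus> r \<otimes> b) [^] n \<ominus> (a1 \<otimes> x) [^] n) \<in> add_gen A (b [^] n) p"
      using smodD(5)[OF cic_setting(7) e(1) 2] add_gen_sup(1)[OF A ac[OF bn(1)] cic_setting(7)] by blast
    ultimately have 3: "e \<otimes> (a1 \<otimes> x) [^] n \<in> add_gen A (b [^] n) p" using smod_minus[OF A idlD(1)[OF I] 1] by simp
    have "e \<otimes> (a1 \<otimes> x) [^] n = x [^] n \<otimes> (e \<otimes> a1 [^] n)" using nat_pow_distrib[OF K(4,5)] K nat_pow_closed by (simp add: m_ac)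
    then show ?thesis using cancel_xk[OF subringD(6)[OF A e(1) subringD(9)[OF A a1(1)]] bn] 3 by simp
  qed
  obtain r' a2 where a2: "r' \<in> A" "a2 \<in> A" "a1 \<ominus> (r' \<otimes> b \<oplus> a2 \<otimes> x [^] k) \<in> p" using Suc.IH[OF a1(1) H1] by blast
  have K2: "r' \<in> carrier K" "a2 \<in> carrier K" "x [^] k \<in> carrier K" using ac a2(1,2) cic_setting(3) by auto
  have "a \<ominus> ((r \<oplus> r' \<otimes> x) \<otimes> b \<oplus> a2 \<otimes> x [^] Suc k) = x \<otimes> (a1 \<ominus> (r' \<otimes> b \<oplus> a2 \<otimes> x [^] k)) \<oplus> i"
    unfolding r(3) a1(3) nat_pow_Suc using K K2 by algebra
  then have "a \<ominus> ((r \<oplus> r' \<otimes> x) \<otimes> b \<oplus> a2 \<otimes> x [^] Suc k) \<in> p" using smodD(4)[OF cic_setting(7) smodD(5)[OF cic_setting(7) cic_setting(2) a2(3)] a1(2)] by simp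
  then show ?case using subringD(7)[OF A r(1) subringD(6)[OF A a2(1) cic_setting(2)]] a2(2) by blast
qed

text \<open>A power of \<open>x\<close> in \<open>e\<close> may be cancelled because \<open>b\<close> is not in \<open>J\<close>; then Krull's intersection theorem applies.\<close>

lemma cic_base2:
  assumes cJ: "cic_mod A J" and b: "b \<in> A" "b \<notin> J" and e: "e \<in> A" "e \<notin> p" and a: "a \<in> A"
    and H: "\<And>n::nat. e \<otimes> a [^] n \<in> add_gen A (b [^] n) p"
  shows "a \<in> add_gen A b p"
proof -
  note A = cic_setting(1)
  note ac = subringD(4)[OF A]
  obtain k :: nat and e' where e': "e' \<in> A" "e' \<notin> J" "e \<ominus> x [^] k \<otimes> e' \<in> p" using x_factor[OF e] by blast
  have xk: "x [^] k \<in> A" using subringD(9)[OF A cic_setting(2)] .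
  have H': "e' \<otimes> a [^] n \<in> add_gen A (b [^] n) p" for n :: nat
  proof -
    have bn: "b [^] n \<in> A" "b [^] n \<notin> J" using subringD(9)[OF A b(1)] pow_notin_J[OF b] by auto
    have an: "a [^] n \<in> A" using subringD(9)[OF A a] .
    have K: "e \<in> carrier K" "e' \<in> carrier K" "x [^] k \<in> carrier K" "a [^] n \<in> carrier K" using ac e(1) e'(1) xk an by auto
    have "x [^] k \<otimes> (e' \<otimes> a [^] n) = e \<otimes> a [^] n \<ominus> a [^] n \<otimes> (e \<ominus> x [^] k \<otimes> e')" using K by algebra
    moreover have "a [^] n \<otimes> (e \<ominus> x [^] k \<otimes> e') \<in> add_gen A (b [^] n) p" using smodD(5)[OF cic_setting(7) an e'(3)] add_gen_sup(1)[OF A ac[OF bn(1)] cic_setting(7)] by blast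
    ultimately have "x [^] k \<otimes> (e' \<otimes> a [^] n) \<in> add_gen A (b [^] n) p" using smod_minus[OF A idlD(1)[OF cic_setting_idl[OF bn(1)]] H] by simp
    then show ?thesis using cancel_xk[OF subringD(6)[OF A e'(1) an] bn] by blast
  qed
  have "a \<in> add_gen A (x [^] j) (add_gen A b p)" for j :: nat
  proof -
    obtain r a1 where r: "r \<in> A" "a1 \<in> A" "a \<ominus> (r \<otimes> b \<oplus> a1 \<otimes> x [^] j) \<in> p" using cic_base[OF cJ b e'(1,2) a H'] by blast
    let ?i = "a \<ominus> (r \<otimes> b \<oplus> a1 \<otimes> x [^] j)"
    have K: "a \<in> carrier K" "b \<in> carrier K" "r \<in> carrier K" "a1 \<in> carrier K" "x [^] j \<in> carrier K" using ac a b(1) r cic_setting(3) by auto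
    have "a = a1 \<otimes> x [^] j \<oplus> (r \<otimes> b \<oplus> ?i)" using K by algebra
    moreover have "r \<otimes> b \<oplus> ?i \<in> add_gen A b p" unfolding add_gen_def using r by blast
    ultimately show ?thesis unfolding add_gen_iff[of a A "x [^] j"] using r(2) by blast
  qed
  then show ?thesis using krull_intersection[OF l nA cic_setting_idl[OF b(1)] x(1) a] by blast
qed

text \<open>
  If \<open>A/p\<close> modulo its prime element \<open>x\<close> is completely integrally closed, then so is \<open>A/p\<close>. It remains to
  reduce to \<open>b\<close> outside \<open>J\<close>: if \<open>x\<close> divides \<open>b\<close>, then it divides \<open>a\<close>, since otherwise \<open>e\<close>
  would be divisible by all powers of \<open>x\<close>.
\<close>

lemma cic_step: assumes cJ: "cic_mod A J" shows "cic_mod A p"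
proof -
  note A = cic_setting(1)
  note ac = subringD(4)[OF A]
  have main: "a \<in> add_gen A (x [^] k \<otimes> b) p" if b: "b \<in> A" "b \<notin> J" and e: "e \<in> A" "e \<notin> p" and a: "a \<in> A"
    and H: "\<And>n::nat. e \<otimes> a [^] n \<in> add_gen A ((x [^] k \<otimes> b) [^] n) p" for a b e and k :: nat using a H
  proof (induction k arbitrary: a)
    case 0
    have "x [^] (0::nat) \<otimes> b = b" using ac[OF b(1)] by simp
    then show ?case using cic_base2[OF cJ b e 0(1)] 0(2) by simp
  next
    case (Suc k)
    have xk: "x [^] k \<in> A" using subringD(9)[OF A cic_setting(2)] .
    let ?b = "x [^] k \<otimes> b"
    have bA: "?b \<in> A" using subringD(6)[OF A xk b(1)] .
    have bK: "?b \<in> carrier K" using ac[OF bA] .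
    have bs: "x [^] Suc k \<otimes> b = x \<otimes> ?b" unfolding nat_pow_Suc using ac[OF xk] ac[OF b(1)] cic_setting(3) by algebra
    have bsn: "(x [^] Suc k \<otimes> b) [^] n = x [^] n \<otimes> ?b [^] n" for n :: nat unfolding bs using nat_pow_distrib[OF cic_setting(3) bK] .
    have aJ: "a \<in> J"
    proof (rule ccontr)
      assume aJ: "a \<notin> J"
      have "e \<in> add_gen A (x [^] n) p" for n :: nat
      proof -
        have an: "a [^] n \<in> A" "a [^] n \<notin> J" using subringD(9)[OF A Suc.prems(1)] pow_notin_J[OF Suc.prems(1) aJ] by auto
        obtain c i where c: "c \<in> A" "i \<in> p" "e \<otimes> a [^] n = c \<otimes> (x [^] n \<otimes> ?b [^] n) \<oplus> i"
          using Suc.prems(2)[of n] unfolding bsn add_gen_def by blast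
        have bn: "?b [^] n \<in> A" using subringD(9)[OF A bA] .
        have "c \<otimes> (x [^] n \<otimes> ?b [^] n) = (c \<otimes> ?b [^] n) \<otimes> x [^] n" using ac[OF c(1)] ac[OF bn] cic_setting(3) by (simp add: m_ac)
        then have "e \<otimes> a [^] n \<in> add_gen A (x [^] n) p" unfolding c(3) add_gen_def using subringD(6)[OF A c(1) bn] c(2) by auto
        then show ?thesis using cancel_v[OF an e(1)] by blast
      qed
      then show False using krull_intersection[OF l nA cic_setting(4) x(1) e(1)] e(2) by blast
    qed
    then obtain a1 i where a1: "a1 \<in> A" "i \<in> p" "a = a1 \<otimes> x \<oplus> i" unfolding J(1) add_gen_def by blast
    have K: "a1 \<in> carrier K" "i \<in> carrier K" "x \<in> carrier K" "e \<in> carrier K" using ac a1(1) smodD(3)[OF cic_setting(7) a1(2)] cic_setting(3) e(1) by auto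
    have "e \<otimes> a1 [^] n \<in> add_gen A (?b [^] n) p" for n :: nat
    proof -
      have bn: "?b [^] n \<in> A" using subringD(9)[OF A bA] .
      have xn: "x [^] n \<in> A" using subringD(9)[OF A cic_setting(2)] .
      have axA: "a1 \<otimes> x \<in> A" using subringD(6)[OF A a1(1) cic_setting(2)] .
      have "a \<ominus> a1 \<otimes> x = i" unfolding a1(3) using K by algebra
      then have 2: "a [^] n \<ominus> (a1 \<otimes> x) [^] n \<in> p" using pow_cong[OF A cic_setting(4) Suc.prems(1) axA] a1(2) by simp
      obtain c j where c: "c \<in> A" "j \<in> p" "e \<otimes> a [^] n = c \<otimes> (x [^] n \<otimes> ?b [^] n) \<oplus> j" using Suc.prems(2)[of n] unfolding bsn add_gen_def by blast
      have a1n: "a1 [^] n \<in> A" using subringD(9)[OF A a1(1)] .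
      have e2: "(a1 \<otimes> x) [^] n = a1 [^] n \<otimes> x [^] n" using nat_pow_distrib[OF K(1,3)] .
      have K2: "a [^] n \<in> carrier K" "a1 [^] n \<in> carrier K" "x [^] n \<in> carrier K" "?b [^] n \<in> carrier K" "c \<in> carrier K" "j \<in> carrier K"
        using ac Suc.prems(1) a1n xn bn c(1) smodD(3)[OF cic_setting(7) c(2)] by auto
      have "x [^] n \<otimes> (e \<otimes> a1 [^] n \<ominus> c \<otimes> ?b [^] n) = e \<otimes> a [^] n \<ominus> c \<otimes> (x [^] n \<otimes> ?b [^] n) \<ominus> e \<otimes> (a [^] n \<ominus> a1 [^] n \<otimes> x [^] n)"
        using K(4) K2 by algebra
      also have "\<dots> = j \<ominus> e \<otimes> (a [^] n \<ominus> a1 [^] n \<otimes> x [^] n)" unfolding c(3) using K(4) K2 by algebra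
      finally have "x [^] n \<otimes> (e \<otimes> a1 [^] n \<ominus> c \<otimes> ?b [^] n) \<in> p"
        using smod_minus[OF A cic_setting(7) c(2) smodD(5)[OF cic_setting(7) e(1) 2]] unfolding e2 by simp
      moreover have dA: "e \<otimes> a1 [^] n \<ominus> c \<otimes> ?b [^] n \<in> A" using subringD(8)[OF A subringD(6)[OF A e(1) a1n] subringD(6)[OF A c(1) bn]] .
      moreover have "x [^] n \<notin> p" using prm_pow[OF A p cic_setting(2)] x(2) by blast
      ultimately have "e \<otimes> a1 [^] n \<ominus> c \<otimes> ?b [^] n \<in> p" using prmD(6)[OF p xn dA] by blast
      then show ?thesis using add_gen_congr[OF A cic_setting(7) _ K2(4)] c(1) K(4) K2(2) by blast
    qed
    then have "a1 \<in> add_gen A ?b p" using Suc.IH[OF a1(1)] by blast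
    then obtain c j where c: "c \<in> A" "j \<in> p" "a1 = c \<otimes> ?b \<oplus> j" unfolding add_gen_def by blast
    have "a = c \<otimes> (x \<otimes> ?b) \<oplus> (x \<otimes> j \<oplus> i)" unfolding a1(3) c(3) using K bK ac[OF c(1)] smodD(3)[OF cic_setting(7) c(2)]
      by (simp add: l_distr r_distr m_ac a_ac)
    moreover have "x \<otimes> j \<oplus> i \<in> p" using smodD(4)[OF cic_setting(7) smodD(5)[OF cic_setting(7) cic_setting(2) c(2)] a1(2)] .
    ultimately show ?case unfolding bs add_gen_def using c(1) by blast
  qed
  show ?thesis unfolding cic_mod_def
  proof (intro ballI impI)
    fix a b e assume h: "a \<in> A" "b \<in> A" "e \<in> A" "b \<notin> p" "e \<notin> p" "\<forall>n::nat. e \<otimes> a [^] n \<in> add_gen A (b [^] n) p"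
    obtain k :: nat and b' where b': "b' \<in> A" "b' \<notin> J" "b \<ominus> x [^] k \<otimes> b' \<in> p" using x_factor[OF h(2,4)] by blast
    have cA': "x [^] k \<otimes> b' \<in> A" using subringD(6)[OF A subringD(9)[OF A cic_setting(2)] b'(1)] .
    have eq: "add_gen A (b [^] n) p = add_gen A ((x [^] k \<otimes> b') [^] n) p" for n :: nat
      using add_gen_gen_cong[OF A cic_setting(4) subringD(9)[OF A h(2)] subringD(9)[OF A cA'] pow_cong[OF A cic_setting(4) h(2) cA' b'(3)]] .
    have "a \<in> add_gen A (x [^] k \<otimes> b') p" using main[OF b'(1,2) h(3,5,1)] h(6) unfolding eq by blast
    then show "a \<in> add_gen A b p" using add_gen_gen_cong[OF A cic_setting(4) h(2) cA' b'(3)] by simp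
  qed
qed

end

text \<open>Going down the chain of primes from the residue field, which is trivially completely integrally closed.\<close>

theorem regular_cic:
  assumes r: "reg A xs" and u: "u \<in> carrier K" and e: "e \<in> A" "e \<noteq> \<zero>" and H: "\<And>n::nat. e \<otimes> u [^] n \<in> A"
  shows "u \<in> A"
proof -
  have l: "lcl A" and nA: "noeth A" and xs: "set xs \<subseteq> A" and m: "mx A = add_gens A xs {\<zero>}"
    and pr: "\<And>ys z zs. xs = ys @ z # zs \<Longrightarrow> prm A (add_gens A ys {\<zero>}) \<and> z \<notin> add_gens A ys {\<zero>}"
    using r unfolding reg_def by auto
  note A = lclD(1)[OF l]
  note ac = subringD(4)[OF A]
  have "xs = ys @ zs \<Longrightarrow> cic_mod A (add_gens A ys {\<zero>})" for ys zs
  proof (induction zs arbitrary: ys)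
    case Nil
    have "a \<in> add_gen A b (mx A)" if ab: "a \<in> A" "b \<in> A" "b \<notin> mx A" for a b
    proof -
      obtain c where c: "c \<in> A" "b \<otimes> c = \<one>" using notin_mx[OF ab(2,3)] .
      have "a = (a \<otimes> c) \<otimes> b \<oplus> \<zero>" using c(2) ac[OF ab(1)] ac[OF ab(2)] ac[OF c(1)] by (simp add: m_assoc m_comm[of c b])
      then show ?thesis unfolding add_gen_def using subringD(6)[OF A ab(1) c(1)] idlD(3)[OF lclD(2)[OF l]] by blast
    qed
    then show ?case using Nil m unfolding cic_mod_def by simp
  next
    case (Cons z zs)
    have ys: "set ys \<subseteq> A" "z \<in> A" "set zs \<subseteq> A" using Cons.prems xs by auto
    have K: "set ys \<subseteq> carrier K" "z \<in> carrier K" using ys ac by auto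
    have eq: "add_gens A (ys @ [z]) {\<zero>} = add_gen A z (add_gens A ys {\<zero>})"
      using add_gens_perm[OF A _ smod_zero[OF A], of "ys @ [z]" "z # ys"] K by simp
    have J: "prm A (add_gens A (ys @ [z]) {\<zero>})"
    proof (cases zs)
      case Nil then show ?thesis using prm_mx[OF l] m Cons.prems by simp
    next
      case (Cons w ws) then show ?thesis using pr[of "ys @ [z]" w ws] Cons.prems by simp
    qed
    have zm: "z \<in> mx A" unfolding m using add_gens_sup(2)[OF A _ smod_zero[OF A], of xs] Cons.prems xs ac by auto
    show ?case
      by (rule cic_step[OF l nA _ zm _ eq J]) (use pr[OF Cons.prems] Cons.IH[of "ys @ [z]"] Cons.prems in auto)
  qed
  from this[of "[]" xs] have c0: "cic_mod A {\<zero>}" by simp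
  have eK: "e \<in> carrier K" using ac[OF e(1)] .
  define a where "a = e \<otimes> u"
  have aA: "a \<in> A" unfolding a_def using H[of 1] u by simp
  have "e \<otimes> a [^] n \<in> add_gen A (e [^] n) {\<zero>}" for n :: nat
  proof -
    have "e \<otimes> a [^] n = (e \<otimes> u [^] n) \<otimes> e [^] n \<oplus> \<zero>" unfolding a_def nat_pow_distrib[OF eK u] using eK u by (simp add: m_ac)
    then show ?thesis unfolding add_gen_def using H by blast
  qed
  then have "a \<in> add_gen A e {\<zero>}" using c0 aA e unfolding cic_mod_def by blast
  then obtain r where r: "r \<in> A" "a = r \<otimes> e \<oplus> \<zero>" unfolding add_gen_def by blast
  have "e \<otimes> u = e \<otimes> r" using r ac[OF r(1)] eK unfolding a_def by (simp add: m_comm)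
  then have "u = r" using eq_cancelK[OF eK u ac[OF r(1)] e(2)] by blast
  then show ?thesis using r(1) by simp
qed

section \<open>Discrete valuation overrings\<close>

lemma common_denominator:
  assumes A: "subring A K" and p: "prm A p" and gs: "set gs \<subseteq> locI A p I" and I: "smod A I"
  shows "\<exists>s\<in>A. s \<notin> p \<and> (\<forall>g\<in>set gs. g \<otimes> s \<in> I)"
  using gs
proof (induction gs)
  case Nil then show ?case using subringD(3)[OF A] prmD(4)[OF p] by auto
next
  case (Cons g gs)
  then obtain s where s: "s \<in> A" "s \<notin> p" "\<forall>g\<in>set gs. g \<otimes> s \<in> I" by auto
  obtain t where t: "g \<in> carrier K" "t \<in> A" "t \<notin> p" "g \<otimes> t \<in> I" using Cons.prems unfolding locI_def by auto
  note K = subringD(4)[OF A s(1)] subringD(4)[OF A t(2)]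
  have "h \<otimes> (s \<otimes> t) \<in> I" if h: "h \<in> set (g # gs)" for h
  proof (cases "h = g")
    case True
    have "g \<otimes> (s \<otimes> t) = s \<otimes> (g \<otimes> t)" using t(1) K by algebra
    then show ?thesis using smodD(5)[OF I s(1) t(4)] True by simp
  next
    case False
    then have hg: "h \<in> set gs" using h by simp
    have "h \<in> carrier K" using hg Cons.prems unfolding locI_def by auto
    then have "h \<otimes> (s \<otimes> t) = t \<otimes> (h \<otimes> s)" using K by algebra
    then show ?thesis using smodD(5)[OF I t(2)] s(3) hg by simp
  qed
  then show ?case using loc_den_mult[OF A p s(1,2) t(2,3)] by blast
qed

text \<open>
  An element \<open>z = a/b\<close> outside \<open>A\<^sub>P\<close> is excluded by the localization at a prime \<open>p = (bA\<^sub>P : c)\<close> chosen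
  maximal above \<open>(bA\<^sub>P : a)\<close>. Put \<open>v = c/b\<close>, so that \<open>vp \<subseteq> A\<^sub>P\<close> while \<open>v\<close> is not in \<open>A\<^sub>p\<close>. If
  \<open>vp\<close> contains a unit of \<open>A\<^sub>p\<close>, then \<open>1/v\<close> generates the maximal ideal of \<open>A\<^sub>p\<close>. Otherwise
  multiplication by \<open>sv\<close>, for a suitable \<open>s\<close> outside \<open>p\<close>, maps \<open>p\<close> into itself, and complete integral
  closedness puts \<open>sv\<close> into \<open>A\<close>.
\<close>

lemma dvr_separates:
  assumes r: "reg A xs" and P: "prm A P" and ab: "a \<in> A" "b \<in> A" "b \<noteq> \<zero>" and z: "z \<in> carrier K" "z \<otimes> b = a" "z \<notin> locI A P A"
  shows "\<exists>p u. prm A p \<and> p \<subseteq> P \<and> z \<notin> locI A p A \<and> u \<in> mx (locI A p A) \<and> u \<noteq> \<zero> \<and> mx (locI A p A) = add_gen (locI A p A) u {\<zero>}"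
proof -
  have l: "lcl A" and nA: "noeth A" using r unfolding reg_def by auto
  note A = lclD(1)[OF l]
  note ac = subringD(4)[OF A]
  define T where "T = locI A P A"
  have T: "subring T K" unfolding T_def using loc_subring[OF A P] .
  have AT: "A \<subseteq> T" unfolding T_def using loc_sup[OF A P] .
  have bK: "b \<in> carrier K" using ac[OF ab(2)] .
  define M where "M = smul b T"
  have MT: "smod T M" unfolding M_def using smul_smod[OF T smod_self[OF T] bK] .
  have MA: "smod A M" using smod_mono[OF MT AT] .
  have bM: "v \<otimes> b \<in> M \<longleftrightarrow> v \<in> T" if v: "v \<in> carrier K" for v
  proof
    assume "v \<otimes> b \<in> M"
    then obtain t where t: "t \<in> T" "v \<otimes> b = b \<otimes> t" unfolding M_def smul_def by blast
    have "b \<otimes> v = b \<otimes> t" using t(2) m_comm[OF v bK] by simp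
    then have "v = t" using eq_cancelK[OF bK v subringD(4)[OF T t(1)] ab(3)] by blast
    then show "v \<in> T" using t by simp
  next
    assume "v \<in> T" then show "v \<otimes> b \<in> M" unfolding M_def smul_def using m_comm[OF v bK] by auto
  qed
  have aM: "a \<notin> M" using bM[OF z(1)] z(2,3) unfolding T_def by simp
  \<comment> \<open>\<open>colon A M c\<close> is the ideal of all \<open>r\<close> in \<open>A\<close> with \<open>rc/b\<close> in \<open>A\<^sub>P\<close>\<close>
  define F where "F = {colon A M c | c. c \<in> A \<and> c \<notin> M \<and> colon A M a \<subseteq> colon A M c}"
  have Fi: "idl A J" if "J \<in> F" for J using that colon_idl[OF A MA ac] unfolding F_def by blast
  have ne: "F \<noteq> {}" using ab(1) aM unfolding F_def by blast
  obtain p where p: "p \<in> F" "\<forall>J\<in>F. p \<subseteq> J \<longrightarrow> J = p" using noeth_max[OF A nA Fi ne] by blast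
  obtain c where c: "c \<in> A" "c \<notin> M" "colon A M a \<subseteq> colon A M c" "p = colon A M c" using p(1) unfolding F_def by blast
  have xy_carrier: "c \<in> carrier K" using ac[OF c(1)] .
  have pi: "idl A p" using Fi[OF p(1)] .
  have pp: "prm A p" unfolding prm_def
  proof (intro conjI ballI impI)
    show "idl A p" by (rule pi)
    show "\<one> \<notin> p" unfolding c(4) colon_def using c(2) xy_carrier by simp
    fix r s assume rs: "r \<in> A" "s \<in> A" "r \<otimes> s \<in> p"
    show "r \<in> p \<or> s \<in> p"
    proof (rule ccontr)
      assume n: "\<not> ?thesis"
      note K = ac[OF rs(1)] ac[OF rs(2)] xy_carrier
      have sc: "s \<otimes> c \<notin> M" using n rs(2) unfolding c(4) colon_def by blast
      have "p \<subseteq> colon A M (s \<otimes> c)"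
      proof
        fix t assume t: "t \<in> p"
        then have tt: "t \<in> A" "t \<otimes> c \<in> M" unfolding c(4) colon_def by auto
        have "t \<otimes> (s \<otimes> c) = s \<otimes> (t \<otimes> c)" using ac[OF tt(1)] K by algebra
        then show "t \<in> colon A M (s \<otimes> c)" unfolding colon_def using tt smodD(5)[OF MA rs(2) tt(2)] by simp
      qed
      moreover from this have "colon A M (s \<otimes> c) \<in> F" unfolding F_def using subringD(6)[OF A rs(2) c(1)] sc c(3,4) by blast
      ultimately have "colon A M (s \<otimes> c) = p" using p(2) by blast
      moreover have "r \<in> colon A M (s \<otimes> c)" using rs(1,3) K unfolding c(4) colon_def by (simp add: m_assoc)
      ultimately show False using n by blast
    qed
  qed
  have pP: "p \<subseteq> P"
  proof
    fix r assume "r \<in> p"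
    then have rr: "r \<in> A" "r \<otimes> c \<in> M" unfolding c(4) colon_def by auto
    show "r \<in> P"
    proof (rule ccontr)
      assume n: "r \<notin> P"
      have "c \<otimes> r \<in> M" using rr m_comm[OF xy_carrier ac[OF rr(1)]] by simp
      then have "c \<in> M" using loc_den_cancel[OF A P MT[unfolded T_def] rr(1) n xy_carrier] by blast
      then show False using c(2) by blast
    qed
  qed
  define W where "W = locI A p A"
  have W: "subring W K" unfolding W_def using loc_subring[OF A pp] .
  have AW: "A \<subseteq> W" unfolding W_def using loc_sup[OF A pp] .
  have mW: "mx W = locI A p p" unfolding W_def using mx_loc[OF A pp] .
  have lW: "lcl W" unfolding W_def using loc_lcl[OF A pp] .
  have TW: "T \<subseteq> W" unfolding T_def W_def locI_def using pP by blast
  define u where "u = c \<otimes> inv b"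
  note ib = invK[OF bK ab(3)]
  have uK: "u \<in> carrier K" unfolding u_def using xy_carrier ib by simp
  have ub: "u \<otimes> b = c" unfolding u_def using xy_carrier bK ib by (simp add: m_assoc)
  have ug: "u \<otimes> g \<in> T" if g: "g \<in> p" for g
  proof -
    have gg: "g \<in> A" "g \<otimes> c \<in> M" using g unfolding c(4) colon_def by auto
    have "(u \<otimes> g) \<otimes> b = g \<otimes> (u \<otimes> b)" using uK bK ac[OF gg(1)] by algebra
    then show ?thesis using bM[of "u \<otimes> g"] gg uK ac[OF gg(1)] unfolding ub by simp
  qed
  have in_p: "s \<in> p" if s: "s \<in> A" "v \<in> carrier K" "v \<otimes> s \<in> A" "v \<otimes> b = e" "colon A M e \<subseteq> p" for s v e
  proof -
    have "(v \<otimes> s) \<otimes> b = s \<otimes> (v \<otimes> b)" using ac[OF s(1)] s(2) bK by algebra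
    moreover have "(v \<otimes> s) \<otimes> b \<in> M" using bM[of "v \<otimes> s"] s AT ac by auto
    ultimately have "s \<in> colon A M e" unfolding colon_def using s(1,4) by simp
    then show ?thesis using s(5) by blast
  qed
  have zW: "z \<notin> W" using in_p[OF _ z(1) _ z(2)] c(3,4) unfolding W_def locI_def by blast
  have uW: "u \<notin> W" using in_p[OF _ uK _ ub] c(4) unfolding W_def locI_def by blast
  have u0: "u \<noteq> \<zero>" using uW subringD(2)[OF W] by blast
  have bp: "b \<in> p" unfolding c(4) colon_def using ab(2) bM[OF xy_carrier] AT c(1) m_comm[OF bK xy_carrier] by auto
  have "\<exists>g\<in>p. u \<otimes> g \<notin> mx W"
  proof (rule ccontr)
    assume "\<not> ?thesis"
    then have h: "u \<otimes> g \<in> locI A p p" if "g \<in> p" for g using that mW by blast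
    obtain gs where gs: "set gs \<subseteq> A" "p = add_gens A gs {\<zero>}" using nA pi unfolding noeth_def by blast
    have gsp: "set gs \<subseteq> p" unfolding gs(2) using add_gens_sup(2)[OF A _ smod_zero[OF A]] gs(1) subringD(1)[OF A] by blast
    then have "set (map (\<lambda>g. u \<otimes> g) gs) \<subseteq> locI A p p" using h by auto
    then obtain s where s: "s \<in> A" "s \<notin> p" "\<forall>g\<in>set (map (\<lambda>g. u \<otimes> g) gs). g \<otimes> s \<in> p"
      using common_denominator[OF A pp _ prmD(2)[OF pp]] by blast
    have sK: "s \<in> carrier K" using ac[OF s(1)] .
    define v where "v = u \<otimes> s"
    have vK: "v \<in> carrier K" unfolding v_def using uK sK by simp
    have "smod A {g \<in> carrier K. g \<otimes> v \<in> p}" unfolding smod_def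
    proof (intro conjI ballI)
      show "{g \<in> carrier K. g \<otimes> v \<in> p} \<subseteq> carrier K" "\<zero> \<in> {g \<in> carrier K. g \<otimes> v \<in> p}" using vK prmD(5)[OF pp] by auto
      show "g \<oplus> h \<in> {g \<in> carrier K. g \<otimes> v \<in> p}" if "g \<in> {g \<in> carrier K. g \<otimes> v \<in> p}" "h \<in> {g \<in> carrier K. g \<otimes> v \<in> p}" for g h
        using that idlD(6)[OF pi] vK by (auto simp: l_distr)
      show "r \<otimes> h \<in> {g \<in> carrier K. g \<otimes> v \<in> p}" if "r \<in> A" "h \<in> {g \<in> carrier K. g \<otimes> v \<in> p}" for r h
        using that idlD(7)[OF pi] vK ac[OF that(1)] by (auto simp: m_assoc)
    qed
    moreover have "set gs \<subseteq> {g \<in> carrier K. g \<otimes> v \<in> p}"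
    proof
      fix g assume g: "g \<in> set gs"
      have gK: "g \<in> carrier K" using g gs(1) ac by blast
      have "g \<otimes> v = (u \<otimes> g) \<otimes> s" unfolding v_def using gK uK sK by algebra
      then show "g \<in> {g \<in> carrier K. g \<otimes> v \<in> p}" using s(3) g gK by simp
    qed
    moreover have "{\<zero>} \<subseteq> {g \<in> carrier K. g \<otimes> v \<in> p}" using vK prmD(5)[OF pp] by auto
    ultimately have "p \<subseteq> {g \<in> carrier K. g \<otimes> v \<in> p}" unfolding gs(2) by (rule add_gens_least)
    then have vp: "g \<otimes> v \<in> p" if "g \<in> p" for g using that by blast
    have "b \<otimes> v [^] n \<in> p" for n :: nat
    proof (induction n)
      case 0 then show ?case using bp bK by simp
    next
      case (Suc n)
      have "b \<otimes> v [^] Suc n = (b \<otimes> v [^] n) \<otimes> v" using bK vK by (simp add: m_assoc)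
      then show ?case using vp[OF Suc] by simp
    qed
    then have "b \<otimes> v [^] n \<in> A" for n :: nat using idlD(2)[OF pi] by blast
    then have "u \<otimes> s \<in> A" using regular_cic[OF r vK ab(2,3)] unfolding v_def by blast
    then have "u \<in> W" unfolding W_def locI_def using uK s by blast
    then show False using uW by blast
  qed
  then obtain g where g: "g \<in> p" "u \<otimes> g \<notin> mx W" by blast
  have "u \<otimes> g \<in> W" using ug[OF g(1)] TW by blast
  then obtain h where h: "h \<in> W" "(u \<otimes> g) \<otimes> h = \<one>" using notin_mx g(2) by blast
  have gK: "g \<in> carrier K" using idlD(5)[OF pi g(1)] .
  have hK: "h \<in> carrier K" using subringD(4)[OF W h(1)] .
  define \<pi> where "\<pi> = h \<otimes> g"
  have \<pi>K: "\<pi> \<in> carrier K" unfolding \<pi>_def using hK gK by simp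
  have gm: "g \<in> mx W" unfolding mW using locI_sup[OF A pp prmD(2)[OF pp]] g(1) by blast
  have \<pi>m: "\<pi> \<in> mx W" unfolding \<pi>_def using idlD(7)[OF lclD(2)[OF lW] h(1) gm] .
  have "u \<otimes> \<pi> = (u \<otimes> g) \<otimes> h" unfolding \<pi>_def using uK gK hK by algebra
  then have u\<pi>: "u \<otimes> \<pi> = \<one>" using h(2) by simp
  then have \<pi>0: "\<pi> \<noteq> \<zero>" using uK by auto
  have "mx W = add_gen W \<pi> {\<zero>}"
  proof
    show "add_gen W \<pi> {\<zero>} \<subseteq> mx W" using add_gen_least[OF idlD(1)[OF lclD(2)[OF lW]] \<pi>m] idlD(3)[OF lclD(2)[OF lW]] by blast
    show "mx W \<subseteq> add_gen W \<pi> {\<zero>}"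
    proof
      fix w assume "w \<in> mx W"
      then obtain s where s: "w \<in> carrier K" "s \<in> A" "s \<notin> p" "w \<otimes> s \<in> p" unfolding mW locI_def by blast
      have "u \<otimes> (w \<otimes> s) \<in> W" using ug[OF s(4)] TW by blast
      moreover have "u \<otimes> (w \<otimes> s) = (u \<otimes> w) \<otimes> s" using uK s(1) ac[OF s(2)] by (simp add: m_assoc)
      ultimately have "u \<otimes> w \<in> W" using loc_den_cancel[OF A pp smod_self[OF W, unfolded W_def] s(2,3)] uK s(1) unfolding W_def by simp
      moreover have "(u \<otimes> w) \<otimes> \<pi> \<oplus> \<zero> = (u \<otimes> \<pi>) \<otimes> w" using uK s(1) \<pi>K by algebra
      then have "w = (u \<otimes> w) \<otimes> \<pi> \<oplus> \<zero>" using u\<pi> s(1) by simp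
      ultimately show "w \<in> add_gen W \<pi> {\<zero>}" unfolding add_gen_def by blast
    qed
  qed
  then show ?thesis using pp pP zW \<pi>m \<pi>0 unfolding W_def by blast
qed

text \<open>Every ideal is generated by the least power of the uniformizer that it contains.\<close>

lemma principal_ideals:
  assumes l: "lcl W" and n: "noeth W" and u: "u \<noteq> \<zero>" "u \<in> mx W" and m: "mx W = add_gen W u {\<zero>}" and I: "idl W I"
  shows "\<exists>g\<in>W. I = {w \<otimes> g | w. w \<in> W}"
proof (cases "I = {\<zero>}")
  case True
  have "I = {w \<otimes> \<zero> | w. w \<in> W}" unfolding True using subringD(2,4)[OF lclD(1)[OF l]] by (auto intro!: exI[of _ \<zero>])
  then show ?thesis using subringD(2)[OF lclD(1)[OF l]] by blast
next
  case False
  note W = lclD(1)[OF l]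
  note ac = subringD(4)[OF W]
  have uW: "u \<in> W" using u unfolding mx_def by blast
  have uK: "u \<in> carrier K" using ac[OF uW] .
  \<comment> \<open>every nonzero element is a unit times a power of \<open>u\<close>\<close>
  have fac: "\<exists>(k::nat) v. v \<in> W \<and> v \<notin> mx W \<and> w = v \<otimes> u [^] k" if w: "w \<in> W" "w \<noteq> \<zero>" for w
  proof -
    obtain k :: nat and v where v: "v \<in> W" "v \<notin> mx W" "w \<ominus> u [^] k \<otimes> v \<in> {\<zero>}"
      using x_factor[OF l n prm_zero[OF W] u(2) _ m prm_mx[OF l] w(1)] u(1) w(2) by blast
    have K: "w \<in> carrier K" "v \<in> carrier K" "u [^] k \<in> carrier K" using ac w(1) v(1) uK by auto
    have "w = (w \<ominus> u [^] k \<otimes> v) \<oplus> v \<otimes> u [^] k" using K by algebra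
    then have "w = v \<otimes> u [^] k" using v(3) K by (simp add: m_comm)
    then show ?thesis using v(1,2) by blast
  qed
  have pin: "u [^] k \<in> I" if "v \<in> W" "v \<notin> mx W" "v \<otimes> u [^] k \<in> I" for v and k :: nat
    using unit_cancel[OF W idlD(1)[OF I] that(1,2) _ that(3)] uK by simp
  have ex: "\<exists>k::nat. u [^] k \<in> I"
  proof -
    obtain w where w: "w \<in> I" "w \<noteq> \<zero>" using False idlD(3)[OF I] by blast
    obtain k :: nat and v where "v \<in> W" "v \<notin> mx W" "w = v \<otimes> u [^] k" using fac[OF idlD(4)[OF I w(1)] w(2)] by blast
    then show ?thesis using pin w(1) by blast
  qed
  define k where "k = (LEAST k::nat. u [^] k \<in> I)"
  have k: "u [^] k \<in> I" unfolding k_def using LeastI_ex[OF ex] .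
  have "I = {w \<otimes> u [^] k | w. w \<in> W}"
  proof
    show "{w \<otimes> u [^] k | w. w \<in> W} \<subseteq> I" using idlD(7)[OF I _ k] by blast
    show "I \<subseteq> {w \<otimes> u [^] k | w. w \<in> W}"
    proof
      fix w assume w: "w \<in> I"
      show "w \<in> {w \<otimes> u [^] k | w. w \<in> W}"
      proof (cases "w = \<zero>")
        case True
        have "w = \<zero> \<otimes> u [^] k" using True uK by simp
        then show ?thesis using subringD(2)[OF W] by blast
      next
        case F: False
        obtain j :: nat and v where j: "v \<in> W" "v \<notin> mx W" "w = v \<otimes> u [^] j" using fac[OF idlD(4)[OF I w] F] by blast
        have "u [^] j \<in> I" using pin j w by blast
        then have "k \<le> j" unfolding k_def by (rule Least_le)
        then obtain i where i: "j = i + k" using le_Suc_ex by (metis add.commute)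
        have "w = (v \<otimes> u [^] i) \<otimes> u [^] k" unfolding j(3) i using nat_pow_mult[OF uK, of i k, symmetric] ac[OF j(1)] uK by (simp add: m_assoc)
        then show ?thesis using subringD(6)[OF W j(1) subringD(9)[OF W uW]] by blast
      qed
    qed
  qed
  then show ?thesis using subringD(9)[OF W uW] by blast
qed

section \<open>Existence of valuation rings\<close>

definition vring :: "'a set \<Rightarrow> bool" where
  "vring V \<longleftrightarrow> lcl V \<and> (\<forall>u\<in>carrier K. u \<noteq> \<zero> \<longrightarrow> u \<in> V \<or> inv u \<in> V)"

text \<open>The ideal of \<open>D\<close> generated by \<open>I\<close>.\<close>

definition extension :: "'a set \<Rightarrow> 'a set \<Rightarrow> 'a set" where
  "extension D I = \<Inter>{M. smod D M \<and> I \<subseteq> M}"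

lemma extension_facts: assumes D: "subring D K" and I: "I \<subseteq> D"
  shows "idl D (extension D I)" "I \<subseteq> extension D I" "\<And>M. smod D M \<Longrightarrow> I \<subseteq> M \<Longrightarrow> extension D I \<subseteq> M"
proof -
  have self: "D \<in> {M. smod D M \<and> I \<subseteq> M}" using smod_self[OF D] I by blast
  then have sub: "extension D I \<subseteq> D" unfolding extension_def by blast
  have "smod D (extension D I)" unfolding smod_def
  proof (intro conjI ballI)
    show "extension D I \<subseteq> carrier K" using sub subringD(1)[OF D] by blast
    show "\<zero> \<in> extension D I" unfolding extension_def using smodD(2) by blast
    show "x \<oplus> y \<in> extension D I" if "x \<in> extension D I" "y \<in> extension D I" for x y using that smodD(4) unfolding extension_def by blast
    show "x \<otimes> y \<in> extension D I" if "x \<in> D" "y \<in> extension D I" for x y using that smodD(5) unfolding extension_def by blast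
  qed
  then show "idl D (extension D I)" unfolding idl_def using sub by blast
  show "I \<subseteq> extension D I" "\<And>M. smod D M \<Longrightarrow> I \<subseteq> M \<Longrightarrow> extension D I \<subseteq> M" unfolding extension_def by blast+
qed

text \<open>Of two nonunits one divides the other, so their sum is a multiple of a nonunit.\<close>

lemma valuative_local:
  assumes V: "subring V K" and v: "\<And>u. u \<in> carrier K \<Longrightarrow> u \<noteq> \<zero> \<Longrightarrow> u \<in> V \<or> inv u \<in> V"
  shows "vring V"
proof -
  note ac = subringD(4)[OF V]
  have mV: "a \<in> V" "\<And>b. b \<in> V \<Longrightarrow> a \<otimes> b \<noteq> \<one>" if "a \<in> mx V" for a using that unfolding mx_def by auto
  have mult: "r \<otimes> a \<in> mx V" if r: "r \<in> V" and a: "a \<in> mx V" for r a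
  proof -
    have "(r \<otimes> a) \<otimes> b \<noteq> \<one>" if b: "b \<in> V" for b
    proof -
      have "(r \<otimes> a) \<otimes> b = a \<otimes> (r \<otimes> b)" using ac[OF r] ac[OF b] ac[OF mV(1)[OF a]] by algebra
      then show ?thesis using mV(2)[OF a subringD(6)[OF V r b]] by simp
    qed
    then show ?thesis unfolding mx_def using subringD(6)[OF V r mV(1)[OF a]] by blast
  qed
  have z: "\<zero> \<in> mx V" unfolding mx_def using subringD(2)[OF V] ac by auto
  have *: "a \<oplus> b \<in> mx V" if ab: "a \<in> mx V" "b \<in> mx V" "b \<noteq> \<zero>" "a \<otimes> inv b \<in> V" for a b
  proof -
    have K: "a \<in> carrier K" "b \<in> carrier K" using ac mV(1) ab by auto
    note i = invK[OF K(2) ab(3)]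
    have "(a \<otimes> inv b \<oplus> \<one>) \<otimes> b = a \<otimes> (inv b \<otimes> b) \<oplus> b" using K i(1) by algebra
    then have "(a \<otimes> inv b \<oplus> \<one>) \<otimes> b = a \<oplus> b" using i(3) K by simp
    then show ?thesis using mult[OF subringD(7)[OF V ab(4) subringD(3)[OF V]] ab(2)] by simp
  qed
  have "a \<oplus> b \<in> mx V" if ab: "a \<in> mx V" "b \<in> mx V" for a b
  proof -
    have K: "a \<in> carrier K" "b \<in> carrier K" using ac mV(1) ab by auto
    show ?thesis
    proof (cases "a = \<zero> \<or> b = \<zero>")
      case True then show ?thesis using ab K by auto
    next
      case False
      note ib = invK[OF K(2)]
      have ne: "a \<otimes> inv b \<noteq> \<zero>" using integral[of a "inv b"] False ib K(1) by blast
      have "a \<otimes> inv b \<in> V \<or> inv (a \<otimes> inv b) \<in> V" using v[OF _ ne] K(1) ib False by auto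
      moreover have "inv (a \<otimes> inv b) = b \<otimes> inv a" using inv_quotient K False by simp
      ultimately have "a \<otimes> inv b \<in> V \<or> b \<otimes> inv a \<in> V" by simp
      then show ?thesis using *[OF ab] *[OF ab(2,1)] False a_comm[OF K] by auto
    qed
  qed
  then have "idl V (mx V)" unfolding idl_def smod_def using mult z mV(1) subringD(1)[OF V] by blast
  then show ?thesis unfolding vring_def lcl_def using V v by blast
qed

text \<open>
  Multiplying a polynomial of degree \<open>M\<close> in \<open>w = 1/u\<close> by \<open>u\<^sup>M\<close> turns its constant term into the leading
  coefficient of a polynomial in \<open>u\<close>.
\<close>

lemma pols_reverse:
  assumes V: "subring V K" and J: "smod V J" and u: "u \<in> carrier K" "w \<in> carrier K" "u \<otimes> w = \<one>"
  shows "z \<in> pols J w (Suc M) \<Longrightarrow> \<exists>d\<in>J. u [^] M \<otimes> z \<ominus> d \<otimes> u [^] M \<in> pols J u M"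
proof (induction M arbitrary: z)
  case 0
  obtain a where a: "a \<in> J" "z = \<zero> \<oplus> a \<otimes> w [^] (0::nat)" using 0 unfolding pols_Suc[OF V u(2)] pols_0[OF V u(2) J] by auto
  have "u [^] (0::nat) \<otimes> z \<ominus> a \<otimes> u [^] (0::nat) = \<zero>" unfolding a(2) using smodD(3)[OF J a(1)] by (simp add: a_minus_def r_neg)
  then show ?case using a(1) pols_0[OF V u(1) J] by auto
next
  case (Suc M)
  obtain g a where g: "g \<in> pols J w (Suc M)" "a \<in> J" "z = g \<oplus> a \<otimes> w [^] Suc M" using Suc.prems unfolding pols_Suc[OF V u(2), of z J "Suc M"] by blast
  obtain d where d: "d \<in> J" "u [^] M \<otimes> g \<ominus> d \<otimes> u [^] M \<in> pols J u M" using Suc.IH[OF g(1)] by blast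
  have K: "g \<in> carrier K" "a \<in> carrier K" "d \<in> carrier K" "u [^] M \<in> carrier K" using pols_carrier[OF V u(2) J g(1)] smodD(3)[OF J] g(2) d(1) u(1) by auto
  have one: "u [^] Suc M \<otimes> w [^] Suc M = \<one>" using nat_pow_distrib[OF u(1,2), of "Suc M"] u(3) nat_pow_one by metis
  have wK: "w [^] Suc M \<in> carrier K" using u(2) by simp
  have "u [^] Suc M \<otimes> z \<ominus> d \<otimes> u [^] Suc M = u \<otimes> (u [^] M \<otimes> g \<ominus> d \<otimes> u [^] M) \<oplus> a \<otimes> (u [^] Suc M \<otimes> w [^] Suc M)"
  proof -
    have "\<And>w'. w' \<in> carrier K \<Longrightarrow> (um \<otimes> u) \<otimes> (g \<oplus> a \<otimes> w') \<ominus> d \<otimes> (um \<otimes> u) = u \<otimes> (um \<otimes> g \<ominus> d \<otimes> um) \<oplus> a \<otimes> ((um \<otimes> u) \<otimes> w')"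
      if "um \<in> carrier K" for um using that K u(1) by algebra
    from this[OF K(4) wK] show ?thesis unfolding g(3) nat_pow_Suc[of u M] .
  qed
  also have "\<dots> = u \<otimes> (u [^] M \<otimes> g \<ominus> d \<otimes> u [^] M) \<oplus> a" unfolding one using K by simp
  finally have e: "u [^] Suc M \<otimes> z \<ominus> d \<otimes> u [^] Suc M = u \<otimes> (u [^] M \<otimes> g \<ominus> d \<otimes> u [^] M) \<oplus> a" .
  have "a \<in> pols J u (Suc M)" using pols_const[OF V u(1) J g(2)] pols_mono[OF V u(1) J, of 1 "Suc M"] by auto
  then have "u [^] Suc M \<otimes> z \<ominus> d \<otimes> u [^] Suc M \<in> pols J u (Suc M)" unfolding e
    using smodD(4)[OF pols_smod[OF V u(1) J] pols_shift1[OF V u(1) J d(2)]] by blast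
  then show ?case using d(1) by blast
qed

text \<open>
  Chevalley's extension theorem. A subring \<open>V\<close> maximal among those in which \<open>I\<close> generates a proper ideal \<open>J\<close>
  is a valuation ring: if \<open>J\<close> became the unit ideal both in \<open>V[u]\<close> and in \<open>V[1/u]\<close>, then the relation of
  smaller degree could be used to lower the degree of the other one.
\<close>

theorem dominating_valuation_ring:
  assumes A: "subring A K" and I: "idl A I" "\<one> \<notin> I"
  shows "\<exists>V. vring V \<and> A \<subseteq> V \<and> I \<subseteq> mx V"
proof -
  define F where "F = {D. subring D K \<and> A \<subseteq> D \<and> \<one> \<notin> extension D I}"
  have IA: "I \<subseteq> A" using idlD(2)[OF I(1)] .
  have "extension A I \<subseteq> I" using extension_facts(3)[OF A IA idlD(1)[OF I(1)]] by blast
  then have "A \<in> F" unfolding F_def using A I(2) by blast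
  then have ne: "F \<noteq> {}" by blast
  have "\<exists>V\<in>F. \<forall>D\<in>F. V \<subseteq> D \<longrightarrow> D = V"
  proof (rule subset_Zorn_nonempty[OF ne])
    fix C assume C: "C \<noteq> {}" "subset.chain F C"
    then have CF: "C \<subseteq> F" and tot: "\<And>U W. U \<in> C \<Longrightarrow> W \<in> C \<Longrightarrow> (U \<subseteq> W \<or> W \<subseteq> U)"
      unfolding subset_chain_def by blast+
    have Cs: "subring D K" "A \<subseteq> D" "\<one> \<notin> extension D I" if "D \<in> C" for D using that CF unfolding F_def by auto
    have dir: "\<exists>D\<in>C. a \<in> D \<and> b \<in> D" if ab: "a \<in> \<Union>C" "b \<in> \<Union>C" for a b
    proof -
      obtain D E where "D \<in> C" "E \<in> C" "a \<in> D" "b \<in> E" using ab by blast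
      then show ?thesis using tot[of D E] by blast
    qed
    have Us: "subring (\<Union>C) K"
    proof (rule subringI)
      show "\<Union>C \<subseteq> carrier K" using subringD(1)[OF Cs(1)] by blast
      show "\<one> \<in> \<Union>C" using subringD(3)[OF Cs(1)] C(1) by blast
      show "\<ominus> h \<in> \<Union>C" if "h \<in> \<Union>C" for h using that subringD(5)[OF Cs(1)] by blast
      show "h1 \<otimes> h2 \<in> \<Union>C" if "h1 \<in> \<Union>C" "h2 \<in> \<Union>C" for h1 h2 using dir[OF that] subringD(6)[OF Cs(1)] by blast
      show "h1 \<oplus> h2 \<in> \<Union>C" if "h1 \<in> \<Union>C" "h2 \<in> \<Union>C" for h1 h2 using dir[OF that] subringD(7)[OF Cs(1)] by blast
    qed
    have AU: "A \<subseteq> \<Union>C" using C(1) Cs(2) by blast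
    define M where "M = (\<Union>D\<in>C. extension D I)"
    have EI: "idl D (extension D I)" "I \<subseteq> extension D I" if "D \<in> C" for D using extension_facts(1,2)[OF Cs(1)[OF that]] Cs(2)[OF that] IA by auto
    have emono: "extension D I \<subseteq> extension E I" if "D \<in> C" "E \<in> C" "D \<subseteq> E" for D E
      using extension_facts(3)[OF Cs(1)[OF that(1)] _ smod_mono[OF idlD(1)[OF EI(1)[OF that(2)]] that(3)] EI(2)[OF that(2)]] Cs(2)[OF that(1)] IA by blast
    have "smod (\<Union>C) M" unfolding smod_def
    proof (intro conjI ballI)
      show "M \<subseteq> carrier K" unfolding M_def using idlD(5)[OF EI(1)] by blast
      show "\<zero> \<in> M" unfolding M_def using idlD(3)[OF EI(1)] C(1) by blast
      show "x \<oplus> y \<in> M" if "x \<in> M" "y \<in> M" for x y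
      proof -
        obtain D E where D: "D \<in> C" "E \<in> C" "x \<in> extension D I" "y \<in> extension E I" using \<open>x \<in> M\<close> \<open>y \<in> M\<close> unfolding M_def by blast
        then obtain G where "G \<in> C" "x \<in> extension G I" "y \<in> extension G I" using tot[OF D(1,2)] emono[of D E] emono[of E D] by blast
        then show ?thesis unfolding M_def using idlD(6)[OF EI(1)] by blast
      qed
      show "x \<otimes> y \<in> M" if "x \<in> \<Union>C" "y \<in> M" for x y
      proof -
        obtain D E where D: "D \<in> C" "E \<in> C" "x \<in> D" "y \<in> extension E I" using \<open>x \<in> \<Union>C\<close> \<open>y \<in> M\<close> unfolding M_def by blast
        then obtain G where "G \<in> C" "x \<in> G" "y \<in> extension G I" using tot[OF D(1,2)] emono[of E D] by blast
        then show ?thesis unfolding M_def using idlD(7)[OF EI(1)] by blast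
      qed
    qed
    moreover have "I \<subseteq> M" unfolding M_def using EI(2) C(1) by blast
    ultimately have "extension (\<Union>C) I \<subseteq> M" using extension_facts(3)[OF Us] IA AU by blast
    then have "\<one> \<notin> extension (\<Union>C) I" unfolding M_def using Cs(3) by blast
    then show "\<Union>C \<in> F" unfolding F_def using Us AU by blast
  qed
  then obtain V where V0: "V \<in> F" and Vmax: "\<And>D. D \<in> F \<Longrightarrow> V \<subseteq> D \<Longrightarrow> D = V" by blast
  have V: "subring V K" "A \<subseteq> V" "\<one> \<notin> extension V I" using V0 unfolding F_def by auto
  note ac = subringD(4)[OF V(1)]
  have IV: "I \<subseteq> V" using IA V(2) by blast
  define J where "J = extension V I"
  note J = extension_facts[OF V(1) IV, folded J_def]
  note sJ = idlD(1)[OF J(1)]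
  have J1: "\<one> \<notin> J" unfolding J_def using V(3) .
  have one_in: "\<one> \<in> M" if "subring D K" "V \<subset> D" "smod D M" "I \<subseteq> M" for D M
  proof -
    have "D \<notin> F" using Vmax[of D] that(2) by blast
    then have "\<one> \<in> extension D I" unfolding F_def using that V(2) by blast
    then show ?thesis using extension_facts(3)[OF that(1) _ that(3,4)] IV that(2) by blast
  qed
  \<comment> \<open>elements congruent to one modulo \<open>J\<close> are invertible\<close>
  have unit: "inv (\<one> \<ominus> c) \<in> V" "\<one> \<ominus> c \<noteq> \<zero>" "\<one> \<ominus> c \<in> V" if c: "c \<in> J" for c
  proof -
    have cV: "c \<in> V" using idlD(4)[OF J(1) c] .
    have den: "\<one> \<ominus> d \<noteq> \<zero>" "\<one> \<ominus> d \<in> V" if d: "d \<in> J" for d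
    proof -
      have dV: "d \<in> V" using idlD(4)[OF J(1) d] .
      have "\<one> = (\<one> \<ominus> d) \<oplus> d" using ac[OF dV] by algebra
      then show "\<one> \<ominus> d \<noteq> \<zero>" using J1 d ac[OF dV] by auto
      show "\<one> \<ominus> d \<in> V" using subringD(8)[OF V(1) subringD(3)[OF V(1)] dV] .
    qed
    show d0: "\<one> \<ominus> c \<noteq> \<zero>" "\<one> \<ominus> c \<in> V" using den[OF c] by auto
    \<comment> \<open>the fractions with denominators in \<open>1 + J\<close> form an overring in which \<open>J\<close> stays proper\<close>
    let ?X = "\<lambda>N. {z \<in> carrier K. \<exists>d\<in>J. z \<otimes> (\<one> \<ominus> d) \<in> N}"
    have dm: "\<exists>f\<in>J. (\<one> \<ominus> d) \<otimes> (\<one> \<ominus> e) = \<one> \<ominus> f" if "d \<in> J" "e \<in> J" for d e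
    proof -
      have K: "d \<in> carrier K" "e \<in> carrier K" using idlD(5)[OF J(1)] that by auto
      have "(\<one> \<ominus> d) \<otimes> (\<one> \<ominus> e) = \<one> \<ominus> (d \<oplus> (\<one> \<ominus> d) \<otimes> e)" using K by algebra
      moreover have "d \<oplus> (\<one> \<ominus> d) \<otimes> e \<in> J" using idlD(6)[OF J(1) that(1) idlD(7)[OF J(1) den(2)[OF that(1)] that(2)]] .
      ultimately show ?thesis by blast
    qed
    have cl: "x \<oplus> y \<in> ?X N" if N: "smod V N" and xy: "x \<in> ?X N" "y \<in> ?X N" for x y N
    proof -
      obtain d e where d: "x \<in> carrier K" "d \<in> J" "x \<otimes> (\<one> \<ominus> d) \<in> N" "y \<in> carrier K" "e \<in> J" "y \<otimes> (\<one> \<ominus> e) \<in> N" using xy by blast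
      obtain f where f: "f \<in> J" "(\<one> \<ominus> d) \<otimes> (\<one> \<ominus> e) = \<one> \<ominus> f" using dm[OF d(2,5)] by blast
      note K = ac[OF den(2)[OF d(2)]] ac[OF den(2)[OF d(5)]]
      have "(x \<oplus> y) \<otimes> (\<one> \<ominus> f) = (\<one> \<ominus> e) \<otimes> (x \<otimes> (\<one> \<ominus> d)) \<oplus> (\<one> \<ominus> d) \<otimes> (y \<otimes> (\<one> \<ominus> e))"
        unfolding f(2)[symmetric] using d(1,4) K by (simp add: l_distr r_distr m_ac)
      then have "(x \<oplus> y) \<otimes> (\<one> \<ominus> f) \<in> N" using smodD(4)[OF N smodD(5)[OF N den(2)[OF d(5)] d(3)] smodD(5)[OF N den(2)[OF d(2)] d(6)]] by simp
      then show ?thesis using f(1) d(1,4) by blast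
    qed
    have ml: "x \<otimes> y \<in> ?X N" if N: "smod V N" and xy: "x \<in> ?X V" "y \<in> ?X N" for x y N
    proof -
      obtain d e where d: "x \<in> carrier K" "d \<in> J" "x \<otimes> (\<one> \<ominus> d) \<in> V" "y \<in> carrier K" "e \<in> J" "y \<otimes> (\<one> \<ominus> e) \<in> N" using xy by blast
      obtain f where f: "f \<in> J" "(\<one> \<ominus> d) \<otimes> (\<one> \<ominus> e) = \<one> \<ominus> f" using dm[OF d(2,5)] by blast
      note K = ac[OF den(2)[OF d(2)]] ac[OF den(2)[OF d(5)]]
      have "(x \<otimes> y) \<otimes> (\<one> \<ominus> f) = (x \<otimes> (\<one> \<ominus> d)) \<otimes> (y \<otimes> (\<one> \<ominus> e))"
        unfolding f(2)[symmetric] using d(1,4) K by (simp add: m_ac)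
      then have "(x \<otimes> y) \<otimes> (\<one> \<ominus> f) \<in> N" using smodD(5)[OF N d(3) d(6)] by simp
      then show ?thesis using f(1) d(1,4) by blast
    qed
    have sup: "N \<subseteq> ?X N" if N: "smod V N" for N
    proof
      fix z assume zN: "z \<in> N"
      have zK: "z \<in> carrier K" using smodD(3)[OF N zN] .
      have "z \<otimes> (\<one> \<ominus> \<zero>) = z" using zK by algebra
      then show "z \<in> ?X N" using zN zK idlD(3)[OF J(1)] by force
    qed
    have smX: "smod (?X V) (?X N)" if N: "smod V N" for N
      unfolding smod_def using cl[OF N] ml[OF N] sup[OF N] smodD(2)[OF N] by blast
    have Xs: "subring (?X V) K"
    proof (rule subringI)
      note S = smX[OF smod_self[OF V(1)]]
      show "?X V \<subseteq> carrier K" by blast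
      show "\<one> \<in> ?X V" using sup[OF smod_self[OF V(1)]] subringD(3)[OF V(1)] by blast
      show "h1 \<otimes> h2 \<in> ?X V" if "h1 \<in> ?X V" "h2 \<in> ?X V" for h1 h2 using smodD(5)[OF S that] .
      show "h1 \<oplus> h2 \<in> ?X V" if "h1 \<in> ?X V" "h2 \<in> ?X V" for h1 h2 using smodD(4)[OF S that] .
      show "\<ominus> h \<in> ?X V" if h: "h \<in> ?X V" for h
      proof -
        have o: "\<ominus> \<one> \<in> ?X V" using sup[OF smod_self[OF V(1)]] subringD(5)[OF V(1) subringD(3)[OF V(1)]] by blast
        have hh: "\<ominus> h = (\<ominus> \<one>) \<otimes> h" using h by (auto simp: l_minus)
        show ?thesis unfolding hh by (rule smodD(5)[OF S o h])
      qed
    qed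
    have "?X V = V"
    proof (rule ccontr)
      assume "?X V \<noteq> V"
      then have "V \<subset> ?X V" using sup[OF smod_self[OF V(1)]] by blast
      moreover have "I \<subseteq> ?X J" using sup[OF sJ] J(2) by blast
      ultimately have "\<one> \<in> ?X J" using one_in[OF Xs _ smX[OF sJ]] by blast
      then obtain d where d: "d \<in> J" "\<one> \<otimes> (\<one> \<ominus> d) \<in> J" by blast
      have dK: "d \<in> carrier K" using idlD(5)[OF J(1) d(1)] .
      have "\<one> = \<one> \<otimes> (\<one> \<ominus> d) \<oplus> d" using dK by algebra
      then show False using idlD(6)[OF J(1) d(2,1)] J1 by simp
    qed
    moreover note iv = invK[OF ac[OF d0(2)] d0(1)]
    have "inv (\<one> \<ominus> c) \<otimes> (\<one> \<ominus> c) \<in> V" using iv(3) subringD(3)[OF V(1)] by simp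
    then have "inv (\<one> \<ominus> c) \<in> ?X V" using iv(1) c by blast
    ultimately show "inv (\<one> \<ominus> c) \<in> V" by blast
  qed
  have shorter: False
    if u: "u \<in> carrier K" "w \<in> carrier K" "u \<otimes> w = \<one>" and n: "\<one> \<in> pols J u (Suc N)" "\<one> \<notin> pols J u N" and m: "\<one> \<in> pols J w (Suc M)" and MN: "M \<le> N" for u w N M
  proof -
    obtain d where d: "d \<in> J" "u [^] M \<otimes> \<one> \<ominus> d \<otimes> u [^] M \<in> pols J u M" using pols_reverse[OF V(1) sJ u m] by blast
    have uM: "u [^] M \<in> carrier K" "d \<in> carrier K" using u(1) idlD(5)[OF J(1) d(1)] by auto
    note iv = invK[OF ac[OF unit(3)[OF d(1)]] unit(2)[OF d(1)]]
    have "u [^] M \<otimes> \<one> \<ominus> d \<otimes> u [^] M = (\<one> \<ominus> d) \<otimes> u [^] M" using uM by algebra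
    then have "inv (\<one> \<ominus> d) \<otimes> ((\<one> \<ominus> d) \<otimes> u [^] M) \<in> pols J u M" using smodD(5)[OF pols_smod[OF V(1) u(1) sJ] unit(1)[OF d(1)] d(2)] by simp
    moreover have "inv (\<one> \<ominus> d) \<otimes> ((\<one> \<ominus> d) \<otimes> u [^] M) = (inv (\<one> \<ominus> d) \<otimes> (\<one> \<ominus> d)) \<otimes> u [^] M"
      using m_assoc[OF iv(1) ac[OF unit(3)[OF d(1)]] uM(1)] by simp
    then have "inv (\<one> \<ominus> d) \<otimes> ((\<one> \<ominus> d) \<otimes> u [^] M) = u [^] M" using iv(3) uM by simp
    ultimately have "u [^] M \<in> pols J u M" by simp
    then have "u [^] (N - M) \<otimes> u [^] M \<in> pols J u (M + (N - M))" using pols_shift[OF V(1) u(1) sJ] by blast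
    then have uN: "u [^] N \<in> pols J u N" using MN nat_pow_mult[OF u(1), of "N - M" M] by simp
    obtain g a where g: "g \<in> pols J u N" "a \<in> J" "\<one> = g \<oplus> a \<otimes> u [^] N" using n(1) unfolding pols_Suc[OF V(1) u(1)] by blast
    have "a \<otimes> u [^] N \<in> pols J u N" using smodD(5)[OF pols_smod[OF V(1) u(1) sJ] idlD(4)[OF J(1) g(2)] uN] .
    then have "\<one> \<in> pols J u N" using smodD(4)[OF pols_smod[OF V(1) u(1) sJ] g(1)] g(3) by simp
    then show False using n(2) by blast
  qed
  have len: "\<exists>N. \<one> \<in> pols J u (Suc N) \<and> \<one> \<notin> pols J u N" if u: "u \<in> carrier K" "u \<notin> V" for u
  proof -
    have "\<one> \<in> adjoin J u"
      by (rule one_in[OF adjoin_subring[OF V(1) u(1)] _ adjoin_smod[OF V(1) u(1) sJ]])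
        (use adjoin_base[OF V(1) u(1)] adjoin_elem[OF V(1) u(1)] u(2) adjoin_sup[OF V(1) u(1) sJ] J(2) in blast)+
    then have ex: "\<exists>n. \<one> \<in> pols J u n" unfolding adjoin_def by blast
    define n where "n = (LEAST n. \<one> \<in> pols J u n)"
    have n: "\<one> \<in> pols J u n" unfolding n_def using LeastI_ex[OF ex] .
    have "n \<noteq> 0"
    proof
      assume "n = 0"
      then show False using n pols_0[OF V(1) u(1) sJ] one_not_zero by simp
    qed
    then obtain N where N: "n = Suc N" by (cases n) auto
    have "\<one> \<notin> pols J u N" using not_less_Least[of N "\<lambda>n. \<one> \<in> pols J u n"] N unfolding n_def by simp
    then show ?thesis using n N by blast
  qed
  have "u \<in> V \<or> inv u \<in> V" if u: "u \<in> carrier K" "u \<noteq> \<zero>" for u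
  proof (rule ccontr)
    assume n: "\<not> ?thesis"
    note i = invK[OF u]
    obtain N where N: "\<one> \<in> pols J u (Suc N)" "\<one> \<notin> pols J u N" using len[OF u(1)] n by blast
    obtain M where M: "\<one> \<in> pols J (inv u) (Suc M)" "\<one> \<notin> pols J (inv u) M" using len[OF i(1)] n by blast
    show False
    proof (cases "M \<le> N")
      case True then show False using shorter[OF u(1) i(1,2) N M(1)] by blast
    next
      case False
      then have "N \<le> M" by simp
      then show False using shorter[OF i(1) u(1) i(3) M N(1)] by blast
    qed
  qed
  then have vV: "vring V" using valuative_local[OF V(1)] by blast
  have "J \<subseteq> mx V" using prop_idl_mx[OF V(1) J(1) J1] .
  then show ?thesis using vV V(2) J(2) by blast
qed

section \<open>The Krull--Akizuki bound\<close>

text \<open>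
  Let \<open>y = z\<^sub>0 \<dots> z\<^sub>N\<^sub>-\<^sub>1 s\<close> in \<open>D\<close> and let \<open>w\<^sub>i\<close> be the partial products, with a common denominator
  \<open>d\<close> in \<open>C\<close>. Modulo \<open>Q\<close>, the submodules \<open>d w\<^sub>i D\<close> decrease strictly, and their traces on \<open>C\<close> form a
  chain of \<open>N\<close> steps between \<open>yI\<close> and \<open>I = C \<inter> dD\<close>. On the other hand \<open>I/yI\<close> is no longer than \<open>C/yC\<close>:
  both \<open>C \<supseteq> I \<supseteq> yI\<close> and \<open>C \<supseteq> yC \<supseteq> yI\<close> compute the length of \<open>C/yI\<close>, and \<open>yC/yI\<close> is
  isomorphic to \<open>C/I\<close>.
\<close>

theorem krull_akizuki_bound:
  assumes C: "subring C K" "noeth C" and D: "subring D K" "C \<subseteq> D" and T: "lcl T" "D \<subseteq> T" and Q: "Q = mx T"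
    and frac: "\<And>v. v \<in> D \<Longrightarrow> \<exists>d\<in>C. d \<notin> Q \<and> v \<otimes> d \<in> C"
    and one_dim: "\<And>q J. prm C q \<Longrightarrow> Q \<inter> C \<subset> q \<Longrightarrow> idl C J \<Longrightarrow> q \<subseteq> J \<Longrightarrow> J = q \<or> J = C"
    and y: "y \<in> C" "y \<notin> Q"
  shows "\<exists>n. \<forall>N w z s. w 0 = \<one> \<and> (\<forall>i<N. z i \<in> D \<and> w (Suc i) = w i \<otimes> z i \<and> (\<forall>d\<in>D. \<one> \<ominus> z i \<otimes> d \<notin> Q)) \<and> s \<in> D \<and> y = w N \<otimes> s \<longrightarrow> N \<le> n"
proof -
  note c = subringD(4)[OF C(1)] and dc = subringD(4)[OF D(1)]
  have CT: "C \<subseteq> T" using D(2) T(2) by blast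
  have pQ: "prm T Q" unfolding Q using prm_mx[OF T(1)] .
  define p0 where "p0 = Q \<inter> C"
  have p0: "prm C p0" unfolding p0_def Q using centre_prm[OF T(1) C(1) CT] .
  have sQ: "smod C Q" using smod_mono[OF prmD(2)[OF pQ] CT] .
  have sQD: "smod D Q" using smod_mono[OF prmD(2)[OF pQ] T(2)] .
  \<comment> \<open>modulo \<open>Q\<close>, nonzero ideals of \<open>C\<close> have finite colength\<close>
  have fl: "\<exists>n. lenle C I C n" if I: "idl C I" "p0 \<subset> I" for I
  proof (rule noeth_finite_length[OF C I(1)])
    show "J = q \<or> J = C" if "prm C q" "I \<subseteq> q" "idl C J" "q \<subseteq> J" for q J
      using one_dim[OF that(1) _ that(3,4)] I(2) that(2) unfolding p0_def by blast
  qed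
  define Y where "Y = add_gen C y p0"
  have yK: "y \<in> carrier K" using c[OF y(1)] .
  have Y: "idl C Y" unfolding Y_def using add_gen_idl[OF C(1) y(1) prmD(1)[OF p0]] .
  have Ys: "p0 \<subseteq> Y" "y \<in> Y" unfolding Y_def using add_gen_sup[OF C(1) yK prmD(2)[OF p0]] by auto
  have "p0 \<subset> Y" using Ys y(2) unfolding p0_def by blast
  then obtain n where n: "lenle C Y C n" using fl[OF Y] by blast
  have "N \<le> n" if w0: "w 0 = \<one>" and z: "\<And>i. i < N \<Longrightarrow> z i \<in> D" "\<And>i. i < N \<Longrightarrow> w (Suc i) = w i \<otimes> z i"
    and zn: "\<And>i d. i < N \<Longrightarrow> d \<in> D \<Longrightarrow> \<one> \<ominus> z i \<otimes> d \<notin> Q" and s: "s \<in> D" "y = w N \<otimes> s" for N w z s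
  proof -
    have wD: "w i \<in> D" if "i \<le> N" for i using that
    proof (induction i)
      case 0 then show ?case using w0 subringD(3)[OF D(1)] by simp
    next
      case (Suc i) then show ?case using z[of i] subringD(6)[OF D(1)] by simp
    qed
    have wdiv: "\<exists>v\<in>D. w j = w i \<otimes> v" if "i \<le> j" "j \<le> N" for i j using that
    proof (induction j)
      case 0
      have "w 0 = w i \<otimes> \<one>" using 0 w0 by simp
      then show ?case using subringD(3)[OF D(1)] by blast
    next
      case (Suc j)
      show ?case
      proof (cases "i = Suc j")
        case True then show ?thesis using subringD(3)[OF D(1)] dc[OF wD[OF Suc.prems(2)]] r_one by metis
      next
        case False
        then obtain v where v: "v \<in> D" "w j = w i \<otimes> v" using Suc by auto
        have "w (Suc j) = w i \<otimes> (v \<otimes> z j)" using z(2)[of j] Suc.prems v(2) dc[OF v(1)] dc[OF z(1)[of j]] dc[OF wD[of i]] by (simp add: m_assoc)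
        then show ?thesis using subringD(6)[OF D(1) v(1) z(1)[of j]] Suc.prems by auto
      qed
    qed
    have wQ: "w i \<notin> Q" if iN: "i \<le> N" for i
    proof
      assume h: "w i \<in> Q"
      obtain v where v: "v \<in> D" "w N = w i \<otimes> v" using wdiv[OF iN order_refl] by blast
      have "y = (v \<otimes> s) \<otimes> w i" unfolding s(2) v(2) using dc[OF v(1)] dc[OF s(1)] dc[OF wD[OF iN]] by algebra
      then show False using y(2) smodD(5)[OF sQD subringD(6)[OF D(1) v(1) s(1)] h] by simp
    qed
    have "\<exists>d\<in>C. d \<notin> Q \<and> (\<forall>j\<le>i. w j \<otimes> d \<in> C)" if "i \<le> N" for i using that
    proof (induction i)
      case 0
      have "\<one> \<notin> Q" using prmD(4)[OF pQ] .
      then show ?case using w0 subringD(3)[OF C(1)] by (intro bexI[of _ \<one>]) auto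
    next
      case (Suc i)
      then obtain d where d: "d \<in> C" "d \<notin> Q" "\<forall>j\<le>i. w j \<otimes> d \<in> C" by auto
      obtain e where e: "e \<in> C" "e \<notin> Q" "w (Suc i) \<otimes> e \<in> C" using frac[OF wD[OF Suc.prems]] by blast
      have "w j \<otimes> (d \<otimes> e) \<in> C" if j: "j \<le> Suc i" for j
      proof (cases "j = Suc i")
        case True
        have "w j \<otimes> (d \<otimes> e) = d \<otimes> (w (Suc i) \<otimes> e)" using c[OF d(1)] c[OF e(1)] dc[OF wD[OF Suc.prems]] unfolding True by algebra
        then show ?thesis using subringD(6)[OF C(1) d(1) e(3)] by simp
      next
        case False
        have wj: "w j \<in> carrier K" using dc[OF wD[of j]] j Suc.prems by simp
        have "w j \<otimes> (d \<otimes> e) = (w j \<otimes> d) \<otimes> e" using c[OF d(1)] c[OF e(1)] wj by (simp add: m_assoc)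
        then show ?thesis using subringD(6)[OF C(1) _ e(1)] d(3) j False by simp
      qed
      moreover have "d \<otimes> e \<notin> Q" using prmD(6)[OF pQ, of d e] d e CT by blast
      ultimately show ?case using subringD(6)[OF C(1) d(1) e(1)] by blast
    qed
    from this[OF order_refl] obtain d where d: "d \<in> C" "d \<notin> Q" "\<And>j. j \<le> N \<Longrightarrow> w j \<otimes> d \<in> C" by blast
    have dK: "d \<in> carrier K" using c[OF d(1)] .
    define a where "a i = w i \<otimes> d" for i
    have aC: "a i \<in> C" if "i \<le> N" for i unfolding a_def using d(3)[OF that] .
    have aK: "a i \<in> carrier K" if "i \<le> N" for i using c[OF aC[OF that]] .
    have aQ: "a i \<notin> Q" if "i \<le> N" for i unfolding a_def using prmD(6)[OF pQ, of "w i" d] wQ[OF that] d(1,2) wD[OF that] T(2) CT by blast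
    have aD: "a i \<in> D" if "i \<le> N" for i using aC[OF that] D(2) by blast
    define M where "M i = msum (smul (a i) D) Q" for i
    have sD: "smod C D" using smod_mono[OF smod_self[OF D(1)] D(2)] .
    have sa: "smod C (smul (a i) D)" if "i \<le> N" for i using smul_smod[OF C(1) sD aK[OF that]] .
    have sM: "smod C (M i)" if "i \<le> N" for i unfolding M_def using smod_msum[OF sa[OF that] sQ C(1)] .
    have QM: "Q \<subseteq> M i" if "i \<le> N" for i unfolding M_def using msum_upper(2)[OF sa[OF that] sQ] .
    have aM: "a i \<otimes> v \<in> M i" if "i \<le> N" "v \<in> D" for i v
      unfolding M_def using msum_upper(1)[OF sa[OF that(1)] sQ] that(2) unfolding smul_def by blast
    have Mmono: "M j \<subseteq> M i" if ij: "i \<le> j" "j \<le> N" for i j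
    proof -
      have iN: "i \<le> N" using ij by simp
      obtain v where v: "v \<in> D" "w j = w i \<otimes> v" using wdiv[OF ij] by blast
      have "a j = a i \<otimes> v" unfolding a_def v(2) using dc[OF wD[OF iN]] dc[OF v(1)] dK by algebra
      then have "a j \<otimes> r = a i \<otimes> (v \<otimes> r)" if "r \<in> D" for r using aK[OF iN] dc[OF v(1)] dc[OF that] by (simp add: m_assoc)
      then have "smul (a j) D \<subseteq> M i" using aM[OF iN subringD(6)[OF D(1) v(1)]] unfolding smul_def by auto
      then show ?thesis unfolding M_def[of j] using msum_least[OF sM[OF iN] _ QM[OF iN]] by blast
    qed
    have strict: "a i \<notin> M (Suc i)" if i: "i < N" for i
    proof
      assume "a i \<in> M (Suc i)"
      then obtain v q where v: "v \<in> D" "q \<in> Q" "a i = a (Suc i) \<otimes> v \<oplus> q" unfolding M_def msum_def smul_def by blast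
      have iN: "i \<le> N" using i by simp
      have K: "a i \<in> carrier K" "z i \<in> carrier K" "v \<in> carrier K" "q \<in> carrier K" "w i \<in> carrier K"
        using aK[OF iN] dc[OF z(1)[OF i]] dc[OF v(1)] smodD(3)[OF sQ v(2)] dc[OF wD[OF iN]] by auto
      have as: "a (Suc i) = a i \<otimes> z i" unfolding a_def z(2)[OF i] using K dK by algebra
      have "a i \<otimes> (\<one> \<ominus> z i \<otimes> v) = a i \<ominus> (a i \<otimes> z i) \<otimes> v" using K by algebra
      also have "\<dots> = ((a i \<otimes> z i) \<otimes> v \<oplus> q) \<ominus> (a i \<otimes> z i) \<otimes> v" using v(3) as by simp
      also have "\<dots> = q" using K by algebra
      finally have "a i \<otimes> (\<one> \<ominus> z i \<otimes> v) \<in> Q" using v(2) by simp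
      moreover have "\<one> \<ominus> z i \<otimes> v \<in> D" using subringD(8)[OF D(1) subringD(3)[OF D(1)] subringD(6)[OF D(1) z(1)[OF i] v(1)]] .
      ultimately have "\<one> \<ominus> z i \<otimes> v \<in> Q" using prmD(6)[OF pQ, of "a i"] aQ[OF iN] aD[OF iN] T(2) by blast
      then show False using zn[OF i v(1)] by blast
    qed
    define I where "I = C \<inter> M 0"
    have I: "idl C I" unfolding I_def idl_def using smod_Int[OF smod_self[OF C(1)] sM[of 0]] by blast
    have "a 0 \<otimes> \<one> \<in> M 0" using aM[of 0] subringD(3)[OF D(1)] by simp
    then have a0I: "a 0 \<in> I" unfolding I_def using aC[of 0] aK[of 0] by simp
    have p0I: "p0 \<subseteq> I" unfolding I_def p0_def using QM[of 0] by blast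
    have "p0 \<subset> I" using a0I p0I aQ[of 0] unfolding p0_def by blast
    then obtain n0 where n0: "lenle C I C n0" using fl[OF I] by blast
    obtain e where e: "lenle C I C e" "lenge C I C e" using len_exact[OF n0 idlD(1)[OF I] idlD(2)[OF I]] by blast
    define lo where "lo = msum (smul y I) p0"
    have syI: "smod C (smul y I)" using smul_smod[OF C(1) idlD(1)[OF I] yK] .
    have slo: "smod C lo" unfolding lo_def using smod_msum[OF syI prmD(2)[OF p0] C(1)] .
    have p0lo: "p0 \<subseteq> lo" "smul y I \<subseteq> lo" unfolding lo_def using msum_upper[OF syI prmD(2)[OF p0]] by auto
    have loY: "lo \<subseteq> Y" unfolding lo_def
    proof (rule msum_least[OF idlD(1)[OF Y] _ Ys(1)])
      show "smul y I \<subseteq> Y" unfolding smul_def using idlD(7)[OF Y _ Ys(2)] idlD(4)[OF I] m_comm[OF yK c] by auto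
    qed
    have 1: "lenle C lo Y e"
    proof -
      have "I \<subseteq> colon C lo y"
      proof
        fix r assume r: "r \<in> I"
        have "y \<otimes> r \<in> lo" using p0lo(2) r unfolding smul_def by blast
        then show "r \<in> colon C lo y" unfolding colon_def using idlD(4)[OF I r] m_comm[OF yK idlD(5)[OF I r]] by simp
      qed
      then have "lenle C lo (add_gen C y lo) e" using lenle_cyclic[OF C(1) slo yK] lenle_weaken[OF e(1) _ subset_refl] by blast
      moreover have "Y \<subseteq> add_gen C y lo" unfolding Y_def add_gen_def using p0lo(1) by blast
      ultimately show ?thesis using lenle_weaken by blast
    qed
    have le: "lenle C lo C (e + n)" using lenle_add[OF C(1) 1 n loY idlD(2)[OF Y] idlD(1)[OF Y] smod_self[OF C(1)]] .
    have ge: "lenge C lo I N"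
    proof -
      \<comment> \<open>the \<open>M i\<close> decrease, so the chain is read backwards\<close>
      define f where "f j = C \<inter> M (N - j)" for j
      have fs: "smod C (f j)" for j unfolding f_def using smod_Int[OF smod_self[OF C(1)] sM] by simp
      have "lo \<subseteq> C \<inter> M N" unfolding lo_def
      proof (rule msum_least[OF smod_Int[OF smod_self[OF C(1)] sM[OF order_refl]]])
        show "p0 \<subseteq> C \<inter> M N" unfolding p0_def using QM[OF order_refl] by blast
        show "smul y I \<subseteq> C \<inter> M N"
        proof
          fix t assume "t \<in> smul y I"
          then obtain r where r: "r \<in> I" "t = y \<otimes> r" unfolding smul_def by blast
          have tC: "t \<in> C" using r subringD(6)[OF C(1) y(1) idlD(4)[OF I r(1)]] by simp
          obtain v q where v: "v \<in> D" "q \<in> Q" "r = a 0 \<otimes> v \<oplus> q" using r(1) unfolding I_def M_def msum_def smul_def by blast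
          have K: "v \<in> carrier K" "q \<in> carrier K" "s \<in> carrier K" "w N \<in> carrier K" "a N \<in> carrier K" using dc[OF v(1)] smodD(3)[OF sQ v(2)] dc[OF s(1)] dc[OF wD[OF order_refl]] aK by auto
          have a0: "a 0 = d" unfolding a_def w0 using dK by simp
          have "t = a N \<otimes> (s \<otimes> v) \<oplus> y \<otimes> q" unfolding r(2) v(3) a0 a_def[of N] s(2) using K dK by algebra
          moreover have "a N \<otimes> (s \<otimes> v) \<in> M N" using aM[OF order_refl subringD(6)[OF D(1) s(1) v(1)]] .
          moreover have "y \<otimes> q \<in> M N" using smodD(5)[OF sQ y(1) v(2)] QM[OF order_refl] by blast
          ultimately show "t \<in> C \<inter> M N" using smodD(4)[OF sM[OF order_refl]] tC by simp
        qed
      qed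
      moreover have "M N \<subseteq> M (N - j)" for j using Mmono[of "N - j" N] by simp
      ultimately have flo: "lo \<subseteq> f j" for j unfolding f_def by blast
      have fhi: "f j \<subseteq> I" for j unfolding f_def I_def using Mmono[of 0 "N - j"] by auto
      have fm: "f j \<subseteq> f (Suc j)" for j unfolding f_def using Mmono[of "N - Suc j" "N - j"] diff_le_mono2[of j "Suc j" N] by auto
      have "flag C lo I f" unfolding flag_def using fs flo fhi fm by blast
      moreover have "jumps f N = {..<N}"
      proof -
        have "f j \<noteq> f (Suc j)" if j: "j < N" for j
        proof -
          define i where "i = N - Suc j"
          have i: "i < N" "Suc i = N - j" unfolding i_def using j by auto
          have "a i \<otimes> \<one> \<in> M i" using aM[of i] subringD(3)[OF D(1)] i by simp
          then have "a i \<in> f (Suc j)" unfolding f_def i_def[symmetric] using aC[of i] aK[of i] i by simp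
          moreover have "a i \<notin> f j" unfolding f_def i(2)[symmetric] using strict[OF i(1)] by blast
          ultimately show ?thesis by blast
        qed
        then show ?thesis unfolding jumps_def by auto
      qed
      ultimately show ?thesis unfolding lenge_def by (intro exI[of _ f] exI[of _ N]) simp
    qed
    have loI: "lo \<subseteq> I" using ge unfolding lenge_def flag_def by blast
    have "lenge C lo C (N + e)" using lenge_add[OF ge e(2) loI idlD(2)[OF I]] .
    then have "N + e \<le> e + n" using len_le_ge[OF le] by blast
    then show ?thesis by simp
  qed
  then show ?thesis by blast
qed

section \<open>Subrings as ring records\<close>

lemma sub_cring: assumes "subring A K" shows "cring (sub K A)" "domain (sub K A)" "ring (sub K A)"
proof -
  show d: "domain (sub K A)" using subring_is_domain[OF assms] .
  then show "cring (sub K A)" by (rule domain.axioms(1))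
  then show "ring (sub K A)" by (rule cring.axioms(1))
qed

lemma ideal_iff: assumes A: "subring A K" shows "ideal I (sub K A) \<longleftrightarrow> idl A I"
proof
  assume "ideal I (sub K A)"
  then interpret I: ideal I "sub K A" .
  show "idl A I" unfolding idl_def smod_def
    using I.a_subset additive_subgroup.zero_closed[OF I.is_additive_subgroup] additive_subgroup.a_closed[OF I.is_additive_subgroup]
      I.I_l_closed subringD(1)[OF A] by auto
next
  assume I: "idl A I"
  interpret S: cring "sub K A" using sub_cring[OF A] by blast
  have neg: "\<ominus>\<^bsub>sub K A\<^esub> a \<in> I" if a: "a \<in> I" for a
  proof -
    have aA: "a \<in> carrier (sub K A)" using idlD(4)[OF I a] by simp
    have "\<ominus>\<^bsub>sub K A\<^esub> a = (\<ominus>\<^bsub>sub K A\<^esub> \<one>\<^bsub>sub K A\<^esub>) \<otimes>\<^bsub>sub K A\<^esub> a"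
      using aA S.l_minus[OF S.one_closed aA] S.l_one[OF aA] by metis
    moreover have "\<ominus>\<^bsub>sub K A\<^esub> \<one>\<^bsub>sub K A\<^esub> \<in> A" using S.a_inv_closed[OF S.one_closed] by simp
    ultimately show ?thesis using idlD(7)[OF I _ a] by simp
  qed
  show "ideal I (sub K A)"
  proof (rule idealI[OF S.ring_axioms])
    show "subgroup I (add_monoid (sub K A))"
    proof (rule S.add.subgroupI)
      show "I \<subseteq> carrier (sub K A)" using idlD(2)[OF I] by simp
      show "I \<noteq> {}" using idlD(3)[OF I] by blast
      show "\<ominus>\<^bsub>sub K A\<^esub> a \<in> I" if "a \<in> I" for a using neg[OF that] .
      show "a \<oplus>\<^bsub>sub K A\<^esub> b \<in> I" if "a \<in> I" "b \<in> I" for a b using idlD(6)[OF I that] by simp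
    qed
    show "x \<otimes>\<^bsub>sub K A\<^esub> a \<in> I" if "a \<in> I" "x \<in> carrier (sub K A)" for a x using idlD(7)[OF I] that by simp
    show "a \<otimes>\<^bsub>sub K A\<^esub> x \<in> I" if "a \<in> I" "x \<in> carrier (sub K A)" for a x
      using idlD(7)[OF I, of x a] that m_comm[OF idlD(5)[OF I that(1)], of x] subringD(4)[OF A, of x] by simp
  qed
qed

lemma primeideal_iff: assumes A: "subring A K" shows "primeideal p (sub K A) \<longleftrightarrow> prm A p"
proof
  assume "primeideal p (sub K A)"
  then interpret I: primeideal p "sub K A" .
  have i: "idl A p" using ideal_iff[OF A] I.ideal_axioms by blast
  have "\<one> \<notin> p" using idl_one[OF A i] I.I_notcarr by auto
  then show "prm A p" unfolding prm_def using i I.I_prime by auto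
next
  assume p: "prm A p"
  show "primeideal p (sub K A)"
  proof (rule primeidealI)
    show "ideal p (sub K A)" using ideal_iff[OF A] prmD(1)[OF p] by blast
    show "cring (sub K A)" using sub_cring[OF A] by blast
    show "carrier (sub K A) \<noteq> p" using prmD(4)[OF p] subringD(3)[OF A] by auto
    show "a \<in> p \<or> b \<in> p" if "a \<in> carrier (sub K A)" "b \<in> carrier (sub K A)" "a \<otimes>\<^bsub>sub K A\<^esub> b \<in> p" for a b
      using prmD(6)[OF p, of a b] that by simp
  qed
qed

lemma Idl_eq: assumes A: "subring A K" and xs: "set xs \<subseteq> A" shows "Idl\<^bsub>sub K A\<^esub> (set xs) = add_gens A xs {\<zero>}"
proof
  interpret S: cring "sub K A" using sub_cring[OF A] by blast
  have xsK: "set xs \<subseteq> carrier K" using xs subringD(1)[OF A] by blast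
  have i: "idl A (add_gens A xs {\<zero>})" using add_gens_idl[OF A xs idl_zero[OF A]] .
  show "Idl\<^bsub>sub K A\<^esub> (set xs) \<subseteq> add_gens A xs {\<zero>}"
    using S.genideal_minimal[of "add_gens A xs {\<zero>}" "set xs"] ideal_iff[OF A] i add_gens_sup(2)[OF A xsK smod_zero[OF A]] by blast
  have g: "idl A (Idl\<^bsub>sub K A\<^esub> (set xs))" using S.genideal_ideal[of "set xs"] xs ideal_iff[OF A] by simp
  show "add_gens A xs {\<zero>} \<subseteq> Idl\<^bsub>sub K A\<^esub> (set xs)"
    using add_gens_least[OF idlD(1)[OF g]] S.genideal_self[of "set xs"] xs idlD(3)[OF g] by simp
qed

lemma noeth_iff: assumes A: "subring A K" shows "noetherian_ring (sub K A) \<longleftrightarrow> noeth A"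
proof
  assume "noetherian_ring (sub K A)"
  then interpret N: noetherian_ring "sub K A" .
  show "noeth A" unfolding noeth_def
  proof (intro allI impI)
    fix I assume "idl A I"
    then obtain G where G: "G \<subseteq> A" "finite G" "I = Idl\<^bsub>sub K A\<^esub> G" using N.finetely_gen[of I] ideal_iff[OF A] by auto
    obtain xs where "set xs = G" using finite_list[OF G(2)] by blast
    then show "\<exists>xs. set xs \<subseteq> A \<and> I = add_gens A xs {\<zero>}" using G Idl_eq[OF A, of xs] by auto
  qed
next
  assume n: "noeth A"
  interpret S: cring "sub K A" using sub_cring[OF A] by blast
  show "noetherian_ring (sub K A)"
  proof
    fix I assume "ideal I (sub K A)"
    then obtain xs where "set xs \<subseteq> A" "I = add_gens A xs {\<zero>}" using n ideal_iff[OF A] unfolding noeth_def by blast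
    then show "\<exists>G\<subseteq>carrier (sub K A). finite G \<and> I = Idl\<^bsub>sub K A\<^esub> G" using Idl_eq[OF A, of xs] by (intro exI[of _ "set xs"]) simp
  qed
qed

lemma maximal_iff: assumes A: "subring A K"
  shows "maximalideal M (sub K A) \<longleftrightarrow> idl A M \<and> M \<noteq> A \<and> (\<forall>J. idl A J \<and> M \<subseteq> J \<longrightarrow> J = M \<or> J = A)"
proof
  assume "maximalideal M (sub K A)"
  then interpret M: maximalideal M "sub K A" .
  show "idl A M \<and> M \<noteq> A \<and> (\<forall>J. idl A J \<and> M \<subseteq> J \<longrightarrow> J = M \<or> J = A)"
    using M.ideal_axioms M.I_notcarr M.I_maximal ideal_iff[OF A] idlD(2) by auto
next
  assume h: "idl A M \<and> M \<noteq> A \<and> (\<forall>J. idl A J \<and> M \<subseteq> J \<longrightarrow> J = M \<or> J = A)"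
  show "maximalideal M (sub K A)"
    by (rule maximalidealI) (use h ideal_iff[OF A] in auto)
qed

lemma lcl_maximal: assumes l: "lcl A" shows "maximalideal M (sub K A) \<longleftrightarrow> M = mx A"
proof
  note A = lclD(1)[OF l]
  have mA: "mx A \<noteq> A" using one_notin_mx[OF A] subringD(3)[OF A] by blast
  show "maximalideal M (sub K A)" if "M = mx A"
    unfolding maximal_iff[OF A] using that lclD(2)[OF l] mA mx_maximal[OF l] by blast
  assume "maximalideal M (sub K A)"
  then have M: "idl A M" "M \<noteq> A" "\<And>J. idl A J \<Longrightarrow> M \<subseteq> J \<Longrightarrow> J = M \<or> J = A" unfolding maximal_iff[OF A] by auto
  have "\<one> \<notin> M" using M(1,2) idl_one[OF A] by blast
  then have "M \<subseteq> mx A" using prop_idl_mx[OF A M(1)] by blast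
  then show "M = mx A" using M(3)[OF lclD(2)[OF l]] mA by blast
qed

lemma lcl_local: assumes l: "lcl A" shows "local_ring (sub K A)" "max_ideal (sub K A) = mx A"
  unfolding local_ring_def max_ideal_def lcl_maximal[OF l] using sub_cring[OF lclD(1)[OF l]] by auto

text \<open>Every nonunit lies in a maximal ideal, hence in the only one.\<close>

lemma noeth_local: assumes A: "subring A K" and n: "noeth A" and loc: "local_ring (sub K A)" shows "lcl A"
proof -
  obtain M where M: "maximalideal M (sub K A)" "\<And>L. maximalideal L (sub K A) \<Longrightarrow> L = M" using loc unfolding local_ring_def by blast
  have Mi: "idl A M" "M \<noteq> A" using M(1) unfolding maximal_iff[OF A] by auto
  have "\<one> \<notin> M" using Mi idl_one[OF A] by blast
  then have 1: "M \<subseteq> mx A" using prop_idl_mx[OF A Mi(1)] by blast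
  have "mx A \<subseteq> M"
  proof
    fix a assume a: "a \<in> mx A"
    have aA: "a \<in> A" using a unfolding mx_def by blast
    have aK: "a \<in> carrier K" using subringD(4)[OF A aA] .
    define F where "F = {J. idl A J \<and> a \<in> J \<and> \<one> \<notin> J}"
    have i: "idl A (add_gen A a {\<zero>})" using add_gen_idl[OF A aA idl_zero[OF A]] .
    have "\<one> \<notin> add_gen A a {\<zero>}"
    proof
      assume "\<one> \<in> add_gen A a {\<zero>}"
      then obtain b where b: "b \<in> A" "\<one> = b \<otimes> a \<oplus> \<zero>" unfolding add_gen_def by blast
      have "\<one> = a \<otimes> b" using b aK subringD(4)[OF A b(1)] m_comm by simp
      then show False using a b(1) unfolding mx_def by auto
    qed
    then have ne: "F \<noteq> {}" using i add_gen_sup(2)[OF A aK smod_zero[OF A]] unfolding F_def by blast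
    have Fi: "idl A J" if "J \<in> F" for J using that unfolding F_def by blast
    obtain L where L: "L \<in> F" "\<forall>J\<in>F. L \<subseteq> J \<longrightarrow> J = L" using noeth_max[OF A n Fi ne] by blast
    have LF: "idl A L" "a \<in> L" "\<one> \<notin> L" using L(1) unfolding F_def by auto
    have "maximalideal L (sub K A)" unfolding maximal_iff[OF A]
    proof (intro conjI allI impI)
      show "idl A L" "L \<noteq> A" using LF subringD(3)[OF A] by auto
      fix J assume J: "idl A J \<and> L \<subseteq> J"
      show "J = L \<or> J = A"
      proof (cases "\<one> \<in> J")
        case True then show ?thesis using idl_one[OF A] J by blast
      next
        case False
        then have "J \<in> F" unfolding F_def using J LF(2) by blast
        then show ?thesis using L(2) J by blast
      qed
    qed
    then show "a \<in> M" using M(2) LF(2) by blast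
  qed
  then have "mx A = M" using 1 by blast
  then show ?thesis unfolding lcl_def using A Mi by simp
qed

lemma krull_dim_eq: assumes A: "subring A K" shows "krull_dim (sub K A) = Sup {enat n | n. \<exists>p. pchain A p n}"
  unfolding krull_dim_def pchain_def primeideal_iff[OF A] ..

lemma krull_dim_ge: assumes A: "subring A K" and "pchain A p n" shows "enat n \<le> krull_dim (sub K A)"
  unfolding krull_dim_eq[OF A] by (rule Sup_upper) (use assms in blast)

text \<open>The height theorem bounds chains of primes by every number of generators of the maximal ideal.\<close>

lemma reg_regular: assumes r: "reg A xs" shows "regular_local_ring (sub K A)"
proof -
  have l: "lcl A" and n: "noeth A" and xs: "set xs \<subseteq> A" and m: "mx A = add_gens A xs {\<zero>}" using r unfolding reg_def by auto
  note A = lclD(1)[OF l]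
  let ?P = "\<lambda>n. \<exists>G. G \<subseteq> A \<and> finite G \<and> card G = n \<and> mx A = Idl\<^bsub>sub K A\<^esub> G"
  have e: "embedding_dim (sub K A) = (LEAST n. ?P n)" unfolding embedding_dim_def lcl_local(2)[OF l] by simp
  have P1: "?P (card (set xs))" using xs m Idl_eq[OF A xs] by (intro exI[of _ "set xs"]) simp
  have bound: "d \<le> n" if G: "?P n" and p: "pchain A p d" for n p d
  proof -
    obtain G where G: "G \<subseteq> A" "finite G" "card G = n" "mx A = Idl\<^bsub>sub K A\<^esub> G" using G by blast
    obtain gs where gs: "set gs = G" "distinct gs" using finite_distinct_list[OF G(2)] by blast
    have gl: "length gs = n" using distinct_card[OF gs(2)] gs(1) G(3) by simp
    have "{\<zero>} \<subseteq> p 0" using prmD(5)[OF pchain_prm[OF p]] by simp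
    then show ?thesis using dim_bound[OF l n _ smod_zero[OF A] _ p, of gs] Idl_eq[OF A, of gs] gs(1) G(1,4) gl by simp
  qed
  obtain p where p: "pchain A p (length xs)" using reg_chain[OF r] by blast
  have "length xs \<le> (LEAST n. ?P n)" using bound[OF LeastI[of ?P, OF P1] p] .
  moreover have "(LEAST n. ?P n) \<le> card (set xs)" using Least_le[of ?P, OF P1] .
  ultimately have el: "embedding_dim (sub K A) = length xs" unfolding e using card_length[of xs] by linarith
  have "krull_dim (sub K A) \<le> enat (length xs)" unfolding krull_dim_eq[OF A]
  proof (rule Sup_least)
    fix d assume "d \<in> {enat n | n. \<exists>p. pchain A p n}"
    then obtain k q where k: "d = enat k" "pchain A q k" by blast
    have "k \<le> length xs" using bound[OF P1 k(2)] card_length[of xs] by linarith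
    then show "d \<le> enat (length xs)" using k(1) by simp
  qed
  then have "krull_dim (sub K A) = enat (length xs)" using krull_dim_ge[OF A p] by (rule antisym)
  then show ?thesis unfolding regular_local_ring_def using noeth_iff[OF A] n lcl_local(1)[OF l] el by simp
qed

lemma regular_reg: assumes A: "subring A K" and r: "regular_local_ring (sub K A)" shows "\<exists>xs. reg A xs"
proof -
  have n: "noeth A" using r noeth_iff[OF A] unfolding regular_local_ring_def by blast
  have l: "lcl A" using noeth_local[OF A n] r unfolding regular_local_ring_def by blast
  let ?P = "\<lambda>n. \<exists>G. G \<subseteq> A \<and> finite G \<and> card G = n \<and> mx A = Idl\<^bsub>sub K A\<^esub> G"
  have e: "embedding_dim (sub K A) = (LEAST n. ?P n)" unfolding embedding_dim_def lcl_local(2)[OF l] by simp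
  obtain ys where ys: "set ys \<subseteq> A" "mx A = add_gens A ys {\<zero>}" using n lclD(2)[OF l] unfolding noeth_def by blast
  have P1: "?P (card (set ys))" using ys Idl_eq[OF A ys(1)] by (intro exI[of _ "set ys"]) simp
  define d where "d = embedding_dim (sub K A)"
  have "?P d" unfolding d_def e using LeastI[of ?P, OF P1] .
  then obtain G where G: "G \<subseteq> A" "finite G" "card G = d" "mx A = Idl\<^bsub>sub K A\<^esub> G" by blast
  obtain gs where gs: "set gs = G" "distinct gs" using finite_distinct_list[OF G(2)] by blast
  have gl: "length gs = d" using distinct_card[OF gs(2)] gs(1) G(3) by simp
  have m: "mx A = add_gens A gs {\<zero>}" using Idl_eq[OF A, of gs] gs(1) G by simp
  have k: "krull_dim (sub K A) = enat d" using r unfolding regular_local_ring_def d_def by blast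
  have "\<exists>p k. d \<le> k \<and> pchain A p k"
  proof (cases d)
    case 0
    have "pchain A (\<lambda>_. mx A) 0" unfolding pchain_def using prm_mx[OF l] by simp
    then show ?thesis using 0 by blast
  next
    case (Suc c)
    show ?thesis
    proof (rule ccontr)
      assume no: "\<not> ?thesis"
      have "krull_dim (sub K A) \<le> enat c" unfolding krull_dim_eq[OF A]
      proof (rule Sup_least)
        fix t assume "t \<in> {enat n | n. \<exists>p. pchain A p n}"
        then obtain j q where j: "t = enat j" "pchain A q j" by blast
        then show "t \<le> enat c" using no Suc by (metis enat_ord_simps(1) not_less_eq_eq)
      qed
      then show False using k Suc by simp
    qed
  qed
  then obtain p j where "d \<le> j" "pchain A p j" by blast
  then show ?thesis using reg_intro[OF l n _ m] gs(1) G(1) gl by blast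
qed

lemma pow_sub: "a [^]\<^bsub>sub K A\<^esub> (n::nat) = a [^] n" unfolding nat_pow_def by simp

lemma PIdl_sub: assumes "a \<in> A" shows "PIdl\<^bsub>sub K A\<^esub> a = {x \<otimes> a | x. x \<in> A}" unfolding cgenideal_def by simp

lemma Units_sub: assumes A: "subring A K" shows "carrier (sub K A) - Units (sub K A) = mx A"
  unfolding Units_def mx_def using m_comm subringD(4)[OF A] by auto

text \<open>A nonzero \<open>f\<close> that is divisible by all powers of a nonunit violates the archimedean property.\<close>

lemma not_archimedean: assumes A: "subring A K" and a: "a \<in> mx A" and f: "f \<noteq> \<zero>" "\<And>n::nat. \<exists>g\<in>A. f = g \<otimes> a [^] n"
  shows "\<not> archimedean_domain (sub K A)"
proof
  assume ar: "archimedean_domain (sub K A)"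
  have aA: "a \<in> A" using a unfolding mx_def by blast
  have "(\<Inter>n\<in>{n::nat. n > 0}. PIdl\<^bsub>sub K A\<^esub> (a [^]\<^bsub>sub K A\<^esub> n)) = {\<zero>}"
    using ar a Units_sub[OF A] unfolding archimedean_domain_def by auto
  moreover have "f \<in> PIdl\<^bsub>sub K A\<^esub> (a [^]\<^bsub>sub K A\<^esub> n)" for n :: nat
    unfolding pow_sub PIdl_sub[OF subringD(9)[OF A aA]] using f(2)[of n] by blast
  ultimately have "f \<in> {\<zero>}" by blast
  then show False using f(1) by blast
qed

lemma dvr_intro: assumes l: "lcl W" and n: "noeth W" and u: "u \<noteq> \<zero>" "u \<in> mx W" and m: "mx W = add_gen W u {\<zero>}"
  shows "dvr (sub K W)"
proof -
  note W = lclD(1)[OF l]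
  interpret D: domain "sub K W" using sub_cring[OF W] by blast
  have "principal_domain (sub K W)"
  proof
    fix I assume "ideal I (sub K W)"
    then obtain g where g: "g \<in> W" "I = {w \<otimes> g | w. w \<in> W}" using principal_ideals[OF l n u m] ideal_iff[OF W] by blast
    then show "\<exists>a\<in>carrier (sub K W). I = PIdl\<^bsub>sub K W\<^esub> a" using PIdl_sub[OF g(1)] by auto
  qed
  moreover have "\<not> field (sub K W)"
  proof
    assume "field (sub K W)"
    then have "Units (sub K W) = carrier (sub K W) - {\<zero>\<^bsub>sub K W\<^esub>}" by (rule field.field_Units)
    moreover have "u \<in> carrier (sub K W) - Units (sub K W)" using Units_sub[OF W] u(2) by blast
    ultimately show False using u(1) by auto
  qed
  ultimately show ?thesis unfolding dvr_def using lcl_local(1)[OF l] by blast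
qed

lemma dvr_elim: assumes W: "subring W K" and d: "dvr (sub K W)" shows "lcl W" "noeth W"
proof -
  interpret P: principal_domain "sub K W" using d unfolding dvr_def by blast
  show n: "noeth W" using noeth_iff[OF W] P.noetherian_ring_axioms by blast
  show "lcl W" using noeth_local[OF W n] d unfolding dvr_def by blast
qed

text \<open>Primes above \<open>P\<close> have prime images in the quotient, and different primes have different images.\<close>

lemma krull_dim_quotient:
  assumes A: "subring A K" and p: "pchain A c n" and Pc: "prm A P" "P \<subseteq> c 0"
  shows "enat n \<le> krull_dim (sub K A Quot P)"
proof -
  interpret P: primeideal P "sub K A" using primeideal_iff[OF A] Pc(1) by blast
  let ?S = "sub K A" and ?Q = "sub K A Quot P"
  interpret Q: cring ?Q using P.quotient_is_cring[OF sub_cring(1)[OF A]] .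
  define h where "h = a_r_coset ?S P"
  interpret H: ring_hom_ring ?S ?Q h unfolding h_def by (rule P.rcos_ring_hom_ring)
  have car: "carrier ?Q = h ` A" unfolding FactRing_def h_def A_RCOSETS_def' by auto
  have refl_mem: "a \<in> q" if q: "idl A q" "P \<subseteq> q" and a: "a \<in> A" "h a \<in> h ` q" for q a
  proof -
    obtain b where b: "b \<in> q" "h a = h b" using a(2) by blast
    have "a \<in> h a" unfolding h_def using P.a_rcos_self a(1) by simp
    then have "a \<in> h b" by (simp only: b(2))
    then obtain e where e: "e \<in> P" "a = e \<oplus> b" unfolding h_def a_r_coset_def' by auto
    then show ?thesis using idlD(6)[OF q(1)] q(2) b(1) by blast
  qed
  have hA: "h a \<in> carrier ?Q" if "a \<in> A" for a using H.hom_closed[of a] that by simp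
  have pr: "primeideal (h ` q) ?Q" if q: "prm A q" "P \<subseteq> q" for q
  proof (rule primeidealI)
    note i = prmD(1)[OF q(1)]
    have qi: "ideal q ?S" using ideal_iff[OF A] i by blast
    interpret q: ideal q ?S by (rule qi)
    show "ideal (h ` q) ?Q"
    proof (rule idealI[OF Q.ring_axioms])
      show "subgroup (h ` q) (add_monoid ?Q)"
      proof (rule Q.add.subgroupI)
        show "h ` q \<subseteq> carrier ?Q" using hA idlD(4)[OF i] by blast
        show "h ` q \<noteq> {}" using idlD(3)[OF i] by blast
        show "\<ominus>\<^bsub>?Q\<^esub> a \<in> h ` q" if a: "a \<in> h ` q" for a
        proof -
          obtain b where b: "b \<in> q" "a = h b" using a by blast
          have "\<ominus>\<^bsub>?Q\<^esub> a = h (\<ominus>\<^bsub>?S\<^esub> b)" using H.hom_a_inv[of b] b idlD(4)[OF i] by simp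
          then show ?thesis using q.a_inv_closed[OF b(1)] by blast
        qed
        show "a \<oplus>\<^bsub>?Q\<^esub> b \<in> h ` q" if ab: "a \<in> h ` q" "b \<in> h ` q" for a b
        proof -
          obtain a' b' where s: "a' \<in> q" "a = h a'" "b' \<in> q" "b = h b'" using ab by blast
          have "a \<oplus>\<^bsub>?Q\<^esub> b = h (a' \<oplus> b')" using H.hom_add[of a' b'] s idlD(4)[OF i] by simp
          then show ?thesis using idlD(6)[OF i s(1,3)] by blast
        qed
      qed
      show l: "x \<otimes>\<^bsub>?Q\<^esub> a \<in> h ` q" if a: "a \<in> h ` q" "x \<in> carrier ?Q" for a x
      proof -
        have "x \<in> h ` A" using a(2) by (simp only: car)
        then obtain a' x' where s: "a' \<in> q" "a = h a'" "x' \<in> A" "x = h x'" using a(1) by blast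
        have "x \<otimes>\<^bsub>?Q\<^esub> a = h (x' \<otimes> a')" using H.hom_mult[of x' a'] s idlD(4)[OF i] by simp
        then show ?thesis using idlD(7)[OF i s(3,1)] by blast
      qed
      show "a \<otimes>\<^bsub>?Q\<^esub> x \<in> h ` q" if a: "a \<in> h ` q" "x \<in> carrier ?Q" for a x
      proof -
        have "a \<in> carrier ?Q" using a(1) hA idlD(4)[OF i] by blast
        then show ?thesis using l[OF a] Q.m_comm[of a x] a(2) by simp
      qed
    qed
    show "cring ?Q" by (rule Q.is_cring)
    have "h \<one> \<notin> h ` q" using refl_mem[OF i q(2) subringD(3)[OF A]] prmD(4)[OF q(1)] by blast
    then show "carrier ?Q \<noteq> h ` q" using hA[OF subringD(3)[OF A]] by blast
    show "a \<in> h ` q \<or> b \<in> h ` q" if ab: "a \<in> carrier ?Q" "b \<in> carrier ?Q" "a \<otimes>\<^bsub>?Q\<^esub> b \<in> h ` q" for a b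
    proof -
      have "a \<in> h ` A" "b \<in> h ` A" using ab(1,2) by (simp_all only: car)
      then obtain a' b' where s: "a' \<in> A" "a = h a'" "b' \<in> A" "b = h b'" by blast
      have "a \<otimes>\<^bsub>?Q\<^esub> b = h (a' \<otimes> b')" using H.hom_mult[of a' b'] s by simp
      then have "a' \<otimes> b' \<in> q" using refl_mem[OF i q(2) subringD(6)[OF A s(1,3)]] ab(3) by simp
      then show ?thesis using prmD(6)[OF q(1) s(1,3)] s(2,4) by blast
    qed
  qed
  have Pi: "P \<subseteq> c i" if "i \<le> n" for i using pchain_mono[OF p, of 0 i] that Pc(2) by blast
  have "primeideal (h ` c i) ?Q" if "i \<le> n" for i using pr[OF pchain_prm[OF p that] Pi[OF that]] .
  moreover have "h ` c i \<subset> h ` c (Suc i)" if i: "i < n" for i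
  proof -
    have "c i \<subset> c (Suc i)" using p i unfolding pchain_def by blast
    then have sub: "c i \<subseteq> c (Suc i)" and "\<exists>a. a \<in> c (Suc i) \<and> a \<notin> c i" by auto
    then obtain a where a: "a \<in> c (Suc i)" "a \<notin> c i" by blast
    have pi: "prm A (c i)" "prm A (c (Suc i))" using pchain_prm[OF p] i by auto
    have "h a \<notin> h ` c i" using refl_mem[OF prmD(1)[OF pi(1)] Pi] i a prmD(3)[OF pi(2)] by auto
    then show ?thesis using a(1) sub by blast
  qed
  ultimately have fin: "(\<forall>i\<le>n. primeideal ((\<lambda>i. h ` c i) i) ?Q) \<and> (\<forall>i<n. (\<lambda>i. h ` c i) i \<subset> (\<lambda>i. h ` c i) (Suc i))" by simp
  have "\<exists>p. (\<forall>i\<le>n. primeideal (p i) ?Q) \<and> (\<forall>i<n. p i \<subset> p (Suc i))"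
    by (rule exI[of _ "\<lambda>i. h ` c i"], rule fin)
  then show ?thesis unfolding krull_dim_def by (intro Sup_upper) blast
qed

section \<open>Local quadratic transforms\<close>

text \<open>
  What later arguments need from a quadratic transform, with the valuation ring eliminated; along a Shannon sequence the
  valuation rings may change from step to step.
\<close>

lemma lqt_properties:
  assumes lA: "lcl A" and q: "lqt K A A'"
  shows "\<exists>x\<in>mx A. x \<noteq> \<zero> \<and> (\<forall>a\<in>mx A. a \<otimes> inv x \<in> A') \<and> x \<in> mx A'" "A \<subseteq> A'"
proof -
  note A = lclD(1)[OF lA]
  obtain V where "lqt_along K A V A'" using q unfolding lqt_def by blast
  then obtain x where V: "valuation_domain (sub K V)" "birationally_dominates K V A" and x: "x \<in> mx A" "x \<noteq> \<zero>"
    and gen: "Idl\<^bsub>sub K V\<^esub> (mx A) = PIdl\<^bsub>sub K V\<^esub> x"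
    and A': "A' = localization K (generate_ring K (A \<union> {a \<otimes> inv x | a. a \<in> mx A})) (max_ideal (sub K V) \<inter> generate_ring K (A \<union> {a \<otimes> inv x | a. a \<in> mx A}))"
    unfolding lqt_along_def lcl_local(2)[OF lA] Let_def by blast
  have ov: "subring V K" "A \<subseteq> V" and lV: "local_ring (sub K V)" and dom: "mx A \<subseteq> max_ideal (sub K V)"
    using V(2) unfolding birationally_dominates_def overring_def lcl_local(2)[OF lA] by auto
  note VS = ov(1)
  interpret VR: cring "sub K V" using sub_cring[OF VS] by blast
  define M where "M = max_ideal (sub K V)"
  have "maximalideal M (sub K V)" using lV unfolding local_ring_def M_def max_ideal_def by (metis theI')
  then have M: "idl V M" "M \<noteq> V" and pM: "prm V M"
    using maximal_iff[OF VS] VR.maximalideal_prime primeideal_iff[OF VS] by blast+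
  define B where "B = generate_ring K (A \<union> {a \<otimes> inv x | a. a \<in> mx A})"
  have xK: "x \<in> carrier K" using idlD(5)[OF lclD(2)[OF lA] x(1)] .
  note i = invK[OF xK x(2)]
  have aV: "a \<otimes> inv x \<in> V" if a: "a \<in> mx A" for a
  proof -
    have xV: "x \<in> V" using x(1) dom M(1) idlD(2) unfolding M_def by blast
    have "mx A \<subseteq> carrier (sub K V)" using dom idlD(2)[OF M(1)] unfolding M_def by auto
    then have "a \<in> PIdl\<^bsub>sub K V\<^esub> x" using VR.genideal_self[of "mx A"] gen a by blast
    then obtain v where v: "v \<in> V" "a = v \<otimes> x" unfolding PIdl_sub[OF xV] by blast
    have "a \<otimes> inv x = v" unfolding v(2) using subringD(4)[OF VS v(1)] xK i by (simp add: m_assoc)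
    then show ?thesis using v(1) by simp
  qed
  have sub: "A \<union> {a \<otimes> inv x | a. a \<in> mx A} \<subseteq> V" using ov(2) aV by auto
  note g = gen_facts[OF order_trans[OF sub subringD(1)[OF VS]], folded B_def]
  have BV: "B \<subseteq> V" using g(3)[OF VS sub] .
  have pB: "prm B (M \<inter> B)" by (rule prm_contract[OF g(1) BV pM])
  have A'e: "A' = locI B (M \<inter> B) B" using A' localization_eq[OF g(1) pB] unfolding B_def M_def by simp
  have BA': "B \<subseteq> A'" unfolding A'e using loc_sup[OF g(1) pB] .
  show "A \<subseteq> A'" using g(2) BA' by blast
  have "x \<in> M \<inter> B" using x(1) dom g(2) lclD(2)[OF lA] idlD(4) unfolding M_def by blast
  then have "x \<in> mx A'" unfolding A'e mx_loc[OF g(1) pB] using locI_sup[OF g(1) pB prmD(2)[OF pB]] by blast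
  moreover have "a \<otimes> inv x \<in> A'" if "a \<in> mx A" for a using g(2) BA' that by blast
  ultimately show "\<exists>x\<in>mx A. x \<noteq> \<zero> \<and> (\<forall>a\<in>mx A. a \<otimes> inv x \<in> A') \<and> x \<in> mx A'" using x by blast
qed

lemma lqt_mx_mono: assumes l: "lcl A" "lcl A'" and q: "lqt K A A'" shows "mx A \<subseteq> mx A'"
proof
  fix b assume b: "b \<in> mx A"
  obtain x where x: "x \<in> mx A" "x \<noteq> \<zero>" "b \<otimes> inv x \<in> A'" "x \<in> mx A'" using lqt_properties(1)[OF l(1) q] b by blast
  have K: "b \<in> carrier K" "x \<in> carrier K" using idlD(5)[OF lclD(2)[OF l(1)]] b x(1) by auto
  have "b = (b \<otimes> inv x) \<otimes> x" using K invK[OF K(2) x(2)] by (simp add: m_assoc)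
  then show "b \<in> mx A'" using idlD(7)[OF lclD(2)[OF l(2)] x(3,4)] by simp
qed

lemma least_value:
  assumes V: "vring V"
  shows "set xs \<subseteq> carrier K - {\<zero>} \<Longrightarrow> xs \<noteq> [] \<Longrightarrow> \<exists>x\<in>set xs. \<forall>y\<in>set xs. y \<otimes> inv x \<in> V"
proof (induction xs)
  case (Cons a xs)
  have VS: "subring V K" using V lclD(1) unfolding vring_def by blast
  have a: "a \<in> carrier K" "a \<noteq> \<zero>" using Cons.prems(1) by auto
  note ia = invK[OF a]
  have aa: "a \<otimes> inv a \<in> V" using ia(2) subringD(3)[OF VS] by simp
  show ?case
  proof (cases "xs = []")
    case True then show ?thesis using aa by auto
  next
    case False
    then obtain x where x: "x \<in> set xs" "\<forall>y\<in>set xs. y \<otimes> inv x \<in> V" using Cons by auto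
    have xK: "x \<in> carrier K" "x \<noteq> \<zero>" using x(1) Cons.prems(1) by auto
    note ix = invK[OF xK]
    show ?thesis
    proof (cases "a \<otimes> inv x \<in> V")
      case True then show ?thesis using x by auto
    next
      case False
      have ne: "a \<otimes> inv x \<noteq> \<zero>" using integral[of a "inv x"] a ix by blast
      have "inv (a \<otimes> inv x) \<in> V" using False V ne a(1) ix(1) unfolding vring_def by blast
      then have xa: "x \<otimes> inv a \<in> V" using inv_quotient[OF a xK] by simp
      have "y \<otimes> inv a \<in> V" if y: "y \<in> set xs" for y
      proof -
        have yK: "y \<in> carrier K" using y Cons.prems(1) by auto
        have "(y \<otimes> inv x) \<otimes> (x \<otimes> inv a) = (y \<otimes> inv a) \<otimes> (inv x \<otimes> x)" using yK xK(1) ia(1) ix(1) by algebra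
        then have "y \<otimes> inv a = (y \<otimes> inv x) \<otimes> (x \<otimes> inv a)" using ix(3) yK ia(1) by simp
        then show ?thesis using subringD(6)[OF VS _ xa] x(2) y by simp
      qed
      then show ?thesis using aa by auto
    qed
  qed
qed simp

lemma vring_lcl: "vring V \<Longrightarrow> lcl V" unfolding vring_def by blast

lemma vring_valuation: assumes V: "vring V" shows "valuation_domain (sub K V)"
proof -
  note l = vring_lcl[OF V]
  note VS = lclD(1)[OF l]
  have "a divides\<^bsub>sub K V\<^esub> b \<or> b divides\<^bsub>sub K V\<^esub> a" if ab: "a \<in> V" "b \<in> V" for a b
  proof -
    have K: "a \<in> carrier K" "b \<in> carrier K" using subringD(4)[OF VS] ab by auto
    show ?thesis
    proof (cases "a = \<zero> \<or> b = \<zero>")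
      case True
      then show ?thesis
      proof
        assume "a = \<zero>"
        then have "a = b \<otimes> \<zero>" using K by simp
        then show ?thesis unfolding factor_def using subringD(2)[OF VS] by auto
      next
        assume "b = \<zero>"
        then have "b = a \<otimes> \<zero>" using K by simp
        then show ?thesis unfolding factor_def using subringD(2)[OF VS] by auto
      qed
    next
      case False
      then obtain x where x: "x \<in> {a, b}" "\<forall>y\<in>{a, b}. y \<otimes> inv x \<in> V" using least_value[OF V, of "[a, b]"] K by auto
      have d: "\<exists>c\<in>V. y = x \<otimes> c" if y: "y \<in> {a, b}" for y
      proof -
        have xy: "x \<in> carrier K" "x \<noteq> \<zero>" "y \<in> carrier K" using x(1) y K False by auto
        note ix = invK[OF xy(1,2)]
        have "x \<otimes> (y \<otimes> inv x) = y \<otimes> (x \<otimes> inv x)" using xy ix(1) by algebra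
        then have "y = x \<otimes> (y \<otimes> inv x)" using ix(2) xy by simp
        then show ?thesis using x(2) y by blast
      qed
      then show ?thesis unfolding factor_def using x(1) d[of a] d[of b] by auto
    qed
  qed
  then show ?thesis unfolding valuation_domain_def using sub_cring(2)[OF VS] by auto
qed

text \<open>
  The transform along \<open>V\<close> exists, is regular, and stays inside a local ring \<open>T\<close> whose maximal ideal lies in that of
  \<open>V\<close> but does not contain the maximal ideal of \<open>A\<close>: such a \<open>T\<close> contains the inverses of \<open>x\<close> and of
  all units of \<open>V\<close> that lie in it.
\<close>

lemma lqt_along_valuation:
  assumes V: "vring V" and quot: "carrier K = quotient_field K A" and r: "reg A xs" "xs \<noteq> []" and AV: "A \<subseteq> V" "mx A \<subseteq> mx V"
    and T: "lcl T" "A \<subseteq> T" "mx T \<subseteq> mx V" and a: "a \<in> mx A" "a \<notin> mx T"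
  shows "\<exists>A' ys. lqt K A A' \<and> reg A' ys \<and> A \<subseteq> A' \<and> A' \<subseteq> V \<and> mx A' \<subseteq> mx V \<and> A' \<subseteq> T"
proof -
  note lV = vring_lcl[OF V]
  note VS = lclD(1)[OF lV]
  note TS = lclD(1)[OF T(1)]
  have lA: "lcl A" and nA: "noeth A" and xsA: "set xs \<subseteq> A" and m: "mx A = add_gens A xs {\<zero>}"
    and pr: "\<And>ys z zs. xs = ys @ z # zs \<Longrightarrow> z \<notin> add_gens A ys {\<zero>}" using r unfolding reg_def by auto
  note A = lclD(1)[OF lA]
  have xsK: "set xs \<subseteq> carrier K" using xsA subringD(1)[OF A] by blast
  have nz: "set xs \<subseteq> carrier K - {\<zero>}"
  proof
    fix z assume z: "z \<in> set xs"
    obtain ys zs where e: "xs = ys @ z # zs" using split_list[OF z] by blast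
    have "smod A (add_gens A ys {\<zero>})" using add_gens_smod[OF A _ smod_zero[OF A]] xsK e by simp
    then have "z \<noteq> \<zero>" using pr[OF e] smodD(2) by blast
    then show "z \<in> carrier K - {\<zero>}" using z xsK by blast
  qed
  obtain x where x: "x \<in> set xs" "\<And>y. y \<in> set xs \<Longrightarrow> y \<otimes> inv x \<in> V" using least_value[OF V nz r(2)] by blast
  define B where "B = generate_ring K (A \<union> {a \<otimes> inv x | a. a \<in> mx A})"
  define A' where "A' = localization K B (mx V \<inter> B)"
  have aV: "b \<otimes> inv x \<in> V" if "b \<in> mx A" for b
    using quadratic_transform_regular(5)[OF lV r(1) AV x(1) _ B_def that] x(2) by blast
  note Q = quadratic_transform_regular[OF lV r(1) AV x B_def]
  obtain ws where ws: "reg A' (x # ws)" using Q(1) unfolding A'_def by blast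
  have A'e: "A' = LocV V B" unfolding A'_def using Q(2) .
  note F = LocV_facts[OF lV Q(3,4), folded A'e]
  have x0: "x \<noteq> \<zero>" using Q(6) .
  have xK: "x \<in> carrier K" using x(1) xsK by blast
  note ix = invK[OF xK x0]
  have xm: "x \<in> mx A" unfolding m using add_gens_sup(2)[OF A xsK smod_zero[OF A]] x(1) by blast
  have subK: "A \<union> {a \<otimes> inv x | a. a \<in> mx A} \<subseteq> carrier K" using subringD(1)[OF A] idlD(5)[OF lclD(2)[OF lA]] ix(1) by auto
  note g = gen_facts[OF subK, folded B_def]
  have AA': "A \<subseteq> A'" using g(2) F(3) by blast
  have Vq: "V \<subseteq> quotient_field K A" using subringD(1)[OF VS] quot by simp
  interpret VR: cring "sub K V" using sub_cring[OF VS] by blast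
  have gen: "Idl\<^bsub>sub K V\<^esub> (mx A) = PIdl\<^bsub>sub K V\<^esub> x"
  proof
    have xV: "x \<in> V" using xm AV(1) idlD(4)[OF lclD(2)[OF lA]] by blast
    show "Idl\<^bsub>sub K V\<^esub> (mx A) \<subseteq> PIdl\<^bsub>sub K V\<^esub> x"
    proof (rule VR.genideal_minimal)
      show "ideal (PIdl\<^bsub>sub K V\<^esub> x) (sub K V)" using VR.cgenideal_ideal[of x] xV by simp
      show "mx A \<subseteq> PIdl\<^bsub>sub K V\<^esub> x"
      proof
        fix b assume b: "b \<in> mx A"
        have bK: "b \<in> carrier K" using idlD(5)[OF lclD(2)[OF lA] b] .
        have "b = (b \<otimes> inv x) \<otimes> x" using bK xK ix by (simp add: m_assoc)
        then show "b \<in> PIdl\<^bsub>sub K V\<^esub> x" unfolding PIdl_sub[OF xV] using aV[OF b] by blast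
      qed
    qed
    have sV: "mx A \<subseteq> carrier (sub K V)" using AV(1) idlD(2)[OF lclD(2)[OF lA]] by auto
    show "PIdl\<^bsub>sub K V\<^esub> x \<subseteq> Idl\<^bsub>sub K V\<^esub> (mx A)"
      using VR.cgenideal_minimal[OF VR.genideal_ideal[OF sV], of x] VR.genideal_self[OF sV] xm by blast
  qed
  have "noetherian_domain (sub K A)" using noeth_iff[OF A] nA sub_cring(2)[OF A] unfolding noetherian_domain_def by blast
  moreover have "birationally_dominates K V A" unfolding birationally_dominates_def overring_def
    using lcl_local[OF lA] lcl_local[OF lV] A VS AV Vq by simp
  ultimately have "lqt_along K A V A'"
    unfolding lqt_along_def Let_def lcl_local(2)[OF lA] lcl_local(2)[OF lV]
    using lcl_local(1)[OF lA] vring_valuation[OF V] xm x0 gen unfolding A'_def B_def by blast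
  then have lq: "lqt K A A'" unfolding lqt_def by blast
  \<comment> \<open>\<open>x\<close> is a unit of \<open>T\<close>\<close>
  have pT: "prm T (mx T)" using prm_mx[OF T(1)] .
  have xT: "x \<in> T" using x(1) xsA T(2) by blast
  have aK: "a \<in> carrier K" using idlD(5)[OF lclD(2)[OF lA] a(1)] .
  have aT: "a \<in> T" using idlD(4)[OF lclD(2)[OF lA] a(1)] T(2) by blast
  have xQ: "x \<notin> mx T"
  proof
    assume h: "x \<in> mx T"
    have "(x \<otimes> b) \<in> mx V" if "b \<in> T" for b using idlD(7)[OF lclD(2)[OF T(1)] that h] T(3) m_comm[OF xK subringD(4)[OF TS that]] by auto
    moreover obtain b where b: "b \<in> T" "a \<otimes> b = \<one>" using notin_mx[OF aT a(2)] .
    ultimately have 1: "x \<otimes> b \<in> mx V" by blast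
    have bK: "b \<in> carrier K" using subringD(4)[OF TS b(1)] .
    have "(x \<otimes> b) \<otimes> (a \<otimes> inv x) = (a \<otimes> b) \<otimes> (x \<otimes> inv x)" using xK bK aK ix(1) by algebra
    then have "(x \<otimes> b) \<otimes> (a \<otimes> inv x) = \<one>" using b(2) ix(2) by simp
    then show False using 1 aV[OF a(1)] unfolding mx_def by blast
  qed
  have ixT: "inv x \<in> T" using unit_inv(1)[OF TS xT xQ] .
  have BT: "B \<subseteq> T"
    by (rule g(3)[OF TS]) (use T(2) subringD(6)[OF TS _ ixT] idlD(4)[OF lclD(2)[OF lA]] in auto)
  have "A' \<subseteq> T"
  proof
    fix z assume "z \<in> A'"
    then obtain s where s: "z \<in> carrier K" "s \<in> B" "s \<notin> mx V" "z \<otimes> s \<in> B" unfolding A'e LocV_iff by blast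
    have sK: "s \<in> carrier K" using subringD(4)[OF g(1) s(2)] .
    have "s \<otimes> z \<in> T" using s(4) BT m_comm[OF s(1) sK] by auto
    then show "z \<in> T" using unit_cancel[OF TS smod_self[OF TS] _ _ s(1)] s(2,3) BT T(3) by blast
  qed
  then show ?thesis using lq ws AA' F(4,5) by blast
qed

section \<open>Shannon sequences\<close>

primrec partial_prod :: "(nat \<Rightarrow> 'a) \<Rightarrow> nat \<Rightarrow> 'a" where
  "partial_prod x 0 = \<one>"
| "partial_prod x (Suc n) = partial_prod x n \<otimes> x n"

text \<open>
  Divide \<open>y\<close> and \<open>f\<close> simultaneously by \<open>x\<^sub>0, x\<^sub>1, \<dots>\<close> until the quotient of \<open>y\<close> is a unit of \<open>R\<^sub>n\<close>;
  the bound says that this happens. The quotients of \<open>f\<close> remain in the maximal ideal of \<open>T\<close>, so they stay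
  divisible.
\<close>

lemma shannon_quotient:
  assumes l: "\<And>n. lcl (Rs n)" and xm: "\<And>n. x n \<in> mx (Rs n)" "\<And>n. x n \<noteq> \<zero>"
    and dv: "\<And>n a. a \<in> mx (Rs n) \<Longrightarrow> a \<otimes> inv (x n) \<in> Rs (Suc n)"
    and T: "lcl T" "\<And>n. Rs n \<subseteq> T" and xT: "\<And>n. x n \<notin> mx T"
    and y: "y \<in> Rs 0" "y \<notin> mx T" and f: "f \<in> Rs 0" "f \<in> mx T"
    and bound: "\<And>N s. (\<exists>j. s \<in> Rs j) \<Longrightarrow> y = partial_prod x N \<otimes> s \<Longrightarrow> N \<le> n0"
  shows "\<exists>j. f \<otimes> inv y \<in> Rs j"
proof -
  note TS = lclD(1)[OF T(1)]
  note c = subringD(4)[OF lclD(1)[OF l]]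
  have xR: "x n \<in> Rs n" for n using xm(1)[of n] unfolding mx_def by blast
  have xK: "x n \<in> carrier K" for n using c[OF xR] .
  note ix = invK[OF xK xm(2)]
  have ixT: "inv (x n) \<in> T" for n using unit_inv(1)[OF TS _ xT] xR T(2) by blast
  have wK: "partial_prod x n \<in> carrier K" for n by (induction n) (use xK in auto)
  have w0: "partial_prod x n \<noteq> \<zero>" for n
  proof (induction n)
    case (Suc n) then show ?case using integral[of "partial_prod x n" "x n"] wK xK xm(2) by auto
  qed simp
  define Y where "Y n = y \<otimes> inv (partial_prod x n)" for n
  define F where "F n = f \<otimes> inv (partial_prod x n)" for n
  have yK: "y \<in> carrier K" "f \<in> carrier K" using c y(1) f(1) by auto
  have iw: "inv (partial_prod x (Suc n)) = inv (partial_prod x n) \<otimes> inv (x n)" for n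
  proof -
    note a = invK[OF wK[of n] w0[of n]]
    show ?thesis
    proof (rule comm_inv_char)
      have "partial_prod x (Suc n) \<otimes> (inv (partial_prod x n) \<otimes> inv (x n)) = (partial_prod x n \<otimes> inv (partial_prod x n)) \<otimes> (x n \<otimes> inv (x n))"
        unfolding partial_prod.simps using wK[of n] xK[of n] a(1) ix(1)[of n] by algebra
      then show "partial_prod x (Suc n) \<otimes> (inv (partial_prod x n) \<otimes> inv (x n)) = \<one>" using a(2) ix(2) by simp
    qed (use wK[of "Suc n"] a(1) ix(1)[of n] in auto)
  qed
  have YS: "Y (Suc n) = Y n \<otimes> inv (x n)" and FS: "F (Suc n) = F n \<otimes> inv (x n)" for n
    unfolding Y_def F_def iw using yK invK(1)[OF wK w0] ix(1) by (simp_all add: m_assoc)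
  have yY: "y = partial_prod x n \<otimes> Y n" for n
  proof -
    note a = invK[OF wK[of n] w0[of n]]
    have "partial_prod x n \<otimes> (y \<otimes> inv (partial_prod x n)) = y \<otimes> (partial_prod x n \<otimes> inv (partial_prod x n))" using yK(1) wK[of n] a(1) by algebra
    then show ?thesis unfolding Y_def using a(2) yK by simp
  qed
  have FY: "f \<otimes> inv y = F n \<otimes> inv (Y n)" for n
  proof -
    note a = invK[OF wK[of n] w0[of n]]
    have y0: "y \<noteq> \<zero>" using y(2) idlD(3)[OF lclD(2)[OF T(1)]] by blast
    note iy = invK[OF yK(1) y0]
    have "inv (Y n) = partial_prod x n \<otimes> inv y" unfolding Y_def by (rule inv_quotient[OF yK(1) y0 wK w0])
    moreover have "f \<otimes> inv (partial_prod x n) \<otimes> (partial_prod x n \<otimes> inv y) = f \<otimes> inv y \<otimes> (partial_prod x n \<otimes> inv (partial_prod x n))" using yK(2) wK[of n] a(1) iy(1) by algebra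
    ultimately show ?thesis unfolding F_def using a(2) yK iy(1) by simp
  qed
  have step: "(\<forall>j<n. Y j \<in> mx (Rs j)) \<Longrightarrow> Y n \<in> Rs n \<and> F n \<in> Rs n \<and> F n \<in> mx T" for n
  proof (induction n)
    case 0
    have "inv \<one> = \<one>" by simp
    then show ?case unfolding Y_def F_def using y f yK by simp
  next
    case (Suc n)
    then have ih: "F n \<in> Rs n" "F n \<in> mx T" "Y n \<in> mx (Rs n)" by auto
    have "Y (Suc n) \<in> Rs (Suc n)" unfolding YS using dv[OF ih(3)] .
    moreover have "F n \<in> mx (Rs n)"
    proof (rule ccontr)
      assume n: "F n \<notin> mx (Rs n)"
      obtain b where b: "b \<in> Rs n" "F n \<otimes> b = \<one>" using notin_mx[OF ih(1) n] .
      then show False using ih(2) T(2) unfolding mx_def by blast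
    qed
    then have "F (Suc n) \<in> Rs (Suc n)" unfolding FS using dv by blast
    moreover have "F n \<in> carrier K" using c[OF ih(1)] .
    then have "F (Suc n) \<in> mx T" unfolding FS using idlD(7)[OF lclD(2)[OF T(1)] ixT ih(2), of n] m_comm[OF _ ix(1)] by simp
    ultimately show ?case by blast
  qed
  have "\<exists>n. Y n \<notin> mx (Rs n)"
  proof (rule ccontr)
    assume "\<not> ?thesis"
    then have "Y (Suc n0) \<in> Rs (Suc n0)" using step[of "Suc n0"] by blast
    then have "Suc n0 \<le> n0" using bound[OF _ yY] by blast
    then show False by simp
  qed
  define n where "n = (LEAST n. Y n \<notin> mx (Rs n))"
  have n: "Y n \<notin> mx (Rs n)" unfolding n_def using LeastI_ex[OF \<open>\<exists>n. Y n \<notin> mx (Rs n)\<close>] .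
  have "\<forall>j<n. Y j \<in> mx (Rs j)" using not_less_Least unfolding n_def by blast
  then have s: "Y n \<in> Rs n" "F n \<in> Rs n" using step by auto
  have "inv (Y n) \<in> Rs n" using unit_inv(1)[OF lclD(1)[OF l] s(1) n] .
  then show ?thesis unfolding FY[of n] using subringD(6)[OF lclD(1)[OF l] s(2)] by blast
qed

lemma union_subring:
  assumes s: "\<And>n. subring (Rs n) K" and inc: "\<And>n::nat. Rs n \<subseteq> Rs (Suc n)"
  shows "subring (\<Union>n. Rs n) K"
proof -
  have mono: "Rs n \<subseteq> Rs m" if "n \<le> m" for n m using lift_Suc_mono_le[of Rs, OF inc that] .
  have dir: "\<exists>n. a \<in> Rs n \<and> b \<in> Rs n" if ab: "a \<in> (\<Union>n. Rs n)" "b \<in> (\<Union>n. Rs n)" for a b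
  proof -
    obtain n m where "a \<in> Rs n" "b \<in> Rs m" using ab by blast
    then show ?thesis using mono[of n "max n m"] mono[of m "max n m"] by auto
  qed
  show ?thesis
  proof (rule subringI)
    show "(\<Union>n. Rs n) \<subseteq> carrier K" using subringD(1)[OF s] by blast
    show "\<one> \<in> (\<Union>n. Rs n)" using subringD(3)[OF s] by blast
    show "\<ominus> h \<in> (\<Union>n. Rs n)" if "h \<in> (\<Union>n. Rs n)" for h using that subringD(5)[OF s] by blast
    show "h1 \<otimes> h2 \<in> (\<Union>n. Rs n)" if "h1 \<in> (\<Union>n. Rs n)" "h2 \<in> (\<Union>n. Rs n)" for h1 h2
      using dir[OF that] subringD(6)[OF s] by blast
    show "h1 \<oplus> h2 \<in> (\<Union>n. Rs n)" if "h1 \<in> (\<Union>n. Rs n)" "h2 \<in> (\<Union>n. Rs n)" for h1 h2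
      using dir[OF that] subringD(7)[OF s] by blast
  qed
qed

text \<open>
  The common part of both halves of the theorem, for a sequence of transforms inside \<open>D\<close>. In the second half
  \<open>C\<close> is \<open>R\<close> and \<open>D\<close> is the Shannon extension; in the first half \<open>D\<close> is \<open>V \<inter> R\<^sub>P\<close>.
\<close>

lemma shannon_core:
  assumes l: "\<And>n. lcl (Rs n)" and q: "\<And>n. lqt K (Rs n) (Rs (Suc n))"
    and T: "lcl T" and a: "a \<in> mx (Rs 0)" "a \<notin> mx T"
    and C: "subring C K" "noeth C" "Rs 0 \<subseteq> C" and D: "subring D K" "C \<subseteq> D" "D \<subseteq> T" "\<And>n. Rs n \<subseteq> D"
    and one_dim': "\<forall>q J. prm C q \<and> mx T \<inter> C \<subset> q \<and> idl C J \<and> q \<subseteq> J \<longrightarrow> J = q \<or> J = C"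
    and frac': "\<forall>v\<in>D. \<exists>d\<in>C. d \<notin> mx T \<and> v \<otimes> d \<in> C"
    and nonunit': "\<forall>n. \<forall>u\<in>mx (Rs n). \<forall>d\<in>D. \<one> \<ominus> u \<otimes> d \<notin> mx T"
  shows "\<And>n. Rs n \<subseteq> Rs (Suc n)" "subring (\<Union>n. Rs n) K" "mx (Rs 0) \<subseteq> mx (\<Union>n. Rs n)"
    "\<And>y f. y \<in> Rs 0 \<Longrightarrow> y \<notin> mx T \<Longrightarrow> f \<in> Rs 0 \<Longrightarrow> f \<in> mx T \<Longrightarrow> f \<otimes> inv y \<in> (\<Union>n. Rs n)"
proof -
  note s = lclD(1)[OF l]
  note c = subringD(4)[OF s]
  note TS = lclD(1)[OF T]
  have one_dim: "J = q \<or> J = C" if "prm C q" "mx T \<inter> C \<subset> q" "idl C J" "q \<subseteq> J" for q J using one_dim' that by blast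
  have frac: "\<exists>d\<in>C. d \<notin> mx T \<and> v \<otimes> d \<in> C" if "v \<in> D" for v using frac' that by blast
  have nonunit: "\<one> \<ominus> u \<otimes> d \<notin> mx T" if "u \<in> mx (Rs n)" "d \<in> D" for n u d using nonunit' that by blast
  show inc: "Rs n \<subseteq> Rs (Suc n)" for n using lqt_properties(2)[OF l q] .
  show "subring (\<Union>n. Rs n) K" by (rule union_subring[where Rs = Rs, OF s inc])
  have "\<forall>n. \<exists>x. x \<in> mx (Rs n) \<and> x \<noteq> \<zero> \<and> (\<forall>a\<in>mx (Rs n). a \<otimes> inv x \<in> Rs (Suc n))"
    using lqt_properties(1)[OF l q] by blast
  then obtain x where x: "\<And>n. x n \<in> mx (Rs n)" "\<And>n. x n \<noteq> \<zero>" "\<And>n a. a \<in> mx (Rs n) \<Longrightarrow> a \<otimes> inv (x n) \<in> Rs (Suc n)"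
    by metis
  have xK: "x n \<in> carrier K" for n using idlD(5)[OF lclD(2)[OF l] x(1)] .
  have fac: "b = (b \<otimes> inv (x n)) \<otimes> x n" if b: "b \<in> mx (Rs n)" for b n
  proof -
    have "b \<in> carrier K" using idlD(5)[OF lclD(2)[OF l] b] .
    then show ?thesis using xK[of n] invK[OF xK x(2), of n] by (simp add: m_assoc)
  qed
  have mi: "mx (Rs n) \<subseteq> mx (Rs (Suc n))" for n using lqt_mx_mono[OF l l q] .
  have mn: "mx (Rs 0) \<subseteq> mx (Rs n)" for n using lift_Suc_mono_le[of "\<lambda>n. mx (Rs n)", OF mi, of 0 n] by simp
  show "mx (Rs 0) \<subseteq> mx (\<Union>n. Rs n)"
  proof
    fix b assume b: "b \<in> mx (Rs 0)"
    have "b \<otimes> v \<noteq> \<one>" if "v \<in> Rs n" for v n using b mn[of n] that unfolding mx_def by blast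
    then show "b \<in> mx (\<Union>n. Rs n)" using b unfolding mx_def by blast
  qed
  have RT: "Rs n \<subseteq> T" for n using D(3,4) by blast
  have xT: "x n \<notin> mx T" for n
  proof
    assume h: "x n \<in> mx T"
    have an: "a \<in> mx (Rs n)" using a(1) mn by blast
    have "(a \<otimes> inv (x n)) \<otimes> x n \<in> mx T" using idlD(7)[OF lclD(2)[OF T] _ h] x(3)[OF an] RT by blast
    then show False using fac[OF an] a(2) by simp
  qed
  fix y f assume y: "y \<in> Rs 0" "y \<notin> mx T" and f: "f \<in> Rs 0" "f \<in> mx T"
  have yC: "y \<in> C" using y(1) C(3) by blast
  have xD: "x n \<in> D" for n using x(1)[of n] D(4)[of n] unfolding mx_def by blast
  obtain n0 where n0: "\<forall>N w z s. w 0 = \<one> \<and> (\<forall>i<N. z i \<in> D \<and> w (Suc i) = w i \<otimes> z i \<and> (\<forall>d\<in>D. \<one> \<ominus> z i \<otimes> d \<notin> mx T)) \<and> s \<in> D \<and> y = w N \<otimes> s \<longrightarrow> N \<le> n0"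
    using krull_akizuki_bound[OF C(1,2) D(1,2) T D(3) refl frac one_dim yC y(2)] by blast
  have bound: "N \<le> n0" if sj: "\<exists>j. s \<in> Rs j" and e: "y = partial_prod x N \<otimes> s" for N s
  proof -
    have sD: "s \<in> D" using sj D(4) by blast
    have "partial_prod x 0 = \<one> \<and> (\<forall>i<N. x i \<in> D \<and> partial_prod x (Suc i) = partial_prod x i \<otimes> x i \<and> (\<forall>d\<in>D. \<one> \<ominus> x i \<otimes> d \<notin> mx T)) \<and> s \<in> D \<and> y = partial_prod x N \<otimes> s"
      using xD nonunit[OF x(1)] sD e by auto
    then show ?thesis using n0 by blast
  qed
  have "\<exists>j. f \<otimes> inv y \<in> Rs j" by (rule shannon_quotient[OF l x(1,2,3) T RT xT y f bound])
  then show "f \<otimes> inv y \<in> (\<Union>n. Rs n)" by blast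
qed

lemma shannon_not_archimedean:
  assumes S: "subring S K" and l: "lcl T" and R: "lcl R" "R \<subseteq> T" and a: "a \<in> mx R" "a \<notin> mx T" "a \<in> mx S" and f: "f \<in> R" "f \<in> mx T" "f \<noteq> \<zero>"
    and div: "\<And>y f. y \<in> R \<Longrightarrow> y \<notin> mx T \<Longrightarrow> f \<in> R \<Longrightarrow> f \<in> mx T \<Longrightarrow> f \<otimes> inv y \<in> S"
  shows "\<not> archimedean_domain (sub K S)"
proof (rule not_archimedean[OF S a(3) f(3)])
  fix n :: nat
  note RS = lclD(1)[OF R(1)]
  have aR: "a \<in> R" using a(1) unfolding mx_def by blast
  have an: "a [^] n \<in> R" using subringD(9)[OF RS aR] .
  have "a [^] n \<notin> mx T" using prm_pow[OF lclD(1)[OF l] prm_mx[OF l]] aR R(2) a(2) by blast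
  then have g: "f \<otimes> inv (a [^] n) \<in> S" using div[OF an _ f(1,2)] by blast
  have K: "f \<in> carrier K" "a [^] n \<in> carrier K" using subringD(4)[OF RS] f(1) an by auto
  have "a [^] n \<noteq> \<zero>" using \<open>a [^] n \<notin> mx T\<close> idlD(3)[OF lclD(2)[OF l]] by metis
  then have "f = (f \<otimes> inv (a [^] n)) \<otimes> a [^] n" using invK[OF K(2)] K by (simp add: m_assoc)
  then show "\<exists>g\<in>S. f = g \<otimes> a [^] n" using g by blast
qed

text \<open>
  The maximal ideals of \<open>C\<close> and of \<open>T\<close> together generate a proper ideal of \<open>C + \<mm>\<^sub>T\<close>, because an
  element of \<open>\<mm>\<^sub>T \<inter> C\<close> is a nonunit of \<open>C\<close>.
\<close>

lemma dominating_with_prime: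
  assumes C: "lcl C" and T: "lcl T" "C \<subseteq> T"
  shows "\<exists>V. vring V \<and> C \<subseteq> V \<and> mx T \<subseteq> mx V \<and> mx C \<subseteq> mx V"
proof -
  note CS = lclD(1)[OF C] and TS = lclD(1)[OF T(1)]
  note Q = lclD(2)[OF T(1)] and M = lclD(2)[OF C]
  have sQ: "smod C (mx T)" using smod_mono[OF idlD(1)[OF Q] T(2)] .
  define A where "A = msum C (mx T)"
  define I where "I = msum (mx C) (mx T)"
  have sA: "smod C A" unfolding A_def using smod_msum[OF smod_self[OF CS] sQ CS] .
  have sI: "smod C I" unfolding I_def using smod_msum[OF idlD(1)[OF M] sQ CS] .
  have supA: "C \<subseteq> A" "mx T \<subseteq> A" unfolding A_def using msum_upper[OF smod_self[OF CS] sQ] by auto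
  have supI: "mx C \<subseteq> I" "mx T \<subseteq> I" unfolding I_def using msum_upper[OF idlD(1)[OF M] sQ] by auto
  have mult: "r \<otimes> z \<in> N" if N: "smod C N" "mx T \<subseteq> N" and r: "r \<in> A" and z: "z \<in> N" "z \<in> T" for r z N
  proof -
    obtain c q where c: "c \<in> C" "q \<in> mx T" "r = c \<oplus> q" using r unfolding A_def msum_def by blast
    have K: "c \<in> carrier K" "q \<in> carrier K" "z \<in> carrier K" using subringD(4)[OF CS c(1)] idlD(5)[OF Q c(2)] subringD(4)[OF TS z(2)] by auto
    have "r \<otimes> z = c \<otimes> z \<oplus> z \<otimes> q" unfolding c(3) using K by algebra
    moreover have "z \<otimes> q \<in> N" using idlD(7)[OF Q z(2) c(2)] N(2) by blast
    ultimately show ?thesis using smodD(4)[OF N(1) smodD(5)[OF N(1) c(1) z(1)]] by simp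
  qed
  have AT: "A \<subseteq> T" unfolding A_def using msum_least[OF smod_self[OF TS] T(2) idlD(2)[OF Q]] .
  have IA: "I \<subseteq> A" unfolding I_def A_def msum_def using idlD(2)[OF M] by blast
  have As: "subring A K"
  proof (rule subringI)
    show "A \<subseteq> carrier K" using smodD(1)[OF sA] .
    show "\<one> \<in> A" using supA(1) subringD(3)[OF CS] by blast
    show "\<ominus> h \<in> A" if "h \<in> A" for h using smod_neg[OF CS sA that] .
    show "h1 \<otimes> h2 \<in> A" if "h1 \<in> A" "h2 \<in> A" for h1 h2 using mult[OF sA supA(2) that] that(2) AT by blast
    show "h1 \<oplus> h2 \<in> A" if "h1 \<in> A" "h2 \<in> A" for h1 h2 using smodD(4)[OF sA that] .
  qed
  have Ii: "idl A I" unfolding idl_def smod_def using smodD(1,2)[OF sI] smodD(4)[OF sI] mult[OF sI supI(2)] IA AT by blast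
  have "\<one> \<notin> I"
  proof
    assume "\<one> \<in> I"
    then obtain c q where c: "c \<in> mx C" "q \<in> mx T" "\<one> = c \<oplus> q" unfolding I_def msum_def by blast
    have K: "c \<in> carrier K" "q \<in> carrier K" using idlD(5)[OF M c(1)] idlD(5)[OF Q c(2)] by auto
    have "(c \<oplus> q) \<ominus> c = q" using K by algebra
    then have e: "\<one> \<ominus> c = q" using c(3) by simp
    note o = one_minus_mx[OF C c(1)]
    obtain b where "b \<in> C" "(\<one> \<ominus> c) \<otimes> b = \<one>" using notin_mx[OF o] .
    then show False using c(2) T(2) unfolding e mx_def[of T] by blast
  qed
  then obtain V where "vring V" "A \<subseteq> V" "I \<subseteq> mx V" using dominating_valuation_ring[OF As Ii] by blast
  then show ?thesis using supA supI by blast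
qed

text \<open>The bottom prime of a longest chain of primes containing \<open>p\<^sub>0\<close> and \<open>x\<close>.\<close>

lemma minimal_prime_over:
  assumes l: "lcl A" and n: "noeth A" and p0: "idl A p0" "p0 \<subseteq> mx A" and x: "x \<in> mx A"
  shows "\<exists>q. prm A q \<and> p0 \<subseteq> q \<and> x \<in> q \<and> (\<forall>r. prm A r \<and> p0 \<subseteq> r \<and> x \<in> r \<and> r \<subseteq> q \<longrightarrow> r = q)"
proof -
  note A = lclD(1)[OF l]
  obtain gs where gs: "set gs \<subseteq> A" "mx A = add_gens A gs {\<zero>}" using n lclD(2)[OF l] unfolding noeth_def by blast
  define Pr where "Pr d \<longleftrightarrow> (\<exists>c. pchain A c d \<and> p0 \<subseteq> c 0 \<and> x \<in> c 0)" for d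
  have b: "d \<le> length gs" if pd: "Pr d" for d
  proof -
    obtain c where c: "pchain A c d" using pd unfolding Pr_def by blast
    have "{\<zero>} \<subseteq> c 0" using prmD(5)[OF pchain_prm[OF c]] by simp
    then show ?thesis using dim_bound[OF l n gs(1) smod_zero[OF A] gs(2) c] by blast
  qed
  have "pchain A (\<lambda>_. mx A) 0" unfolding pchain_def using prm_mx[OF l] by simp
  then have "Pr 0" unfolding Pr_def using p0(2) x by blast
  then obtain d where d: "Pr d" "\<And>e. Pr e \<Longrightarrow> e \<le> d" using b Greatest_le_nat[of Pr 0 "length gs"] GreatestI_nat[of Pr 0 "length gs"]
    by (metis Greatest_le_nat)
  obtain c where c: "pchain A c d" "p0 \<subseteq> c 0" "x \<in> c 0" using d(1) unfolding Pr_def by blast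
  have "t = c 0" if t: "prm A t" "p0 \<subseteq> t" "x \<in> t" "t \<subseteq> c 0" for t
  proof (rule ccontr)
    assume "t \<noteq> c 0"
    then have "pchain A (\<lambda>i. case i of 0 \<Rightarrow> t | Suc j \<Rightarrow> c j) (Suc d)" using pchain_cons[OF c(1) t(1)] t(4) by blast
    then have "Pr (Suc d)" unfolding Pr_def using t(2,3) by (intro exI[of _ "\<lambda>i. case i of 0 \<Rightarrow> t | Suc j \<Rightarrow> c j"]) simp
    then show False using d(2)[of "Suc d"] by simp
  qed
  then show ?thesis using c pchain_prm[OF c(1), of 0] by blast
qed

section \<open>Shannon extensions inside \<open>R\<^sub>P\<close>\<close>

text \<open>From here on \<open>R\<close> is a regular local ring with quotient field \<open>K\<close> and \<open>P\<close> a nonzero nonmaximal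
  prime of it.\<close>

context
  fixes R P xs
  assumes r: "reg R xs" and P: "prm R P" and P0: "P \<noteq> {\<zero>}" and Pm: "P \<noteq> mx R" and quot: "carrier K = quotient_field K R"
begin

definition RP :: "'a set" where "RP = locI R P R"

lemma R_facts: "lcl R" "noeth R" "subring R K" using r lclD(1) unfolding reg_def by auto

lemma RP_facts: "lcl RP" "subring RP K" "R \<subseteq> RP" "mx RP = locI R P P" "mx RP \<inter> R = P"
  unfolding RP_def
  using loc_lcl[OF R_facts(3) P] loc_subring[OF R_facts(3) P] loc_sup[OF R_facts(3) P] mx_loc[OF R_facts(3) P] locI_contract[OF R_facts(3) P P]
  by auto

lemma witnesses: obtains a f where "a \<in> mx R" "a \<notin> mx RP" "f \<in> R" "f \<in> mx RP" "f \<noteq> \<zero>"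
proof -
  have "P \<subset> mx R" using prm_sub_mx[OF R_facts(1) P] Pm by blast
  then obtain a where a: "a \<in> mx R" "a \<notin> P" by blast
  then have "a \<notin> mx RP" using RP_facts(5) unfolding mx_def[of R] by blast
  moreover obtain f where "f \<in> P" "f \<noteq> \<zero>" using P0 prmD(5)[OF P] by blast
  ultimately show ?thesis using that a(1) RP_facts(5) by blast
qed

lemma frac_R: assumes "v \<in> RP" shows "\<exists>d\<in>R. d \<notin> mx RP \<and> v \<otimes> d \<in> R"
proof -
  obtain d where d: "d \<in> R" "d \<notin> P" "v \<otimes> d \<in> R" using assms unfolding RP_def locI_def by blast
  then have "d \<notin> mx RP" using RP_facts(5) by blast
  then show ?thesis using d by blast
qed

text \<open>
  If \<open>P\<close> and the maximal ideal were neighbours, \<open>R\<close> itself would be one-dimensional modulo \<open>P\<close>, and the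
  elements of \<open>P\<close> would be divisible in \<open>S\<close> by all powers of a nonunit.
\<close>

theorem archimedean_dim:
  assumes q: "quadratic_shannon_extension K R S" and ar: "archimedean_domain (sub K S)" and ST: "S \<subseteq> RP"
  shows "krull_dim (sub K R Quot P) \<ge> 2"
proof -
  obtain Rs where Rs: "Rs 0 = R" "\<And>n. subring (Rs n) K" "\<And>n. regular_local_ring (sub K (Rs n))" "\<And>n. lqt K (Rs n) (Rs (Suc n))" "S = (\<Union>n. Rs n)"
    using q unfolding quadratic_shannon_extension_def by blast
  have l: "lcl (Rs n)" for n using regular_reg[OF Rs(2,3)] unfolding reg_def by blast
  obtain a f where af: "a \<in> mx R" "a \<notin> mx RP" "f \<in> R" "f \<in> mx RP" "f \<noteq> \<zero>" by (rule witnesses)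
  have inc: "Rs n \<subseteq> Rs (Suc n)" for n using lqt_properties(2)[OF l Rs(4)] .
  have Ss: "subring S K" unfolding Rs(5) by (rule union_subring[where Rs = Rs, OF Rs(2) inc])
  have mono: "Rs n \<subseteq> Rs m" if "n \<le> m" for n m using lift_Suc_mono_le[of Rs, OF inc that] .
  have RS: "R \<subseteq> S" unfolding Rs(5) using Rs(1) by blast
  have mi: "mx (Rs n) \<subseteq> mx (Rs (Suc n))" for n using lqt_mx_mono[OF l l Rs(4)] .
  have mm: "mx (Rs n) \<subseteq> mx (Rs m)" if "n \<le> m" for n m using lift_Suc_mono_le[of "\<lambda>n. mx (Rs n)", OF mi that] .
  have "\<exists>q. prm R q \<and> P \<subset> q \<and> q \<noteq> mx R"
  proof (rule ccontr)
    assume no: "\<not> ?thesis"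
    have one_dim: "J = q \<or> J = R" if "prm R q" "mx RP \<inter> R \<subset> q" "idl R J" "q \<subseteq> J" for q J
    proof -
      have "q = mx R" using no that(1,2) RP_facts(5) by blast
      then show ?thesis using mx_maximal[OF R_facts(1) that(3)] that(4) by blast
    qed
    have nonunit: "\<one> \<ominus> u \<otimes> d \<notin> mx RP" if u: "u \<in> mx (Rs n)" and d: "d \<in> S" for n u d
    proof
      assume h: "\<one> \<ominus> u \<otimes> d \<in> mx RP"
      obtain m where m: "d \<in> Rs m" using d Rs(5) by blast
      define k where "k = max n m"
      have uk: "u \<in> mx (Rs k)" "d \<in> Rs k" using u m mm[of n k] mono[of m k] unfolding k_def by auto
      have K: "u \<in> carrier K" "d \<in> carrier K" using subringD(4)[OF Rs(2)] uk idlD(5)[OF lclD(2)[OF l]] by auto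
      have ud: "u \<otimes> d \<in> mx (Rs k)" using idlD(7)[OF lclD(2)[OF l] uk(2,1)] m_comm[OF K] by simp
      note o = one_minus_mx[OF l ud]
      obtain b where b: "b \<in> Rs k" "(\<one> \<ominus> u \<otimes> d) \<otimes> b = \<one>" using notin_mx[OF o] .
      have "b \<in> RP" using b(1) ST Rs(5) by blast
      then show False using h b(2) unfolding mx_def by blast
    qed
    have frac: "\<exists>d\<in>R. d \<notin> mx RP \<and> v \<otimes> d \<in> R" if "v \<in> S" for v using frac_R that ST by blast
    have RsS: "Rs n \<subseteq> S" for n unfolding Rs(5) by blast
    have a0: "a \<in> mx (Rs 0)" "Rs 0 \<subseteq> R" using af(1) Rs(1) by auto
    have o1: "\<forall>q J. prm R q \<and> mx RP \<inter> R \<subset> q \<and> idl R J \<and> q \<subseteq> J \<longrightarrow> J = q \<or> J = R" using one_dim by blast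
    have o2: "\<forall>v\<in>S. \<exists>d\<in>R. d \<notin> mx RP \<and> v \<otimes> d \<in> R" using frac by blast
    have o3: "\<forall>n. \<forall>u\<in>mx (Rs n). \<forall>d\<in>S. \<one> \<ominus> u \<otimes> d \<notin> mx RP" using nonunit by blast
    note core = shannon_core[where Rs = Rs, OF l Rs(4) RP_facts(1) a0(1) af(2) R_facts(3,2) a0(2) Ss RS ST RsS o1 o2 o3]
    have aS: "a \<in> mx S" using core(3) a0 Rs(5) by blast
    have div: "g \<otimes> inv y \<in> S" if "y \<in> R" "y \<notin> mx RP" "g \<in> R" "g \<in> mx RP" for y g using core(4)[of y g] that unfolding Rs(1) Rs(5) .
    show False using shannon_not_archimedean[OF Ss RP_facts(1) R_facts(1) RP_facts(3) af(1,2) aS af(3,4,5) div] ar by blast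
  qed
  then obtain q where qq: "prm R q" "P \<subset> q" "q \<noteq> mx R" by blast
  define c where "c i = (if i = 0 then P else if i = 1 then q else mx R)" for i :: nat
  have "q \<subset> mx R" using prm_sub_mx[OF R_facts(1) qq(1)] qq(3) by blast
  then have "pchain R c 2" unfolding pchain_def c_def using P qq(1,2) prm_mx[OF R_facts(1)] by (auto simp: less_Suc_eq numeral_2_eq_2)
  then have "enat 2 \<le> krull_dim (sub K R Quot P)" by (rule krull_dim_quotient[OF R_facts(3) _ P]) (simp add: c_def)
  then show ?thesis by (simp add: numeral_eq_enat)
qed

text \<open>
  Dimension one is reached by a blow-up: in the transform \<open>A\<close> the maximal ideal of \<open>R\<close> is contained in \<open>xA\<close>, so
  every prime of \<open>A\<close> that contains \<open>x\<close> lies over the maximal ideal of \<open>R\<close>, in particular one that is minimal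
  over \<open>x\<close> and \<open>P R\<^sub>P \<inter> A\<close>.
\<close>

lemma one_dimensional_overring:
  "\<exists>C. lcl C \<and> noeth C \<and> R \<subseteq> C \<and> C \<subseteq> RP \<and> mx R \<subseteq> mx C \<and>
     (\<forall>q J. prm C q \<and> mx RP \<inter> C \<subset> q \<and> idl C J \<and> q \<subseteq> J \<longrightarrow> J = q \<or> J = C)"
proof -
  obtain a f where af: "a \<in> mx R" "a \<notin> mx RP" "f \<in> R" "f \<in> mx RP" "f \<noteq> \<zero>" by (rule witnesses)
  obtain W where W: "vring W" "R \<subseteq> W" "mx RP \<subseteq> mx W" "mx R \<subseteq> mx W"
    using dominating_with_prime[OF R_facts(1) RP_facts(1,3)] by blast
  have "a \<noteq> \<zero>" using af(2) idlD(3)[OF lclD(2)[OF RP_facts(1)]] by metis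
  then have ne: "xs \<noteq> []" using af(1) r unfolding reg_def by auto
  obtain A ys where A: "lqt K R A" "reg A ys" "R \<subseteq> A" "A \<subseteq> W" "mx A \<subseteq> mx W" "A \<subseteq> RP"
    using lqt_along_valuation[OF W(1) quot r ne W(2,4) RP_facts(1,3) W(3) af(1,2)] by blast
  have lA: "lcl A" and nA: "noeth A" using A(2) unfolding reg_def by auto
  note AS = lclD(1)[OF lA]
  obtain x where x: "x \<in> mx R" "x \<noteq> \<zero>" "\<And>b. b \<in> mx R \<Longrightarrow> b \<otimes> inv x \<in> A" "x \<in> mx A" using lqt_properties(1)[OF R_facts(1) A(1)] by blast
  define p0 where "p0 = mx RP \<inter> A"
  have p0: "prm A p0" unfolding p0_def using centre_prm[OF RP_facts(1) AS A(6)] .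
  obtain q where q: "prm A q" "p0 \<subseteq> q" "x \<in> q" and qmin: "\<And>t. prm A t \<Longrightarrow> p0 \<subseteq> t \<Longrightarrow> x \<in> t \<Longrightarrow> t \<subseteq> q \<Longrightarrow> t = q"
    using minimal_prime_over[OF lA nA prmD(1)[OF p0] prm_sub_mx[OF lA p0] x(4)] by blast
  define C where "C = locI A q A"
  have lC: "lcl C" and nC: "noeth C" and AC: "A \<subseteq> C" and mC: "mx C = locI A q q"
    unfolding C_def using loc_lcl[OF AS q(1)] noeth_loc[OF AS q(1) nA] loc_sup[OF AS q(1)] mx_loc[OF AS q(1)] by auto
  have CT: "C \<subseteq> RP"
  proof
    fix z assume "z \<in> C"
    then obtain s where s: "z \<in> carrier K" "s \<in> A" "s \<notin> q" "z \<otimes> s \<in> A" unfolding C_def locI_def by blast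
    have "s \<notin> mx RP" using s(2,3) q(2) unfolding p0_def by blast
    moreover have "s \<otimes> z \<in> RP" using s(4) A(6) m_comm[OF s(1) subringD(4)[OF AS s(2)]] by auto
    ultimately show "z \<in> RP" using unit_cancel[OF RP_facts(2) smod_self[OF RP_facts(2)] _ _ s(1)] s(2) A(6) by blast
  qed
  have RC: "mx R \<subseteq> mx C"
  proof
    fix b assume b: "b \<in> mx R"
    have K: "b \<in> carrier K" "x \<in> carrier K" using idlD(5)[OF lclD(2)[OF R_facts(1)]] b x(1) by auto
    have "b = (b \<otimes> inv x) \<otimes> x" using K invK[OF K(2) x(2)] by (simp add: m_assoc)
    then have "b \<in> q" using smodD(5)[OF prmD(2)[OF q(1)] x(3)[OF b] q(3)] by simp
    then show "b \<in> mx C" unfolding mC using locI_sup[OF AS q(1) prmD(2)[OF q(1)]] by blast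
  qed
  have "J = t \<or> J = C" if t: "prm C t" "mx RP \<inter> C \<subset> t" and J: "idl C J" "t \<subseteq> J" for t J
  proof -
    define u where "u = t \<inter> A"
    have u: "prm A u" "u \<subseteq> q" unfolding u_def using loc_prm_contract[OF AS q(1)] t(1) unfolding C_def by auto
    have tu: "t = locI A q u" unfolding u_def using loc_expand(2)[OF AS q(1)] prmD(1)[OF t(1)] unfolding C_def by blast
    have p0u: "p0 \<subseteq> u" unfolding p0_def u_def using t(2) AC by blast
    have "p0 \<noteq> u"
    proof
      assume e: "p0 = u"
      have "locI A q p0 \<subseteq> mx RP \<inter> C"
      proof (rule locI_least[OF AS q(1)])
        show "smod (locI A q A) (mx RP \<inter> C)" using smod_Int[OF smod_mono[OF idlD(1)[OF lclD(2)[OF RP_facts(1)]] CT] smod_self[OF lclD(1)[OF lC]]] unfolding C_def .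
        show "p0 \<subseteq> mx RP \<inter> C" unfolding p0_def using AC by blast
      qed
      then show False using t(2) tu e by blast
    qed
    have "u = q"
    proof (rule ccontr)
      assume "u \<noteq> q"
      then obtain q' where q': "prm A q'" "p0 \<subseteq> q'" "x \<in> q'" "q' \<subset> q"
        using pit[OF AS nA p0 u(1) q(1) _ _ q(3)] p0u \<open>p0 \<noteq> u\<close> u(2) by blast
      then show False using qmin[OF q'(1,2,3)] by blast
    qed
    then have "t = mx C" using tu mC by simp
    then show ?thesis using mx_maximal[OF lC J(1)] J(2) by blast
  qed
  then show ?thesis using lC nC AC A(3) CT RC by blast
qed

lemma quot_mono: assumes "R \<subseteq> A" "subring A K" shows "carrier K = quotient_field K A"
proof
  show "carrier K \<subseteq> quotient_field K A" using assms(1) unfolding quot quotient_field_def localization_def by blast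
  show "quotient_field K A \<subseteq> carrier K"
  proof
    fix z assume "z \<in> quotient_field K A"
    then obtain c b where z: "c \<in> A" "b \<in> A" "b \<noteq> \<zero>" "z = c \<otimes> inv b" unfolding quotient_field_def localization_def by blast
    have "c \<in> carrier K" "b \<in> carrier K" using subringD(4)[OF assms(2)] z by auto
    then show "z \<in> carrier K" using invK(1)[of b] z by simp
  qed
qed

text \<open>
  The sequence of transforms along a valuation ring \<open>V\<close> dominating both \<open>C\<close> and \<open>P R\<^sub>P\<close>, where \<open>C\<close> is the
  one-dimensional overring.
\<close>

lemma shannon_sequence_exists:
  "\<exists>Rs. Rs 0 = R \<and> (\<forall>n. lqt K (Rs n) (Rs (Suc n))) \<and> (\<forall>n. (\<exists>ys. reg (Rs n) ys) \<and> R \<subseteq> Rs n \<and> Rs n \<subseteq> RP \<and> (\<exists>b\<in>mx (Rs n). b \<notin> mx RP)) \<and>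
    (\<Union>n. Rs n) \<subseteq> RP \<and> subring (\<Union>n. Rs n) K \<and> mx R \<subseteq> mx (\<Union>n. Rs n) \<and> mx RP \<subseteq> (\<Union>n. Rs n)"
proof -
  obtain a f where af: "a \<in> mx R" "a \<notin> mx RP" "f \<in> R" "f \<in> mx RP" "f \<noteq> \<zero>" by (rule witnesses)
  obtain C where C: "lcl C" "noeth C" "R \<subseteq> C" "C \<subseteq> RP" "mx R \<subseteq> mx C"
    and o1: "\<forall>q J. prm C q \<and> mx RP \<inter> C \<subset> q \<and> idl C J \<and> q \<subseteq> J \<longrightarrow> J = q \<or> J = C"
    using one_dimensional_overring by (elim exE conjE) (rule that)
  obtain V where V: "vring V" "C \<subseteq> V" "mx RP \<subseteq> mx V" "mx C \<subseteq> mx V" using dominating_with_prime[OF C(1) RP_facts(1) C(4)] by blast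
  note lV = vring_lcl[OF V(1)]
  note VS = lclD(1)[OF lV]
  have RV: "R \<subseteq> V" "mx R \<subseteq> mx V" using C(3,5) V(2,4) by auto
  define Inv where "Inv A \<longleftrightarrow> (\<exists>ys. reg A ys) \<and> R \<subseteq> A \<and> A \<subseteq> V \<and> A \<subseteq> RP \<and> mx A \<subseteq> mx V" for A
  have aI: "a \<in> mx A" if "Inv A" for A
  proof -
    have lA: "lcl A" using that unfolding Inv_def reg_def by blast
    have "a \<in> A" using that af(1) unfolding Inv_def mx_def[of R] by blast
    then show ?thesis using dominated(1)[OF lV lA] that af(1) RV(2) unfolding Inv_def by blast
  qed
  have "a \<noteq> \<zero>" using af(2) idlD(3)[OF lclD(2)[OF RP_facts(1)]] by metis
  have step: "\<exists>A'. Inv A' \<and> lqt K A A'" if A: "Inv A" for A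
  proof -
    obtain ys where ys: "reg A ys" using A unfolding Inv_def by blast
    have AS: "subring A K" using ys lclD(1) unfolding reg_def by blast
    have ne: "ys \<noteq> []" using aI[OF A] ys \<open>a \<noteq> \<zero>\<close> unfolding reg_def by auto
    have AV: "A \<subseteq> V" "mx A \<subseteq> mx V" "A \<subseteq> RP" "R \<subseteq> A" using A unfolding Inv_def by auto
    obtain A' zs where "lqt K A A'" "reg A' zs" "A \<subseteq> A'" "A' \<subseteq> V" "mx A' \<subseteq> mx V" "A' \<subseteq> RP"
      using lqt_along_valuation[OF V(1) quot_mono[OF AV(4) AS] ys ne AV(1,2) RP_facts(1) AV(3) V(3) aI[OF A] af(2)] by blast
    then show ?thesis using AV(4) unfolding Inv_def by blast
  qed
  have InvR: "Inv R" unfolding Inv_def using r RV RP_facts(3) by blast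
  have "\<exists>Rs. Rs 0 = R \<and> (\<forall>n::nat. Inv (Rs n) \<and> lqt K (Rs n) (Rs (Suc n)))"
  proof -
    have "\<exists>Rs. \<forall>n::nat. (Inv (Rs n) \<and> (n = 0 \<longrightarrow> Rs n = R)) \<and> lqt K (Rs n) (Rs (Suc n))"
    proof (rule dependent_nat_choice[where P = "\<lambda>n A. Inv A \<and> (n = 0 \<longrightarrow> A = R)" and Q = "\<lambda>n A B. lqt K A B"])
      show "\<exists>A. Inv A \<and> ((0::nat) = 0 \<longrightarrow> A = R)" using InvR by blast
      show "\<exists>B. (Inv B \<and> (Suc n = 0 \<longrightarrow> B = R)) \<and> lqt K A B" if "Inv A \<and> (n = 0 \<longrightarrow> A = R)" for A and n :: nat
        using step that by simp
    qed
    then show ?thesis by blast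
  qed
  then obtain Rs where Rs: "Rs 0 = R" "\<And>n::nat. Inv (Rs n)" "\<And>n. lqt K (Rs n) (Rs (Suc n))" by blast
  have l: "lcl (Rs n)" for n using Rs(2)[of n] unfolding Inv_def reg_def by blast
  define D where "D = V \<inter> RP"
  have D: "subring D K" "C \<subseteq> D" "D \<subseteq> RP" unfolding D_def using subring_inter[OF VS RP_facts(2)] V(2) C(4) by auto
  have RD: "Rs n \<subseteq> D" for n using Rs(2)[of n] unfolding Inv_def D_def by blast
  have nonunit: "\<one> \<ominus> u \<otimes> d \<notin> mx RP" if u: "u \<in> mx (Rs n)" and d: "d \<in> D" for n u d
  proof -
    have uV: "u \<in> mx V" "d \<in> V" using u d Rs(2)[of n] unfolding Inv_def D_def by auto
    have "d \<otimes> u \<in> mx V" using idlD(7)[OF lclD(2)[OF lV] uV(2,1)] .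
    then have "u \<otimes> d \<in> mx V" using m_comm[OF subringD(4)[OF VS uV(2)] idlD(5)[OF lclD(2)[OF lV] uV(1)]] by simp
    then show ?thesis using one_minus_mx(2)[OF lV] V(3) by blast
  qed
  have frac: "\<exists>d\<in>C. d \<notin> mx RP \<and> v \<otimes> d \<in> C" if v: "v \<in> D" for v using frac_R[of v] v C(3) unfolding D_def by blast
  have a0: "a \<in> mx (Rs 0)" "Rs 0 \<subseteq> C" using af(1) Rs(1) C(3) by auto
  have o2: "\<forall>v\<in>D. \<exists>d\<in>C. d \<notin> mx RP \<and> v \<otimes> d \<in> C" using frac by blast
  have o3: "\<forall>n. \<forall>u\<in>mx (Rs n). \<forall>d\<in>D. \<one> \<ominus> u \<otimes> d \<notin> mx RP" using nonunit by blast
  note core = shannon_core[where Rs = Rs, OF l Rs(3) RP_facts(1) a0(1) af(2) lclD(1)[OF C(1)] C(2) a0(2) D RD o1 o2 o3]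
  have ST: "(\<Union>n. Rs n) \<subseteq> RP" using RD D(3) by blast
  have "mx RP \<subseteq> (\<Union>n. Rs n)"
  proof
    fix z assume z: "z \<in> mx RP"
    then obtain s where s: "z \<in> carrier K" "s \<in> R" "s \<notin> P" "z \<otimes> s \<in> P" unfolding RP_facts(4) locI_def by blast
    have sT: "s \<notin> mx RP" "z \<otimes> s \<in> R" "z \<otimes> s \<in> mx RP" using s RP_facts(5) by auto
    have sK: "s \<in> carrier K" "s \<noteq> \<zero>" using subringD(4)[OF R_facts(3) s(2)] s(3) prmD(5)[OF P] by auto
    have "(z \<otimes> s) \<otimes> inv s \<in> (\<Union>n. Rs n)" using core(4)[of s "z \<otimes> s"] s(2) sT unfolding Rs(1) by blast
    moreover have "(z \<otimes> s) \<otimes> inv s = z" using s(1) sK invK[OF sK] by (simp add: m_assoc)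
    ultimately show "z \<in> (\<Union>n. Rs n)" by simp
  qed
  moreover have "mx R \<subseteq> mx (\<Union>n. Rs n)" using core(3) unfolding Rs(1) .
  moreover have "\<forall>n. (\<exists>ys. reg (Rs n) ys) \<and> R \<subseteq> Rs n \<and> Rs n \<subseteq> RP \<and> (\<exists>b\<in>mx (Rs n). b \<notin> mx RP)"
    using Rs(2) aI[OF Rs(2)] af(2) unfolding Inv_def by blast
  ultimately show ?thesis using Rs(1,3) core(2) ST by blast
qed

text \<open>
  Elements of \<open>P\<close> are divisible in \<open>S\<close> by all powers of any \<open>s\<close> outside \<open>P\<close>. In a DVR this is possible
  only if \<open>s\<close> is a unit, so the DVR overrings of \<open>S\<close> contain \<open>R\<^sub>P\<close>; the other inclusion is
  \<open>dvr_separates\<close>.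
\<close>

lemma hull_of_shannon:
  assumes S: "S \<subseteq> RP" "R \<subseteq> S" "mx RP \<subseteq> S" "mx R \<subseteq> mx S"
  shows "noetherian_hull K R S = RP"
proof
  obtain a f where af: "a \<in> mx R" "a \<notin> mx RP" "f \<in> R" "f \<in> mx RP" "f \<noteq> \<zero>" by (rule witnesses)
  have TK: "RP \<subseteq> quotient_field K R" using subringD(1)[OF RP_facts(2)] quot by simp
  show "RP \<subseteq> noetherian_hull K R S"
    unfolding noetherian_hull_def
  proof (intro Int_greatest Inter_greatest TK)
    fix W assume "W \<in> {V. overring K R V \<and> dvr (sub K V) \<and> S \<subset> V}"
    then have W: "subring W K" "dvr (sub K W)" "S \<subseteq> W" unfolding overring_def by auto
    note lW = dvr_elim[OF W(1,2)]
    show "RP \<subseteq> W"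
    proof
      fix z assume "z \<in> RP"
      then obtain s where s: "z \<in> carrier K" "s \<in> R" "s \<notin> P" "z \<otimes> s \<in> R" unfolding RP_def locI_def by blast
      have sK: "s \<in> carrier K" using subringD(4)[OF R_facts(3) s(2)] .
      have sW: "s \<in> W" using s(2) S(2) W(3) by blast
      have sT: "s \<notin> mx RP" using s(2,3) RP_facts(5) by blast
      have "s \<notin> mx W"
      proof
        assume sm: "s \<in> mx W"
        have fW: "f \<in> W" using af(3) S(2) W(3) by blast
        have "f \<in> add_gen W (s [^] n) {\<zero>}" for n :: nat
        proof -
          have sn: "s [^] n \<in> R" using subringD(9)[OF R_facts(3) s(2)] .
          have "s [^] n \<notin> mx RP" using prm_pow[OF RP_facts(2) prm_mx[OF RP_facts(1)]] s(2) RP_facts(3) sT by blast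
          then obtain b where b: "b \<in> RP" "s [^] n \<otimes> b = \<one>" using notin_mx sn RP_facts(3) by blast
          have K: "f \<in> carrier K" "b \<in> carrier K" "s [^] n \<in> carrier K" using subringD(4)[OF R_facts(3) af(3)] subringD(4)[OF RP_facts(2) b(1)] sK by auto
          have "b \<otimes> f \<in> W" using idlD(7)[OF lclD(2)[OF RP_facts(1)] b(1) af(4)] S(3) W(3) by blast
          moreover have "(b \<otimes> f) \<otimes> s [^] n \<oplus> \<zero> = (s [^] n \<otimes> b) \<otimes> f" using K by algebra
          then have "f = (b \<otimes> f) \<otimes> s [^] n \<oplus> \<zero>" using b(2) K by simp
          ultimately show ?thesis unfolding add_gen_def by blast
        qed
        then have "f \<in> {\<zero>}" using krull_intersection[OF lW idl_zero[OF W(1)] sm fW] by blast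
        then show False using af(5) by blast
      qed
      moreover have "s \<otimes> z \<in> W" using s(4) S(2) W(3) m_comm[OF s(1) sK] by auto
      ultimately show "z \<in> W" using unit_cancel[OF W(1) smod_self[OF W(1)] sW _ s(1)] by blast
    qed
  qed
  show "noetherian_hull K R S \<subseteq> RP"
  proof
    fix z assume z: "z \<in> noetherian_hull K R S"
    show "z \<in> RP"
    proof (rule ccontr)
      assume n: "z \<notin> RP"
      have "z \<in> quotient_field K R" using z unfolding noetherian_hull_def by blast
      then obtain c b where cb: "c \<in> R" "b \<in> R" "b \<noteq> \<zero>" "z = c \<otimes> inv b" unfolding quotient_field_def localization_def by blast
      have K: "c \<in> carrier K" "b \<in> carrier K" using subringD(4)[OF R_facts(3)] cb by auto
      have zK: "z \<in> carrier K" "z \<otimes> b = c" unfolding cb(4) using K invK[OF K(2) cb(3)] by (auto simp: m_assoc)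
      obtain p u where p: "prm R p" "p \<subseteq> P" "z \<notin> locI R p R" "u \<in> mx (locI R p R)" "u \<noteq> \<zero>" "mx (locI R p R) = add_gen (locI R p R) u {\<zero>}"
        using dvr_separates[OF r P cb(1,2,3) zK n[unfolded RP_def]] by blast
      define W where "W = locI R p R"
      have WS: "subring W K" "R \<subseteq> W" "lcl W" "noeth W" unfolding W_def
        using loc_subring[OF R_facts(3) p(1)] loc_sup[OF R_facts(3) p(1)] loc_lcl[OF R_facts(3) p(1)] noeth_loc[OF R_facts(3) p(1) R_facts(2)] by auto
      have d: "dvr (sub K W)" using dvr_intro[OF WS(3,4) p(5)] p(4,6) unfolding W_def by blast
      have ov: "overring K R W" unfolding overring_def using R_facts(3) WS(1,2) subringD(1)[OF WS(1)] quot by simp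
      have TW: "RP \<subseteq> W" unfolding RP_def W_def locI_def using p(2) by blast
      have "a \<in> RP" using af(1) RP_facts(3) unfolding mx_def by blast
      then obtain e where e: "e \<in> RP" "a \<otimes> e = \<one>" using notin_mx af(2) by blast
      have "e \<notin> S" using e(2) S(4) af(1) unfolding mx_def by blast
      then have "S \<subset> W" using S(1) TW e(1) by blast
      then have "z \<in> W" using z ov d unfolding noetherian_hull_def by blast
      then show False using p(3) unfolding W_def by blast
    qed
  qed
qed

theorem non_archimedean_exists:
  "\<exists>S. quadratic_shannon_extension K R S \<and> non_archimedean_domain (sub K S) \<and> noetherian_hull K R S = RP"
proof -
  obtain Rs where Rs: "Rs 0 = R" "\<And>n. lqt K (Rs n) (Rs (Suc n))" "\<And>n. \<exists>ys. reg (Rs n) ys" "\<And>n. R \<subseteq> Rs n" "\<And>n. Rs n \<subseteq> RP" "\<And>n. \<exists>b\<in>mx (Rs n). b \<notin> mx RP"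
    and S: "(\<Union>n. Rs n) \<subseteq> RP" "subring (\<Union>n. Rs n) K" "mx R \<subseteq> mx (\<Union>n. Rs n)" "mx RP \<subseteq> (\<Union>n. Rs n)"
    using shannon_sequence_exists by auto
  obtain a f where af: "a \<in> mx R" "a \<notin> mx RP" "f \<in> R" "f \<in> mx RP" "f \<noteq> \<zero>" by (rule witnesses)
  define S where "S = (\<Union>n. Rs n)"
  have RS: "R \<subseteq> S" unfolding S_def using Rs(4) by blast
  have l: "lcl (Rs n)" for n using Rs(3)[of n] unfolding reg_def by blast
  have dim: "krull_dim (sub K (Rs n)) \<ge> 2" for n
  proof -
    note A = lclD(1)[OF l[of n]]
    define p where "p = mx RP \<inter> Rs n"
    have p: "prm (Rs n) p" unfolding p_def using centre_prm[OF RP_facts(1) A Rs(5)] .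
    have z: "prm (Rs n) {\<zero>}" by (rule prm_zero[OF A])
    have 1: "{\<zero>} \<subset> p" using af(3,4,5) Rs(4)[of n] prmD(5)[OF p] unfolding p_def by blast
    obtain b where b: "b \<in> mx (Rs n)" "b \<notin> mx RP" using Rs(6) by blast
    have 2: "p \<subset> mx (Rs n)" using prm_sub_mx[OF l p] b unfolding p_def by blast
    define c where "c i = (if i = 0 then {\<zero>} else if i = 1 then p else mx (Rs n))" for i :: nat
    have "pchain (Rs n) c 2" unfolding pchain_def c_def using z p prm_mx[OF l] 1 2 by (auto simp: less_Suc_eq numeral_2_eq_2)
    then show ?thesis using krull_dim_ge[OF A] by (simp add: numeral_eq_enat)
  qed
  have reg: "regular_local_ring (sub K (Rs n))" for n using Rs(3) reg_regular by blast
  have qs: "quadratic_shannon_extension K R S" unfolding quadratic_shannon_extension_def S_def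
    using Rs(1,2) lclD(1)[OF l] reg dim by blast
  have div: "g \<otimes> inv y \<in> S" if y: "y \<in> R" "y \<notin> mx RP" and g: "g \<in> R" "g \<in> mx RP" for y g
  proof -
    have iT: "inv y \<in> RP" using unit_inv(1)[OF RP_facts(2) _ y(2)] y(1) RP_facts(3) by blast
    have "g \<otimes> inv y = inv y \<otimes> g" using m_comm[OF subringD(4)[OF R_facts(3) g(1)] subringD(4)[OF RP_facts(2) iT]] .
    then show ?thesis using idlD(7)[OF lclD(2)[OF RP_facts(1)] iT g(2)] S(4) unfolding S_def by auto
  qed
  have "\<not> archimedean_domain (sub K S)"
    using shannon_not_archimedean[OF _ RP_facts(1) R_facts(1) RP_facts(3) af(1,2) _ af(3,4,5) div] S(2,3) af(1) unfolding S_def by blast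
  then have "non_archimedean_domain (sub K S)" unfolding non_archimedean_domain_def using sub_cring(2)[OF S(2)] unfolding S_def by blast
  moreover have "noetherian_hull K R S = RP" using hull_of_shannon[OF _ RS] S unfolding S_def by blast
  ultimately show ?thesis using qs by blast
qed

end

end

theorem theorem4p5:
  fixes K :: "('a, 'm) ring_scheme" and R P :: "'a set"
  assumes "field K" and "subring R K" and "carrier K = quotient_field K R"
    and "regular_local_ring (sub K R)"
    and "primeideal P (sub K R)"
    and "P \<noteq> {\<zero>\<^bsub>K\<^esub>}"
    and "\<not> maximalideal P (sub K R)"
  shows "(\<exists>S. quadratic_shannon_extension K R S \<and> non_archimedean_domain (sub K S) \<and>
             noetherian_hull K R S = localization K R P)
       \<and> ((\<exists>S. quadratic_shannon_extension K R S \<and> archimedean_domain (sub K S) \<and>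
             S \<subseteq> localization K R P)
           \<longrightarrow> krull_dim (sub K R Quot P) \<ge> 2)"
proof -
  interpret ambient K using assms(1) by (rule ambient.intro)
  obtain xs where r: "reg R xs" using regular_reg[OF assms(2,4)] by blast
  have l: "lcl R" using r unfolding reg_def by blast
  have P: "prm R P" using primeideal_iff[OF assms(2)] assms(5) by blast
  have Pm: "P \<noteq> mx R" using lcl_maximal[OF l] assms(7) by blast
  note hyps = r P assms(6) Pm assms(3)
  have T: "localization K R P = RP R P" unfolding RP_def[OF hyps] by (rule localization_eq[OF assms(2) P])
  show ?thesis unfolding T using non_archimedean_exists[OF hyps] archimedean_dim[OF hyps] by blast
qed

end
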